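(* Let $E$ be an arbitrary directed graph and $K$ an arbitrary field, and let $P$ be any primitive ideal of the Leavitt path algebra $L_K(E)$. Then there exists a Chen simple left $L_K(E)$-module $S$ such that the annihilator of $S$ is $P$.
   Context: Primitive ideal means annihilator of a simple left module. Graphs. A directed graph $E=(E^0,E^1,r,s)$ consists of sets $E^0$ (vertices), $E^1$ (edges), of any cardinality, and maps $r,s:E^1\to E^0$. A vertex $v$ is a sink if $s^{-1}(v)=\emptyset$, regular if $s^{-1}(v)$ is finite and non-empty, an infinite emitter if $s^{-1}(v)$ is infinite. A path of length $n\ge1$ is $e_1\cdots e_n$ with $r(e_i)=s(e_{i+1})$; vertices are paths of length $0$. Write $u\ge v$ if there is a path from $u$ to $v$. A non-trivial path $e_1\cdots e_n$ is closed if $r(e_n)=s(e_1)$; a cycle based at $s(e_1)$ is a closed path with $s(e_i)\ne s(e_j)$ for $i\neq j$; cycles are considered up to rotation. A cycle $c$ is exclusive if no vertex on $c$ is the base of a cycle other than the rotate of $c$ based at that vertex. Leavitt path algebra. $L_K(E)$ is the $K$-algebra generated by pairwise orthogonal idempotents $v\in E^0$ and elements $e,e^*$ ($e\in E^1$) with relations: $s(e)e=e=er(e)$; $r(e)e^*=e^*=e^*s(e)$; $e^*e=r(e)$ and $e^*f=0$ for $e\ne f$; $v=\sum_{s(e)=v}ee^*$ for every regular vertex $v$. Quotient graphs. $H\subseteq E^0$ is hereditary if $v\in H$, $v\ge w$ imply $w\in H$, and a hereditary $H$ is saturated if $v\in H$ for every regular $v$ with $r(s^{-1}(v))\subseteq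 H$. For $H$ hereditary saturated, $B_H$ is the set of infinite emitters $w\in E^0\setminus H$ with $1\le|s^{-1}(w)\cap r^{-1}(E^0\setminus H)|<\infty$; for $v\in B_H$, $v^H=v-\sum_{s(e)=v,\,r(e)\notin H}ee^*$. For $S\subseteq B_H$, $I(H,S)$ is the ideal of $L_K(E)$ generated by $H\cup\{v^H:v\in S\}$. The quotient graph $E\backslash(H,S)$ has vertices $(E^0\setminus H)\cup\{v':v\in B_H\setminus S\}$ and edges $\{e\in E^1:r(e)\notin H\}\cup\{e':e\in E^1,r(e)\in B_H\setminus S\}$, with $s(e')=s(e)$, $r(e')=r(e)'$. There is a surjection $L_K(E)\to L_K(E\backslash(H,S))$ with kernel $I(H,S)$, given by: vertices $u\in H$ and edges $e$ (and $e^*$) with $r(e)\in H$ go to $0$; $u\mapsto u+u'$ if $u\in B_H\setminus S$ and $u\mapsto u$ for other $u\notin H$; $e\mapsto e+e'$, $e^*\mapsto e^*+(e')^*$ if $r(e)\in B_H\setminus S$, and $e\mapsto e$, $e^*\mapsto e^*$ for other $e$ with $r(e)\notin H$. For $v\in E^0$ let $M(v)=\{w\in E^0:w\ge v\}$ and $H(v)=E^0\setminus M(v)$ (hereditary saturated if $v$ is a sink or infinite emitter). Infinite paths. For an infinite path $p=e_1e_2\cdots$ put $\tau_{>n}(p)=e_{n+1}e_{n+2}\cdots$. Infinite paths $p,q$ are tail-equivalent if $\tau_{>m}(p)=\tau_{>n}(q)$ for some positive integers $m,n$; $[p]$ is the class of $p$. $g^\infty=ggg\cdots$ for a closed path $g$.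 Chen modules are the simple left $L_K(E)$-modules of the following types. (1) $\mathbf N_w$, $w$ a sink of $E$: the $K$-space with basis all finite paths in $E$ ending in $w$, with action on a basis path $q$: $v\cdot q=q$ if $v=s(q)$, else $0$; $e\cdot q=eq$ if $r(e)=s(q)$, else $0$; $e^*\cdot q=q'$ if $q=eq'$, else $0$ (so $e^*\cdot w=0$). (2) $\mathbf N_v^{B_{H(v)}}$, $v$ an infinite emitter with $v\in B_{H(v)}$: with $F=E\backslash(H(v),B_{H(v)}\setminus\{v\})$, the vertex $v'$ is a sink in $F$, and $\mathbf N_v^{B_{H(v)}}$ is the $L_K(F)$-module $\mathbf N_{v'}$ viewed as an $L_K(E)$-module via the quotient map $L_K(E)\to L_K(F)$. (3) $\mathbf N_v^{H(v)}$, $v$ an infinite emitter with $r(s^{-1}(v))\subseteq H(v)$: then $v$ is a sink of $G=E\backslash(H(v),B_{H(v)})$, and $\mathbf N_v^{H(v)}$ is the $L_K(G)$-module $\mathbf N_v$ viewed as an $L_K(E)$-module via $L_K(E)\to L_K(G)$. (4) $V_{[p]}$, $p$ an infinite path in $E$: the $K$-space with basis $[p]$ and action given by the same formulas as in (1). (5) $V^f_{[q]}$, where $q=c^\infty$, $c=e_1\cdots e_m$ is an exclusive cycle, and $f(x)=1+a_1x+\cdots+a_nx^n$ ($n\ge1$) is irreducible in $K[x,x^{-1}]$ with $f\ne1-x$: let $K'=K[x,x^{-1}]/(f(x))$, a field, $\overline x$ the class of $x$, and $\sigma$ the $K'$-algebra automorphism of $L_{K'}(E)$ fixing all vertices and all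 $e,e^*$ with $e\in E^1$, $e\ne e_1$, with $\sigma(e_1)=\overline xe_1$, $\sigma(e_1^* )=\overline x^{-1}e_1^*$. $V^f_{[q]}$ is the $L_{K'}(E)$-module $V_{[q]}$ (with $K'$-basis $[q]$) twisted by $\sigma$, i.e. $a*m=\sigma(a)m$, with scalars restricted to $L_K(E)$. *)

theory Defs
  imports
    "HOL-Algebra.QuotRing"
    "HOL-Algebra.Ring_Divisibility"
    "HOL-Algebra.Elementary_Groups"
    "HOL-Library.Stream"
    "Graph_Theory.Arc_Walk"
begin

section \<open>Simple left modules and primitive ideals\<close>

text \<open>
  \<open>L\<^sub>K(E)\<close> has no unit when \<open>E\<close> has infinitely many vertices. Rings without unit are
  represented by ring records whose \<open>one\<close> field carries no meaning; in module records that
  stand for a bare module, neither \<open>one\<close> nor \<open>mult\<close> carries any meaning.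
\<close>

locale left_module = M?: abelian_group M
  for R :: "('r, 'c) ring_scheme" (structure) and M :: "('r, 'm, 'd) module_scheme" (structure) +
  assumes smult_closed:
      "\<lbrakk>a \<in> carrier R; x \<in> carrier M\<rbrakk> \<Longrightarrow> a \<odot>\<^bsub>M\<^esub> x \<in> carrier M"
    and smult_l_distr:
      "\<lbrakk>a \<in> carrier R; b \<in> carrier R; x \<in> carrier M\<rbrakk> \<Longrightarrow>
        (a \<oplus>\<^bsub>R\<^esub> b) \<odot>\<^bsub>M\<^esub> x = a \<odot>\<^bsub>M\<^esub> x \<oplus>\<^bsub>M\<^esub> b \<odot>\<^bsub>M\<^esub> x"
    and smult_r_distr:
      "\<lbrakk>a \<in> carrier R; x \<in> carrier M; y \<in> carrier M\<rbrakk> \<Longrightarrow>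
        a \<odot>\<^bsub>M\<^esub> (x \<oplus>\<^bsub>M\<^esub> y) = a \<odot>\<^bsub>M\<^esub> x \<oplus>\<^bsub>M\<^esub> a \<odot>\<^bsub>M\<^esub> y"
    and smult_assoc:
      "\<lbrakk>a \<in> carrier R; b \<in> carrier R; x \<in> carrier M\<rbrakk> \<Longrightarrow>
        (a \<otimes>\<^bsub>R\<^esub> b) \<odot>\<^bsub>M\<^esub> x = a \<odot>\<^bsub>M\<^esub> (b \<odot>\<^bsub>M\<^esub> x)"

text \<open>Over a ring without unit, simplicity includes \<open>RM \<noteq> 0\<close>, which also gives \<open>M \<noteq> 0\<close>.\<close>

definition simple_left_module ::
    "('r, 'c) ring_scheme \<Rightarrow> ('r, 'm, 'd) module_scheme \<Rightarrow> bool" where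
  "simple_left_module R M \<longleftrightarrow> left_module R M \<and>
     (\<exists>a\<in>carrier R. \<exists>x\<in>carrier M. a \<odot>\<^bsub>M\<^esub> x \<noteq> \<zero>\<^bsub>M\<^esub>) \<and>
     (\<forall>N. submodule N R M \<longrightarrow> N = {\<zero>\<^bsub>M\<^esub>} \<or> N = carrier M)"

definition annihilator ::
    "('r, 'c) ring_scheme \<Rightarrow> ('r, 'm, 'd) module_scheme \<Rightarrow> 'r set" where
  "annihilator R M = {a \<in> carrier R. \<forall>x\<in>carrier M. a \<odot>\<^bsub>M\<^esub> x = \<zero>\<^bsub>M\<^esub>}"

text \<open>
  A HOL formula cannot quantify over types, so the type of the elements of the simple module is
  a parameter; a theorem with a hypothesis \<open>primitive_ideal TYPE('m) R P\<close>, \<open>'m\<close> a type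
  variable, covers simple modules on all types.
\<close>

definition primitive_ideal :: "'m itself \<Rightarrow> ('r, 'c) ring_scheme \<Rightarrow> 'r set \<Rightarrow> bool" where
  "primitive_ideal _ R P \<longleftrightarrow>
     (\<exists>M :: ('r, 'm) module. simple_left_module R M \<and> P = annihilator R M)"


section \<open>Spaces with a given basis and semigroup algebras\<close>

definition with_action :: "('a, 'm, 'd) module_scheme \<Rightarrow> ('r \<Rightarrow> 'm \<Rightarrow> 'm) \<Rightarrow> ('r, 'm) module" where
  "with_action M act = ring.extend (ring.truncate M) (module.fields act)"

definition free_space :: "('a, 'c) ring_scheme \<Rightarrow> 'b set \<Rightarrow> ('a, 'b \<Rightarrow> 'a) module" where
  "free_space R B =
     \<lparr>carrier = {x. (\<forall>b. x b \<in> carrier R) \<and> finite {b. x b \<noteq> \<zero>\<^bsub>R\<^esub>} \<and> {b. x b \<noteq> \<zero>\<^bsub>R\<^esub>} \<subseteq> B},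
      mult = undefined, one = undefined,
      zero = (\<lambda>b. \<zero>\<^bsub>R\<^esub>), add = (\<lambda>x y b. x b \<oplus>\<^bsub>R\<^esub> y b),
      smult = (\<lambda>k x b. k \<otimes>\<^bsub>R\<^esub> x b)\<rparr>"

definition basis_elt :: "('a, 'c) ring_scheme \<Rightarrow> 'b \<Rightarrow> 'b \<Rightarrow> 'a" where
  "basis_elt R b = (\<lambda>b'. if b' = b then \<one>\<^bsub>R\<^esub> else \<zero>\<^bsub>R\<^esub>)"

text \<open>Linear extension of a map sending each basis element to a basis element or (\<open>None\<close>) to 0.\<close>

definition linear_ext ::
    "('a, 'c) ring_scheme \<Rightarrow> ('b \<Rightarrow> 'b option) \<Rightarrow> ('b \<Rightarrow> 'a) \<Rightarrow> ('b \<Rightarrow> 'a)" where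
  "linear_ext R t x = (\<lambda>b'. \<Oplus>\<^bsub>R\<^esub>b\<in>{b. x b \<noteq> \<zero>\<^bsub>R\<^esub> \<and> t b = Some b'}. x b)"

definition semigroup_algebra ::
    "('a, 'c) ring_scheme \<Rightarrow> ('g, 'd) monoid_scheme \<Rightarrow> ('a, 'g \<Rightarrow> 'a) module" where
  "semigroup_algebra R G = (free_space R (carrier G))
     \<lparr>mult := (\<lambda>x y g. finsum R (\<lambda>(a, b). x a \<otimes>\<^bsub>R\<^esub> y b)
        {(a, b). x a \<noteq> \<zero>\<^bsub>R\<^esub> \<and> y b \<noteq> \<zero>\<^bsub>R\<^esub> \<and> a \<otimes>\<^bsub>G\<^esub> b = g}),
      one := basis_elt R \<one>\<^bsub>G\<^esub>\<rparr>"

text \<open>\<open>K[x, x\<^sup>-\<^sup>1]\<close> is the group algebra of the integers: \<open>f i\<close> is the coefficient of \<open>x\<^sup>i\<close>.\<close>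

definition laurent :: "('a, 'c) ring_scheme \<Rightarrow> ('a, int \<Rightarrow> 'a) module" where
  "laurent R = semigroup_algebra R integer_group"

text \<open>The one-field of \<open>words X\<close> lies outside the carrier: the free algebra is not unital.\<close>

definition words :: "'g set \<Rightarrow> 'g list monoid" where
  "words X = \<lparr>carrier = {w. w \<noteq> [] \<and> set w \<subseteq> X}, mult = (@), one = []\<rparr>"

definition free_algebra :: "('a, 'c) ring_scheme \<Rightarrow> 'g set \<Rightarrow> ('a, 'g list \<Rightarrow> 'a) module" where
  "free_algebra R X = semigroup_algebra R (words X)"

definition algebra_ideal ::
    "'k set \<Rightarrow> ('k, 'a) module \<Rightarrow> 'a set \<Rightarrow> bool" where
  "algebra_ideal S A I \<longleftrightarrow> additive_subgroup I A \<and>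
     (\<forall>k\<in>S. \<forall>a\<in>I. k \<odot>\<^bsub>A\<^esub> a \<in> I) \<and>
     (\<forall>b\<in>carrier A. \<forall>a\<in>I. b \<otimes>\<^bsub>A\<^esub> a \<in> I \<and> a \<otimes>\<^bsub>A\<^esub> b \<in> I)"

definition gen_algebra_ideal :: "'k set \<Rightarrow> ('k, 'a) module \<Rightarrow> 'a set \<Rightarrow> 'a set" where
  "gen_algebra_ideal S A X = \<Inter>{I. algebra_ideal S A I \<and> X \<subseteq> I}"

definition quot_algebra :: "('k, 'a) module \<Rightarrow> 'a set \<Rightarrow> ('k, 'a set) module" where
  "quot_algebra A I = ring.extend (A Quot I)
     (module.fields (\<lambda>k X. \<Union>a\<in>X. I +>\<^bsub>A\<^esub> (k \<odot>\<^bsub>A\<^esub> a)))"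


section \<open>Leavitt path algebras\<close>

datatype ('v, 'e) gen = Vertex 'v | Edge 'e | Ghost 'e

type_synonym ('v, 'e, 'k) lpa_elt = "(('v, 'e) gen list \<Rightarrow> 'k) set"

text \<open>Source and range of an edge are \<open>tail\<close> and \<open>head\<close>; \<open>out_arcs E v\<close> is \<open>s\<^sup>-\<^sup>1(v)\<close>.\<close>

definition gens :: "('v, 'e) pre_digraph \<Rightarrow> ('v, 'e) gen set" where
  "gens E = Vertex ` verts E \<union> Edge ` arcs E \<union> Ghost ` arcs E"

definition regular :: "('v, 'e) pre_digraph \<Rightarrow> 'v \<Rightarrow> bool" where
  "regular E v \<longleftrightarrow> v \<in> verts E \<and> finite (out_arcs E v) \<and> out_arcs E v \<noteq> {}"

definition sink :: "('v, 'e) pre_digraph \<Rightarrow> 'v \<Rightarrow> bool" where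
  "sink E v \<longleftrightarrow> v \<in> verts E \<and> out_arcs E v = {}"

definition infinite_emitter :: "('v, 'e) pre_digraph \<Rightarrow> 'v \<Rightarrow> bool" where
  "infinite_emitter E v \<longleftrightarrow> v \<in> verts E \<and> infinite (out_arcs E v)"

text \<open>The elements that are set to zero in the presentation of \<open>L\<^sub>R(E)\<close>.\<close>

definition lpa_relations ::
    "('k, 'c) ring_scheme \<Rightarrow> ('v, 'e) pre_digraph \<Rightarrow> (('v, 'e) gen list \<Rightarrow> 'k) set" where
  "lpa_relations R E =
    (let A = free_algebra R (gens E); m = basis_elt R in
       {m [Vertex v, Vertex v] \<ominus>\<^bsub>A\<^esub> m [Vertex v] | v. v \<in> verts E}
     \<union> {m [Vertex v, Vertex w] | v w. v \<in> verts E \<and> w \<in> verts E \<and> v \<noteq> w}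
     \<union> {m [Vertex (tail E e), Edge e] \<ominus>\<^bsub>A\<^esub> m [Edge e] | e. e \<in> arcs E}
     \<union> {m [Edge e, Vertex (head E e)] \<ominus>\<^bsub>A\<^esub> m [Edge e] | e. e \<in> arcs E}
     \<union> {m [Vertex (head E e), Ghost e] \<ominus>\<^bsub>A\<^esub> m [Ghost e] | e. e \<in> arcs E}
     \<union> {m [Ghost e, Vertex (tail E e)] \<ominus>\<^bsub>A\<^esub> m [Ghost e] | e. e \<in> arcs E}
     \<union> {m [Ghost e, Edge e] \<ominus>\<^bsub>A\<^esub> m [Vertex (head E e)] | e. e \<in> arcs E}
     \<union> {m [Ghost e, Edge f] | e f. e \<in> arcs E \<and> f \<in> arcs E \<and> e \<noteq> f}
     \<union> {m [Vertex v] \<ominus>\<^bsub>A\<^esub> (\<Oplus>\<^bsub>A\<^esub>e\<in>out_arcs E v. m [Edge e, Ghost e]) | v. regular E v})"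

definition lpa_ideal ::
    "('k, 'c) ring_scheme \<Rightarrow> ('v, 'e) pre_digraph \<Rightarrow> (('v, 'e) gen list \<Rightarrow> 'k) set" where
  "lpa_ideal R E = gen_algebra_ideal (carrier R) (free_algebra R (gens E)) (lpa_relations R E)"

definition lpa ::
    "('k, 'c) ring_scheme \<Rightarrow> ('v, 'e) pre_digraph \<Rightarrow> ('k, ('v, 'e, 'k) lpa_elt) module" where
  "lpa R E = quot_algebra (free_algebra R (gens E)) (lpa_ideal R E)"

definition lpa_gen ::
    "('k, 'c) ring_scheme \<Rightarrow> ('v, 'e) pre_digraph \<Rightarrow> ('v, 'e) gen \<Rightarrow> ('v, 'e, 'k) lpa_elt" where
  "lpa_gen R E g = lpa_ideal R E +>\<^bsub>free_algebra R (gens E)\<^esub> basis_elt R [g]"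

text \<open>
  The homomorphism from \<open>L\<^sub>R(E)\<close> to an algebra \<open>B\<close> given by the ring homomorphism \<open>h\<close> on scalars
  and by the images \<open>\<phi>\<close> of the generators. An element of \<open>L\<^sub>R(E)\<close> is a coset; \<open>the_elem\<close> picks
  the common value of the representatives.
\<close>

primrec word_prod :: "('a, 'c) ring_scheme \<Rightarrow> ('g \<Rightarrow> 'a) \<Rightarrow> 'g list \<Rightarrow> 'a" where
  "word_prod B \<phi> [] = \<one>\<^bsub>B\<^esub>"
| "word_prod B \<phi> (g # w) = (if w = [] then \<phi> g else \<phi> g \<otimes>\<^bsub>B\<^esub> word_prod B \<phi> w)"

definition lpa_hom ::
    "('k, 'c) ring_scheme \<Rightarrow> ('l, 'b) module \<Rightarrow> ('k \<Rightarrow> 'l) \<Rightarrow> (('v, 'e) gen \<Rightarrow> 'b) \<Rightarrow>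
     ('v, 'e, 'k) lpa_elt \<Rightarrow> 'b" where
  "lpa_hom R B h \<phi> X = the_elem
     ((\<lambda>x. \<Oplus>\<^bsub>B\<^esub>w\<in>{w. x w \<noteq> \<zero>\<^bsub>R\<^esub>}. h (x w) \<odot>\<^bsub>B\<^esub> word_prod B \<phi> w) ` X)"

text \<open>
  The \<open>L\<^sub>R(E)\<close>-module on the \<open>R\<close>-space with basis \<open>B\<close> on which each generator \<open>g\<close> acts through
  the linear extension of \<open>t g\<close>; \<open>foldr\<close> composes the actions of the letters of a word.
\<close>

definition basis_module ::
    "('k, 'c) ring_scheme \<Rightarrow> 'b set \<Rightarrow> (('v, 'e) gen \<Rightarrow> 'b \<Rightarrow> 'b option) \<Rightarrow>
     (('v, 'e, 'k) lpa_elt, 'b \<Rightarrow> 'k) module" where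
  "basis_module R B t = (let V = free_space R B in
     with_action V (\<lambda>X m. the_elem
       ((\<lambda>x. \<Oplus>\<^bsub>V\<^esub>w\<in>{w. x w \<noteq> \<zero>\<^bsub>R\<^esub>}. x w \<odot>\<^bsub>V\<^esub> foldr (\<lambda>g. linear_ext R (t g)) w m) ` X)))"


section \<open>Hereditary saturated sets and quotient graphs\<close>

definition M_set :: "('v, 'e) pre_digraph \<Rightarrow> 'v \<Rightarrow> 'v set" where
  "M_set E v = {w \<in> verts E. \<exists>p. pre_digraph.awalk E w p v}"

definition H_set :: "('v, 'e) pre_digraph \<Rightarrow> 'v \<Rightarrow> 'v set" where
  "H_set E v = verts E - M_set E v"

definition B_set :: "('v, 'e) pre_digraph \<Rightarrow> 'v set \<Rightarrow> 'v set" where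
  "B_set E H = {w. infinite_emitter E w \<and> w \<notin> H \<and>
     finite {e \<in> out_arcs E w. head E e \<notin> H} \<and> {e \<in> out_arcs E w. head E e \<notin> H} \<noteq> {}}"

text \<open>In a quotient graph, \<open>Inl\<close> marks the old vertices and edges, \<open>Inr\<close> the primed ones.\<close>

definition quotient_graph ::
    "('v, 'e) pre_digraph \<Rightarrow> 'v set \<Rightarrow> 'v set \<Rightarrow> ('v + 'v, 'e + 'e) pre_digraph" where
  "quotient_graph E H S =
     \<lparr>verts = Inl ` (verts E - H) \<union> Inr ` (B_set E H - S),
      arcs = Inl ` {e \<in> arcs E. head E e \<notin> H} \<union> Inr ` {e \<in> arcs E. head E e \<in> B_set E H - S},
      tail = case_sum (\<lambda>e. Inl (tail E e)) (\<lambda>e. Inl (tail E e)),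
      head = case_sum (\<lambda>e. Inl (head E e)) (\<lambda>e. Inr (head E e))\<rparr>"

definition quotient_gen ::
    "('k, 'c) ring_scheme \<Rightarrow> ('v, 'e) pre_digraph \<Rightarrow> 'v set \<Rightarrow> 'v set \<Rightarrow>
     ('v, 'e) gen \<Rightarrow> ('v + 'v, 'e + 'e, 'k) lpa_elt" where
  "quotient_gen R E H S g =
    (let F = quotient_graph E H S; L = lpa R F; \<gamma> = lpa_gen R F;
         image = (\<lambda>v a a'. if v \<in> H then \<zero>\<^bsub>L\<^esub>
                          else if v \<in> B_set E H - S then \<gamma> a \<oplus>\<^bsub>L\<^esub> \<gamma> a'
                          else \<gamma> a)
     in case g of
          Vertex v \<Rightarrow> image v (Vertex (Inl v)) (Vertex (Inr v))
        | Edge e \<Rightarrow> image (head E e) (Edge (Inl e)) (Edge (Inr e))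
        | Ghost e \<Rightarrow> image (head E e) (Ghost (Inl e)) (Ghost (Inr e)))"

definition quotient_map ::
    "('k, 'c) ring_scheme \<Rightarrow> ('v, 'e) pre_digraph \<Rightarrow> 'v set \<Rightarrow> 'v set \<Rightarrow>
     ('v, 'e, 'k) lpa_elt \<Rightarrow> ('v + 'v, 'e + 'e, 'k) lpa_elt" where
  "quotient_map R E H S =
     lpa_hom R (lpa R (quotient_graph E H S)) id (quotient_gen R E H S)"


section \<open>Chen modules\<close>

text \<open>
  A finite path is a pair of its source and its list of edges, so that each vertex \<open>u\<close> yields the
  path \<open>(u, [])\<close> of length 0.
\<close>

fun path_act :: "('v, 'e) pre_digraph \<Rightarrow> ('v, 'e) gen \<Rightarrow> 'v \<times> 'e list \<Rightarrow> ('v \<times> 'e list) option" where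
  "path_act E (Vertex v) (u, p) = (if v = u then Some (u, p) else None)"
| "path_act E (Edge e) (u, p) = (if head E e = u then Some (tail E e, e # p) else None)"
| "path_act E (Ghost e) (u, p) =
     (if p \<noteq> [] \<and> hd p = e then Some (head E e, tl p) else None)"

definition sink_module ::
    "('k, 'c) ring_scheme \<Rightarrow> ('v, 'e) pre_digraph \<Rightarrow> 'v \<Rightarrow>
     (('v, 'e, 'k) lpa_elt, 'v \<times> 'e list \<Rightarrow> 'k) module" where
  "sink_module R E w = basis_module R {(u, p). pre_digraph.awalk E u p w} (path_act E)"

text \<open>The module \<open>N\<^sub>w\<close> of a sink \<open>w\<close> of the quotient graph, viewed as an \<open>L\<^sub>R(E)\<close>-module.\<close>

definition quotient_sink_module ::
    "('k, 'c) ring_scheme \<Rightarrow> ('v, 'e) pre_digraph \<Rightarrow> 'v set \<Rightarrow> 'v set \<Rightarrow> 'v + 'v \<Rightarrow>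
     (('v, 'e, 'k) lpa_elt, ('v + 'v) \<times> ('e + 'e) list \<Rightarrow> 'k) module" where
  "quotient_sink_module R E H S w =
    (let N = sink_module R (quotient_graph E H S) w
     in with_action N (\<lambda>a m. quotient_map R E H S a \<odot>\<^bsub>N\<^esub> m))"

text \<open>Infinite paths are streams of edges, and \<open>\<tau>\<^sub>>\<^sub>n(p)\<close> is \<open>sdrop n p\<close>.\<close>

definition infinite_path :: "('v, 'e) pre_digraph \<Rightarrow> 'e stream \<Rightarrow> bool" where
  "infinite_path E p \<longleftrightarrow> (\<forall>i. p !! i \<in> arcs E \<and> head E (p !! i) = tail E (p !! Suc i))"

definition tail_class :: "('v, 'e) pre_digraph \<Rightarrow> 'e stream \<Rightarrow> 'e stream set" where
  "tail_class E p = {q. infinite_path E q \<and> (\<exists>m>0. \<exists>n>0. sdrop m p = sdrop n q)}"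

primrec inf_path_act :: "('v, 'e) pre_digraph \<Rightarrow> ('v, 'e) gen \<Rightarrow> 'e stream \<Rightarrow> 'e stream option" where
  "inf_path_act E (Vertex v) q = (if v = tail E (shd q) then Some q else None)"
| "inf_path_act E (Edge e) q = (if head E e = tail E (shd q) then Some (e ## q) else None)"
| "inf_path_act E (Ghost e) q = (if shd q = e then Some (stl q) else None)"

definition inf_path_module ::
    "('k, 'c) ring_scheme \<Rightarrow> ('v, 'e) pre_digraph \<Rightarrow> 'e stream \<Rightarrow>
     (('v, 'e, 'k) lpa_elt, 'e stream \<Rightarrow> 'k) module" where
  "inf_path_module R E p = basis_module R (tail_class E p) (inf_path_act E)"

text \<open>
  The graph library's \<open>pre_digraph.cycle E c\<close> says that \<open>c\<close> is a nonempty closed walk whose edges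
  have distinct sources; its base is the source of \<open>hd c\<close>. (The unqualified \<open>cycle c\<close> below is
  the infinite repetition \<open>c\<^sup>\<infinity>\<close> from the stream library.)
\<close>

definition exclusive_cycle :: "('v, 'e) pre_digraph \<Rightarrow> 'e list \<Rightarrow> bool" where
  "exclusive_cycle E c \<longleftrightarrow> pre_digraph.cycle E c \<and>
     (\<forall>d. pre_digraph.cycle E d \<and> tail E (hd d) \<in> tail E ` set c \<longrightarrow> (\<exists>n. d = rotate n c))"

text \<open>\<open>f = 1 + a\<^sub>1x + \<dots> + a\<^sub>nx\<^sup>n\<close> with \<open>n \<ge> 1\<close>, irreducible in \<open>K[x, x\<^sup>-\<^sup>1]\<close>, and \<open>f \<noteq> 1 - x\<close>.\<close>

definition twist_polynomial :: "('k, 'c) ring_scheme \<Rightarrow> (int \<Rightarrow> 'k) \<Rightarrow> bool" where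
  "twist_polynomial K f \<longleftrightarrow> f \<in> carrier (laurent K) \<and>
     f 0 = \<one>\<^bsub>K\<^esub> \<and> (\<forall>i<0. f i = \<zero>\<^bsub>K\<^esub>) \<and> (\<exists>n\<ge>1. f n \<noteq> \<zero>\<^bsub>K\<^esub>) \<and>
     ring_irreducible\<^bsub>laurent K\<^esub> f \<and>
     f \<noteq> \<one>\<^bsub>laurent K\<^esub> \<ominus>\<^bsub>laurent K\<^esub> basis_elt K 1"

definition twist_field :: "('k, 'c) ring_scheme \<Rightarrow> (int \<Rightarrow> 'k) \<Rightarrow> (int \<Rightarrow> 'k) set ring" where
  "twist_field K f = laurent K Quot (PIdl\<^bsub>laurent K\<^esub> f)"

definition twist_class ::
    "('k, 'c) ring_scheme \<Rightarrow> (int \<Rightarrow> 'k) \<Rightarrow> (int \<Rightarrow> 'k) \<Rightarrow> (int \<Rightarrow> 'k) set" where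
  "twist_class K f g = (PIdl\<^bsub>laurent K\<^esub> f) +>\<^bsub>laurent K\<^esub> g"

text \<open>The automorphism \<open>\<sigma>\<close> of \<open>L\<^sub>R(E)\<close> that multiplies \<open>e\<close> by \<open>x\<close> and \<open>e\<^sup>*\<close> by \<open>x\<^sup>-\<^sup>1\<close>.\<close>

definition twist_automorphism ::
    "('k, 'c) ring_scheme \<Rightarrow> ('v, 'e) pre_digraph \<Rightarrow> 'e \<Rightarrow> 'k \<Rightarrow>
     ('v, 'e, 'k) lpa_elt \<Rightarrow> ('v, 'e, 'k) lpa_elt" where
  "twist_automorphism R E e x = lpa_hom R (lpa R E) id
     (\<lambda>g. if g = Edge e then x \<odot>\<^bsub>lpa R E\<^esub> lpa_gen R E g
          else if g = Ghost e then (inv\<^bsub>R\<^esub> x) \<odot>\<^bsub>lpa R E\<^esub> lpa_gen R E g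
          else lpa_gen R E g)"

text \<open>The homomorphism \<open>L\<^sub>K(E) \<rightarrow> L\<^sub>K\<^sub>'(E)\<close> along which scalars are restricted.\<close>

definition scalar_ext ::
    "('k, 'c) ring_scheme \<Rightarrow> (int \<Rightarrow> 'k) \<Rightarrow> ('v, 'e) pre_digraph \<Rightarrow>
     ('v, 'e, 'k) lpa_elt \<Rightarrow> ('v, 'e, (int \<Rightarrow> 'k) set) lpa_elt" where
  "scalar_ext K f E = (let K' = twist_field K f in
     lpa_hom K (lpa K' E) (\<lambda>k. twist_class K f (k \<odot>\<^bsub>laurent K\<^esub> \<one>\<^bsub>laurent K\<^esub>)) (lpa_gen K' E))"

text \<open>\<open>V\<^sup>f\<^bsub>[q]\<^esub>\<close> for \<open>q = c\<^sup>\<infinity>\<close>.\<close>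

definition twisted_module ::
    "('k, 'c) ring_scheme \<Rightarrow> ('v, 'e) pre_digraph \<Rightarrow> 'e list \<Rightarrow> (int \<Rightarrow> 'k) \<Rightarrow>
     (('v, 'e, 'k) lpa_elt, 'e stream \<Rightarrow> (int \<Rightarrow> 'k) set) module" where
  "twisted_module K E c f =
    (let K' = twist_field K f;
         V = inf_path_module K' E (cycle c);
         \<sigma> = twist_automorphism K' E (hd c) (twist_class K f (basis_elt K 1))
     in with_action V (\<lambda>a m. \<sigma> (scalar_ext K f E a) \<odot>\<^bsub>V\<^esub> m))"

end

theory Submission
  imports Defs
begin

text \<open>
  A primitive ideal is the annihilator of a simple module \<open>M\<close>. Let \<open>Y\<close> be the set of the vertices
  that do not kill \<open>M\<close>; it contains every vertex above one of its elements, and any two of its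
  elements have a common descendant in it.

  Suppose that a vertex \<open>w\<close> with only finitely many edges into \<open>Y\<close> fixes a nonzero vector that all
  ghost edges kill. Then \<open>Y = M(w)\<close>, and \<open>M\<close> has the annihilator of the module of paths ending in
  \<open>w\<close>, in \<open>E\<close> or in a quotient of \<open>E\<close> that turns \<open>w\<close> (or its copy \<open>w'\<close>) into a sink. Otherwise each
  vertex with only finitely many edges into \<open>Y\<close> acts on \<open>M\<close> as the sum of \<open>ee\<^sup>*\<close> over these edges.

  If then every closed path in \<open>Y\<close> has an exit in \<open>Y\<close>, the annihilator depends on \<open>Y\<close> alone, as in
  the Cuntz-Krieger uniqueness theorem. Simplicity of \<open>M\<close> forces countably many vertices of \<open>Y\<close>
  to lie below all the others, so \<open>Y\<close> consists of the vertices above some infinite path \<open>p\<close>, and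
  \<open>V\<^bsub>[p]\<^esub>\<close> has the same annihilator as \<open>M\<close>.

  If a closed path in \<open>Y\<close> has no exit in \<open>Y\<close>, a shortest such path \<open>c\<close> is an exclusive cycle. Its base
  cuts \<open>M\<close> down to a simple module over the Laurent polynomials in \<open>c\<close>, whose annihilator is generated
  by an irreducible \<open>f\<close>; then \<open>V\<^sup>f\<^bsub>[q]\<^esub>\<close> with \<open>q = c\<^sup>\<infinity>\<close>, or \<open>V\<^bsub>[q]\<^esub>\<close> if \<open>f = 1 - x\<close>, has the annihilator of \<open>M\<close>.
\<close>

section \<open>Free spaces and additive extension\<close>

text \<open>No basis and no grading of the algebra is used: the products of some
  \<open>mu u p\<close> with some \<open>nu u' q\<close> only span it, and linear independence is
  replaced by the fact that a vertex of \<open>Y\<close> detects scalars on the module. Nor are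
  ideals described by generators: two simple modules are compared on one well chosen vector each, or
  by induction on the length of ghost paths.

  What counts at a vertex is the number of its edges into \<open>Y\<close>, because a vertex outside
  \<open>Y\<close> acts as 0. If the sum of ee* over finitely many such edges fails to act as the
  vertex, the difference is a nonzero vector killed by every ghost edge; such vectors lead to the
  modules of finite paths.

  The obstacle in the case with exits is cardinality: the graph may be uncountable, while an
  infinite path meets only countably many vertices. The way out is to fix one nonzero vector m. Each
  u in \<open>Y\<close> has an element of the algebra that fixes m and is written with paths ending
  below u. Any two of these elements have a nonzero product, hence comparable paths, and counting
  such paths bounds how many vertices are needed.\<close>

definition single :: "('a, 'c) ring_scheme \<Rightarrow> 'a \<Rightarrow> 'b \<Rightarrow> 'b \<Rightarrow> 'a" where
  "single R k b = (\<lambda>b'. if b' = b then k else \<zero>\<^bsub>R\<^esub>)"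

text \<open>Additivity in the coefficient is all that can be asked: the targets include modules over
  another field, reached along \<open>h\<close>, and bare modules over the Leavitt path algebra,
  which carry no scalars.\<close>

definition additive_family ::
    "('a, 'c) ring_scheme \<Rightarrow> 'b set \<Rightarrow> ('m, 'd) ring_scheme \<Rightarrow> ('b \<Rightarrow> 'a \<Rightarrow> 'm) \<Rightarrow> bool" where
  "additive_family R B M \<Phi> \<longleftrightarrow> (\<forall>b\<in>B. \<Phi> b \<in> hom (add_monoid R) (add_monoid M))"

definition lin ::
    "('a, 'c) ring_scheme \<Rightarrow> ('m, 'd) ring_scheme \<Rightarrow> ('b \<Rightarrow> 'a \<Rightarrow> 'm) \<Rightarrow> ('b \<Rightarrow> 'a) \<Rightarrow> 'm" where
  "lin R M \<Phi> x = (\<Oplus>\<^bsub>M\<^esub>b\<in>{b. x b \<noteq> \<zero>\<^bsub>R\<^esub>}. \<Phi> b (x b))"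

lemma basis_elt_single: "basis_elt R b = single R \<one>\<^bsub>R\<^esub> b"
  by (simp add: basis_elt_def single_def)

lemma free_space_simps [simp]:
  "\<zero>\<^bsub>free_space R B\<^esub> = (\<lambda>b. \<zero>\<^bsub>R\<^esub>)"
  "x \<oplus>\<^bsub>free_space R B\<^esub> y = (\<lambda>b. x b \<oplus>\<^bsub>R\<^esub> y b)"
  "k \<odot>\<^bsub>free_space R B\<^esub> x = (\<lambda>b. k \<otimes>\<^bsub>R\<^esub> x b)"
  by (simp_all add: free_space_def)

lemma free_space_carrier_iff:
  "x \<in> carrier (free_space R B) \<longleftrightarrow>
     (\<forall>b. x b \<in> carrier R) \<and> finite {b. x b \<noteq> \<zero>\<^bsub>R\<^esub>} \<and> {b. x b \<noteq> \<zero>\<^bsub>R\<^esub>} \<subseteq> B"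
  by (simp add: free_space_def)

lemma additive_familyD:
  assumes "additive_family R B M \<Phi>" and "b \<in> B"
  shows "k \<in> carrier R \<Longrightarrow> \<Phi> b k \<in> carrier M"
    and "k \<in> carrier R \<Longrightarrow> l \<in> carrier R \<Longrightarrow> \<Phi> b (k \<oplus>\<^bsub>R\<^esub> l) = \<Phi> b k \<oplus>\<^bsub>M\<^esub> \<Phi> b l"
  using assms by (auto simp: additive_family_def hom_def Pi_def)

lemma additive_familyI:
  assumes "\<And>b k. \<lbrakk>b \<in> B; k \<in> carrier R\<rbrakk> \<Longrightarrow> \<Phi> b k \<in> carrier M"
    and "\<And>b k l. \<lbrakk>b \<in> B; k \<in> carrier R; l \<in> carrier R\<rbrakk> \<Longrightarrow> \<Phi> b (k \<oplus>\<^bsub>R\<^esub> l) = \<Phi> b k \<oplus>\<^bsub>M\<^esub> \<Phi> b l"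
  shows "additive_family R B M \<Phi>"
  using assms by (auto simp: additive_family_def hom_def)

lemma abelian_group_homI':
  assumes "abelian_group G" "abelian_group H"
    and "\<And>x. x \<in> carrier G \<Longrightarrow> h x \<in> carrier H"
    and "\<And>x y. \<lbrakk>x \<in> carrier G; y \<in> carrier G\<rbrakk> \<Longrightarrow> h (x \<oplus>\<^bsub>G\<^esub> y) = h x \<oplus>\<^bsub>H\<^esub> h y"
  shows "abelian_group_hom G H h"
  using assms
  by (intro abelian_group_homI group_hom.intro group_hom_axioms.intro)
    (auto simp: hom_def abelian_group.a_group)

lemma (in abelian_group) minus_eq_zero_iff:
  assumes "a \<in> carrier G" "b \<in> carrier G"
  shows "a \<ominus> b = \<zero> \<longleftrightarrow> a = b"
  using assms by (metis a_minus_def add.inv_closed minus_equality r_neg minus_minus)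

lemma additive_family_zero:
  assumes "abelian_group R" "abelian_group M" "additive_family R B M \<Phi>" "b \<in> B"
  shows "\<Phi> b \<zero>\<^bsub>R\<^esub> = \<zero>\<^bsub>M\<^esub>"
proof -
  interpret abelian_group_hom R M "\<Phi> b"
    using assms by (intro abelian_group_homI') (auto dest: additive_familyD)
  show ?thesis by simp
qed

context cring
begin

lemma single_carrier: "k \<in> carrier R \<Longrightarrow> b \<in> B \<Longrightarrow> single R k b \<in> carrier (free_space R B)"
  by (auto simp: free_space_carrier_iff single_def)

lemma single_add:
  "k \<in> carrier R \<Longrightarrow> l \<in> carrier R \<Longrightarrow>
    single R (k \<oplus> l) b = single R k b \<oplus>\<^bsub>free_space R B\<^esub> single R l b"
  by (auto simp: single_def)

lemma single_smult:
  "k \<in> carrier R \<Longrightarrow> l \<in> carrier R \<Longrightarrow> k \<odot>\<^bsub>free_space R B\<^esub> single R l b = single R (k \<otimes> l) b"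
  by (auto simp: single_def)

lemma free_space_module: "module R (free_space R B)"
proof -
  let ?V = "free_space R B"
  have add: "x \<oplus>\<^bsub>?V\<^esub> y \<in> carrier ?V" if "x \<in> carrier ?V" "y \<in> carrier ?V" for x y
  proof -
    have "{b. x b \<oplus> y b \<noteq> \<zero>} \<subseteq> {b. x b \<noteq> \<zero>} \<union> {b. y b \<noteq> \<zero>}" by auto
    with that show ?thesis
      unfolding free_space_carrier_iff free_space_simps
      by (meson add.m_closed finite_UnI finite_subset le_sup_iff order_trans)
  qed
  have smult: "k \<odot>\<^bsub>?V\<^esub> x \<in> carrier ?V" if "k \<in> carrier R" "x \<in> carrier ?V" for k x
  proof -
    have "{b. k \<otimes> x b \<noteq> \<zero>} \<subseteq> {b. x b \<noteq> \<zero>}" using that(1) by auto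
    with that show ?thesis
      unfolding free_space_carrier_iff free_space_simps
      by (meson finite_subset m_closed order_trans)
  qed
  show ?thesis
  proof (rule moduleI)
    show "abelian_group ?V"
    proof (rule abelian_groupI)
      fix x assume x: "x \<in> carrier ?V"
      have "(\<lambda>b. \<ominus> x b) \<in> carrier ?V"
        using x by (auto simp: free_space_carrier_iff)
      moreover have "(\<lambda>b. \<ominus> x b) \<oplus>\<^bsub>?V\<^esub> x = \<zero>\<^bsub>?V\<^esub>"
        using x by (auto simp: free_space_carrier_iff l_neg)
      ultimately show "\<exists>y\<in>carrier ?V. y \<oplus>\<^bsub>?V\<^esub> x = \<zero>\<^bsub>?V\<^esub>" by blast
    next
      fix x y assume "x \<in> carrier ?V" "y \<in> carrier ?V"
      then show "x \<oplus>\<^bsub>?V\<^esub> y \<in> carrier ?V" by (rule add)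
    qed (auto simp: free_space_carrier_iff a_ac)
  qed (use is_cring add smult in \<open>auto simp: free_space_carrier_iff l_distr r_distr m_assoc\<close>)
qed

lemma free_space_induct [consumes 1, case_names zero single]:
  assumes "x \<in> carrier (free_space R B)"
    and "Q (\<lambda>b. \<zero>)"
    and "\<And>x k b. \<lbrakk>x \<in> carrier (free_space R B); k \<in> carrier R; b \<in> B; Q x\<rbrakk>
           \<Longrightarrow> Q (x \<oplus>\<^bsub>free_space R B\<^esub> single R k b)"
  shows "Q x"
proof -
  have "finite S \<Longrightarrow> S \<subseteq> B \<Longrightarrow> x \<in> carrier (free_space R B) \<Longrightarrow> {b. x b \<noteq> \<zero>} = S \<Longrightarrow> Q x" for S x
  proof (induction S arbitrary: x rule: finite_induct)
    case empty
    then have "x = (\<lambda>b. \<zero>)" by auto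
    with assms(2) show ?case by simp
  next
    case (insert b S)
    let ?y = "x(b := \<zero>)"
    have y: "{b. ?y b \<noteq> \<zero>} = S" using insert by auto
    have yc: "?y \<in> carrier (free_space R B)"
      using insert.prems insert.hyps y by (auto simp: free_space_carrier_iff)
    have "Q ?y" using insert y yc by blast
    then have "Q (?y \<oplus>\<^bsub>free_space R B\<^esub> single R (x b) b)"
      using insert.prems yc by (intro assms(3)) (auto simp: free_space_carrier_iff)
    moreover have "?y \<oplus>\<^bsub>free_space R B\<^esub> single R (x b) b = x"
      using insert.prems by (auto simp: single_def free_space_carrier_iff fun_eq_iff)
    ultimately show ?case by simp
  qed
  then show ?thesis using assms(1) by (auto simp: free_space_carrier_iff)
qed

lemma lin_superset:
  assumes "abelian_group M" "additive_family R B M \<Phi>" "x \<in> carrier (free_space R B)"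
    and "finite S" "{b. x b \<noteq> \<zero>} \<subseteq> S" "S \<subseteq> B"
  shows "lin R M \<Phi> x = (\<Oplus>\<^bsub>M\<^esub>b\<in>S. \<Phi> b (x b))"
proof -
  interpret M: abelian_group M by fact
  show ?thesis unfolding lin_def
    using assms additive_family_zero[OF is_abelian_group assms(1,2)]
    by (intro M.add.finprod_mono_neutral_cong_left)
      (auto simp: free_space_carrier_iff subset_iff intro!: additive_familyD(1)[OF assms(2)])
qed

lemma lin_closed:
  assumes "abelian_group M" "additive_family R B M \<Phi>" "x \<in> carrier (free_space R B)"
  shows "lin R M \<Phi> x \<in> carrier M"
proof -
  interpret M: abelian_group M by fact
  show ?thesis unfolding lin_def
    using assms
    by (intro M.finsum_closed) (auto simp: free_space_carrier_iff intro!: additive_familyD(1)[OF assms(2)])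
qed

lemma lin_zero:
  assumes "abelian_group M"
  shows "lin R M \<Phi> (\<lambda>b. \<zero>) = \<zero>\<^bsub>M\<^esub>"
proof -
  interpret M: abelian_group M by fact
  show ?thesis unfolding lin_def by simp
qed

lemma lin_add:
  assumes "abelian_group M" "additive_family R B M \<Phi>"
    and "x \<in> carrier (free_space R B)" "y \<in> carrier (free_space R B)"
  shows "lin R M \<Phi> (x \<oplus>\<^bsub>free_space R B\<^esub> y) = lin R M \<Phi> x \<oplus>\<^bsub>M\<^esub> lin R M \<Phi> y"
proof -
  interpret M: abelian_group M by fact
  interpret V: module R "free_space R B" by (rule free_space_module)
  let ?S = "{b. x b \<noteq> \<zero>} \<union> {b. y b \<noteq> \<zero>}"
  have S: "finite ?S" "?S \<subseteq> B" using assms by (auto simp: free_space_carrier_iff)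
  have xy: "x \<oplus>\<^bsub>free_space R B\<^esub> y \<in> carrier (free_space R B)" using assms by blast
  have "lin R M \<Phi> (x \<oplus>\<^bsub>free_space R B\<^esub> y) = (\<Oplus>\<^bsub>M\<^esub>b\<in>?S. \<Phi> b (x b \<oplus> y b))"
  proof -
    have "{b. (x \<oplus>\<^bsub>free_space R B\<^esub> y) b \<noteq> \<zero>} \<subseteq> ?S" by auto
    from lin_superset[OF assms(1,2) xy S(1) this S(2)] show ?thesis by simp
  qed
  also have "\<dots> = (\<Oplus>\<^bsub>M\<^esub>b\<in>?S. \<Phi> b (x b) \<oplus>\<^bsub>M\<^esub> \<Phi> b (y b))"
    using assms S by (intro M.finsum_cong')
      (auto simp: free_space_carrier_iff subset_iff intro!: additive_familyD[OF assms(2)] M.add.m_closed)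
  also have "\<dots> = (\<Oplus>\<^bsub>M\<^esub>b\<in>?S. \<Phi> b (x b)) \<oplus>\<^bsub>M\<^esub> (\<Oplus>\<^bsub>M\<^esub>b\<in>?S. \<Phi> b (y b))"
    using assms S by (intro M.finsum_addf)
      (auto simp: free_space_carrier_iff subset_iff intro!: additive_familyD[OF assms(2)])
  also have "\<dots> = lin R M \<Phi> x \<oplus>\<^bsub>M\<^esub> lin R M \<Phi> y"
    using lin_superset[OF assms(1,2,3) S(1) _ S(2)] lin_superset[OF assms(1,2,4) S(1) _ S(2)] by simp
  finally show ?thesis .
qed

lemma lin_single:
  assumes "abelian_group M" "additive_family R B M \<Phi>" "k \<in> carrier R" "b \<in> B"
  shows "lin R M \<Phi> (single R k b) = \<Phi> b k"
proof -
  interpret M: abelian_group M by fact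
  have "lin R M \<Phi> (single R k b) = (\<Oplus>\<^bsub>M\<^esub>b'\<in>{b}. \<Phi> b' (single R k b b'))"
    by (rule lin_superset[OF assms(1,2) single_carrier[OF assms(3,4)]])
      (use assms in \<open>auto simp: single_def\<close>)
  also have "\<dots> = \<Phi> b k"
    using additive_familyD(1)[OF assms(2,4,3)] by (simp add: single_def)
  finally show ?thesis .
qed

text \<open>The maps are additive and perhaps not linear, so they are compared on all multiples of
  basis elements and not just on the basis.\<close>

lemma additive_ext:
  assumes "abelian_group_hom (free_space R B) M f" "abelian_group_hom (free_space R B) M g"
    and "\<And>k b. \<lbrakk>k \<in> carrier R; b \<in> B\<rbrakk> \<Longrightarrow> f (single R k b) = g (single R k b)"
    and "x \<in> carrier (free_space R B)"
  shows "f x = g x"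
  using assms(4)
proof (induction rule: free_space_induct)
  case zero
  show ?case using abelian_group_hom.hom_zero[OF assms(1)] abelian_group_hom.hom_zero[OF assms(2)]
    by simp
next
  case (single x k b)
  then show ?case
    using assms(3) abelian_group_hom.hom_add[OF assms(1), of x "single R k b"]
      abelian_group_hom.hom_add[OF assms(2), of x "single R k b"] single_carrier[of k b B] by auto
qed

lemma lin_hom:
  assumes "abelian_group M" "additive_family R B M \<Phi>"
  shows "abelian_group_hom (free_space R B) M (lin R M \<Phi>)"
  using assms module.axioms(2)[OF free_space_module]
  by (intro abelian_group_homI') (simp_all only: lin_closed lin_add)

lemma lin_unique:
  assumes "abelian_group M" "additive_family R B M \<Phi>"
    and "abelian_group_hom (free_space R B) M f"
    and "\<And>k b. \<lbrakk>k \<in> carrier R; b \<in> B\<rbrakk> \<Longrightarrow> f (single R k b) = \<Phi> b k"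
    and "x \<in> carrier (free_space R B)"
  shows "f x = lin R M \<Phi> x"
  by (rule additive_ext[OF assms(3) lin_hom[OF assms(1,2)] _ assms(5)])
    (simp add: assms lin_single[OF assms(1,2)])

lemma hom_lin:
  assumes h: "abelian_group_hom M N h" and "additive_family R B M \<Phi>"
    and "x \<in> carrier (free_space R B)"
  shows "h (lin R M \<Phi> x) = lin R N (\<lambda>b k. h (\<Phi> b k)) x"
proof -
  interpret h: abelian_group_hom M N h by fact
  have ab: "abelian_group M" "abelian_group N" by intro_locales
  have fam: "additive_family R B N (\<lambda>b k. h (\<Phi> b k))"
    using additive_familyD[OF assms(2)] by (intro additive_familyI) auto
  have "abelian_group_hom (free_space R B) N (\<lambda>x. h (lin R M \<Phi> x))"
    using module.axioms(2)[OF free_space_module] ab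
    by (intro abelian_group_homI')
      (simp_all only: lin_add[OF ab(1) assms(2)] lin_closed[OF ab(1) assms(2)] h.hom_closed h.hom_add)
  from lin_unique[OF ab(2) fam this _ assms(3)] show ?thesis
    using lin_single[OF ab(1) assms(2)] by simp
qed

end

section \<open>Algebras without unit\<close>

locale nonunital_algebra = module R A
  for R :: "('a, 'c) ring_scheme" (structure) and A :: "('a, 'b) module" (structure) +
  assumes mult_closed [simp, intro]: "\<lbrakk>a \<in> carrier A; b \<in> carrier A\<rbrakk> \<Longrightarrow> a \<otimes>\<^bsub>A\<^esub> b \<in> carrier A"
    and mult_assoc: "\<lbrakk>a \<in> carrier A; b \<in> carrier A; c \<in> carrier A\<rbrakk> \<Longrightarrow>
      (a \<otimes>\<^bsub>A\<^esub> b) \<otimes>\<^bsub>A\<^esub> c = a \<otimes>\<^bsub>A\<^esub> (b \<otimes>\<^bsub>A\<^esub> c)"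
    and mult_l_distr: "\<lbrakk>a \<in> carrier A; b \<in> carrier A; c \<in> carrier A\<rbrakk> \<Longrightarrow>
      (a \<oplus>\<^bsub>A\<^esub> b) \<otimes>\<^bsub>A\<^esub> c = a \<otimes>\<^bsub>A\<^esub> c \<oplus>\<^bsub>A\<^esub> b \<otimes>\<^bsub>A\<^esub> c"
    and mult_r_distr: "\<lbrakk>a \<in> carrier A; b \<in> carrier A; c \<in> carrier A\<rbrakk> \<Longrightarrow>
      c \<otimes>\<^bsub>A\<^esub> (a \<oplus>\<^bsub>A\<^esub> b) = c \<otimes>\<^bsub>A\<^esub> a \<oplus>\<^bsub>A\<^esub> c \<otimes>\<^bsub>A\<^esub> b"
    and smult_mult: "\<lbrakk>k \<in> carrier R; a \<in> carrier A; b \<in> carrier A\<rbrakk> \<Longrightarrow>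
      (k \<odot>\<^bsub>A\<^esub> a) \<otimes>\<^bsub>A\<^esub> b = k \<odot>\<^bsub>A\<^esub> (a \<otimes>\<^bsub>A\<^esub> b)"
    and mult_smult: "\<lbrakk>k \<in> carrier R; a \<in> carrier A; b \<in> carrier A\<rbrakk> \<Longrightarrow>
      a \<otimes>\<^bsub>A\<^esub> (k \<odot>\<^bsub>A\<^esub> b) = k \<odot>\<^bsub>A\<^esub> (a \<otimes>\<^bsub>A\<^esub> b)"
begin

lemma abelian_group_A: "abelian_group A"
  by intro_locales

lemma left_mult_hom: "a \<in> carrier A \<Longrightarrow> abelian_group_hom A A (\<lambda>x. a \<otimes>\<^bsub>A\<^esub> x)"
  by (intro abelian_group_homI' abelian_group_A) (auto simp: mult_r_distr)

lemma right_mult_hom: "a \<in> carrier A \<Longrightarrow> abelian_group_hom A A (\<lambda>x. x \<otimes>\<^bsub>A\<^esub> a)"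
  by (intro abelian_group_homI' abelian_group_A) (auto simp: mult_l_distr)

lemma mult_zero [simp]: "a \<in> carrier A \<Longrightarrow> a \<otimes>\<^bsub>A\<^esub> \<zero>\<^bsub>A\<^esub> = \<zero>\<^bsub>A\<^esub>" "a \<in> carrier A \<Longrightarrow> \<zero>\<^bsub>A\<^esub> \<otimes>\<^bsub>A\<^esub> a = \<zero>\<^bsub>A\<^esub>"
  using abelian_group_hom.hom_zero[OF left_mult_hom] abelian_group_hom.hom_zero[OF right_mult_hom]
  by auto

lemma smult_additive_family:
  assumes "\<And>b. b \<in> B \<Longrightarrow> F b \<in> carrier A"
  shows "additive_family R B A (\<lambda>b k. k \<odot>\<^bsub>A\<^esub> F b)"
  using assms by (intro additive_familyI) (auto simp: smult_l_distr)

end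

text \<open>Only a semigroup, so that one treatment serves both the nonempty words of the free
  algebra and the integers of the Laurent polynomials.\<close>

locale semigroup_alg = cring R for R (structure) and G (structure) +
  assumes semi_closed: "\<lbrakk>a \<in> carrier G; b \<in> carrier G\<rbrakk> \<Longrightarrow> a \<otimes>\<^bsub>G\<^esub> b \<in> carrier G"
    and semi_assoc: "\<lbrakk>a \<in> carrier G; b \<in> carrier G; c \<in> carrier G\<rbrakk> \<Longrightarrow>
      (a \<otimes>\<^bsub>G\<^esub> b) \<otimes>\<^bsub>G\<^esub> c = a \<otimes>\<^bsub>G\<^esub> (b \<otimes>\<^bsub>G\<^esub> c)"
begin

abbreviation "V \<equiv> free_space R (carrier G)"
abbreviation "SA \<equiv> semigroup_algebra R G"

lemma SA_simps [simp]:
  "carrier SA = carrier V" "\<zero>\<^bsub>SA\<^esub> = (\<lambda>b. \<zero>)" "x \<oplus>\<^bsub>SA\<^esub> y = (\<lambda>b. x b \<oplus> y b)"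
  "k \<odot>\<^bsub>SA\<^esub> x = (\<lambda>b. k \<otimes> x b)" "\<one>\<^bsub>SA\<^esub> = basis_elt R \<one>\<^bsub>G\<^esub>"
  by (simp_all add: semigroup_algebra_def free_space_def)

lemma SA_mult_def: "(x \<otimes>\<^bsub>SA\<^esub> y) g = finsum R (\<lambda>(a, b). x a \<otimes> y b)
        {(a, b). x a \<noteq> \<zero> \<and> y b \<noteq> \<zero> \<and> a \<otimes>\<^bsub>G\<^esub> b = g}"
  by (simp add: semigroup_algebra_def)

lemma SA_module: "module R SA"
proof -
  interpret V: module R V by (rule free_space_module)
  show ?thesis
  proof (rule moduleI)
    show "abelian_group SA"
    proof (rule abelian_groupI)
      fix x assume "x \<in> carrier SA"
      then show "\<exists>y\<in>carrier SA. y \<oplus>\<^bsub>SA\<^esub> x = \<zero>\<^bsub>SA\<^esub>"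
        using V.M.l_neg[of x] V.M.a_inv_closed[of x] by auto
    qed (use V.M.a_ac V.M.a_closed V.M.zero_closed in \<open>auto simp: free_space_carrier_iff a_ac\<close>)
  qed (use is_cring V.smult_closed V.smult_l_distr V.smult_r_distr V.smult_assoc1 in
      \<open>auto simp: free_space_carrier_iff\<close>)
qed

text \<open>The convolution sums over pairs from the two supports, and these change under addition.
  Over a common finite box of indices the sums can be compared term by term.\<close>

lemma SA_mult_superset:
  assumes x: "x \<in> carrier V" and y: "y \<in> carrier V" and "finite S" "finite T"
    and "{a. x a \<noteq> \<zero>} \<subseteq> S" "{b. y b \<noteq> \<zero>} \<subseteq> T"
  shows "(x \<otimes>\<^bsub>SA\<^esub> y) g = finsum R (\<lambda>(a, b). x a \<otimes> y b) {(a, b). a \<in> S \<and> b \<in> T \<and> a \<otimes>\<^bsub>G\<^esub> b = g}"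
proof -
  have "finite {(a, b). a \<in> S \<and> b \<in> T \<and> a \<otimes>\<^bsub>G\<^esub> b = g}"
    by (rule finite_subset[of _ "S \<times> T"]) (use assms in auto)
  moreover have "\<And>a. x a \<in> carrier R" "\<And>b. y b \<in> carrier R"
    using x y by (auto simp: free_space_carrier_iff)
  moreover have "x a \<otimes> y b = \<zero>" if "\<not> (x a \<noteq> \<zero> \<and> y b \<noteq> \<zero>)" for a b
    using that calculation by auto
  ultimately show ?thesis unfolding SA_mult_def
    using assms(5,6) by (intro add.finprod_mono_neutral_cong_left) (auto simp: subset_iff)
qed

lemma SA_mult_closed:
  assumes x: "x \<in> carrier V" and y: "y \<in> carrier V"
  shows "x \<otimes>\<^bsub>SA\<^esub> y \<in> carrier V"
proof -
  let ?S = "{a. x a \<noteq> \<zero>}" and ?T = "{a. y a \<noteq> \<zero>}"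
  have fin: "finite ?S" "finite ?T" and sub: "?S \<subseteq> carrier G" "?T \<subseteq> carrier G"
    and c: "\<And>a. x a \<in> carrier R" "\<And>b. y b \<in> carrier R"
    using x y by (auto simp: free_space_carrier_iff)
  have 1: "(x \<otimes>\<^bsub>SA\<^esub> y) g \<in> carrier R" for g
    unfolding SA_mult_def using c by (intro finsum_closed) auto
  have "g \<in> (\<lambda>(a, b). a \<otimes>\<^bsub>G\<^esub> b) ` (?S \<times> ?T)" if "(x \<otimes>\<^bsub>SA\<^esub> y) g \<noteq> \<zero>" for g
  proof (rule ccontr)
    assume "\<not> ?thesis"
    then have *: "{(a, b). x a \<noteq> \<zero> \<and> y b \<noteq> \<zero> \<and> a \<otimes>\<^bsub>G\<^esub> b = g} = {}" by force
    have "(x \<otimes>\<^bsub>SA\<^esub> y) g = \<zero>" unfolding SA_mult_def * by simp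
    with that show False by simp
  qed
  then have 2: "{g. (x \<otimes>\<^bsub>SA\<^esub> y) g \<noteq> \<zero>} \<subseteq> (\<lambda>(a, b). a \<otimes>\<^bsub>G\<^esub> b) ` (?S \<times> ?T)" by blast
  have 3: "(\<lambda>(a, b). a \<otimes>\<^bsub>G\<^esub> b) ` (?S \<times> ?T) \<subseteq> carrier G"
    using sub semi_closed by auto
  have "finite ((\<lambda>(a, b). a \<otimes>\<^bsub>G\<^esub> b) ` (?S \<times> ?T))"
    using fin by auto
  with 1 2 3 show ?thesis
    unfolding free_space_carrier_iff by (meson finite_subset order_trans)
qed

lemma SA_l_distr:
  assumes x: "x \<in> carrier V" and y: "y \<in> carrier V" and z: "z \<in> carrier V"
  shows "(x \<oplus>\<^bsub>SA\<^esub> y) \<otimes>\<^bsub>SA\<^esub> z = x \<otimes>\<^bsub>SA\<^esub> z \<oplus>\<^bsub>SA\<^esub> y \<otimes>\<^bsub>SA\<^esub> z"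
proof
  fix g
  interpret V: module R V by (rule free_space_module)
  let ?S = "{a. x a \<noteq> \<zero>} \<union> {a. y a \<noteq> \<zero>}" and ?T = "{a. z a \<noteq> \<zero>}"
  let ?U = "{(a, b). a \<in> ?S \<and> b \<in> ?T \<and> a \<otimes>\<^bsub>G\<^esub> b = g}"
  have fin: "finite ?S" "finite ?T"
    and c: "\<And>a. x a \<in> carrier R" "\<And>b. y b \<in> carrier R" "\<And>b. z b \<in> carrier R"
    using x y z by (auto simp: free_space_carrier_iff)
  have "x \<oplus>\<^bsub>V\<^esub> y \<in> carrier V" using x y by blast
  then have "((x \<oplus>\<^bsub>V\<^esub> y) \<otimes>\<^bsub>SA\<^esub> z) g = finsum R (\<lambda>(a, b). (x \<oplus>\<^bsub>V\<^esub> y) a \<otimes> z b) ?U"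
    by (rule SA_mult_superset[OF _ z fin]) auto
  also have "\<dots> = finsum R (\<lambda>p. (\<lambda>(a, b). x a \<otimes> z b) p \<oplus> (\<lambda>(a, b). y a \<otimes> z b) p) ?U"
    using c by (intro finsum_cong') (auto simp: l_distr)
  also have "\<dots> = finsum R (\<lambda>(a, b). x a \<otimes> z b) ?U \<oplus> finsum R (\<lambda>(a, b). y a \<otimes> z b) ?U"
    using c by (intro finsum_addf) auto
  also have "\<dots> = (x \<otimes>\<^bsub>SA\<^esub> z) g \<oplus> (y \<otimes>\<^bsub>SA\<^esub> z) g"
    using SA_mult_superset[OF x z fin, of g] SA_mult_superset[OF y z fin, of g] by simp
  finally show "((x \<oplus>\<^bsub>SA\<^esub> y) \<otimes>\<^bsub>SA\<^esub> z) g = (x \<otimes>\<^bsub>SA\<^esub> z \<oplus>\<^bsub>SA\<^esub> y \<otimes>\<^bsub>SA\<^esub> z) g" by simp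
qed

lemma SA_r_distr:
  assumes x: "x \<in> carrier V" and y: "y \<in> carrier V" and z: "z \<in> carrier V"
  shows "z \<otimes>\<^bsub>SA\<^esub> (x \<oplus>\<^bsub>SA\<^esub> y) = z \<otimes>\<^bsub>SA\<^esub> x \<oplus>\<^bsub>SA\<^esub> z \<otimes>\<^bsub>SA\<^esub> y"
proof
  fix g
  interpret V: module R V by (rule free_space_module)
  let ?S = "{a. x a \<noteq> \<zero>} \<union> {a. y a \<noteq> \<zero>}" and ?T = "{a. z a \<noteq> \<zero>}"
  let ?U = "{(a, b). a \<in> ?T \<and> b \<in> ?S \<and> a \<otimes>\<^bsub>G\<^esub> b = g}"
  have fin: "finite ?T" "finite ?S"
    and c: "\<And>a. x a \<in> carrier R" "\<And>b. y b \<in> carrier R" "\<And>b. z b \<in> carrier R"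
    using x y z by (auto simp: free_space_carrier_iff)
  have "x \<oplus>\<^bsub>V\<^esub> y \<in> carrier V" using x y by blast
  then have "(z \<otimes>\<^bsub>SA\<^esub> (x \<oplus>\<^bsub>V\<^esub> y)) g = finsum R (\<lambda>(a, b). z a \<otimes> (x \<oplus>\<^bsub>V\<^esub> y) b) ?U"
    by (rule SA_mult_superset[OF z _ fin]) auto
  also have "\<dots> = finsum R (\<lambda>p. (\<lambda>(a, b). z a \<otimes> x b) p \<oplus> (\<lambda>(a, b). z a \<otimes> y b) p) ?U"
    using c by (intro finsum_cong') (auto simp: r_distr)
  also have "\<dots> = finsum R (\<lambda>(a, b). z a \<otimes> x b) ?U \<oplus> finsum R (\<lambda>(a, b). z a \<otimes> y b) ?U"
    using c by (intro finsum_addf) auto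
  also have "\<dots> = (z \<otimes>\<^bsub>SA\<^esub> x) g \<oplus> (z \<otimes>\<^bsub>SA\<^esub> y) g"
    using SA_mult_superset[OF z x fin, of g] SA_mult_superset[OF z y fin, of g] by simp
  finally show "(z \<otimes>\<^bsub>SA\<^esub> (x \<oplus>\<^bsub>SA\<^esub> y)) g = (z \<otimes>\<^bsub>SA\<^esub> x \<oplus>\<^bsub>SA\<^esub> z \<otimes>\<^bsub>SA\<^esub> y) g" by simp
qed

lemma SA_single_mult:
  assumes "k \<in> carrier R" "l \<in> carrier R" "a \<in> carrier G" "b \<in> carrier G"
  shows "single R k a \<otimes>\<^bsub>SA\<^esub> single R l b = single R (k \<otimes> l) (a \<otimes>\<^bsub>G\<^esub> b)"
proof
  fix g
  have *: "{(c, d). c \<in> {a} \<and> d \<in> {b} \<and> c \<otimes>\<^bsub>G\<^esub> d = g} = (if a \<otimes>\<^bsub>G\<^esub> b = g then {(a, b)} else {})"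
    by auto
  have "(single R k a \<otimes>\<^bsub>SA\<^esub> single R l b) g =
      finsum R (\<lambda>(c, d). single R k a c \<otimes> single R l b d) {(c, d). c \<in> {a} \<and> d \<in> {b} \<and> c \<otimes>\<^bsub>G\<^esub> d = g}"
    by (rule SA_mult_superset)
      (use single_carrier[OF assms(1,3)] single_carrier[OF assms(2,4)] in \<open>auto simp: single_def\<close>)
  then show "(single R k a \<otimes>\<^bsub>SA\<^esub> single R l b) g = single R (k \<otimes> l) (a \<otimes>\<^bsub>G\<^esub> b) g"
    unfolding * using assms by (auto simp: single_def)
qed

lemma SA_nonunital_algebra: "nonunital_algebra R SA"
proof -
  interpret V: module R V by (rule free_space_module)
  interpret S: module R SA by (rule SA_module)
  have ag: "abelian_group V" "abelian_group SA" by intro_locales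
  note hom = SA_mult_closed SA_l_distr SA_r_distr
  show ?thesis
  proof (intro nonunital_algebra.intro nonunital_algebra_axioms.intro SA_module)
    fix x y z assume xyz: "x \<in> carrier SA" "y \<in> carrier SA" "z \<in> carrier SA"
    then show "x \<otimes>\<^bsub>SA\<^esub> y \<in> carrier SA"
      "(x \<oplus>\<^bsub>SA\<^esub> y) \<otimes>\<^bsub>SA\<^esub> z = x \<otimes>\<^bsub>SA\<^esub> z \<oplus>\<^bsub>SA\<^esub> y \<otimes>\<^bsub>SA\<^esub> z"
      "z \<otimes>\<^bsub>SA\<^esub> (x \<oplus>\<^bsub>SA\<^esub> y) = z \<otimes>\<^bsub>SA\<^esub> x \<oplus>\<^bsub>SA\<^esub> z \<otimes>\<^bsub>SA\<^esub> y"
      by (simp_all only: hom SA_simps(1))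
    show "(x \<otimes>\<^bsub>SA\<^esub> y) \<otimes>\<^bsub>SA\<^esub> z = x \<otimes>\<^bsub>SA\<^esub> (y \<otimes>\<^bsub>SA\<^esub> z)"
    \<comment> \<open>Both sides are additive in each of x, y and z, so three nested applications
      reduce associativity to single terms, where it is the associativity of the semigroup.\<close>
    proof (rule additive_ext[where f = "\<lambda>x. (x \<otimes>\<^bsub>SA\<^esub> y) \<otimes>\<^bsub>SA\<^esub> z" and g = "\<lambda>x. x \<otimes>\<^bsub>SA\<^esub> (y \<otimes>\<^bsub>SA\<^esub> z)"])
      fix k a assume ka: "k \<in> carrier R" "a \<in> carrier G"
      note ka' = single_carrier[OF ka]
      show "(single R k a \<otimes>\<^bsub>SA\<^esub> y) \<otimes>\<^bsub>SA\<^esub> z = single R k a \<otimes>\<^bsub>SA\<^esub> (y \<otimes>\<^bsub>SA\<^esub> z)"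
      proof (rule additive_ext[where f = "\<lambda>y. (single R k a \<otimes>\<^bsub>SA\<^esub> y) \<otimes>\<^bsub>SA\<^esub> z"
            and g = "\<lambda>y. single R k a \<otimes>\<^bsub>SA\<^esub> (y \<otimes>\<^bsub>SA\<^esub> z)"])
        fix l b assume lb: "l \<in> carrier R" "b \<in> carrier G"
        note lb' = single_carrier[OF lb]
        show "(single R k a \<otimes>\<^bsub>SA\<^esub> single R l b) \<otimes>\<^bsub>SA\<^esub> z = single R k a \<otimes>\<^bsub>SA\<^esub> (single R l b \<otimes>\<^bsub>SA\<^esub> z)"
        proof (rule additive_ext[where f = "\<lambda>z. (single R k a \<otimes>\<^bsub>SA\<^esub> single R l b) \<otimes>\<^bsub>SA\<^esub> z"
              and g = "\<lambda>z. single R k a \<otimes>\<^bsub>SA\<^esub> (single R l b \<otimes>\<^bsub>SA\<^esub> z)"])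
          show "abelian_group_hom V SA (\<lambda>z. (single R k a \<otimes>\<^bsub>SA\<^esub> single R l b) \<otimes>\<^bsub>SA\<^esub> z)"
            "abelian_group_hom V SA (\<lambda>z. single R k a \<otimes>\<^bsub>SA\<^esub> (single R l b \<otimes>\<^bsub>SA\<^esub> z))"
            using ag ka' lb' hom by (auto intro!: abelian_group_homI')
        qed (use xyz ka lb in \<open>auto simp: SA_single_mult semi_closed semi_assoc m_assoc\<close>)
      next
        show "abelian_group_hom V SA (\<lambda>y. (single R k a \<otimes>\<^bsub>SA\<^esub> y) \<otimes>\<^bsub>SA\<^esub> z)"
          "abelian_group_hom V SA (\<lambda>y. single R k a \<otimes>\<^bsub>SA\<^esub> (y \<otimes>\<^bsub>SA\<^esub> z))"
          using ag ka' xyz hom by (auto intro!: abelian_group_homI')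
      qed (use xyz in auto)
    next
      show "abelian_group_hom V SA (\<lambda>x. (x \<otimes>\<^bsub>SA\<^esub> y) \<otimes>\<^bsub>SA\<^esub> z)"
        "abelian_group_hom V SA (\<lambda>x. x \<otimes>\<^bsub>SA\<^esub> (y \<otimes>\<^bsub>SA\<^esub> z))"
        using ag xyz hom by (auto intro!: abelian_group_homI')
    qed (use xyz in auto)
  next
    fix k x y assume a: "k \<in> carrier R" and xy: "x \<in> carrier SA" "y \<in> carrier SA"
    then have c: "\<And>a. x a \<in> carrier R" "\<And>b. y b \<in> carrier R"
      and fin: "finite {b. x b \<noteq> \<zero>}" "finite {b. y b \<noteq> \<zero>}"
      and kx: "(\<lambda>b. k \<otimes> x b) \<in> carrier V" "(\<lambda>b. k \<otimes> y b) \<in> carrier V"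
      using V.smult_closed[of k x] V.smult_closed[of k y] by (auto simp: free_space_carrier_iff)
    let ?U = "\<lambda>g. {(a, b). a \<in> {b. x b \<noteq> \<zero>} \<and> b \<in> {b. y b \<noteq> \<zero>} \<and> a \<otimes>\<^bsub>G\<^esub> b = g}"
    have finU: "finite (?U g)" for g
      by (rule finite_subset[of _ "{b. x b \<noteq> \<zero>} \<times> {b. y b \<noteq> \<zero>}"]) (use fin in auto)
    have *: "(x \<otimes>\<^bsub>SA\<^esub> y) g = finsum R (\<lambda>(a, b). x a \<otimes> y b) (?U g)" for g
      by (rule SA_mult_superset) (use xy fin in auto)
    have "k \<otimes> (x \<otimes>\<^bsub>SA\<^esub> y) g = finsum R (\<lambda>p. k \<otimes> (\<lambda>(a, b). x a \<otimes> y b) p) (?U g)" for g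
      unfolding * by (rule finsum_rdistr) (use a c finU in auto)
    moreover have "((k \<odot>\<^bsub>SA\<^esub> x) \<otimes>\<^bsub>SA\<^esub> y) g = finsum R (\<lambda>(a, b). (k \<odot>\<^bsub>SA\<^esub> x) a \<otimes> y b) (?U g)" for g
      by (rule SA_mult_superset) (use xy kx fin a in auto)
    moreover have "(x \<otimes>\<^bsub>SA\<^esub> (k \<odot>\<^bsub>SA\<^esub> y)) g = finsum R (\<lambda>(a, b). x a \<otimes> (k \<odot>\<^bsub>SA\<^esub> y) b) (?U g)" for g
      by (rule SA_mult_superset) (use xy kx fin a in auto)
    moreover have "finsum R (\<lambda>(a, b). (k \<odot>\<^bsub>SA\<^esub> x) a \<otimes> y b) (?U g) = finsum R (\<lambda>p. k \<otimes> (\<lambda>(a, b). x a \<otimes> y b) p) (?U g)"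
      "finsum R (\<lambda>(a, b). x a \<otimes> (k \<odot>\<^bsub>SA\<^esub> y) b) (?U g) = finsum R (\<lambda>p. k \<otimes> (\<lambda>(a, b). x a \<otimes> y b) p) (?U g)" for g
      using a c by (auto intro!: finsum_cong' simp: m_ac)
    ultimately show "(k \<odot>\<^bsub>SA\<^esub> x) \<otimes>\<^bsub>SA\<^esub> y = k \<odot>\<^bsub>SA\<^esub> (x \<otimes>\<^bsub>SA\<^esub> y)" "x \<otimes>\<^bsub>SA\<^esub> (k \<odot>\<^bsub>SA\<^esub> y) = k \<odot>\<^bsub>SA\<^esub> (x \<otimes>\<^bsub>SA\<^esub> y)"
      by (auto simp: fun_eq_iff)
  qed
qed

end

section \<open>Quotient algebras\<close>

lemma hom_finsum:
  assumes "abelian_group_hom M N h" "f \<in> S \<rightarrow> carrier M"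
  shows "h (finsum M f S) = (\<Oplus>\<^bsub>N\<^esub>s\<in>S. h (f s))"
proof -
  interpret abelian_group_hom M N h by fact
  show ?thesis using assms(2)
  proof (induction S rule: infinite_finite_induct)
    case (insert s S)
    then have "f \<in> S \<rightarrow> carrier M" "f s \<in> carrier M" by auto
    moreover from this(1) have "(\<lambda>s. h (f s)) \<in> S \<rightarrow> carrier N" by (auto simp: Pi_iff)
    ultimately show ?case using insert by simp
  qed simp_all
qed

context nonunital_algebra
begin

text \<open>Negatives are multiples by the scalar -1, so closure under sums and scalars already
  gives an additive subgroup.\<close>

lemma algebra_idealI:
  fixes I
  assumes "I \<subseteq> carrier A" "\<zero>\<^bsub>A\<^esub> \<in> I"
    and "\<And>a b. \<lbrakk>a \<in> I; b \<in> I\<rbrakk> \<Longrightarrow> a \<oplus>\<^bsub>A\<^esub> b \<in> I"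
    and "\<And>k a. \<lbrakk>k \<in> carrier R; a \<in> I\<rbrakk> \<Longrightarrow> k \<odot>\<^bsub>A\<^esub> a \<in> I"
    and "\<And>a b. \<lbrakk>b \<in> carrier A; a \<in> I\<rbrakk> \<Longrightarrow> b \<otimes>\<^bsub>A\<^esub> a \<in> I"
    and "\<And>a b. \<lbrakk>b \<in> carrier A; a \<in> I\<rbrakk> \<Longrightarrow> a \<otimes>\<^bsub>A\<^esub> b \<in> I"
  shows "algebra_ideal (carrier R) A I"
proof -
  have "\<ominus>\<^bsub>A\<^esub> a \<in> I" if "a \<in> I" for a
  proof -
    have "(\<ominus> \<one>) \<odot>\<^bsub>A\<^esub> a = \<ominus>\<^bsub>A\<^esub> a"
      using that assms(1) smult_l_minus[of \<one> a] by auto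
    with assms(4)[of "\<ominus> \<one>" a] that show ?thesis by simp
  qed
  then have "subgroup I (add_monoid A)"
    using assms(1-3) by (intro subgroup.intro) (auto simp: a_inv_def[symmetric])
  with assms show ?thesis
    by (auto simp: algebra_ideal_def intro: additive_subgroup.intro)
qed

lemma gen_algebra_ideal_ideal:
  assumes "X \<subseteq> carrier A"
  shows "algebra_ideal (carrier R) A (gen_algebra_ideal (carrier R) A X)"
proof -
  let ?F = "{I. algebra_ideal (carrier R) A I \<and> X \<subseteq> I}"
  have c: "carrier A \<in> ?F" using assms by (auto intro!: algebra_idealI)
  have z: "\<zero>\<^bsub>A\<^esub> \<in> I" "\<And>a b. a \<in> I \<Longrightarrow> b \<in> I \<Longrightarrow> a \<oplus>\<^bsub>A\<^esub> b \<in> I" if "I \<in> ?F" for I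
    using that by (auto simp: algebra_ideal_def additive_subgroup.zero_closed additive_subgroup.a_closed)
  have m: "\<And>k a. k \<in> carrier R \<Longrightarrow> a \<in> I \<Longrightarrow> k \<odot>\<^bsub>A\<^esub> a \<in> I"
    "\<And>a b. b \<in> carrier A \<Longrightarrow> a \<in> I \<Longrightarrow> b \<otimes>\<^bsub>A\<^esub> a \<in> I"
    "\<And>a b. b \<in> carrier A \<Longrightarrow> a \<in> I \<Longrightarrow> a \<otimes>\<^bsub>A\<^esub> b \<in> I" if "I \<in> ?F" for I
    using that by (auto simp: algebra_ideal_def)
  show ?thesis unfolding gen_algebra_ideal_def
  proof (rule algebra_idealI)
    show "\<Inter> ?F \<subseteq> carrier A" using c by blast
    show "\<zero>\<^bsub>A\<^esub> \<in> \<Inter> ?F" using z(1) by blast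
  next
    fix a b assume "a \<in> \<Inter> ?F" "b \<in> \<Inter> ?F"
    then show "a \<oplus>\<^bsub>A\<^esub> b \<in> \<Inter> ?F" by (intro InterI z(2)) auto
  next
    fix k a assume "k \<in> carrier R" "a \<in> \<Inter> ?F"
    then show "k \<odot>\<^bsub>A\<^esub> a \<in> \<Inter> ?F" by (intro InterI m(1)) auto
  next
    fix a b assume "b \<in> carrier A" "a \<in> \<Inter> ?F"
    then show "b \<otimes>\<^bsub>A\<^esub> a \<in> \<Inter> ?F" "a \<otimes>\<^bsub>A\<^esub> b \<in> \<Inter> ?F"
      by (intro InterI m(2) m(3); auto)+
  qed
qed

end

locale quotient_algebra = nonunital_algebra R A
  for R :: "('a, 'c) ring_scheme" (structure) and A :: "('a, 'b) module" (structure) +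
  fixes I :: "'b set"
  assumes ideal: "algebra_ideal (carrier R) A I"
begin

sublocale I: abelian_subgroup I A
  using ideal abelian_group_A by (auto simp: algebra_ideal_def intro: abelian_subgroupI3)

abbreviation "Q \<equiv> quot_algebra A I"
abbreviation "cls x \<equiv> I +>\<^bsub>A\<^esub> x"

lemma cls_eq_iff:
  assumes "x \<in> carrier A" "y \<in> carrier A"
  shows "cls x = cls y \<longleftrightarrow> x \<ominus>\<^bsub>A\<^esub> y \<in> I"
proof
  assume "x \<ominus>\<^bsub>A\<^esub> y \<in> I"
  then have "x \<ominus>\<^bsub>A\<^esub> y \<oplus>\<^bsub>A\<^esub> y \<in> cls y" by (rule M.a_rcosI) (use assms I.a_subset in auto)
  moreover have "x \<ominus>\<^bsub>A\<^esub> y \<oplus>\<^bsub>A\<^esub> y = x" using assms by (simp add: a_minus_def M.a_assoc M.l_neg)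
  ultimately show "cls x = cls y"
    using assms(2) I.a_subgroup M.a_repr_independence by metis
next
  assume "cls x = cls y"
  then have "x \<in> cls y" using assms I.a_rcos_self by metis
  then obtain h where "h \<in> I" "x = h \<oplus>\<^bsub>A\<^esub> y" by (auto simp: a_r_coset_def' )
  with assms I.a_subset show "x \<ominus>\<^bsub>A\<^esub> y \<in> I"
    by (auto simp: a_minus_def M.a_assoc M.r_neg subset_iff)
qed

lemma cls_mem: "x \<in> carrier A \<Longrightarrow> a \<in> cls x \<longleftrightarrow> a \<in> carrier A \<and> cls a = cls x"
proof -
  assume x: "x \<in> carrier A"
  have "a \<in> carrier A \<and> cls a = cls x" if "a \<in> cls x"
    using that x M.a_r_coset_subset_G[OF I.a_subset x] M.a_repr_independence[OF that x I.a_subgroup] by auto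
  moreover have "a \<in> cls x" if "a \<in> carrier A" "cls a = cls x"
    using I.a_rcos_self[OF that(1)] that(2) by simp
  ultimately show ?thesis by blast
qed

text \<open>Products and scalar multiples in a quotient are defined as unions over representatives.
  If all members of the union coincide, it collapses to a single coset.\<close>

lemma cls_const:
  assumes "x \<in> carrier A" "\<And>a. a \<in> carrier A \<Longrightarrow> cls a = cls x \<Longrightarrow> F a = F x"
  shows "(\<Union>a\<in>cls x. F a) = F x"
proof -
  have "F a = F x" if "a \<in> cls x" for a using that assms cls_mem by blast
  moreover have "x \<in> cls x" using assms(1) cls_mem by simp
  ultimately show ?thesis by blast
qed

lemma ideal_closed:
  shows "a \<in> I \<Longrightarrow> a \<in> carrier A"
    and "a \<in> I \<Longrightarrow> b \<in> I \<Longrightarrow> a \<oplus>\<^bsub>A\<^esub> b \<in> I"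
    and "k \<in> carrier R \<Longrightarrow> a \<in> I \<Longrightarrow> k \<odot>\<^bsub>A\<^esub> a \<in> I"
    and "b \<in> carrier A \<Longrightarrow> a \<in> I \<Longrightarrow> b \<otimes>\<^bsub>A\<^esub> a \<in> I"
    and "b \<in> carrier A \<Longrightarrow> a \<in> I \<Longrightarrow> a \<otimes>\<^bsub>A\<^esub> b \<in> I"
  using ideal I.a_subset I.a_closed by (auto simp: algebra_ideal_def)

lemma cls_mult_cong:
  assumes "x \<in> carrier A" "y \<in> carrier A" "x' \<in> carrier A" "y' \<in> carrier A"
    and "cls x' = cls x" "cls y' = cls y"
  shows "cls (x' \<otimes>\<^bsub>A\<^esub> y') = cls (x \<otimes>\<^bsub>A\<^esub> y)"
proof -
  have "(x' \<ominus>\<^bsub>A\<^esub> x) \<otimes>\<^bsub>A\<^esub> y' \<oplus>\<^bsub>A\<^esub> x \<otimes>\<^bsub>A\<^esub> (y' \<ominus>\<^bsub>A\<^esub> y) \<in> I"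
    using assms cls_eq_iff by (intro ideal_closed(2) ideal_closed(4)[of x] ideal_closed(5)[of y']) auto
  moreover have "(x' \<ominus>\<^bsub>A\<^esub> x) \<otimes>\<^bsub>A\<^esub> y' = x' \<otimes>\<^bsub>A\<^esub> y' \<ominus>\<^bsub>A\<^esub> x \<otimes>\<^bsub>A\<^esub> y'"
    using assms abelian_group_hom.hom_add[OF right_mult_hom[of y']]
      abelian_group_hom.hom_a_inv[OF right_mult_hom[of y'], of x] by (simp add: a_minus_def)
  moreover have "x \<otimes>\<^bsub>A\<^esub> (y' \<ominus>\<^bsub>A\<^esub> y) = x \<otimes>\<^bsub>A\<^esub> y' \<ominus>\<^bsub>A\<^esub> x \<otimes>\<^bsub>A\<^esub> y"
    using assms abelian_group_hom.hom_add[OF left_mult_hom[of x]]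
      abelian_group_hom.hom_a_inv[OF left_mult_hom[of x], of y] by (simp add: a_minus_def)
  moreover have "(a \<ominus>\<^bsub>A\<^esub> b) \<oplus>\<^bsub>A\<^esub> (b \<ominus>\<^bsub>A\<^esub> c) = a \<ominus>\<^bsub>A\<^esub> c"
    if "a \<in> carrier A" "b \<in> carrier A" "c \<in> carrier A" for a b c
    using that by (simp add: a_minus_def M.a_assoc M.r_neg1)
  ultimately show ?thesis using assms by (simp add: cls_eq_iff)
qed

lemma cls_smult_cong:
  assumes "k \<in> carrier R" "x \<in> carrier A" "x' \<in> carrier A" "cls x' = cls x"
  shows "cls (k \<odot>\<^bsub>A\<^esub> x') = cls (k \<odot>\<^bsub>A\<^esub> x)"
proof -
  have "k \<odot>\<^bsub>A\<^esub> (x' \<ominus>\<^bsub>A\<^esub> x) \<in> I" using assms cls_eq_iff by (intro ideal_closed(3)) auto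
  moreover have "k \<odot>\<^bsub>A\<^esub> (x' \<ominus>\<^bsub>A\<^esub> x) = k \<odot>\<^bsub>A\<^esub> x' \<ominus>\<^bsub>A\<^esub> k \<odot>\<^bsub>A\<^esub> x"
    using assms by (simp add: a_minus_def smult_r_distr smult_r_minus)
  ultimately show ?thesis using assms by (simp add: cls_eq_iff)
qed

lemma quot_simps:
  "carrier Q = cls ` carrier A" "\<zero>\<^bsub>Q\<^esub> = cls \<zero>\<^bsub>A\<^esub>"
  "x \<in> carrier A \<Longrightarrow> y \<in> carrier A \<Longrightarrow> cls x \<oplus>\<^bsub>Q\<^esub> cls y = cls (x \<oplus>\<^bsub>A\<^esub> y)"
  "x \<in> carrier A \<Longrightarrow> y \<in> carrier A \<Longrightarrow> cls x \<otimes>\<^bsub>Q\<^esub> cls y = cls (x \<otimes>\<^bsub>A\<^esub> y)"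
  "k \<in> carrier R \<Longrightarrow> x \<in> carrier A \<Longrightarrow> k \<odot>\<^bsub>Q\<^esub> cls x = cls (k \<odot>\<^bsub>A\<^esub> x)"
proof -
  show "carrier Q = cls ` carrier A"
    by (auto simp: quot_algebra_def ring.defs module.defs FactRing_def A_RCOSETS_def')
  have "cls \<zero>\<^bsub>A\<^esub> = I" using I.a_subset by (simp add: M.a_coset_add_zero)
  then show "\<zero>\<^bsub>Q\<^esub> = cls \<zero>\<^bsub>A\<^esub>"
    by (simp add: quot_algebra_def ring.defs module.defs FactRing_def)
  show "x \<in> carrier A \<Longrightarrow> y \<in> carrier A \<Longrightarrow> cls x \<oplus>\<^bsub>Q\<^esub> cls y = cls (x \<oplus>\<^bsub>A\<^esub> y)"
    by (simp add: quot_algebra_def ring.defs module.defs FactRing_def I.a_rcos_sum)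
  show "cls x \<otimes>\<^bsub>Q\<^esub> cls y = cls (x \<otimes>\<^bsub>A\<^esub> y)" if "x \<in> carrier A" "y \<in> carrier A"
  proof -
    have "cls x \<otimes>\<^bsub>Q\<^esub> cls y = (\<Union>a\<in>cls x. \<Union>b\<in>cls y. cls (a \<otimes>\<^bsub>A\<^esub> b))"
      by (simp add: quot_algebra_def ring.defs module.defs FactRing_def rcoset_mult_def)
    also have "\<dots> = (\<Union>a\<in>cls x. cls (a \<otimes>\<^bsub>A\<^esub> y))"
      using that by (intro SUP_cong refl cls_const cls_mult_cong) (auto simp: cls_mem)
    also have "\<dots> = cls (x \<otimes>\<^bsub>A\<^esub> y)" using that by (intro cls_const cls_mult_cong) auto
    finally show ?thesis .
  qed
  show "k \<odot>\<^bsub>Q\<^esub> cls x = cls (k \<odot>\<^bsub>A\<^esub> x)" if "k \<in> carrier R" "x \<in> carrier A"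
  proof -
    have "k \<odot>\<^bsub>Q\<^esub> cls x = (\<Union>a\<in>cls x. cls (k \<odot>\<^bsub>A\<^esub> a))"
      by (simp add: quot_algebra_def ring.defs module.defs)
    also have "\<dots> = cls (k \<odot>\<^bsub>A\<^esub> x)" using that by (intro cls_const cls_smult_cong) auto
    finally show ?thesis .
  qed
qed

lemma cls_zero_iff: "x \<in> carrier A \<Longrightarrow> cls x = \<zero>\<^bsub>Q\<^esub> \<longleftrightarrow> x \<in> I"
proof -
  assume x: "x \<in> carrier A"
  have "\<ominus>\<^bsub>A\<^esub> \<zero>\<^bsub>A\<^esub> = \<zero>\<^bsub>A\<^esub>" by (rule M.minus_equality) simp_all
  then have "x \<ominus>\<^bsub>A\<^esub> \<zero>\<^bsub>A\<^esub> = x" using x unfolding a_minus_def by (metis M.r_zero)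
  with x show "cls x = \<zero>\<^bsub>Q\<^esub> \<longleftrightarrow> x \<in> I"
    by (simp add: quot_simps cls_eq_iff)
qed

lemma quot_nonunital_algebra: "nonunital_algebra R Q"
proof -
  have ag: "abelian_group Q"
  proof (rule abelian_groupI)
    fix X assume "X \<in> carrier Q"
    then obtain x where x: "x \<in> carrier A" "X = cls x" by (auto simp: quot_simps)
    then have "cls (\<ominus>\<^bsub>A\<^esub> x) \<oplus>\<^bsub>Q\<^esub> X = \<zero>\<^bsub>Q\<^esub>" by (simp add: quot_simps M.l_neg)
    with x show "\<exists>Y\<in>carrier Q. Y \<oplus>\<^bsub>Q\<^esub> X = \<zero>\<^bsub>Q\<^esub>" by (auto simp: quot_simps(1))
  qed (auto simp: quot_simps M.a_ac)
  show ?thesis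
    by (intro nonunital_algebra.intro nonunital_algebra_axioms.intro moduleI is_cring ag)
      (auto simp: quot_simps smult_l_distr smult_r_distr smult_assoc1 mult_assoc mult_l_distr
        mult_r_distr smult_mult mult_smult)
qed

lemma cls_hom: "abelian_group_hom A Q cls"
  using abelian_group_A nonunital_algebra.abelian_group_A[OF quot_nonunital_algebra]
  by (intro abelian_group_homI') (auto simp: quot_simps)

end

section \<open>The universal property of Leavitt path algebras\<close>

definition leavitt_family ::
    "('l, 'b, 'd) module_scheme \<Rightarrow> ('v, 'e) pre_digraph \<Rightarrow> (('v, 'e) gen \<Rightarrow> 'b) \<Rightarrow> bool" where
  "leavitt_family B E \<phi> \<longleftrightarrow>
     \<phi> ` gens E \<subseteq> carrier B \<and>
     (\<forall>v\<in>verts E. \<forall>w\<in>verts E. \<phi> (Vertex v) \<otimes>\<^bsub>B\<^esub> \<phi> (Vertex w) = (if v = w then \<phi> (Vertex v) else \<zero>\<^bsub>B\<^esub>)) \<and>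
     (\<forall>e\<in>arcs E. \<phi> (Vertex (tail E e)) \<otimes>\<^bsub>B\<^esub> \<phi> (Edge e) = \<phi> (Edge e) \<and>
        \<phi> (Edge e) \<otimes>\<^bsub>B\<^esub> \<phi> (Vertex (head E e)) = \<phi> (Edge e) \<and>
        \<phi> (Vertex (head E e)) \<otimes>\<^bsub>B\<^esub> \<phi> (Ghost e) = \<phi> (Ghost e) \<and>
        \<phi> (Ghost e) \<otimes>\<^bsub>B\<^esub> \<phi> (Vertex (tail E e)) = \<phi> (Ghost e)) \<and>
     (\<forall>e\<in>arcs E. \<forall>f\<in>arcs E. \<phi> (Ghost e) \<otimes>\<^bsub>B\<^esub> \<phi> (Edge f) =
        (if e = f then \<phi> (Vertex (head E e)) else \<zero>\<^bsub>B\<^esub>)) \<and>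
     (\<forall>v. regular E v \<longrightarrow> \<phi> (Vertex v) = (\<Oplus>\<^bsub>B\<^esub>e\<in>out_arcs E v. \<phi> (Edge e) \<otimes>\<^bsub>B\<^esub> \<phi> (Ghost e)))"

lemma words_simps [simp]:
  "carrier (words X) = {w. w \<noteq> [] \<and> set w \<subseteq> X}" "u \<otimes>\<^bsub>words X\<^esub> w = u @ w"
  by (simp_all add: words_def)

lemma gens_simps [simp]:
  "Vertex v \<in> gens E \<longleftrightarrow> v \<in> verts E" "Edge e \<in> gens E \<longleftrightarrow> e \<in> arcs E" "Ghost e \<in> gens E \<longleftrightarrow> e \<in> arcs E"
  by (auto simp: gens_def)

locale free_alg = cring K for K (structure) + fixes X :: "'g set"
begin

sublocale W: semigroup_alg K "words X"
  by unfold_locales auto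

abbreviation "A \<equiv> free_algebra K X"

sublocale A: nonunital_algebra K A
  unfolding free_algebra_def by (rule W.SA_nonunital_algebra)

lemma A_carrier: "carrier A = carrier (free_space K (carrier (words X)))"
  by (simp only: free_algebra_def W.SA_simps)

lemma A_add: "x \<oplus>\<^bsub>A\<^esub> y = x \<oplus>\<^bsub>free_space K B\<^esub> y"
  by (simp add: free_algebra_def)

lemma A_smult: "k \<odot>\<^bsub>A\<^esub> x = k \<odot>\<^bsub>free_space K B\<^esub> x"
  by (simp add: free_algebra_def)

lemma A_zero: "\<zero>\<^bsub>A\<^esub> = (\<lambda>w. \<zero>)"
  by (simp add: free_algebra_def)

lemma A_single_mult:
  assumes "k \<in> carrier K" "l \<in> carrier K" "u \<noteq> []" "set u \<subseteq> X" "w \<noteq> []" "set w \<subseteq> X"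
  shows "single K k u \<otimes>\<^bsub>A\<^esub> single K l w = single K (k \<otimes> l) (u @ w)"
  using W.SA_single_mult[OF assms(1,2), of u w] assms by (simp add: free_algebra_def)

lemma A_single: "k \<in> carrier K \<Longrightarrow> w \<noteq> [] \<Longrightarrow> set w \<subseteq> X \<Longrightarrow> single K k w \<in> carrier A"
  by (simp add: A_carrier single_carrier)

lemma hom_A_V: "abelian_group_hom A M f \<longleftrightarrow> abelian_group_hom (free_space K (carrier (words X))) M f"
proof -
  have "abelian_group A" "abelian_group (free_space K (carrier (words X)))"
    using A.abelian_group_A module.axioms(2)[OF free_space_module] by auto
  then show ?thesis
    by (auto simp: A_carrier A_add[of _ _ "carrier (words X)"] intro!: abelian_group_homI'
        dest: abelian_group_hom.hom_closed abelian_group_hom.hom_add intro: abelian_group_hom.axioms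
        simp del: free_space_simps words_simps)
qed

end

lemma word_prod_closed:
  assumes "nonunital_algebra S B" "\<phi> ` X \<subseteq> carrier B" "w \<noteq> []" "set w \<subseteq> X"
  shows "word_prod B \<phi> w \<in> carrier B"
proof -
  interpret nonunital_algebra S B by fact
  show ?thesis using assms(3,4)
  proof (induction w)
    case (Cons g w)
    then have "\<phi> g \<in> carrier B" using assms(2) by auto
    with Cons show ?case by (cases "w = []") auto
  qed simp
qed

lemma word_prod_append:
  assumes "nonunital_algebra S B" "\<phi> ` X \<subseteq> carrier B"
    and "u \<noteq> []" "set u \<subseteq> X" "w \<noteq> []" "set w \<subseteq> X"
  shows "word_prod B \<phi> (u @ w) = word_prod B \<phi> u \<otimes>\<^bsub>B\<^esub> word_prod B \<phi> w"
proof -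
  interpret nonunital_algebra S B by fact
  have w: "word_prod B \<phi> w \<in> carrier B" using word_prod_closed[OF assms(1,2,5,6)] .
  show ?thesis using assms(3,4)
  proof (induction u)
    case (Cons g u)
    show ?case
    proof (cases "u = []")
      case False
      then have "word_prod B \<phi> u \<in> carrier B" "\<phi> g \<in> carrier B"
        using Cons.prems word_prod_closed[OF assms(1,2)] assms(2) by auto
      with False Cons w show ?thesis by (auto simp: mult_assoc)
    qed (use assms in simp)
  qed simp
qed

section \<open>Leavitt path algebras by generators and relations\<close>

locale leavitt_path = K: field K + E: wf_digraph E
  for K :: "('k, 'c) ring_scheme" and E :: "('v, 'e) pre_digraph"
begin

sublocale free_alg K "gens E" ..

abbreviation "I \<equiv> lpa_ideal K E"
abbreviation "L \<equiv> lpa K E"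
abbreviation "\<gamma> \<equiv> lpa_gen K E"
abbreviation lpa_mult (infixl "\<bullet>" 70) where "a \<bullet> b \<equiv> a \<otimes>\<^bsub>L\<^esub> b"

lemma basis_in_A: "w \<noteq> [] \<Longrightarrow> set w \<subseteq> gens E \<Longrightarrow> basis_elt K w \<in> carrier A"
  by (simp add: basis_elt_single A_single)

lemma ends_in_verts: "e \<in> arcs E \<Longrightarrow> tail E e \<in> verts E" "e \<in> arcs E \<Longrightarrow> head E e \<in> verts E"
  by (fact E.tail_in_verts E.head_in_verts)+

lemma relations_in_A: "lpa_relations K E \<subseteq> carrier A"
proof -
  have "finsum A (\<lambda>e. basis_elt K [Edge e, Ghost e]) (out_arcs E v) \<in> carrier A" for v
    by (intro A.M.finsum_closed) (auto intro!: basis_in_A)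
  then show ?thesis
    unfolding lpa_relations_def Let_def
    by (auto intro!: basis_in_A A.M.minus_closed simp: regular_def)
qed

sublocale QA: quotient_algebra K A I
  using A.gen_algebra_ideal_ideal[OF relations_in_A]
  by unfold_locales (simp add: lpa_ideal_def)

lemma relations_in_I: "lpa_relations K E \<subseteq> I"
  by (auto simp: lpa_ideal_def gen_algebra_ideal_def)

abbreviation "cls x \<equiv> I +>\<^bsub>A\<^esub> x"

sublocale L: nonunital_algebra K L
  unfolding lpa_def by (rule QA.quot_nonunital_algebra)

lemmas L_simps = QA.quot_simps[folded lpa_def]
lemmas L_zero_iff = QA.cls_zero_iff[folded lpa_def]
lemmas L_cls_hom = QA.cls_hom[folded lpa_def]

lemma gen_cls: "\<gamma> g = cls (basis_elt K [g])"
  by (simp add: lpa_gen_def)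

lemma gen_closed [simp, intro]: "g \<in> gens E \<Longrightarrow> \<gamma> g \<in> carrier L"
  by (simp add: gen_cls L_simps basis_in_A)

lemma cls_basis_Cons:
  assumes "g \<in> gens E" "w \<noteq> []" "set w \<subseteq> gens E"
  shows "cls (basis_elt K (g # w)) = \<gamma> g \<bullet> cls (basis_elt K w)"
  using assms A_single_mult[of "\<one>\<^bsub>K\<^esub>" "\<one>\<^bsub>K\<^esub>" "[g]" w]
  by (simp add: gen_cls L_simps basis_in_A) (simp add: basis_elt_single)

lemma cls_word:
  assumes "w \<noteq> []" "set w \<subseteq> gens E"
  shows "cls (basis_elt K w) = word_prod L \<gamma> w"
  using assms
proof (induction w)
  case (Cons g w)
  then show ?case by (cases "w = []") (simp_all add: gen_cls cls_basis_Cons[unfolded gen_cls])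
qed simp

lemma cls_single:
  assumes "k \<in> carrier K" "w \<noteq> []" "set w \<subseteq> gens E"
  shows "cls (single K k w) = k \<odot>\<^bsub>L\<^esub> word_prod L \<gamma> w"
proof -
  have "single K k w = k \<odot>\<^bsub>A\<^esub> basis_elt K w"
    using assms by (auto simp: basis_elt_single A_smult[of _ _ UNIV] single_def)
  with assms show ?thesis by (simp add: L_simps cls_word[symmetric] basis_in_A)
qed

lemma L_relations:
  "x \<in> carrier A \<Longrightarrow> y \<in> carrier A \<Longrightarrow> x \<ominus>\<^bsub>A\<^esub> y \<in> lpa_relations K E \<Longrightarrow> cls x = cls y"
  "x \<in> lpa_relations K E \<Longrightarrow> cls x = \<zero>\<^bsub>L\<^esub>"
  using relations_in_I relations_in_A QA.cls_eq_iff L_zero_iff by blast+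

lemma gen_family: "leavitt_family L E \<gamma>"
proof -
  have two: "\<gamma> g \<bullet> \<gamma> h = cls (basis_elt K [g, h])" if "g \<in> gens E" "h \<in> gens E" for g h
    using that cls_basis_Cons[of g "[h]"] by (simp add: gen_cls)
  have eq: "\<gamma> g \<bullet> \<gamma> h = \<gamma> j"
    if "g \<in> gens E" "h \<in> gens E" "j \<in> gens E" "basis_elt K [g, h] \<ominus>\<^bsub>A\<^esub> basis_elt K [j] \<in> lpa_relations K E" for g h j
    using that two L_relations(1) basis_in_A by (simp add: gen_cls)
  have z: "\<gamma> g \<bullet> \<gamma> h = \<zero>\<^bsub>L\<^esub>"
    if "g \<in> gens E" "h \<in> gens E" "basis_elt K [g, h] \<in> lpa_relations K E" for g h
    using that two L_relations(2) by simp
  have reg: "\<gamma> (Vertex v) = (\<Oplus>\<^bsub>L\<^esub>e\<in>out_arcs E v. \<gamma> (Edge e) \<bullet> \<gamma> (Ghost e))" if "regular E v" for v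
  proof -
    have ee: "(\<lambda>e. basis_elt K [Edge e, Ghost e]) \<in> out_arcs E v \<rightarrow> carrier A"
      by (auto intro!: basis_in_A)
    have "basis_elt K [Vertex v] \<ominus>\<^bsub>A\<^esub> (\<Oplus>\<^bsub>A\<^esub>e\<in>out_arcs E v. basis_elt K [Edge e, Ghost e]) \<in> lpa_relations K E"
      using that unfolding lpa_relations_def Let_def by blast
    then have "\<gamma> (Vertex v) = cls (\<Oplus>\<^bsub>A\<^esub>e\<in>out_arcs E v. basis_elt K [Edge e, Ghost e])"
      unfolding gen_cls using that ee
      by (intro L_relations(1) basis_in_A A.M.finsum_closed) (auto simp: regular_def)
    also have "\<dots> = (\<Oplus>\<^bsub>L\<^esub>e\<in>out_arcs E v. cls (basis_elt K [Edge e, Ghost e]))"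
      by (rule hom_finsum[OF L_cls_hom ee])
    also have "\<dots> = (\<Oplus>\<^bsub>L\<^esub>e\<in>out_arcs E v. \<gamma> (Edge e) \<bullet> \<gamma> (Ghost e))"
      by (rule L.M.finsum_cong') (auto simp: two)
    finally show ?thesis .
  qed
  have "\<gamma> (Vertex v) \<bullet> \<gamma> (Vertex v) = \<gamma> (Vertex v)" if "v \<in> verts E" for v
    by (rule eq) (use that in \<open>auto simp: lpa_relations_def Let_def\<close>)
  moreover have "\<gamma> (Vertex v) \<bullet> \<gamma> (Vertex w) = \<zero>\<^bsub>L\<^esub>"
    if "v \<in> verts E" "w \<in> verts E" "v \<noteq> w" for v w
    by (rule z) (use that in \<open>auto simp: lpa_relations_def Let_def\<close>)
  moreover have "\<gamma> (Ghost e) \<bullet> \<gamma> (Edge e) = \<gamma> (Vertex (head E e))" if "e \<in> arcs E" for e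
    by (rule eq) (use that in \<open>auto simp: lpa_relations_def Let_def\<close>)
  moreover have "\<gamma> (Ghost e) \<bullet> \<gamma> (Edge f) = \<zero>\<^bsub>L\<^esub>"
    if "e \<in> arcs E" "f \<in> arcs E" "e \<noteq> f" for e f
    by (rule z) (use that in \<open>auto simp: lpa_relations_def Let_def\<close>)
  moreover have "\<gamma> (Vertex (tail E e)) \<bullet> \<gamma> (Edge e) = \<gamma> (Edge e)"
    "\<gamma> (Edge e) \<bullet> \<gamma> (Vertex (head E e)) = \<gamma> (Edge e)"
    "\<gamma> (Vertex (head E e)) \<bullet> \<gamma> (Ghost e) = \<gamma> (Ghost e)"
    "\<gamma> (Ghost e) \<bullet> \<gamma> (Vertex (tail E e)) = \<gamma> (Ghost e)" if "e \<in> arcs E" for e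
    by (rule eq; use that in \<open>auto simp: lpa_relations_def Let_def\<close>)+
  ultimately show ?thesis
    unfolding leavitt_family_def using reg by auto
qed

lemma L_induct [consumes 1, case_names zero add word]:
  assumes "a \<in> carrier L" "Q \<zero>\<^bsub>L\<^esub>"
    and add: "\<And>a b. \<lbrakk>a \<in> carrier L; b \<in> carrier L; Q a; Q b\<rbrakk> \<Longrightarrow> Q (a \<oplus>\<^bsub>L\<^esub> b)"
    and word: "\<And>k w. \<lbrakk>k \<in> carrier K; w \<noteq> []; set w \<subseteq> gens E\<rbrakk> \<Longrightarrow> Q (k \<odot>\<^bsub>L\<^esub> word_prod L \<gamma> w)"
  shows "Q a"
proof -
  obtain x where x: "x \<in> carrier A" "a = cls x" using assms(1) by (auto simp: L_simps)
  have "x \<in> carrier (free_space K (carrier (words (gens E))))" using x A_carrier by simp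
  then have "Q (cls x)"
  proof (induction x rule: K.free_space_induct)
    case zero
    then show ?case using assms(2) by (simp add: L_simps A_zero)
  next
    case (single x k w)
    then have w: "x \<in> carrier A" "single K k w \<in> carrier A"
      by (auto simp: A_carrier intro: K.single_carrier)
    have "Q (cls x \<oplus>\<^bsub>L\<^esub> cls (single K k w))"
      using single w word[of k w] cls_single[of k w] by (intro add) (auto simp: L_simps(1))
    with w show ?case
      by (simp only: L_simps A_add[of _ _ "carrier (words (gens E))"])
  qed
  with x show ?thesis by simp
qed

end

text \<open>The target has its own scalars \<open>S\<close>, since \<open>scalar_ext\<close> maps
  into an algebra over an extension field; for all other targets \<open>h\<close> will be the
  identity.\<close>

locale lpa_univ = leavitt_path K E + B: nonunital_algebra S B
  for K :: "('k, 'c) ring_scheme" and E :: "('v, 'e) pre_digraph"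
    and S :: "('l, 's) ring_scheme" and B :: "('l, 'b) module" +
  fixes h :: "'k \<Rightarrow> 'l" and \<phi> :: "('v, 'e) gen \<Rightarrow> 'b"
  assumes h: "h \<in> ring_hom K S" and family: "leavitt_family B E \<phi>"
begin

definition ev where "ev = lin K B (\<lambda>w k. h k \<odot>\<^bsub>B\<^esub> word_prod B \<phi> w)"

abbreviation "WX \<equiv> carrier (words (gens E))"

lemma \<phi>_closed: "\<phi> ` gens E \<subseteq> carrier B"
  using family by (simp add: leavitt_family_def)

lemma h_simps: "k \<in> carrier K \<Longrightarrow> h k \<in> carrier S"
  "k \<in> carrier K \<Longrightarrow> l \<in> carrier K \<Longrightarrow> h (k \<otimes>\<^bsub>K\<^esub> l) = h k \<otimes>\<^bsub>S\<^esub> h l"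
  "k \<in> carrier K \<Longrightarrow> l \<in> carrier K \<Longrightarrow> h (k \<oplus>\<^bsub>K\<^esub> l) = h k \<oplus>\<^bsub>S\<^esub> h l"
  "h \<one>\<^bsub>K\<^esub> = \<one>\<^bsub>S\<^esub>"
  using h by (auto simp: ring_hom_closed ring_hom_mult ring_hom_add ring_hom_one)

lemma wp_closed: "w \<in> WX \<Longrightarrow> word_prod B \<phi> w \<in> carrier B"
  using word_prod_closed[OF B.nonunital_algebra_axioms \<phi>_closed] by simp

lemma fam: "additive_family K WX B (\<lambda>w k. h k \<odot>\<^bsub>B\<^esub> word_prod B \<phi> w)"
  using wp_closed by (intro additive_familyI) (auto simp: h_simps B.smult_l_distr simp del: words_simps)

lemma ev_hom: "abelian_group_hom A B ev"
  unfolding hom_A_V ev_def by (rule K.lin_hom[OF B.abelian_group_A fam])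

sublocale ev: abelian_group_hom A B ev by (rule ev_hom)

lemma ev_single: "k \<in> carrier K \<Longrightarrow> w \<in> WX \<Longrightarrow> ev (single K k w) = h k \<odot>\<^bsub>B\<^esub> word_prod B \<phi> w"
  unfolding ev_def by (rule K.lin_single[OF B.abelian_group_A fam])

lemma ev_word: "w \<noteq> [] \<Longrightarrow> set w \<subseteq> gens E \<Longrightarrow> ev (basis_elt K w) = word_prod B \<phi> w"
  using ev_single[of "\<one>\<^bsub>K\<^esub>" w] wp_closed[of w] by (simp add: basis_elt_single h_simps)

lemma A_ext:
  assumes "abelian_group_hom A M f" "abelian_group_hom A M g"
    and "\<And>k w. \<lbrakk>k \<in> carrier K; w \<in> WX\<rbrakk> \<Longrightarrow> f (single K k w) = g (single K k w)" "x \<in> carrier A"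
  shows "f x = g x"
  using K.additive_ext[where B = WX and f = f and g = g] assms
  by (simp add: hom_A_V A_carrier del: words_simps)

lemma ev_mult:
  assumes "x \<in> carrier A" "y \<in> carrier A"
  shows "ev (x \<otimes>\<^bsub>A\<^esub> y) = ev x \<otimes>\<^bsub>B\<^esub> ev y"
proof (rule A_ext[where f = "\<lambda>x. ev (x \<otimes>\<^bsub>A\<^esub> y)" and g = "\<lambda>x. ev x \<otimes>\<^bsub>B\<^esub> ev y"])
  show "abelian_group_hom A B (\<lambda>x. ev (x \<otimes>\<^bsub>A\<^esub> y))" "abelian_group_hom A B (\<lambda>x. ev x \<otimes>\<^bsub>B\<^esub> ev y)"
    using assms A.abelian_group_A B.abelian_group_A
    by (auto intro!: abelian_group_homI' simp: A.mult_l_distr B.mult_l_distr)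
  fix k u assume ku: "k \<in> carrier K" "u \<in> WX"
  then have s: "single K k u \<in> carrier A" using A_single by simp
  show "ev (single K k u \<otimes>\<^bsub>A\<^esub> y) = ev (single K k u) \<otimes>\<^bsub>B\<^esub> ev y"
  proof (rule A_ext[where f = "\<lambda>y. ev (single K k u \<otimes>\<^bsub>A\<^esub> y)" and g = "\<lambda>y. ev (single K k u) \<otimes>\<^bsub>B\<^esub> ev y"])
    show "abelian_group_hom A B (\<lambda>y. ev (single K k u \<otimes>\<^bsub>A\<^esub> y))"
      "abelian_group_hom A B (\<lambda>y. ev (single K k u) \<otimes>\<^bsub>B\<^esub> ev y)"
      using s A.abelian_group_A B.abelian_group_A
      by (auto intro!: abelian_group_homI' simp: A.mult_r_distr B.mult_r_distr)
    fix l w assume lw: "l \<in> carrier K" "w \<in> WX"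
    have "ev (single K k u \<otimes>\<^bsub>A\<^esub> single K l w) = ev (single K (k \<otimes>\<^bsub>K\<^esub> l) (u @ w))"
      using A_single_mult ku lw by simp
    also have "\<dots> = (h k \<otimes>\<^bsub>S\<^esub> h l) \<odot>\<^bsub>B\<^esub> (word_prod B \<phi> u \<otimes>\<^bsub>B\<^esub> word_prod B \<phi> w)"
      using ku lw by (subst ev_single)
        (auto simp: h_simps word_prod_append[OF B.nonunital_algebra_axioms \<phi>_closed])
    also have "\<dots> = (h k \<odot>\<^bsub>B\<^esub> word_prod B \<phi> u) \<otimes>\<^bsub>B\<^esub> (h l \<odot>\<^bsub>B\<^esub> word_prod B \<phi> w)"
    proof -
      have "(h k \<odot>\<^bsub>B\<^esub> word_prod B \<phi> u) \<otimes>\<^bsub>B\<^esub> (h l \<odot>\<^bsub>B\<^esub> word_prod B \<phi> w) =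
          h k \<odot>\<^bsub>B\<^esub> (word_prod B \<phi> u \<otimes>\<^bsub>B\<^esub> (h l \<odot>\<^bsub>B\<^esub> word_prod B \<phi> w))"
        using ku lw wp_closed[of u] wp_closed[of w] by (intro B.smult_mult) (auto simp: h_simps)
      also have "word_prod B \<phi> u \<otimes>\<^bsub>B\<^esub> (h l \<odot>\<^bsub>B\<^esub> word_prod B \<phi> w) =
          h l \<odot>\<^bsub>B\<^esub> (word_prod B \<phi> u \<otimes>\<^bsub>B\<^esub> word_prod B \<phi> w)"
        using ku lw wp_closed[of u] wp_closed[of w] by (intro B.mult_smult) (auto simp: h_simps)
      finally show ?thesis
        using ku lw wp_closed[of u] wp_closed[of w] by (simp add: h_simps B.smult_assoc1)
    qed
    finally show "ev (single K k u \<otimes>\<^bsub>A\<^esub> single K l w) = ev (single K k u) \<otimes>\<^bsub>B\<^esub> ev (single K l w)"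
      using ku lw by (simp add: ev_single)
  qed (use assms in auto)
qed (use assms in auto)

lemma ev_smult:
  assumes "k \<in> carrier K" "x \<in> carrier A"
  shows "ev (k \<odot>\<^bsub>A\<^esub> x) = h k \<odot>\<^bsub>B\<^esub> ev x"
proof (rule A_ext[where f = "\<lambda>x. ev (k \<odot>\<^bsub>A\<^esub> x)" and g = "\<lambda>x. h k \<odot>\<^bsub>B\<^esub> ev x"])
  show "abelian_group_hom A B (\<lambda>x. ev (k \<odot>\<^bsub>A\<^esub> x))" "abelian_group_hom A B (\<lambda>x. h k \<odot>\<^bsub>B\<^esub> ev x)"
    using assms A.abelian_group_A B.abelian_group_A
    by (auto intro!: abelian_group_homI' simp: A.smult_r_distr B.smult_r_distr h_simps)
  fix l w assume lw: "l \<in> carrier K" "w \<in> WX"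
  have "k \<odot>\<^bsub>A\<^esub> single K l w = single K (k \<otimes>\<^bsub>K\<^esub> l) w"
    using assms lw K.single_smult[of k l UNIV w] by (simp add: A_smult[of _ _ UNIV])
  then show "ev (k \<odot>\<^bsub>A\<^esub> single K l w) = h k \<odot>\<^bsub>B\<^esub> ev (single K l w)"
    using assms lw wp_closed by (simp add: ev_single h_simps B.smult_assoc1)
qed (use assms in auto)

lemma ev_relations: "x \<in> lpa_relations K E \<Longrightarrow> ev x = \<zero>\<^bsub>B\<^esub>"
proof -
  have sub: "ev (x \<ominus>\<^bsub>A\<^esub> y) = \<zero>\<^bsub>B\<^esub>" if "x \<in> carrier A" "y \<in> carrier A" "ev x = ev y" for x y
    using that by (simp add: a_minus_def B.M.r_neg)
  have reg: "ev (finsum A (\<lambda>e. basis_elt K [Edge e, Ghost e]) (out_arcs E v)) = \<phi> (Vertex v)"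
    if v: "regular E v" for v
  proof -
    have "ev (finsum A (\<lambda>e. basis_elt K [Edge e, Ghost e]) (out_arcs E v)) =
      (\<Oplus>\<^bsub>B\<^esub>e\<in>out_arcs E v. ev (basis_elt K [Edge e, Ghost e]))"
      by (rule hom_finsum[OF ev_hom]) (auto intro!: basis_in_A)
    also have "\<dots> = (\<Oplus>\<^bsub>B\<^esub>e\<in>out_arcs E v. \<phi> (Edge e) \<otimes>\<^bsub>B\<^esub> \<phi> (Ghost e))"
      using \<phi>_closed by (intro B.M.finsum_cong') (auto simp: ev_word image_subset_iff)
    also have "\<dots> = \<phi> (Vertex v)" using v family by (simp add: leavitt_family_def)
    finally show ?thesis .
  qed
  have fc: "finsum A (\<lambda>e. basis_elt K [Edge e, Ghost e]) (out_arcs E v) \<in> carrier A" for v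
    by (intro A.M.finsum_closed) (auto intro!: basis_in_A)
  assume "x \<in> lpa_relations K E"
  moreover have "v \<in> verts E" if "regular E v" for v using that by (simp add: regular_def)
  ultimately show ?thesis
    unfolding lpa_relations_def Let_def
    by (elim UnE; elim CollectE exE conjE;
      simp add: sub basis_in_A ev_word reg fc family[unfolded leavitt_family_def])
qed

text \<open>The kernel is an algebra ideal containing the relations, and \<open>I\<close> is the
  least such ideal.\<close>

lemma ev_I: "x \<in> I \<Longrightarrow> ev x = \<zero>\<^bsub>B\<^esub>"
proof -
  have "algebra_ideal (carrier K) A {x \<in> carrier A. ev x = \<zero>\<^bsub>B\<^esub>}"
    by (rule A.algebra_idealI) (auto simp: ev_mult ev_smult h_simps B.smult_r_null)
  then have "I \<subseteq> {x \<in> carrier A. ev x = \<zero>\<^bsub>B\<^esub>}"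
    unfolding lpa_ideal_def gen_algebra_ideal_def using ev_relations relations_in_A by blast
  then show "x \<in> I \<Longrightarrow> ev x = \<zero>\<^bsub>B\<^esub>" by blast
qed

abbreviation "\<Theta> \<equiv> lpa_hom K B h \<phi>"

text \<open>\<open>lpa_hom\<close> applies \<open>the_elem\<close> to the image of a coset. That
  image is a singleton because representatives differ by an element of \<open>I\<close>, which
  \<open>ev\<close> kills.\<close>

lemma hom_cls: "x \<in> carrier A \<Longrightarrow> \<Theta> (cls x) = ev x"
proof -
  assume x: "x \<in> carrier A"
  have "ev y = ev x" if "y \<in> carrier A" "cls y = cls x" for y
  proof -
    have "ev (y \<ominus>\<^bsub>A\<^esub> x) = \<zero>\<^bsub>B\<^esub>" using QA.cls_eq_iff[OF that(1) x] that(2) by (intro ev_I) simp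
    moreover have "ev (y \<ominus>\<^bsub>A\<^esub> x) = ev y \<ominus>\<^bsub>B\<^esub> ev x" using that x by (simp add: a_minus_def)
    ultimately show ?thesis using that x by (simp add: B.M.minus_eq_zero_iff)
  qed
  then have "\<And>y. y \<in> cls x \<Longrightarrow> ev y = ev x" "x \<in> cls x" using QA.cls_mem[OF x] x by blast+
  then have "ev ` (cls x) = {ev x}" by blast
  moreover have eq: "(\<lambda>x. \<Oplus>\<^bsub>B\<^esub>w\<in>{w. x w \<noteq> \<zero>\<^bsub>K\<^esub>}. h (x w) \<odot>\<^bsub>B\<^esub> word_prod B \<phi> w) = ev"
    by (simp add: ev_def lin_def fun_eq_iff)
  ultimately show ?thesis unfolding lpa_hom_def eq by simp
qed

lemma hom_closed: "a \<in> carrier L \<Longrightarrow> \<Theta> a \<in> carrier B"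
  and hom_add: "a \<in> carrier L \<Longrightarrow> b \<in> carrier L \<Longrightarrow> \<Theta> (a \<oplus>\<^bsub>L\<^esub> b) = \<Theta> a \<oplus>\<^bsub>B\<^esub> \<Theta> b"
  and hom_mult: "a \<in> carrier L \<Longrightarrow> b \<in> carrier L \<Longrightarrow> \<Theta> (a \<bullet> b) = \<Theta> a \<otimes>\<^bsub>B\<^esub> \<Theta> b"
  and hom_smult: "k \<in> carrier K \<Longrightarrow> a \<in> carrier L \<Longrightarrow> \<Theta> (k \<odot>\<^bsub>L\<^esub> a) = h k \<odot>\<^bsub>B\<^esub> \<Theta> a"
  and hom_gen: "g \<in> gens E \<Longrightarrow> \<Theta> (\<gamma> g) = \<phi> g"
  by (auto simp: L_simps hom_cls ev_mult ev_smult gen_cls basis_in_A ev_word)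

end

section \<open>Modules on spaces with a basis\<close>

text \<open>Endomorphisms are extensional functions, so that maps agreeing on the carrier are equal;
  the Leavitt relations have to hold between them as equations.\<close>

definition end_algebra :: "('a, 'c) ring_scheme \<Rightarrow> ('a, 'm, 'd) module_scheme \<Rightarrow> ('a, 'm \<Rightarrow> 'm) module" where
  "end_algebra R V =
     \<lparr>carrier = {f \<in> extensional (carrier V). abelian_group_hom V V f \<and>
        (\<forall>k\<in>carrier R. \<forall>x\<in>carrier V. f (k \<odot>\<^bsub>V\<^esub> x) = k \<odot>\<^bsub>V\<^esub> f x)},
      mult = (\<lambda>f g. \<lambda>x\<in>carrier V. f (g x)), one = (\<lambda>x\<in>carrier V. x),
      zero = (\<lambda>x\<in>carrier V. \<zero>\<^bsub>V\<^esub>), add = (\<lambda>f g. \<lambda>x\<in>carrier V. f x \<oplus>\<^bsub>V\<^esub> g x),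
      smult = (\<lambda>k f. \<lambda>x\<in>carrier V. k \<odot>\<^bsub>V\<^esub> f x)\<rparr>"

context module
begin

lemma end_carrier_iff:
  "f \<in> carrier (end_algebra R M) \<longleftrightarrow> f \<in> extensional (carrier M) \<and> f \<in> carrier M \<rightarrow> carrier M \<and>
     (\<forall>x\<in>carrier M. \<forall>y\<in>carrier M. f (x \<oplus>\<^bsub>M\<^esub> y) = f x \<oplus>\<^bsub>M\<^esub> f y) \<and>
     (\<forall>k\<in>carrier R. \<forall>x\<in>carrier M. f (k \<odot>\<^bsub>M\<^esub> x) = k \<odot>\<^bsub>M\<^esub> f x)"
proof -
  have "abelian_group M" by intro_locales
  then have "abelian_group_hom M M f \<longleftrightarrow> f \<in> carrier M \<rightarrow> carrier M \<and>
     (\<forall>x\<in>carrier M. \<forall>y\<in>carrier M. f (x \<oplus>\<^bsub>M\<^esub> y) = f x \<oplus>\<^bsub>M\<^esub> f y)"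
    by (auto intro!: abelian_group_homI' dest: abelian_group_hom.hom_closed abelian_group_hom.hom_add)
  then show ?thesis by (auto simp: end_algebra_def)
qed

lemma end_simps:
  "\<zero>\<^bsub>end_algebra R M\<^esub> = (\<lambda>x\<in>carrier M. \<zero>\<^bsub>M\<^esub>)"
  "f \<oplus>\<^bsub>end_algebra R M\<^esub> g = (\<lambda>x\<in>carrier M. f x \<oplus>\<^bsub>M\<^esub> g x)"
  "f \<otimes>\<^bsub>end_algebra R M\<^esub> g = (\<lambda>x\<in>carrier M. f (g x))"
  "k \<odot>\<^bsub>end_algebra R M\<^esub> f = (\<lambda>x\<in>carrier M. k \<odot>\<^bsub>M\<^esub> f x)"
  by (simp_all add: end_algebra_def)

lemma smult_left_commute:
  "k \<in> carrier R \<Longrightarrow> l \<in> carrier R \<Longrightarrow> x \<in> carrier M \<Longrightarrow> k \<odot>\<^bsub>M\<^esub> (l \<odot>\<^bsub>M\<^esub> x) = l \<odot>\<^bsub>M\<^esub> (k \<odot>\<^bsub>M\<^esub> x)"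
  by (metis R.m_comm smult_assoc1)

end

lemma end_nonunital_algebra:
  fixes V :: "('a, 'm) module"
  assumes "module R V"
  shows "nonunital_algebra R (end_algebra R V)"
proof -
  interpret V: module R V by fact
  let ?E = "end_algebra R V"
  note iff = V.end_carrier_iff and simps = V.end_simps
  have ag: "abelian_group ?E"
  proof (rule abelian_groupI)
    fix f g assume "f \<in> carrier ?E" "g \<in> carrier ?E"
    then show "f \<oplus>\<^bsub>?E\<^esub> g \<in> carrier ?E"
      unfolding iff simps by (auto simp: Pi_iff V.M.a_ac V.smult_r_distr)
  next
    show "\<zero>\<^bsub>?E\<^esub> \<in> carrier ?E" unfolding iff simps by auto
  next
    fix f assume f: "f \<in> carrier ?E"
    let ?g = "\<lambda>x\<in>carrier V. \<ominus>\<^bsub>V\<^esub> f x"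
    have "?g \<in> carrier ?E" using f unfolding iff by (auto simp: Pi_iff V.M.minus_add V.smult_r_minus)
    moreover have "?g \<oplus>\<^bsub>?E\<^esub> f = \<zero>\<^bsub>?E\<^esub>"
      using f unfolding iff simps by (auto simp: Pi_iff V.M.l_neg intro!: ext)
    ultimately show "\<exists>g\<in>carrier ?E. g \<oplus>\<^bsub>?E\<^esub> f = \<zero>\<^bsub>?E\<^esub>" by blast
  qed (auto simp: iff simps Pi_iff V.M.a_ac extensional_def intro!: ext)
  show ?thesis
  proof (intro nonunital_algebra.intro nonunital_algebra_axioms.intro moduleI V.R.is_cring ag)
    fix k f assume "k \<in> carrier R" "f \<in> carrier ?E"
    then show "k \<odot>\<^bsub>?E\<^esub> f \<in> carrier ?E"
      unfolding iff simps by (auto simp: Pi_iff V.smult_r_distr V.smult_left_commute)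
  next
    fix f g assume "f \<in> carrier ?E" "g \<in> carrier ?E"
    then show "f \<otimes>\<^bsub>?E\<^esub> g \<in> carrier ?E"
      unfolding iff simps by (auto simp: Pi_iff)
  qed (auto simp: iff simps Pi_iff V.smult_l_distr V.smult_r_distr V.smult_assoc1 extensional_def intro!: ext)
qed

lemma word_prod_end:
  assumes "module R V" "\<phi> ` X \<subseteq> carrier (end_algebra R V)" "w \<noteq> []" "set w \<subseteq> X" "m \<in> carrier V"
  shows "word_prod (end_algebra R V) \<phi> w m = foldr \<phi> w m"
  using assms(3,4)
proof (induction w)
  case (Cons g w)
  interpret module R V by fact
  show ?case
  proof (cases "w = []")
    case False
    then show ?thesis using Cons assms(5) by (simp add: end_simps)
  qed simp
qed simp

text \<open>Serves twice: along the map to the algebra of a quotient graph, and along a change of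
  scalars followed by the twist.\<close>

lemma left_module_pullback:
  assumes "left_module R' N" "nonunital_algebra S R"
    and "\<And>a. a \<in> carrier R \<Longrightarrow> \<Theta> a \<in> carrier R'"
    and "\<And>a b. \<lbrakk>a \<in> carrier R; b \<in> carrier R\<rbrakk> \<Longrightarrow> \<Theta> (a \<oplus>\<^bsub>R\<^esub> b) = \<Theta> a \<oplus>\<^bsub>R'\<^esub> \<Theta> b"
    and "\<And>a b. \<lbrakk>a \<in> carrier R; b \<in> carrier R\<rbrakk> \<Longrightarrow> \<Theta> (a \<otimes>\<^bsub>R\<^esub> b) = \<Theta> a \<otimes>\<^bsub>R'\<^esub> \<Theta> b"
  shows "left_module R (with_action N (\<lambda>a m. \<Theta> a \<odot>\<^bsub>N\<^esub> m))"
proof -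
  interpret N: left_module R' N by fact
  let ?N = "with_action N (\<lambda>a m. \<Theta> a \<odot>\<^bsub>N\<^esub> m)"
  have eq: "carrier ?N = carrier N" "\<zero>\<^bsub>?N\<^esub> = \<zero>\<^bsub>N\<^esub>" "add ?N = add N" "a \<odot>\<^bsub>?N\<^esub> m = \<Theta> a \<odot>\<^bsub>N\<^esub> m" for a m
    by (simp_all add: with_action_def ring.defs module.defs)
  have "abelian_group ?N"
    by (rule abelian_groupI) (auto simp: eq N.M.a_ac intro: N.M.a_inv_closed N.M.l_neg)
  then show ?thesis
    by (intro left_module.intro left_module_axioms.intro)
      (auto simp: eq assms N.smult_closed N.smult_l_distr N.smult_r_distr N.smult_assoc)
qed

text \<open>
  \<open>h\<close> restricts scalars and \<open>\<chi>\<close> rescales the generators; both are nontrivial only for \<open>V\<^sup>f\<^bsub>[q]\<^esub>\<close>.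
\<close>

definition monomial_module ::
    "('k, 'c) ring_scheme \<Rightarrow> ('v, 'e) pre_digraph \<Rightarrow> ('l, 's) ring_scheme \<Rightarrow> ('k \<Rightarrow> 'l) \<Rightarrow>
     (('v, 'e) gen \<Rightarrow> 'l) \<Rightarrow> 'b set \<Rightarrow> (('v, 'e) gen \<Rightarrow> 'b \<Rightarrow> 'b option) \<Rightarrow>
     (('v, 'e, 'k) lpa_elt, 'b \<Rightarrow> 'l) module \<Rightarrow> bool" where
  "monomial_module K E S h \<chi> B t N \<longleftrightarrow>
     left_module (lpa K E) N \<and> carrier N = carrier (free_space S B) \<and>
     \<zero>\<^bsub>N\<^esub> = (\<lambda>b. \<zero>\<^bsub>S\<^esub>) \<and> add N = add (free_space S B) \<and>
     (\<forall>k\<in>carrier K. \<forall>g\<in>gens E. \<forall>l\<in>carrier S. \<forall>b\<in>B.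
        (k \<odot>\<^bsub>lpa K E\<^esub> lpa_gen K E g) \<odot>\<^bsub>N\<^esub> single S l b =
        (case t g b of None \<Rightarrow> (\<lambda>b. \<zero>\<^bsub>S\<^esub>) | Some b' \<Rightarrow> single S (h k \<otimes>\<^bsub>S\<^esub> \<chi> g \<otimes>\<^bsub>S\<^esub> l) b'))"

text \<open>The Leavitt relations in terms of partial bijections of a set. An edge and its ghost are
  inverse to each other; \<open>t_ghost_unique\<close> makes the images of distinct edges disjoint,
  so the ghost of one edge kills the other; \<open>t_regular\<close> makes them cover everything
  over a regular vertex, which is the sum relation. Paths into a sink and tail classes of infinite
  paths are the two instances.\<close>

locale branching_system = leavitt_path K E
  for K :: "('k, 'c) ring_scheme" and E :: "('v, 'e) pre_digraph" +
  fixes B :: "'b set" and t :: "('v, 'e) gen \<Rightarrow> 'b \<Rightarrow> 'b option" and src :: "'b \<Rightarrow> 'v"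
  assumes t_vertex: "\<lbrakk>v \<in> verts E; b \<in> B\<rbrakk> \<Longrightarrow> t (Vertex v) b = (if v = src b then Some b else None)"
    and t_edge: "\<lbrakk>e \<in> arcs E; b \<in> B; head E e = src b\<rbrakk> \<Longrightarrow>
       \<exists>b'\<in>B. t (Edge e) b = Some b' \<and> src b' = tail E e \<and> t (Ghost e) b' = Some b"
    and t_edge_None: "\<lbrakk>e \<in> arcs E; b \<in> B; head E e \<noteq> src b\<rbrakk> \<Longrightarrow> t (Edge e) b = None"
    and t_ghost: "\<lbrakk>e \<in> arcs E; b \<in> B; t (Ghost e) b = Some b'\<rbrakk> \<Longrightarrow>
       b' \<in> B \<and> src b = tail E e \<and> src b' = head E e \<and> t (Edge e) b' = Some b"
    and t_ghost_unique: "\<lbrakk>e \<in> arcs E; f \<in> arcs E; b \<in> B; t (Ghost e) b \<noteq> None; t (Ghost f) b \<noteq> None\<rbrakk> \<Longrightarrow> e = f"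
    and t_regular: "\<lbrakk>b \<in> B; regular E (src b)\<rbrakk> \<Longrightarrow> \<exists>e\<in>arcs E. t (Ghost e) b \<noteq> None"
begin

abbreviation "V \<equiv> free_space K B"

sublocale V: module K V by (rule K.free_space_module)

definition act where
  "act g = lin K V (\<lambda>b k. case t g b of None \<Rightarrow> \<zero>\<^bsub>V\<^esub> | Some b' \<Rightarrow> single K k b')"

lemma t_closed: "g \<in> gens E \<Longrightarrow> b \<in> B \<Longrightarrow> t g b = Some b' \<Longrightarrow> b' \<in> B"
proof (cases g)
  case (Vertex v)
  moreover assume "g \<in> gens E" "b \<in> B" "t g b = Some b'"
  ultimately show "b' \<in> B" using t_vertex[of v b] by (simp split: if_splits)
next
  case (Edge e)
  moreover assume "g \<in> gens E" "b \<in> B" "t g b = Some b'"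
  ultimately show "b' \<in> B" using t_edge[of e b] t_edge_None[of e b] by auto
next
  case (Ghost e)
  moreover assume "g \<in> gens E" "b \<in> B" "t g b = Some b'"
  ultimately show "b' \<in> B" using t_ghost[of e b b'] by simp
qed

lemma ab_V: "abelian_group V" by intro_locales

lemma act_family:
  "g \<in> gens E \<Longrightarrow> additive_family K B V (\<lambda>b k. case t g b of None \<Rightarrow> \<zero>\<^bsub>V\<^esub> | Some b' \<Rightarrow> single K k b')"
  using V.M.zero_closed V.M.l_zero[OF V.M.zero_closed]
  by (intro additive_familyI)
    (auto split: option.split intro: K.single_carrier t_closed simp: K.single_add[of _ _ _ B] simp del: free_space_simps)

lemma act_hom: "g \<in> gens E \<Longrightarrow> abelian_group_hom V V (act g)"
  unfolding act_def by (rule K.lin_hom[OF ab_V act_family])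

lemma act_single:
  "g \<in> gens E \<Longrightarrow> k \<in> carrier K \<Longrightarrow> b \<in> B \<Longrightarrow>
    act g (single K k b) = (case t g b of None \<Rightarrow> \<zero>\<^bsub>V\<^esub> | Some b' \<Rightarrow> single K k b')"
  unfolding act_def by (rule K.lin_single[OF ab_V act_family])

lemma act_smult:
  assumes "g \<in> gens E" "k \<in> carrier K" "x \<in> carrier V"
  shows "act g (k \<odot>\<^bsub>V\<^esub> x) = k \<odot>\<^bsub>V\<^esub> act g x"
proof (rule K.additive_ext[where f = "\<lambda>x. act g (k \<odot>\<^bsub>V\<^esub> x)" and g = "\<lambda>x. k \<odot>\<^bsub>V\<^esub> act g x"])
  interpret a: abelian_group_hom V V "act g" by (rule act_hom[OF assms(1)])
  show "abelian_group_hom V V (\<lambda>x. act g (k \<odot>\<^bsub>V\<^esub> x))" "abelian_group_hom V V (\<lambda>x. k \<odot>\<^bsub>V\<^esub> act g x)"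
    using assms(2) ab_V by (auto intro!: abelian_group_homI' simp: V.smult_r_distr simp del: free_space_simps)
  fix l b assume lb: "l \<in> carrier K" "b \<in> B"
  show "act g (k \<odot>\<^bsub>V\<^esub> single K l b) = k \<odot>\<^bsub>V\<^esub> act g (single K l b)"
    using lb assms act_single V.smult_r_null[of k]
    by (simp add: K.single_smult[of _ _ B] del: free_space_simps split: option.split)
qed (fact assms)

lemma act_linear_ext:
  assumes "g \<in> gens E" "x \<in> carrier V"
  shows "act g x = linear_ext K (t g) x"
proof
  fix b'
  have fam: "additive_family K B K (\<lambda>b k. (case t g b of None \<Rightarrow> \<zero>\<^bsub>V\<^esub> | Some b' \<Rightarrow> single K k b') b')"
    using additive_familyD[OF act_family[OF assms(1)]]
    by (intro additive_familyI) (auto simp: free_space_carrier_iff)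
  have x: "\<And>b. x b \<in> carrier K" "finite {b. x b \<noteq> \<zero>\<^bsub>K\<^esub>}" "{b. x b \<noteq> \<zero>\<^bsub>K\<^esub>} \<subseteq> B"
    using assms(2) by (auto simp: free_space_carrier_iff)
  \<comment> \<open>Evaluation at \<open>b'\<close> is additive, so the extension can be computed
    one coordinate at a time.\<close>
  have "abelian_group_hom V K (\<lambda>x. x b')"
    using ab_V K.is_abelian_group by (intro abelian_group_homI') (auto simp: free_space_carrier_iff)
  from K.hom_lin[OF this act_family[OF assms(1)] assms(2)]
  have "act g x b' = lin K K (\<lambda>b k. (case t g b of None \<Rightarrow> \<zero>\<^bsub>V\<^esub> | Some b' \<Rightarrow> single K k b') b') x"
    by (simp add: act_def)
  also have "\<dots> = (\<Oplus>\<^bsub>K\<^esub>b\<in>{b. x b \<noteq> \<zero>\<^bsub>K\<^esub> \<and> t g b = Some b'}. x b)"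
    unfolding lin_def using x additive_familyD(1)[OF fam]
    by (intro K.add.finprod_mono_neutral_cong_right)
      (auto simp: single_def subset_iff split: option.split)
  also have "\<dots> = linear_ext K (t g) x b'" by (simp add: linear_ext_def)
  finally show "act g x b' = linear_ext K (t g) x b'" .
qed

abbreviation "EV \<equiv> end_algebra K V"

sublocale EV: nonunital_algebra K EV
  by (rule end_nonunital_algebra[OF K.free_space_module])

definition op where "op g = restrict (act g) (carrier V)"

lemma op_closed: "g \<in> gens E \<Longrightarrow> op g \<in> carrier EV"
  using act_hom[of g] act_smult[of g] V.M.a_closed V.smult_closed
  unfolding V.end_carrier_iff op_def
  by (auto simp: abelian_group_hom.hom_closed abelian_group_hom.hom_add simp del: free_space_simps)

lemma op_single:
  "g \<in> gens E \<Longrightarrow> k \<in> carrier K \<Longrightarrow> b \<in> B \<Longrightarrow>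
    op g (single K k b) = (case t g b of None \<Rightarrow> \<zero>\<^bsub>V\<^esub> | Some b' \<Rightarrow> single K k b')"
  using act_single[of g k b] K.single_carrier[of k b B] by (simp add: op_def del: free_space_simps)

lemma end_ext:
  assumes "f \<in> carrier EV" "g \<in> carrier EV"
    and "\<And>k b. \<lbrakk>k \<in> carrier K; b \<in> B\<rbrakk> \<Longrightarrow> f (single K k b) = g (single K k b)"
  shows "f = g"
proof (rule extensionalityI)
  show "f \<in> extensional (carrier V)" "g \<in> extensional (carrier V)"
    using assms by (auto simp: V.end_carrier_iff)
  have h: "abelian_group_hom V V f" "abelian_group_hom V V g"
    using assms by (auto simp: end_algebra_def)
  fix x assume "x \<in> carrier V"
  then show "f x = g x" using K.additive_ext[OF h assms(3)] by blast
qed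

lemma op_mult_single:
  assumes "g \<in> gens E" "g' \<in> gens E" "k \<in> carrier K" "b \<in> B"
  shows "(op g \<otimes>\<^bsub>EV\<^esub> op g') (single K k b) =
    (case t g' b of None \<Rightarrow> \<zero>\<^bsub>V\<^esub> | Some b' \<Rightarrow> (case t g b' of None \<Rightarrow> \<zero>\<^bsub>V\<^esub> | Some b'' \<Rightarrow> single K k b''))"
proof -
  interpret g: abelian_group_hom V V "op g"
    using op_closed[OF assms(1)] by (simp add: end_algebra_def)
  show ?thesis
    using assms K.single_carrier[OF assms(3,4)] t_closed[OF assms(2,4)]
    by (auto simp: V.end_simps op_single simp del: free_space_simps split: option.split)
qed

lemma op_family: "leavitt_family EV E op"
proof -
  have z: "\<zero>\<^bsub>EV\<^esub> (single K k b) = \<zero>\<^bsub>V\<^esub>" if "k \<in> carrier K" "b \<in> B" for k b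
    using K.single_carrier[OF that] by (simp add: V.end_simps del: free_space_simps)
  have eq: "op g \<otimes>\<^bsub>EV\<^esub> op g' = x"
    if "g \<in> gens E" "g' \<in> gens E" "x \<in> carrier EV"
      "\<And>k b. \<lbrakk>k \<in> carrier K; b \<in> B\<rbrakk> \<Longrightarrow> (op g \<otimes>\<^bsub>EV\<^esub> op g') (single K k b) = x (single K k b)" for g g' x
    using that op_closed by (intro end_ext) auto
  have vv: "op (Vertex v) \<otimes>\<^bsub>EV\<^esub> op (Vertex w) = (if v = w then op (Vertex v) else \<zero>\<^bsub>EV\<^esub>)"
    if "v \<in> verts E" "w \<in> verts E" for v w
    by (rule eq) (use that in \<open>auto simp: op_closed op_mult_single op_single z t_vertex simp del: free_space_simps\<close>)
  have e1: "op (Vertex (tail E e)) \<otimes>\<^bsub>EV\<^esub> op (Edge e) = op (Edge e)" if "e \<in> arcs E" for e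
  proof (rule eq)
    fix k b assume kb: "k \<in> carrier K" "b \<in> B"
    show "(op (Vertex (tail E e)) \<otimes>\<^bsub>EV\<^esub> op (Edge e)) (single K k b) = op (Edge e) (single K k b)"
      using that kb t_edge[of e b] t_edge_None[of e b]
      by (cases "head E e = src b") (auto simp: op_mult_single op_single t_vertex ends_in_verts simp del: free_space_simps)
  qed (use that in \<open>auto simp: ends_in_verts op_closed\<close>)
  have e2: "op (Edge e) \<otimes>\<^bsub>EV\<^esub> op (Vertex (head E e)) = op (Edge e)" if "e \<in> arcs E" for e
  proof (rule eq)
    fix k b assume kb: "k \<in> carrier K" "b \<in> B"
    show "(op (Edge e) \<otimes>\<^bsub>EV\<^esub> op (Vertex (head E e))) (single K k b) = op (Edge e) (single K k b)"
      using that kb t_edge_None[of e b]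
      by (auto simp: op_mult_single op_single t_vertex ends_in_verts simp del: free_space_simps)
  qed (use that in \<open>auto simp: ends_in_verts op_closed\<close>)
  have e3: "op (Vertex (head E e)) \<otimes>\<^bsub>EV\<^esub> op (Ghost e) = op (Ghost e)" if "e \<in> arcs E" for e
  proof (rule eq)
    fix k b assume kb: "k \<in> carrier K" "b \<in> B"
    show "(op (Vertex (head E e)) \<otimes>\<^bsub>EV\<^esub> op (Ghost e)) (single K k b) = op (Ghost e) (single K k b)"
      using that kb t_ghost[of e b]
      by (auto simp: op_mult_single op_single t_vertex ends_in_verts simp del: free_space_simps split: option.split)
  qed (use that in \<open>auto simp: ends_in_verts op_closed\<close>)
  have e4: "op (Ghost e) \<otimes>\<^bsub>EV\<^esub> op (Vertex (tail E e)) = op (Ghost e)" if "e \<in> arcs E" for e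
  proof (rule eq)
    fix k b assume kb: "k \<in> carrier K" "b \<in> B"
    show "(op (Ghost e) \<otimes>\<^bsub>EV\<^esub> op (Vertex (tail E e))) (single K k b) = op (Ghost e) (single K k b)"
      using that kb t_ghost[of e b]
      by (auto simp: op_mult_single op_single t_vertex ends_in_verts simp del: free_space_simps split: option.split)
  qed (use that in \<open>auto simp: ends_in_verts op_closed\<close>)
  have e5: "op (Ghost e) \<otimes>\<^bsub>EV\<^esub> op (Edge f) = (if e = f then op (Vertex (head E e)) else \<zero>\<^bsub>EV\<^esub>)"
    if "e \<in> arcs E" "f \<in> arcs E" for e f
  proof (rule eq)
    fix k b assume kb: "k \<in> carrier K" "b \<in> B"
    show "(op (Ghost e) \<otimes>\<^bsub>EV\<^esub> op (Edge f)) (single K k b) =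
        (if e = f then op (Vertex (head E e)) else \<zero>\<^bsub>EV\<^esub>) (single K k b)"
    proof (cases "head E f = src b")
      case True
      note ex = t_edge[OF that(2) kb(2) True]
      from ex obtain b' where b': "b' \<in> B" "t (Edge f) b = Some b'" "t (Ghost f) b' = Some b"
        by blast
      then have "e \<noteq> f \<Longrightarrow> t (Ghost e) b' = None"
        using t_ghost_unique[of e f b'] that by (cases "t (Ghost e) b'") auto
      with b' that kb True ends_in_verts(2)[of f] show ?thesis
        by (auto simp: op_mult_single op_single t_vertex ends_in_verts z simp del: free_space_simps)
    next
      case False
      with that kb t_edge_None[of f b] show ?thesis
        by (auto simp: op_mult_single op_single t_vertex ends_in_verts z simp del: free_space_simps)
    qed
  qed (use that in \<open>auto simp: ends_in_verts op_closed\<close>)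
  have reg: "op (Vertex v) = (\<Oplus>\<^bsub>EV\<^esub>e\<in>out_arcs E v. op (Edge e) \<otimes>\<^bsub>EV\<^esub> op (Ghost e))" if v: "regular E v" for v
  proof (rule end_ext)
    have vv: "v \<in> verts E" "finite (out_arcs E v)" using v by (auto simp: regular_def)
    show "op (Vertex v) \<in> carrier EV" using vv op_closed by simp
    have c: "(\<lambda>e. op (Edge e) \<otimes>\<^bsub>EV\<^esub> op (Ghost e)) \<in> out_arcs E v \<rightarrow> carrier EV"
      using op_closed by (auto simp: ends_in_verts)
    then show "(\<Oplus>\<^bsub>EV\<^esub>e\<in>out_arcs E v. op (Edge e) \<otimes>\<^bsub>EV\<^esub> op (Ghost e)) \<in> carrier EV" by (rule EV.M.finsum_closed)
    fix k b assume kb: "k \<in> carrier K" "b \<in> B"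
    note s = K.single_carrier[OF kb]
    have "abelian_group_hom EV V (\<lambda>f. f (single K k b))"
      using EV.abelian_group_A ab_V s by (intro abelian_group_homI') (auto simp: V.end_carrier_iff V.end_simps Pi_iff simp del: free_space_simps)
    from hom_finsum[OF this c] have "(\<Oplus>\<^bsub>EV\<^esub>e\<in>out_arcs E v. op (Edge e) \<otimes>\<^bsub>EV\<^esub> op (Ghost e)) (single K k b) =
        (\<Oplus>\<^bsub>V\<^esub>e\<in>out_arcs E v. (op (Edge e) \<otimes>\<^bsub>EV\<^esub> op (Ghost e)) (single K k b))" .
    also have "\<dots> = (\<Oplus>\<^bsub>V\<^esub>e\<in>out_arcs E v. if t (Ghost e) b \<noteq> None then single K k b else \<zero>\<^bsub>V\<^esub>)"
    proof (rule V.M.finsum_cong')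
      fix e assume "e \<in> out_arcs E v"
      then show "(op (Edge e) \<otimes>\<^bsub>EV\<^esub> op (Ghost e)) (single K k b) = (if t (Ghost e) b \<noteq> None then single K k b else \<zero>\<^bsub>V\<^esub>)"
        using kb t_ghost[of e b] by (auto simp: op_mult_single simp del: free_space_simps split: option.split)
    qed (use s V.M.zero_closed in \<open>auto simp del: free_space_simps\<close>)
    also have "\<dots> = op (Vertex v) (single K k b)"
    \<comment> \<open>Over \<open>v\<close>, covering and disjointness leave exactly one nonzero
      summand; elsewhere every ghost of an edge leaving \<open>v\<close> kills
      \<open>b\<close>.\<close>
    proof (cases "v = src b")
      case True
      then obtain e0 where e0: "e0 \<in> arcs E" "t (Ghost e0) b \<noteq> None" using t_regular kb v by blast
      then have e0v: "e0 \<in> out_arcs E v" using t_ghost[of e0 b] kb True by auto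
      have "(\<Oplus>\<^bsub>V\<^esub>e\<in>out_arcs E v. if t (Ghost e) b \<noteq> None then single K k b else \<zero>\<^bsub>V\<^esub>) =
          (\<Oplus>\<^bsub>V\<^esub>e\<in>out_arcs E v. if e0 = e then single K k b else \<zero>\<^bsub>V\<^esub>)"
      proof (rule V.M.finsum_cong')
        fix e assume e: "e \<in> out_arcs E v"
        have "t (Ghost e) b \<noteq> None \<longleftrightarrow> e0 = e"
          using e0 e kb t_ghost_unique[of e0 e b] by (metis in_out_arcs_conv)
        then show "(if t (Ghost e) b \<noteq> None then single K k b else \<zero>\<^bsub>V\<^esub>) = (if e0 = e then single K k b else \<zero>\<^bsub>V\<^esub>)"
          by presburger
      qed (use s V.M.zero_closed in \<open>auto simp del: free_space_simps\<close>)
      also have "\<dots> = single K k b"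
        using V.M.finsum_singleton[OF e0v vv(2), of "\<lambda>_. single K k b"] s by (simp del: free_space_simps)
      finally show ?thesis using True kb vv by (simp add: op_single t_vertex del: free_space_simps)
    next
      case False
      have "(\<Oplus>\<^bsub>V\<^esub>e\<in>out_arcs E v. if t (Ghost e) b \<noteq> None then single K k b else \<zero>\<^bsub>V\<^esub>) =
          (\<Oplus>\<^bsub>V\<^esub>e\<in>out_arcs E v. \<zero>\<^bsub>V\<^esub>)"
      proof (rule V.M.finsum_cong')
        fix e assume e: "e \<in> out_arcs E v"
        then have "t (Ghost e) b = None"
          using False t_ghost[of e b] kb by (cases "t (Ghost e) b") auto
        then show "(if t (Ghost e) b \<noteq> None then single K k b else \<zero>\<^bsub>V\<^esub>) = \<zero>\<^bsub>V\<^esub>" by simp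
      qed (use V.M.zero_closed in \<open>auto simp del: free_space_simps\<close>)
      also have "\<dots> = \<zero>\<^bsub>V\<^esub>" by (rule V.M.finsum_zero)
      finally show ?thesis using False kb vv by (simp add: op_single t_vertex del: free_space_simps)
    qed
    finally show "op (Vertex v) (single K k b) =
      (\<Oplus>\<^bsub>EV\<^esub>e\<in>out_arcs E v. op (Edge e) \<otimes>\<^bsub>EV\<^esub> op (Ghost e)) (single K k b)" by simp
  qed
  show ?thesis unfolding leavitt_family_def
    by (intro conjI ballI allI impI image_subsetI op_closed vv e1 e2 e3 e4 e5 reg) assumption+
qed

sublocale univ: lpa_univ K E K EV id op
  by unfold_locales (simp_all add: op_family id_ring_hom)

lemma foldr_linear_ext:
  assumes "set w \<subseteq> gens E" "m \<in> carrier V"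
  shows "foldr (\<lambda>g. linear_ext K (t g)) w m = foldr op w m \<and> foldr op w m \<in> carrier V"
  using assms(1)
proof (induction w)
  case (Cons g w)
  then show ?case
    using op_closed[of g] by (auto simp: op_def act_linear_ext V.end_carrier_iff Pi_iff)
qed (use assms in simp)

text \<open>The action is a homomorphism into the endomorphism algebra in disguise. This makes
  \<open>the_elem\<close> well defined, and the module laws become the homomorphism laws.\<close>

lemma basis_module_action:
  assumes "a \<in> carrier L" "m \<in> carrier V"
  shows "a \<odot>\<^bsub>basis_module K B t\<^esub> m = univ.\<Theta> a m"
proof -
  obtain x where x: "x \<in> carrier A" "a = cls x" using assms(1) by (auto simp: L_simps)
  define F where "F = (\<lambda>x. \<Oplus>\<^bsub>V\<^esub>w\<in>{w. x w \<noteq> \<zero>\<^bsub>K\<^esub>}. x w \<odot>\<^bsub>V\<^esub> foldr (\<lambda>g. linear_ext K (t g)) w m)"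
  have ev_app: "abelian_group_hom EV V (\<lambda>f. f m)"
    using EV.abelian_group_A ab_V assms(2)
    by (intro abelian_group_homI') (auto simp: V.end_carrier_iff V.end_simps Pi_iff simp del: free_space_simps)
  have F: "F y = univ.ev y m" if y: "y \<in> carrier A" for y
  proof -
    have y': "y \<in> carrier (free_space K univ.WX)" using y A_carrier by simp
    have "univ.ev y m = lin K V (\<lambda>w k. (id k \<odot>\<^bsub>EV\<^esub> word_prod EV op w) m) y"
      unfolding univ.ev_def by (rule K.hom_lin[OF ev_app univ.fam y'])
    also have "\<dots> = F y"
      unfolding lin_def F_def
    proof (rule V.M.finsum_cong')
      fix w assume w: "w \<in> {w. y w \<noteq> \<zero>\<^bsub>K\<^esub>}"
      then have w': "w \<noteq> []" "set w \<subseteq> gens E" using y' by (auto simp: free_space_carrier_iff)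
      have "word_prod EV op w m = foldr op w m"
        by (rule word_prod_end[OF K.free_space_module _ w' assms(2)]) (use op_closed in auto)
      then show "(id (y w) \<odot>\<^bsub>EV\<^esub> word_prod EV op w) m = y w \<odot>\<^bsub>V\<^esub> foldr (\<lambda>g. linear_ext K (t g)) w m"
        using assms(2) foldr_linear_ext[OF w'(2) assms(2)] by (simp add: V.end_simps)
    qed (use y' foldr_linear_ext[OF _ assms(2)] V.smult_closed in \<open>auto simp: free_space_carrier_iff[of y] subset_iff simp del: free_space_simps\<close>)
    finally show ?thesis by simp
  qed
  have "F y = F x" if "y \<in> cls x" for y
    using that F[OF x(1)] F[of y] univ.hom_cls[of y] univ.hom_cls[OF x(1)] QA.cls_mem[OF x(1), of y] by simp
  moreover have "x \<in> cls x" using QA.cls_mem[OF x(1), of x] x(1) by simp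
  ultimately have "F ` cls x = {F x}" by blast
  then have "a \<odot>\<^bsub>basis_module K B t\<^esub> m = F x"
    by (simp add: basis_module_def Let_def with_action_def ring.defs module.defs F_def x(2))
  then show ?thesis using F[OF x(1)] univ.hom_cls[OF x(1)] x(2) by simp
qed

lemma basis_module_simps:
  "carrier (basis_module K B t) = carrier V" "\<zero>\<^bsub>basis_module K B t\<^esub> = \<zero>\<^bsub>V\<^esub>"
  "add (basis_module K B t) = add V"
  by (simp_all add: basis_module_def Let_def with_action_def ring.defs module.defs)

lemma basis_left_module: "left_module L (basis_module K B t)"
proof -
  let ?N = "basis_module K B t"
  have "abelian_group ?N"
    by (rule abelian_groupI) (auto simp: basis_module_simps V.M.a_ac V.M.a_closed V.M.zero_closed
        simp del: free_space_simps intro: V.M.a_inv_closed V.M.l_neg)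
  then show ?thesis
  proof (intro left_module.intro left_module_axioms.intro)
    fix a b x assume ab: "a \<in> carrier L" "b \<in> carrier L" "x \<in> carrier ?N"
    then have c: "univ.\<Theta> a \<in> carrier EV" "univ.\<Theta> b \<in> carrier EV" "x \<in> carrier V"
      by (auto simp: univ.hom_closed basis_module_simps)
    then show "(a \<oplus>\<^bsub>L\<^esub> b) \<odot>\<^bsub>?N\<^esub> x = a \<odot>\<^bsub>?N\<^esub> x \<oplus>\<^bsub>?N\<^esub> b \<odot>\<^bsub>?N\<^esub> x"
      using ab by (simp add: basis_module_simps basis_module_action univ.hom_add V.end_simps)
    have "univ.\<Theta> b x \<in> carrier V" using c by (auto simp: V.end_carrier_iff)
    with c show "(a \<bullet> b) \<odot>\<^bsub>?N\<^esub> x = a \<odot>\<^bsub>?N\<^esub> (b \<odot>\<^bsub>?N\<^esub> x)"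
      using ab by (simp add: basis_module_simps basis_module_action univ.hom_mult V.end_simps)
  next
    fix a x assume "a \<in> carrier L" "x \<in> carrier ?N"
    then show "a \<odot>\<^bsub>?N\<^esub> x \<in> carrier ?N"
      using univ.hom_closed[of a] by (auto simp: basis_module_simps basis_module_action V.end_carrier_iff)
  next
    fix a x y assume "a \<in> carrier L" "x \<in> carrier ?N" "y \<in> carrier ?N"
    then show "a \<odot>\<^bsub>?N\<^esub> (x \<oplus>\<^bsub>?N\<^esub> y) = a \<odot>\<^bsub>?N\<^esub> x \<oplus>\<^bsub>?N\<^esub> a \<odot>\<^bsub>?N\<^esub> y"
      using univ.hom_closed[of a] V.M.a_closed[of x y]
      by (auto simp: basis_module_simps basis_module_action V.end_carrier_iff simp del: free_space_simps)
  qed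
qed

lemma basis_module_smult:
  assumes "k \<in> carrier K" "a \<in> carrier L" "m \<in> carrier V"
  shows "(k \<odot>\<^bsub>L\<^esub> a) \<odot>\<^bsub>basis_module K B t\<^esub> m = k \<odot>\<^bsub>V\<^esub> (a \<odot>\<^bsub>basis_module K B t\<^esub> m)"
  using assms by (simp add: basis_module_action univ.hom_smult V.end_simps)

lemma basis_module_gen:
  assumes "g \<in> gens E" "l \<in> carrier K" "b \<in> B"
  shows "\<gamma> g \<odot>\<^bsub>basis_module K B t\<^esub> single K l b = (case t g b of None \<Rightarrow> \<zero>\<^bsub>V\<^esub> | Some b' \<Rightarrow> single K l b')"
  using assms K.single_carrier[of l b B] by (simp add: basis_module_action univ.hom_gen op_single del: free_space_simps)

lemma basis_monomial_module: "monomial_module K E K id (\<lambda>_. \<one>\<^bsub>K\<^esub>) B t (basis_module K B t)"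
  unfolding monomial_module_def
proof (intro conjI ballI basis_left_module)
  fix k g l b assume a: "k \<in> carrier K" "g \<in> gens E" "l \<in> carrier K" "b \<in> B"
  show "(k \<odot>\<^bsub>L\<^esub> \<gamma> g) \<odot>\<^bsub>basis_module K B t\<^esub> single K l b =
    (case t g b of None \<Rightarrow> \<lambda>b. \<zero>\<^bsub>K\<^esub> | Some b' \<Rightarrow> single K (id k \<otimes>\<^bsub>K\<^esub> \<one>\<^bsub>K\<^esub> \<otimes>\<^bsub>K\<^esub> l) b')"
    using a K.single_carrier[of l b B] V.smult_r_null[of k] K.single_smult[of k l B]
    by (auto simp: basis_module_smult basis_module_gen simp del: free_space_simps split: option.split)
      (simp_all add: free_space_simps)
qed (simp_all add: basis_module_simps)

end

section \<open>Paths and monomials\<close>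

\<comment> \<open>Elements of a Leavitt path algebra are sets, whose equality is not to be split into inclusions.\<close>
declare equalityI [rule del]

context leavitt_path
begin

abbreviation "walk \<equiv> E.awalk"

lemma vertex_mult:
  "v \<in> verts E \<Longrightarrow> w \<in> verts E \<Longrightarrow> \<gamma> (Vertex v) \<bullet> \<gamma> (Vertex w) = (if v = w then \<gamma> (Vertex v) else \<zero>\<^bsub>L\<^esub>)"
  and tail_edge: "e \<in> arcs E \<Longrightarrow> \<gamma> (Vertex (tail E e)) \<bullet> \<gamma> (Edge e) = \<gamma> (Edge e)"
  and edge_head: "e \<in> arcs E \<Longrightarrow> \<gamma> (Edge e) \<bullet> \<gamma> (Vertex (head E e)) = \<gamma> (Edge e)"
  and head_ghost: "e \<in> arcs E \<Longrightarrow> \<gamma> (Vertex (head E e)) \<bullet> \<gamma> (Ghost e) = \<gamma> (Ghost e)"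
  and ghost_tail: "e \<in> arcs E \<Longrightarrow> \<gamma> (Ghost e) \<bullet> \<gamma> (Vertex (tail E e)) = \<gamma> (Ghost e)"
  and ghost_edge: "e \<in> arcs E \<Longrightarrow> f \<in> arcs E \<Longrightarrow>
      \<gamma> (Ghost e) \<bullet> \<gamma> (Edge f) = (if e = f then \<gamma> (Vertex (head E e)) else \<zero>\<^bsub>L\<^esub>)"
  and regular_sum: "regular E v \<Longrightarrow> \<gamma> (Vertex v) = (\<Oplus>\<^bsub>L\<^esub>e\<in>out_arcs E v. \<gamma> (Edge e) \<bullet> \<gamma> (Ghost e))"
  using gen_family unfolding leavitt_family_def by (auto simp del: in_out_arcs_conv)

text \<open>The start vertex is an argument because the empty path stands for its vertex.
  \<open>nu\<close> gives the ghost of the same path and so reverses the factors.\<close>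

primrec mu :: "'v \<Rightarrow> 'e list \<Rightarrow> ('v, 'e, 'k) lpa_elt" where
  "mu u [] = \<gamma> (Vertex u)"
| "mu u (e # p) = \<gamma> (Edge e) \<bullet> mu (head E e) p"

primrec nu :: "'v \<Rightarrow> 'e list \<Rightarrow> ('v, 'e, 'k) lpa_elt" where
  "nu u [] = \<gamma> (Vertex u)"
| "nu u (e # p) = nu (head E e) p \<bullet> \<gamma> (Ghost e)"

lemma walk_Nil [simp]: "walk u [] w \<longleftrightarrow> u = w \<and> u \<in> verts E"
  by (rule E.awalk_Nil_iff)

lemma walk_Cons [simp]: "walk u (e # p) w \<longleftrightarrow> e \<in> arcs E \<and> u = tail E e \<and> walk (head E e) p w"
  by (rule E.awalk_Cons_iff)

lemma walk_verts: "walk u p w \<Longrightarrow> u \<in> verts E" "walk u p w \<Longrightarrow> w \<in> verts E"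
  by (rule E.awalk_hd_in_verts E.awalk_last_in_verts; assumption)+

lemma walk_append: "walk u (p @ q) w \<longleftrightarrow> (\<exists>x. walk u p x \<and> walk x q w)"
  by (induction p arbitrary: u) (auto dest: walk_verts)

lemma walk_unique: "walk u p w \<Longrightarrow> walk u p x \<Longrightarrow> w = x"
  by (induction p arbitrary: u) auto

lemma mu_closed [simp]: "walk u p w \<Longrightarrow> mu u p \<in> carrier L"
  by (induction p arbitrary: u) auto

lemma nu_closed [simp]: "walk u p w \<Longrightarrow> nu u p \<in> carrier L"
  by (induction p arbitrary: u) auto

lemma vertex_mu: "walk u p w \<Longrightarrow> v \<in> verts E \<Longrightarrow> \<gamma> (Vertex v) \<bullet> mu u p = (if v = u then mu u p else \<zero>\<^bsub>L\<^esub>)"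
proof (cases p)
  case (Cons e p')
  assume a: "walk u p w" "v \<in> verts E"
  then have "\<gamma> (Vertex v) \<bullet> mu u p = (\<gamma> (Vertex v) \<bullet> (\<gamma> (Vertex u) \<bullet> \<gamma> (Edge e))) \<bullet> mu (head E e) p'"
    using Cons by (auto simp: tail_edge L.mult_assoc)
  also have "\<dots> = ((\<gamma> (Vertex v) \<bullet> \<gamma> (Vertex u)) \<bullet> \<gamma> (Edge e)) \<bullet> mu (head E e) p'"
    using Cons a by (auto simp: L.mult_assoc)
  finally show ?thesis using Cons a by (auto simp: vertex_mult tail_edge)
qed (auto simp: vertex_mult)

lemma mu_vertex: "walk u p w \<Longrightarrow> mu u p \<bullet> \<gamma> (Vertex w) = mu u p"
proof (induction p arbitrary: u)
  case (Cons e p)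
  then show ?case using walk_verts(2)[OF Cons.prems] by (auto simp: L.mult_assoc)
qed (simp add: vertex_mult)

lemma vertex_nu: "walk u p w \<Longrightarrow> \<gamma> (Vertex w) \<bullet> nu u p = nu u p"
proof (induction p arbitrary: u)
  case (Cons e p)
  then show ?case using walk_verts(2)[OF Cons.prems] by (auto simp: L.mult_assoc[symmetric])
qed (simp add: vertex_mult)

lemma nu_vertex: "walk u p w \<Longrightarrow> v \<in> verts E \<Longrightarrow> nu u p \<bullet> \<gamma> (Vertex v) = (if v = u then nu u p else \<zero>\<^bsub>L\<^esub>)"
proof (cases p)
  case (Cons e p')
  assume a: "walk u p w" "v \<in> verts E"
  then have "nu u p \<bullet> \<gamma> (Vertex v) = nu (head E e) p' \<bullet> ((\<gamma> (Ghost e) \<bullet> \<gamma> (Vertex u)) \<bullet> \<gamma> (Vertex v))"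
    using Cons by (auto simp: ghost_tail L.mult_assoc)
  also have "\<dots> = nu (head E e) p' \<bullet> (\<gamma> (Ghost e) \<bullet> (\<gamma> (Vertex u) \<bullet> \<gamma> (Vertex v)))"
    using Cons a by (auto simp: L.mult_assoc)
  finally show ?thesis using Cons a by (auto simp: vertex_mult ghost_tail)
qed (auto simp: vertex_mult)

lemma mu_append: "walk u p w \<Longrightarrow> walk w q x \<Longrightarrow> mu u (p @ q) = mu u p \<bullet> mu w q"
proof (induction p arbitrary: u)
  case Nil
  then show ?case using vertex_mu[of w q x w] by (auto dest: walk_verts)
next
  case (Cons e p)
  then show ?case by (auto simp: L.mult_assoc)
qed

lemma nu_append: "walk u p w \<Longrightarrow> walk w q x \<Longrightarrow> nu u (p @ q) = nu w q \<bullet> nu u p"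
proof (induction p arbitrary: u)
  case Nil
  then show ?case using nu_vertex[of w q x w] by (auto dest: walk_verts)
next
  case (Cons e p)
  then show ?case by (auto simp: L.mult_assoc)
qed

lemma nu_mu_Cons:
  assumes "walk (tail E e) (e # p) w" "walk (tail E f) (f # q) x"
  shows "nu (tail E e) (e # p) \<bullet> mu (tail E f) (f # q) =
    (if e = f then nu (head E e) p \<bullet> mu (head E f) q else \<zero>\<^bsub>L\<^esub>)"
proof -
  have "nu (tail E e) (e # p) \<bullet> mu (tail E f) (f # q) =
      nu (head E e) p \<bullet> ((\<gamma> (Ghost e) \<bullet> \<gamma> (Edge f)) \<bullet> mu (head E f) q)"
    using assms by (auto simp: L.mult_assoc)
  then show ?thesis using assms by (auto simp: ghost_edge vertex_mu ends_in_verts)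
qed

lemma nu_mu_same: "walk u p w \<Longrightarrow> nu u p \<bullet> mu u p = \<gamma> (Vertex w)"
proof (induction p arbitrary: u)
  case (Cons e p)
  then show ?case using nu_mu_Cons[of e p w e p w] by simp
qed (simp add: vertex_mult)

text \<open>Equal first edges cancel in pairs. What is left is a path, a ghost path, or a ghost edge
  meeting a different edge, which gives 0. Later computations with products of monomials rest on
  this trichotomy.\<close>

lemma nu_mu_cases:
  assumes "walk u p w" "walk u' q x"
  shows "(u = u' \<and> (\<exists>r. q = p @ r \<and> walk w r x \<and> nu u p \<bullet> mu u' q = mu w r)) \<or>
    (u = u' \<and> (\<exists>r. r \<noteq> [] \<and> p = q @ r \<and> walk x r w \<and> nu u p \<bullet> mu u' q = nu x r)) \<or>
    ((u = u' \<longrightarrow> (\<nexists>r. q = p @ r) \<and> (\<nexists>r. p = q @ r)) \<and> nu u p \<bullet> mu u' q = \<zero>\<^bsub>L\<^esub>)"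
proof (cases "u = u'")
  case False
  have "nu u p \<bullet> mu u' q = nu u p \<bullet> (\<gamma> (Vertex u') \<bullet> mu u' q)"
    using assms walk_verts(1)[OF assms(2)] by (simp add: vertex_mu)
  also have "\<dots> = (nu u p \<bullet> \<gamma> (Vertex u')) \<bullet> mu u' q"
    using assms walk_verts(1)[OF assms(2)] by (simp add: L.mult_assoc)
  also have "\<dots> = \<zero>\<^bsub>L\<^esub>" using assms walk_verts(1)[OF assms(2)] False by (simp add: nu_vertex)
  finally show ?thesis using False by simp
next
  case True
  show ?thesis using assms unfolding True
  proof (induction p arbitrary: u' q)
    case Nil
    then show ?case using vertex_mu[of u' q x u'] by auto
  next
    case (Cons e p)
    show ?case
    proof (cases q)
      case Nil
      then show ?thesis using Cons.prems nu_vertex[of u' "e # p" w u'] walk_verts(1)[OF Cons.prems(1)] by auto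
    next
      case (Cons f q')
      then have eq: "nu u' (e # p) \<bullet> mu u' q =
          (if e = f then nu (head E e) p \<bullet> mu (head E e) q' else \<zero>\<^bsub>L\<^esub>)"
        using Cons.prems nu_mu_Cons[of e p w f q' x] by auto
      show ?thesis
      proof (cases "e = f")
        case True
        have "walk (head E e) p w" "walk (head E e) q' x" using Cons Cons.prems True by auto
        from Cons.IH[OF this] show ?thesis unfolding eq using True Cons by simp
      next
        case False
        then show ?thesis unfolding eq using Cons by simp
      qed
    qed
  qed
qed

section \<open>Monomials and the left ideals they span\<close>

definition PP :: "'v set \<Rightarrow> ('v \<times> 'e list \<times> 'v \<times> 'e list) set" where
  "PP R = {(u, p, u', q). \<exists>w\<in>R. walk u p w \<and> walk u' q w}"

definition mon :: "'v \<times> 'e list \<times> 'v \<times> 'e list \<Rightarrow> ('v, 'e, 'k) lpa_elt" where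
  "mon = (\<lambda>(u, p, u', q). mu u p \<bullet> nu u' q)"

lemma mon_closed: "t \<in> PP R \<Longrightarrow> mon t \<in> carrier L"
  by (auto simp: PP_def mon_def)

lemma gen_mon:
  assumes "g \<in> gens E" "t \<in> PP R" "\<And>e. e \<in> arcs E \<Longrightarrow> tail E e \<in> R \<Longrightarrow> head E e \<in> R"
  shows "\<gamma> g \<bullet> mon t \<in> insert \<zero>\<^bsub>L\<^esub> (mon ` PP R)"
proof -
  obtain u p u' q w where t: "t = (u, p, u', q)" "walk u p w" "walk u' q w" "w \<in> R"
    using assms(2) by (auto simp: PP_def)
  note c = mu_closed[OF t(2)] nu_closed[OF t(3)]
  have assoc: "\<gamma> g \<bullet> mon t = (\<gamma> g \<bullet> mu u p) \<bullet> nu u' q"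
    using c assms(1) by (simp add: t(1) mon_def L.mult_assoc)
  have inI: "x \<in> insert \<zero>\<^bsub>L\<^esub> (mon ` PP R)" if "walk v r y" "walk v' r' y" "y \<in> R" "x = mu v r \<bullet> nu v' r'" for x v r v' r' y
  proof -
    have "x = mon (v, r, v', r')" "(v, r, v', r') \<in> PP R" using that by (auto simp: mon_def PP_def)
    then show ?thesis by blast
  qed
  show ?thesis
  proof (cases g)
    case (Vertex v)
    then have "\<gamma> g \<bullet> mon t = (if v = u then mu u p \<bullet> nu u' q else \<zero>\<^bsub>L\<^esub>)"
      unfolding assoc using assms(1) c vertex_mu[OF t(2), of v] by simp
    then show ?thesis using inI[OF t(2,3,4) refl] by simp
  next
    case (Edge e)
    then have e: "e \<in> arcs E" using assms(1) by simp
    show ?thesis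
    proof (cases "head E e = u")
      case True
      then show ?thesis unfolding assoc using Edge e t by (intro inI[of "tail E e" "e # p" w]) auto
    next
      case False
      have "\<gamma> g \<bullet> mu u p = \<gamma> (Edge e) \<bullet> (\<gamma> (Vertex (head E e)) \<bullet> mu u p)"
        using e Edge c by (simp add: edge_head ends_in_verts L.mult_assoc[symmetric])
      then have "\<gamma> g \<bullet> mu u p = \<zero>\<^bsub>L\<^esub>" using False e t by (simp add: vertex_mu ends_in_verts)
      then show ?thesis unfolding assoc using c by simp
    qed
  next
    case (Ghost e)
    then have e: "e \<in> arcs E" using assms(1) by simp
    show ?thesis
    proof (cases p)
      case Nil
      then have uw: "u = w" "w \<in> verts E" using t by auto
      show ?thesis
      proof (cases "tail E e = u")
        case True
        \<comment> \<open>Only here does the meeting vertex of the two paths move: a ghost edge that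
          finds no path to cancel against is appended to the second path. This is why
          \<open>R\<close> has to be closed along edges.\<close>
        have wq: "walk u' (q @ [e]) (head E e)" using t uw True e by (auto simp: walk_append ends_in_verts)
        have "\<gamma> g \<bullet> mon t = \<gamma> (Ghost e) \<bullet> nu u' q"
          unfolding assoc using Ghost Nil True ghost_tail[OF e] by simp
        also have "\<dots> = nu u' (q @ [e])"
          using nu_append[OF t(3), of "[e]" "head E e"] True uw e by (simp add: head_ghost ends_in_verts)
        also have "\<dots> = mu (head E e) [] \<bullet> nu u' (q @ [e])"
          using vertex_nu[OF wq] by simp
        finally show ?thesis
          by (rule inI[of "head E e" "[]" "head E e" u' "q @ [e]", rotated 3])
            (use wq e assms(3)[OF e] True uw t(4) in \<open>auto simp: ends_in_verts\<close>)
      next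
        case False
        have "\<gamma> g \<bullet> mu u p = \<gamma> (Ghost e) \<bullet> (\<gamma> (Vertex (tail E e)) \<bullet> \<gamma> (Vertex u))"
          using e Ghost Nil uw by (simp add: ghost_tail ends_in_verts L.mult_assoc[symmetric])
        then have "\<gamma> g \<bullet> mu u p = \<zero>\<^bsub>L\<^esub>" using False e uw by (simp add: vertex_mult ends_in_verts)
        then show ?thesis unfolding assoc using c by simp
      qed
    next
      case (Cons f p')
      then have f: "f \<in> arcs E" "walk (head E f) p' w" using t by auto
      have "\<gamma> g \<bullet> mu u p = (\<gamma> (Ghost e) \<bullet> \<gamma> (Edge f)) \<bullet> mu (head E f) p'"
        using Ghost Cons e f by (simp add: L.mult_assoc)
      also have "\<dots> = (if e = f then mu (head E f) p' else \<zero>\<^bsub>L\<^esub>)"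
        using e f by (auto simp: ghost_edge vertex_mu ends_in_verts)
      finally have "\<gamma> g \<bullet> mon t = (if e = f then mu (head E f) p' \<bullet> nu u' q else \<zero>\<^bsub>L\<^esub>)"
        unfolding assoc using c by simp
      then show ?thesis using inI[OF f(2) t(3,4) refl] by simp
    qed
  qed
qed

lemma gen_in_mon: "g \<in> gens E \<Longrightarrow> \<gamma> g \<in> mon ` PP UNIV"
proof -
  assume g: "g \<in> gens E"
  have inI: "x \<in> mon ` PP UNIV" if "walk v r y" "walk v' r' y" "mu v r \<bullet> nu v' r' = x" for x v r v' r' y
  proof -
    have "x = mon (v, r, v', r')" "(v, r, v', r') \<in> PP UNIV" using that by (auto simp: mon_def PP_def)
    then show ?thesis by blast
  qed
  show ?thesis
  proof (cases g)
    case (Vertex v)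
    with g show ?thesis by (intro inI[of v "[]" v v "[]"]) (auto simp: vertex_mult)
  next
    case (Edge e)
    with g show ?thesis by (intro inI[of "tail E e" "[e]" "head E e" "head E e" "[]"])
      (auto simp: ends_in_verts edge_head)
  next
    case (Ghost e)
    with g show ?thesis by (intro inI[of "head E e" "[]" "head E e" "tail E e" "[e]"])
      (auto simp: ends_in_verts head_ghost)
  qed
qed

lemma word_mon: "w \<noteq> [] \<Longrightarrow> set w \<subseteq> gens E \<Longrightarrow> word_prod L \<gamma> w \<in> insert \<zero>\<^bsub>L\<^esub> (mon ` PP UNIV)"
proof (induction w)
  case (Cons g w)
  show ?case
  proof (cases "w = []")
    case True
    then show ?thesis using Cons.prems gen_in_mon[of g] by simp
  next
    case False
    then have "word_prod L \<gamma> w \<in> insert \<zero>\<^bsub>L\<^esub> (mon ` PP UNIV)" using Cons by simp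
    then consider "word_prod L \<gamma> w = \<zero>\<^bsub>L\<^esub>" | t where "t \<in> PP UNIV" "word_prod L \<gamma> w = mon t" by blast
    then show ?thesis using False Cons.prems gen_mon[of g _ UNIV] by cases simp_all
  qed
qed simp

lemma mon_induct [consumes 1, case_names zero add mon]:
  assumes "a \<in> carrier L" "Q \<zero>\<^bsub>L\<^esub>"
    and "\<And>a b. \<lbrakk>a \<in> carrier L; b \<in> carrier L; Q a; Q b\<rbrakk> \<Longrightarrow> Q (a \<oplus>\<^bsub>L\<^esub> b)"
    and mon: "\<And>k u p u' q w. \<lbrakk>k \<in> carrier K; walk u p w; walk u' q w\<rbrakk> \<Longrightarrow> Q (k \<odot>\<^bsub>L\<^esub> (mu u p \<bullet> nu u' q))"
  shows "Q a"
  using assms(1)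
proof (induction a rule: L_induct)
  case (word k w)
  then show ?case using word_mon[of w] mon assms(2)
    by (auto simp: mon_def PP_def)
qed (use assms in auto)

text \<open>Coefficients are indexed by path data and not by elements: at a regular vertex the
  monomials satisfy a linear relation, so an element does not determine its coefficients.\<close>

definition comb :: "('v \<times> 'e list \<times> 'v \<times> 'e list \<Rightarrow> 'k) \<Rightarrow> ('v, 'e, 'k) lpa_elt" where
  "comb = lin K L (\<lambda>t k. k \<odot>\<^bsub>L\<^esub> mon t)"

lemma comb_family: "T \<subseteq> PP R \<Longrightarrow> additive_family K T L (\<lambda>t k. k \<odot>\<^bsub>L\<^esub> mon t)"
  by (intro L.smult_additive_family) (auto intro: mon_closed)

lemma comb_hom: "T \<subseteq> PP R \<Longrightarrow> abelian_group_hom (free_space K T) L comb"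
  unfolding comb_def by (rule K.lin_hom[OF L.abelian_group_A comb_family])

lemma comb_single: "t \<in> PP R \<Longrightarrow> k \<in> carrier K \<Longrightarrow> comb (single K k t) = k \<odot>\<^bsub>L\<^esub> mon t"
  unfolding comb_def by (rule K.lin_single[OF L.abelian_group_A comb_family[OF order_refl]])

lemma comb_closed: "T \<subseteq> PP R \<Longrightarrow> x \<in> carrier (free_space K T) \<Longrightarrow> comb x \<in> carrier L"
  using abelian_group_hom.hom_closed[OF comb_hom] .

lemma comb_add:
  "T \<subseteq> PP R \<Longrightarrow> x \<in> carrier (free_space K T) \<Longrightarrow> y \<in> carrier (free_space K T) \<Longrightarrow>
    comb (x \<oplus>\<^bsub>free_space K T\<^esub> y) = comb x \<oplus>\<^bsub>L\<^esub> comb y"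
  using abelian_group_hom.hom_add[OF comb_hom] .

lemma comb_zero: "comb (\<lambda>t. \<zero>\<^bsub>K\<^esub>) = \<zero>\<^bsub>L\<^esub>"
  unfolding comb_def by (rule K.lin_zero[OF L.abelian_group_A])

lemma comb_induct [consumes 2, case_names zero add]:
  assumes "T \<subseteq> PP R" "x \<in> carrier (free_space K T)" "Q \<zero>\<^bsub>L\<^esub>"
    and step: "\<And>a k t. \<lbrakk>a \<in> carrier L; k \<in> carrier K; t \<in> T; Q a\<rbrakk> \<Longrightarrow> Q (a \<oplus>\<^bsub>L\<^esub> k \<odot>\<^bsub>L\<^esub> mon t)"
  shows "Q (comb x)"
  using assms(2)
proof (induction x rule: K.free_space_induct)
  case zero
  show ?case using assms(3) by (simp only: comb_zero)
next
  case (single x k t)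
  have "comb (x \<oplus>\<^bsub>free_space K T\<^esub> single K k t) = comb x \<oplus>\<^bsub>L\<^esub> k \<odot>\<^bsub>L\<^esub> mon t"
    using comb_add[OF assms(1) single(1) K.single_carrier[OF single(2,3)]] comb_single[of t R k] assms(1) single by auto
  then show ?case using step[of "comb x" k t] single comb_closed[OF assms(1)] by simp
qed

text \<open>\<open>R\<close> restricts the vertex in which the two paths meet. When \<open>R\<close>
  is closed along edges, the span is a left ideal, see \<open>SP_left\<close>.\<close>

definition SP :: "'v set \<Rightarrow> ('v, 'e, 'k) lpa_elt set" where
  "SP R = comb ` carrier (free_space K (PP R))"

lemma SP_closed: "a \<in> SP R \<Longrightarrow> a \<in> carrier L"
  using comb_closed[OF order_refl] by (auto simp: SP_def)

lemma SP_zero: "\<zero>\<^bsub>L\<^esub> \<in> SP R"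
  unfolding SP_def by (rule image_eqI[of _ _ "\<lambda>t. \<zero>\<^bsub>K\<^esub>"]) (auto simp: comb_zero free_space_carrier_iff)

lemma SP_add: "a \<in> SP R \<Longrightarrow> b \<in> SP R \<Longrightarrow> a \<oplus>\<^bsub>L\<^esub> b \<in> SP R"
proof -
  assume "a \<in> SP R" "b \<in> SP R"
  then obtain x y where xy: "x \<in> carrier (free_space K (PP R))" "a = comb x"
    "y \<in> carrier (free_space K (PP R))" "b = comb y" by (auto simp: SP_def)
  have "a \<oplus>\<^bsub>L\<^esub> b = comb (x \<oplus>\<^bsub>free_space K (PP R)\<^esub> y)"
    using comb_add[OF order_refl xy(1,3)] xy by (simp only:)
  moreover have "x \<oplus>\<^bsub>free_space K (PP R)\<^esub> y \<in> carrier (free_space K (PP R))"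
    by (rule abelian_groupE(1)[OF module.axioms(2)[OF K.free_space_module] xy(1,3)])
  ultimately show ?thesis unfolding SP_def by (rule image_eqI)
qed

lemma SP_mon: "t \<in> PP R \<Longrightarrow> k \<in> carrier K \<Longrightarrow> k \<odot>\<^bsub>L\<^esub> mon t \<in> SP R"
  unfolding SP_def by (metis comb_single K.single_carrier imageI)

lemma SP_induct [consumes 1, case_names zero add]:
  assumes "a \<in> SP R" "Q \<zero>\<^bsub>L\<^esub>"
    and "\<And>a k t. \<lbrakk>a \<in> SP R; k \<in> carrier K; t \<in> PP R; Q a\<rbrakk> \<Longrightarrow> Q (a \<oplus>\<^bsub>L\<^esub> k \<odot>\<^bsub>L\<^esub> mon t)"
  shows "Q a"
proof -
  obtain x where x: "x \<in> carrier (free_space K (PP R))" "a = comb x" using assms(1) by (auto simp: SP_def)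
  have "comb x \<in> SP R \<and> Q (comb x)"
    using order_refl x(1)
  proof (induction x rule: comb_induct)
    case (add a k t)
    then show ?case using assms(3)[of a k t] SP_add SP_mon by blast
  qed (use assms SP_zero in auto)
  with x show ?thesis by simp
qed

lemma SP_smult: "a \<in> SP R \<Longrightarrow> l \<in> carrier K \<Longrightarrow> l \<odot>\<^bsub>L\<^esub> a \<in> SP R"
proof (induction a rule: SP_induct)
  case (add a k t)
  then have "l \<odot>\<^bsub>L\<^esub> (a \<oplus>\<^bsub>L\<^esub> k \<odot>\<^bsub>L\<^esub> mon t) = l \<odot>\<^bsub>L\<^esub> a \<oplus>\<^bsub>L\<^esub> (l \<otimes>\<^bsub>K\<^esub> k) \<odot>\<^bsub>L\<^esub> mon t"
    using mon_closed SP_closed by (simp add: L.smult_r_distr L.smult_assoc1)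
  with add show ?case using SP_add SP_mon[of t R "l \<otimes>\<^bsub>K\<^esub> k"] by simp
qed (simp add: L.smult_r_null SP_zero)

lemma SP_left:
  assumes R: "\<And>e. e \<in> arcs E \<Longrightarrow> tail E e \<in> R \<Longrightarrow> head E e \<in> R"
    and "a \<in> carrier L" "b \<in> SP R"
  shows "a \<bullet> b \<in> SP R"
proof -
  have gen: "\<gamma> g \<bullet> b \<in> SP R" if "g \<in> gens E" "b \<in> SP R" for g b
    using that(2)
  proof (induction b rule: SP_induct)
    case zero
    then show ?case using that(1) by (simp add: SP_zero)
  next
    case (add b k t)
    have c: "b \<in> carrier L" "mon t \<in> carrier L" "\<gamma> g \<in> carrier L"
      using add mon_closed SP_closed that(1) by auto
    have "\<gamma> g \<bullet> mon t \<in> insert \<zero>\<^bsub>L\<^esub> (mon ` PP R)" using gen_mon[OF that(1) add(3) R] by blast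
    then have "k \<odot>\<^bsub>L\<^esub> (\<gamma> g \<bullet> mon t) \<in> SP R"
      using SP_mon[OF _ add(2)] SP_zero L.smult_r_null[OF add(2)] by auto
    then show ?case using add c SP_add by (simp add: L.mult_r_distr L.mult_smult)
  qed
  have word: "word_prod L \<gamma> w \<bullet> b \<in> SP R" if "w \<noteq> []" "set w \<subseteq> gens E" for w
    using that
  proof (induction w)
    case (Cons g w)
    show ?case
    proof (cases "w = []")
      case False
      have "word_prod L \<gamma> w \<in> carrier L"
        using word_prod_closed[OF L.nonunital_algebra_axioms, of \<gamma> "gens E" w] Cons.prems False by auto
      then show ?thesis
        using Cons False gen[of g "word_prod L \<gamma> w \<bullet> b"] SP_closed[OF assms(3)] by (simp add: L.mult_assoc)
    qed (use Cons.prems gen assms(3) in simp)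
  qed simp
  have b: "b \<in> carrier L" using assms(3) by (rule SP_closed)
  show ?thesis using assms(2)
  proof (induction a rule: L_induct)
    case (word k w)
    have "word_prod L \<gamma> w \<in> carrier L"
      using word_prod_closed[OF L.nonunital_algebra_axioms, of \<gamma> "gens E" w] word by auto
    then show ?case using word \<open>\<And>w. w \<noteq> [] \<Longrightarrow> set w \<subseteq> gens E \<Longrightarrow> word_prod L \<gamma> w \<bullet> b \<in> SP R\<close> b
      by (simp add: L.smult_mult SP_smult)
  qed (use b in \<open>simp_all add: SP_zero SP_add L.mult_l_distr\<close>)
qed

lemma SP_finite:
  assumes "a \<in> SP R"
  obtains T x where "finite T" "T \<subseteq> PP R" "x \<in> carrier (free_space K T)" "a = comb x"
proof -
  obtain x where x: "x \<in> carrier (free_space K (PP R))" "a = comb x" using assms by (auto simp: SP_def)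
  then show thesis using that[of "{t. x t \<noteq> \<zero>\<^bsub>K\<^esub>}" x] by (auto simp: free_space_carrier_iff)
qed

end

section \<open>Simple modules\<close>

lemma (in left_module) act_l_hom: "abelian_group R \<Longrightarrow> x \<in> carrier M \<Longrightarrow> abelian_group_hom R M (\<lambda>a. a \<odot>\<^bsub>M\<^esub> x)"
proof -
  have "abelian_group M" by intro_locales
  then show "abelian_group R \<Longrightarrow> x \<in> carrier M \<Longrightarrow> abelian_group_hom R M (\<lambda>a. a \<odot>\<^bsub>M\<^esub> x)"
    by (intro abelian_group_homI') (auto simp: smult_closed smult_l_distr)
qed

lemma (in left_module) act_r_hom: "a \<in> carrier R \<Longrightarrow> abelian_group_hom M M (\<lambda>x. a \<odot>\<^bsub>M\<^esub> x)"
proof -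
  have "abelian_group M" by intro_locales
  then show "a \<in> carrier R \<Longrightarrow> abelian_group_hom M M (\<lambda>x. a \<odot>\<^bsub>M\<^esub> x)"
    by (intro abelian_group_homI') (auto simp: smult_closed smult_r_distr)
qed

lemma (in left_module) submoduleI':
  assumes "N \<subseteq> carrier M" "\<zero>\<^bsub>M\<^esub> \<in> N"
    and "\<And>x y. \<lbrakk>x \<in> N; y \<in> N\<rbrakk> \<Longrightarrow> x \<oplus>\<^bsub>M\<^esub> y \<in> N"
    and "\<And>x. x \<in> N \<Longrightarrow> \<ominus>\<^bsub>M\<^esub> x \<in> N"
    and "\<And>a x. \<lbrakk>a \<in> carrier R; x \<in> N\<rbrakk> \<Longrightarrow> a \<odot>\<^bsub>M\<^esub> x \<in> N"
  shows "submodule N R M"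
  using assms
  by (intro submodule.intro subgroup.intro submodule_axioms.intro) (auto simp: a_inv_def[symmetric])

section \<open>Action of vertices and paths on a module\<close>

locale lpa_module = leavitt_path K E + M: left_module "lpa K E" M
  for K :: "('k, 'c) ring_scheme" and E :: "('v, 'e) pre_digraph"
    and M :: "(('v, 'e, 'k) lpa_elt, 'm) module"
begin

abbreviation act (infixr "\<cdot>" 75) where "a \<cdot> m \<equiv> a \<odot>\<^bsub>M\<^esub> m"

abbreviation "ver v \<equiv> \<gamma> (Vertex v)"

lemma act_closed [simp]: "a \<in> carrier L \<Longrightarrow> m \<in> carrier M \<Longrightarrow> a \<cdot> m \<in> carrier M"
  by (rule M.smult_closed)

lemma act_mult: "a \<in> carrier L \<Longrightarrow> b \<in> carrier L \<Longrightarrow> m \<in> carrier M \<Longrightarrow> (a \<bullet> b) \<cdot> m = a \<cdot> (b \<cdot> m)"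
  by (rule M.smult_assoc)

lemma act_l_hom: "m \<in> carrier M \<Longrightarrow> abelian_group_hom L M (\<lambda>a. a \<cdot> m)"
  using L.abelian_group_A by (rule M.act_l_hom)

lemma act_zero_l [simp]: "m \<in> carrier M \<Longrightarrow> \<zero>\<^bsub>L\<^esub> \<cdot> m = \<zero>\<^bsub>M\<^esub>"
  using abelian_group_hom.hom_zero[OF act_l_hom] .

lemma act_zero_r [simp]: "a \<in> carrier L \<Longrightarrow> a \<cdot> \<zero>\<^bsub>M\<^esub> = \<zero>\<^bsub>M\<^esub>"
  using abelian_group_hom.hom_zero[OF M.act_r_hom] .

lemma act_add_l: "a \<in> carrier L \<Longrightarrow> b \<in> carrier L \<Longrightarrow> m \<in> carrier M \<Longrightarrow> (a \<oplus>\<^bsub>L\<^esub> b) \<cdot> m = a \<cdot> m \<oplus>\<^bsub>M\<^esub> b \<cdot> m"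
  by (rule M.smult_l_distr)

lemma act_minus_l: "a \<in> carrier L \<Longrightarrow> m \<in> carrier M \<Longrightarrow> (\<ominus>\<^bsub>L\<^esub> a) \<cdot> m = \<ominus>\<^bsub>M\<^esub> (a \<cdot> m)"
  using abelian_group_hom.hom_a_inv[OF act_l_hom] .

lemma act_diff_l:
  "a \<in> carrier L \<Longrightarrow> b \<in> carrier L \<Longrightarrow> m \<in> carrier M \<Longrightarrow> (a \<ominus>\<^bsub>L\<^esub> b) \<cdot> m = a \<cdot> m \<ominus>\<^bsub>M\<^esub> b \<cdot> m"
  by (simp add: a_minus_def act_add_l act_minus_l)

lemma act_smult_mult:
  "k \<in> carrier K \<Longrightarrow> a \<in> carrier L \<Longrightarrow> b \<in> carrier L \<Longrightarrow> m \<in> carrier M \<Longrightarrow>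
    (k \<odot>\<^bsub>L\<^esub> (a \<bullet> b)) \<cdot> m = (k \<odot>\<^bsub>L\<^esub> a) \<cdot> (b \<cdot> m)"
  by (simp add: L.smult_mult[symmetric] act_mult)

lemma act_smult_mult':
  "k \<in> carrier K \<Longrightarrow> a \<in> carrier L \<Longrightarrow> b \<in> carrier L \<Longrightarrow> m \<in> carrier M \<Longrightarrow>
    (k \<odot>\<^bsub>L\<^esub> (a \<bullet> b)) \<cdot> m = a \<cdot> ((k \<odot>\<^bsub>L\<^esub> b) \<cdot> m)"
  by (simp add: L.mult_smult[symmetric] act_mult)

lemma ver_closed [simp]: "v \<in> verts E \<Longrightarrow> ver v \<in> carrier L" by auto

lemma ver_ver: "v \<in> verts E \<Longrightarrow> w \<in> verts E \<Longrightarrow> m \<in> carrier M \<Longrightarrow>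
    ver v \<cdot> (ver w \<cdot> m) = (if v = w then ver v \<cdot> m else \<zero>\<^bsub>M\<^esub>)"
  by (simp add: act_mult[symmetric] vertex_mult)

lemma ver_mu: "walk u p w \<Longrightarrow> m \<in> carrier M \<Longrightarrow> ver u \<cdot> (mu u p \<cdot> m) = mu u p \<cdot> m"
  using walk_verts[of u p w] by (simp add: act_mult[symmetric] vertex_mu)

lemma ver_nu: "walk u p w \<Longrightarrow> m \<in> carrier M \<Longrightarrow> ver w \<cdot> (nu u p \<cdot> m) = nu u p \<cdot> m"
  using walk_verts[of u p w] by (simp add: act_mult[symmetric] vertex_nu)

lemma nu_ver: "walk u p w \<Longrightarrow> v \<in> verts E \<Longrightarrow> m \<in> carrier M \<Longrightarrow>
    nu u p \<cdot> (ver v \<cdot> m) = (if v = u then nu u p \<cdot> m else \<zero>\<^bsub>M\<^esub>)"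
  by (simp add: act_mult[symmetric] nu_vertex)

lemma nu_mu: "walk u p w \<Longrightarrow> m \<in> carrier M \<Longrightarrow> nu u p \<cdot> (mu u p \<cdot> m) = ver w \<cdot> m"
  by (simp add: act_mult[symmetric] nu_mu_same)

text \<open>Each monomial absorbs a vertex on its right, so a vector killed by all vertices is
  killed by the whole algebra. This replaces a unit.\<close>

lemma vertex_detects:
  assumes "m \<in> carrier M" "a \<in> carrier L" "a \<cdot> m \<noteq> \<zero>\<^bsub>M\<^esub>"
  shows "\<exists>v\<in>verts E. ver v \<cdot> m \<noteq> \<zero>\<^bsub>M\<^esub>"
proof (rule ccontr)
  assume "\<not> ?thesis"
  then have z: "ver v \<cdot> m = \<zero>\<^bsub>M\<^esub>" if "v \<in> verts E" for v using that by blast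
  have "a \<cdot> m = \<zero>\<^bsub>M\<^esub>" using assms(2)
  proof (induction a rule: mon_induct)
    case (mon k u p u' q w)
    have "nu u' q \<cdot> m = \<zero>\<^bsub>M\<^esub>"
      using nu_ver[OF mon(3) walk_verts(1)[OF mon(3)] assms(1)] z[OF walk_verts(1)[OF mon(3)]] mon(3) by auto
    then show ?case using mon assms(1) by (auto simp: act_smult_mult)
  qed (use assms(1) in \<open>auto simp: act_add_l\<close>)
  with assms(3) show False by simp
qed

definition "Y = {v \<in> verts E. \<exists>m\<in>carrier M. ver v \<cdot> m \<noteq> \<zero>\<^bsub>M\<^esub>}"

lemma Y_verts: "v \<in> Y \<Longrightarrow> v \<in> verts E" by (simp add: Y_def)

lemma not_Y: "v \<in> verts E \<Longrightarrow> v \<notin> Y \<Longrightarrow> m \<in> carrier M \<Longrightarrow> ver v \<cdot> m = \<zero>\<^bsub>M\<^esub>"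
  by (auto simp: Y_def)

lemma Y_I: "v \<in> verts E \<Longrightarrow> m \<in> carrier M \<Longrightarrow> ver v \<cdot> m \<noteq> \<zero>\<^bsub>M\<^esub> \<Longrightarrow> v \<in> Y"
  by (auto simp: Y_def)

text \<open>A path acts injectively on the range of its end vertex, its ghost being a left inverse
  there.\<close>

lemma Y_up:
  assumes "walk u p w" "w \<in> Y"
  shows "u \<in> Y"
proof -
  obtain m where m: "m \<in> carrier M" "ver w \<cdot> m \<noteq> \<zero>\<^bsub>M\<^esub>" using assms(2) by (auto simp: Y_def)
  have "nu u p \<cdot> (mu u p \<cdot> m) \<noteq> \<zero>\<^bsub>M\<^esub>" using nu_mu[OF assms(1) m(1)] m(2) by simp
  then have "mu u p \<cdot> m \<noteq> \<zero>\<^bsub>M\<^esub>" using nu_closed[OF assms(1)] by auto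
  then have "ver u \<cdot> (mu u p \<cdot> m) \<noteq> \<zero>\<^bsub>M\<^esub>" using ver_mu[OF assms(1) m(1)] by simp
  then show ?thesis
    using walk_verts[OF assms(1)] m(1) mu_closed[OF assms(1)] by (intro Y_I[of u "mu u p \<cdot> m"]) auto
qed

lemma nu_Y:
  assumes "walk u p w" "m \<in> carrier M" "nu u p \<cdot> m \<noteq> \<zero>\<^bsub>M\<^esub>"
  shows "w \<in> Y"
  using assms ver_nu[OF assms(1,2)] walk_verts[OF assms(1)] nu_closed[OF assms(1)]
  by (intro Y_I[of w "nu u p \<cdot> m"]) auto

lemma nu_Y_zero: "walk u p w \<Longrightarrow> m \<in> carrier M \<Longrightarrow> w \<notin> Y \<Longrightarrow> nu u p \<cdot> m = \<zero>\<^bsub>M\<^esub>"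
  using nu_Y by blast

lemma ghost_closed: "e \<in> arcs E \<Longrightarrow> \<gamma> (Ghost e) \<in> carrier L" "e \<in> arcs E \<Longrightarrow> \<gamma> (Edge e) \<in> carrier L"
  by auto

lemma ghost_not_Y: "e \<in> arcs E \<Longrightarrow> head E e \<notin> Y \<Longrightarrow> m \<in> carrier M \<Longrightarrow> \<gamma> (Ghost e) \<cdot> m = \<zero>\<^bsub>M\<^esub>"
  using head_ghost[of e] not_Y[of "head E e" "\<gamma> (Ghost e) \<cdot> m"] act_mult[of "ver (head E e)" "\<gamma> (Ghost e)" m]
  by (simp add: ends_in_verts)

lemma regular_expand:
  assumes "regular E v" "m \<in> carrier M"
  shows "ver v \<cdot> m = (\<Oplus>\<^bsub>M\<^esub>e\<in>out_arcs E v. \<gamma> (Edge e) \<cdot> (\<gamma> (Ghost e) \<cdot> m))"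
proof -
  have "ver v \<cdot> m = (\<Oplus>\<^bsub>M\<^esub>e\<in>out_arcs E v. (\<gamma> (Edge e) \<bullet> \<gamma> (Ghost e)) \<cdot> m)"
    unfolding regular_sum[OF assms(1)] by (rule hom_finsum[OF act_l_hom[OF assms(2)]]) auto
  also have "\<dots> = (\<Oplus>\<^bsub>M\<^esub>e\<in>out_arcs E v. \<gamma> (Edge e) \<cdot> (\<gamma> (Ghost e) \<cdot> m))"
    by (rule M.finsum_cong') (use assms(2) in \<open>auto simp: act_mult\<close>)
  finally show ?thesis .
qed

lemma regular_detects:
  assumes "regular E v" "m \<in> carrier M" "ver v \<cdot> m \<noteq> \<zero>\<^bsub>M\<^esub>"
  shows "\<exists>e\<in>out_arcs E v. \<gamma> (Ghost e) \<cdot> m \<noteq> \<zero>\<^bsub>M\<^esub>"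
proof (rule ccontr)
  assume "\<not> ?thesis"
  then have "ver v \<cdot> m = (\<Oplus>\<^bsub>M\<^esub>e\<in>out_arcs E v. \<zero>\<^bsub>M\<^esub>)"
    unfolding regular_expand[OF assms(1,2)] by (intro M.finsum_cong') auto
  then show False using assms(3) by simp
qed

end

locale lpa_simple = leavitt_path K E
  for K :: "('k, 'c) ring_scheme" and E :: "('v, 'e) pre_digraph" +
  fixes M :: "(('v, 'e, 'k) lpa_elt, 'm) module"
  assumes simple: "simple_left_module (lpa K E) M"
begin

sublocale lpa_module K E M
  using simple by (intro lpa_module.intro leavitt_path_axioms) (simp add: simple_left_module_def)

lemma submodule_cases: "submodule N L M \<Longrightarrow> N = {\<zero>\<^bsub>M\<^esub>} \<or> N = carrier M"
  using simple by (simp add: simple_left_module_def)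

text \<open>Without a unit it is not clear at first that \<open>m\<close> generates anything. The
  vectors killed by the whole algebra form a submodule, which is proper and hence 0; so the
  multiples of \<open>m\<close> form a nonzero submodule, which is everything.\<close>

lemma generates:
  assumes "m \<in> carrier M" "m \<noteq> \<zero>\<^bsub>M\<^esub>" "y \<in> carrier M"
  shows "\<exists>a\<in>carrier L. a \<cdot> m = y"
proof -
  let ?N = "{x \<in> carrier M. \<forall>a\<in>carrier L. a \<cdot> x = \<zero>\<^bsub>M\<^esub>}"
  have neg: "a \<cdot> (\<ominus>\<^bsub>M\<^esub> x) = \<ominus>\<^bsub>M\<^esub> (a \<cdot> x)" if "a \<in> carrier L" "x \<in> carrier M" for a x
    using abelian_group_hom.hom_a_inv[OF M.act_r_hom[OF that(1)] that(2)] .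
  have mz: "\<ominus>\<^bsub>M\<^esub> \<zero>\<^bsub>M\<^esub> = \<zero>\<^bsub>M\<^esub>" by (rule M.minus_equality) simp_all
  have "submodule ?N L M"
  proof (rule M.submoduleI')
    fix a x assume "a \<in> carrier L" "x \<in> ?N"
    then show "a \<cdot> x \<in> ?N" by (auto simp: act_mult[symmetric])
  qed (auto simp: M.smult_r_distr neg mz)
  moreover have "?N \<noteq> carrier M" using simple by (auto simp: simple_left_module_def)
  ultimately have "?N = {\<zero>\<^bsub>M\<^esub>}" using submodule_cases by blast
  then obtain a where a: "a \<in> carrier L" "a \<cdot> m \<noteq> \<zero>\<^bsub>M\<^esub>" using assms by blast
  let ?X = "(\<lambda>a. a \<cdot> m) ` carrier L"
  have "submodule ?X L M"
  proof (rule M.submoduleI')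
    show "\<zero>\<^bsub>M\<^esub> \<in> ?X" using assms by (intro image_eqI[of _ _ "\<zero>\<^bsub>L\<^esub>"]) auto
  next
    fix x y assume "x \<in> ?X" "y \<in> ?X"
    then obtain a b where "a \<in> carrier L" "b \<in> carrier L" "x = a \<cdot> m" "y = b \<cdot> m" by auto
    then show "x \<oplus>\<^bsub>M\<^esub> y \<in> ?X" using assms by (intro image_eqI[of _ _ "a \<oplus>\<^bsub>L\<^esub> b"]) (auto simp: act_add_l)
  next
    fix x assume "x \<in> ?X"
    then obtain a where "a \<in> carrier L" "x = a \<cdot> m" by auto
    then show "\<ominus>\<^bsub>M\<^esub> x \<in> ?X" using assms by (intro image_eqI[of _ _ "\<ominus>\<^bsub>L\<^esub> a"]) (auto simp: act_minus_l)
  next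
    fix b x assume "b \<in> carrier L" "x \<in> ?X"
    then obtain a where "a \<in> carrier L" "x = a \<cdot> m" by auto
    then show "b \<cdot> x \<in> ?X" using assms \<open>b \<in> carrier L\<close>
      by (intro image_eqI[of _ _ "b \<bullet> a"]) (auto simp: act_mult)
  qed (use assms in auto)
  moreover have "?X \<noteq> {\<zero>\<^bsub>M\<^esub>}" using a by blast
  ultimately have "?X = carrier M" using submodule_cases by blast
  with assms(3) have "y \<in> ?X" by simp
  then show ?thesis by (auto simp only: image_iff)
qed

lemma ex_vertex: "m \<in> carrier M \<Longrightarrow> m \<noteq> \<zero>\<^bsub>M\<^esub> \<Longrightarrow> \<exists>v\<in>verts E. ver v \<cdot> m \<noteq> \<zero>\<^bsub>M\<^esub>"
  using generates[of m m] vertex_detects[of m] by metis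

lemma ex_nonzero: "\<exists>m\<in>carrier M. m \<noteq> \<zero>\<^bsub>M\<^esub>"
  using simple by (auto simp: simple_left_module_def dest: act_closed)

lemma Y_nonempty: "Y \<noteq> {}"
  using ex_nonzero ex_vertex by (metis Y_I empty_iff)

lemma Y_saturated:
  assumes "v \<in> Y" "regular E v"
  shows "\<exists>e\<in>out_arcs E v. head E e \<in> Y"
proof -
  obtain m where "m \<in> carrier M" "ver v \<cdot> m \<noteq> \<zero>\<^bsub>M\<^esub>" using assms(1) by (auto simp: Y_def)
  then obtain e where "e \<in> out_arcs E v" "\<gamma> (Ghost e) \<cdot> m \<noteq> \<zero>\<^bsub>M\<^esub>" "m \<in> carrier M"
    using regular_detects[OF assms(2)] by blast
  then show ?thesis using ghost_not_Y[of e m] by (intro bexI[of _ e]) auto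
qed

text \<open>\<open>SP R\<close> is a left ideal, so it acts transitively on every vector that it does not kill.\<close>

lemma span_generates:
  assumes R: "\<And>e. e \<in> arcs E \<Longrightarrow> tail E e \<in> R \<Longrightarrow> head E e \<in> R"
    and "m \<in> carrier M" "a \<in> SP R" "a \<cdot> m \<noteq> \<zero>\<^bsub>M\<^esub>" "y \<in> carrier M"
  shows "\<exists>b\<in>SP R. b \<cdot> m = y"
proof -
  obtain c where c: "c \<in> carrier L" "c \<cdot> (a \<cdot> m) = y"
    using generates[of "a \<cdot> m" y] assms SP_closed[of a R] by auto
  then show ?thesis
    using SP_left[OF R c(1) assms(3)] SP_closed[OF assms(3)] assms(2)
    by (intro bexI[of _ "c \<bullet> a"]) (auto simp: act_mult)
qed

lemma SP_restrict_Y: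
  assumes "a \<in> SP R"
  shows "\<exists>b\<in>SP (R \<inter> Y). \<forall>m\<in>carrier M. b \<cdot> m = a \<cdot> m"
  using assms
proof (induction a rule: SP_induct)
  case zero
  show ?case using SP_zero by blast
next
  case (add a k t)
  then obtain b where b: "b \<in> SP (R \<inter> Y)" "\<forall>m\<in>carrier M. b \<cdot> m = a \<cdot> m" by blast
  note c = SP_closed[OF b(1)] SP_closed[OF add(1)] mon_closed[OF add(3)]
  show ?case
  proof (cases "t \<in> PP (R \<inter> Y)")
    case True
    have "b \<oplus>\<^bsub>L\<^esub> k \<odot>\<^bsub>L\<^esub> mon t \<in> SP (R \<inter> Y)" using SP_add b(1) SP_mon[OF True add(2)] by blast
    moreover have "\<forall>m\<in>carrier M. (b \<oplus>\<^bsub>L\<^esub> k \<odot>\<^bsub>L\<^esub> mon t) \<cdot> m = (a \<oplus>\<^bsub>L\<^esub> k \<odot>\<^bsub>L\<^esub> mon t) \<cdot> m"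
      using b(2) c add(2) by (auto simp: act_add_l)
    ultimately show ?thesis by blast
  next
    case False
    obtain u p u' q w where t: "t = (u, p, u', q)" "walk u p w" "walk u' q w" "w \<in> R"
      using add(3) by (auto simp: PP_def)
    then have "w \<notin> Y" using False by (auto simp: PP_def)
    then have "(k \<odot>\<^bsub>L\<^esub> mon t) \<cdot> m = \<zero>\<^bsub>M\<^esub>" if "m \<in> carrier M" for m
      using that t add(2) nu_Y_zero[OF t(3) that] by (simp add: mon_def act_smult_mult)
    then have "\<forall>m\<in>carrier M. b \<cdot> m = (a \<oplus>\<^bsub>L\<^esub> k \<odot>\<^bsub>L\<^esub> mon t) \<cdot> m"
      using b(2) c add(2) by (auto simp: act_add_l)
    with b(1) show ?thesis by blast
  qed
qed

lemma reach_closed: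
  "e \<in> arcs E \<Longrightarrow> tail E e \<in> {w. \<exists>s. walk u s w} \<Longrightarrow> head E e \<in> {w. \<exists>s. walk u s w}"
proof clarsimp
  fix s assume "e \<in> arcs E" "walk u s (tail E e)"
  then have "walk u (s @ [e]) (head E e)" by (auto simp: walk_append ends_in_verts)
  then show "\<exists>s. walk u s (head E e)" by blast
qed

text \<open>All of \<open>M\<close> consists of multiples of \<open>m\<close>. If every monomial
  starting in \<open>u\<close> killed \<open>m\<close>, the vertex \<open>u\<close> would kill all
  these multiples.\<close>

lemma monomial_detects:
  assumes "u \<in> Y" "m \<in> carrier M" "m \<noteq> \<zero>\<^bsub>M\<^esub>"
  shows "\<exists>p u' q w. walk u p w \<and> walk u' q w \<and> mu u p \<cdot> (nu u' q \<cdot> m) \<noteq> \<zero>\<^bsub>M\<^esub>"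
proof (rule ccontr)
  assume none: "\<not> ?thesis"
  have u: "u \<in> verts E" using assms(1) by (rule Y_verts)
  have "ver u \<cdot> (a \<cdot> m) = \<zero>\<^bsub>M\<^esub>" if "a \<in> carrier L" for a
    using that
  proof (induction a rule: mon_induct)
    case (add a b)
    then show ?case using assms(2) u by (simp add: act_add_l M.smult_r_distr)
  next
    case (mon k v p u' q w)
    note v = walk_verts(1)[OF mon(2)]
    have c: "mu v p \<in> carrier L" "nu u' q \<in> carrier L" "nu u' q \<cdot> m \<in> carrier M" "mu v p \<bullet> nu u' q \<in> carrier L"
      using mon assms(2) by auto
    have "ver u \<cdot> ((k \<odot>\<^bsub>L\<^esub> (mu v p \<bullet> nu u' q)) \<cdot> m) = (k \<odot>\<^bsub>L\<^esub> (ver u \<bullet> (mu v p \<bullet> nu u' q))) \<cdot> m"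
      using mon u c assms(2) by (simp add: act_mult[symmetric] L.mult_smult)
    also have "\<dots> = (k \<odot>\<^bsub>L\<^esub> ver u) \<cdot> (mu v p \<cdot> (nu u' q \<cdot> m))"
      using mon u c assms(2) by (simp add: act_smult_mult act_mult)
    also have "\<dots> = \<zero>\<^bsub>M\<^esub>"
    proof (cases "v = u")
      case True
      then show ?thesis using none mon u by auto
    next
      case False
      have "k \<odot>\<^bsub>L\<^esub> ver u = (k \<odot>\<^bsub>L\<^esub> ver u) \<bullet> ver u" using u mon by (simp add: L.smult_mult vertex_mult)
      then have "(k \<odot>\<^bsub>L\<^esub> ver u) \<cdot> (mu v p \<cdot> (nu u' q \<cdot> m)) =
          (k \<odot>\<^bsub>L\<^esub> ver u) \<cdot> (ver u \<cdot> (ver v \<cdot> (mu v p \<cdot> (nu u' q \<cdot> m))))"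
        using u mon c ver_mu[OF mon(2) c(3)] by (metis L.smult_closed act_closed act_mult ver_closed)
      then show ?thesis using False u v mon c by (simp add: ver_ver)
    qed
    finally show ?case .
  qed (use u assms(2) in simp)
  moreover obtain y where "y \<in> carrier M" "ver u \<cdot> y \<noteq> \<zero>\<^bsub>M\<^esub>" using assms(1) by (auto simp: Y_def)
  ultimately show False using generates[OF assms(2,3), of y] by metis
qed

text \<open>Apply \<open>monomial_detects\<close> to a vector in the range of \<open>v\<close>: the
  second path of a surviving monomial must start in \<open>v\<close>, and the two paths meet in
  \<open>Y\<close>. In the graph this expresses that the annihilator is a prime ideal.\<close>

lemma Y_directed:
  assumes "u \<in> Y" "v \<in> Y"
  shows "\<exists>w\<in>Y. \<exists>p q. walk u p w \<and> walk v q w"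
proof -
  obtain m where m: "m \<in> carrier M" "ver v \<cdot> m \<noteq> \<zero>\<^bsub>M\<^esub>" using assms(2) by (auto simp: Y_def)
  have v: "v \<in> verts E" using assms(2) by (rule Y_verts)
  have c: "ver v \<cdot> m \<in> carrier M" using m v by simp
  obtain p u' q w where w: "walk u p w" "walk u' q w" "mu u p \<cdot> (nu u' q \<cdot> (ver v \<cdot> m)) \<noteq> \<zero>\<^bsub>M\<^esub>"
    using monomial_detects[OF assms(1) c m(2)] by blast
  then have nz: "nu u' q \<cdot> (ver v \<cdot> m) \<noteq> \<zero>\<^bsub>M\<^esub>" using mu_closed[OF w(1)] by auto
  then have "v = u'" using nu_ver[OF w(2) v m(1)] by metis
  then show ?thesis using w nu_Y[OF w(2) c nz] by blast
qed

section \<open>Countable separation\<close>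

lemma comb_comb_zero:
  assumes "T \<subseteq> PP R" "T' \<subseteq> PP R'" "x \<in> carrier (free_space K T)" "x' \<in> carrier (free_space K T')"
    and z: "\<And>a p b q a' p' b' q'. (a, p, b, q) \<in> T \<Longrightarrow> (a', p', b', q') \<in> T' \<Longrightarrow> nu b q \<bullet> mu a' p' = \<zero>\<^bsub>L\<^esub>"
  shows "comb x \<bullet> comb x' = \<zero>\<^bsub>L\<^esub>"
proof -
  have c': "comb x' \<in> carrier L" using comb_closed[OF assms(2,4)] .
  have mm: "mon t \<bullet> mon t' = \<zero>\<^bsub>L\<^esub>" if tt: "t \<in> T" "t' \<in> T'" for t t'
  proof -
    obtain a p b q w where t: "t = (a, p, b, q)" "walk a p w" "walk b q w"
      using subsetD[OF assms(1) tt(1)] by (auto simp: PP_def)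
    obtain a' p' b' q' w' where t': "t' = (a', p', b', q')" "walk a' p' w'" "walk b' q' w'"
      using subsetD[OF assms(2) tt(2)] by (auto simp: PP_def)
    have "mon t \<bullet> mon t' = mu a p \<bullet> ((nu b q \<bullet> mu a' p') \<bullet> nu b' q')"
      using mu_closed[OF t(2)] nu_closed[OF t(3)] mu_closed[OF t'(2)] nu_closed[OF t'(3)]
      by (simp add: t(1) t'(1) mon_def L.mult_assoc)
    also have "\<dots> = \<zero>\<^bsub>L\<^esub>"
      using z[of a p b q a' p' b' q'] tt t t' mu_closed[OF t(2)] nu_closed[OF t'(3)] by simp
    finally show ?thesis .
  qed
  have mc: "mon t \<bullet> comb x' = \<zero>\<^bsub>L\<^esub>" if "t \<in> T" for t
    using assms(2,4)
  proof (induction x' rule: comb_induct)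
    case (add a k t')
    then have "mon t \<in> carrier L" "mon t' \<in> carrier L"
      using mon_closed[OF subsetD[OF assms(1) that]] mon_closed[OF subsetD[OF assms(2) add(3)]] by auto
    then show ?case using add that by (simp add: L.mult_r_distr L.mult_smult mm L.smult_r_null)
  qed (use mon_closed[OF subsetD[OF assms(1) that]] in simp)
  show ?thesis using assms(1,3)
  proof (induction x rule: comb_induct)
    case (add a k t)
    then have "mon t \<in> carrier L" using mon_closed[OF subsetD[OF assms(1) add(3)]] by simp
    then show ?case using add c' by (simp add: L.mult_l_distr L.smult_mult mc L.smult_r_null)
  qed (use c' in simp)
qed

text \<open>Some monomial starting in \<open>u\<close> does not kill \<open>m\<close>, and its paths
  meet below \<open>u\<close>. The monomials meeting below \<open>u\<close> span a left ideal, which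
  therefore contains an element fixing \<open>m\<close>; terms that meet outside \<open>Y\<close>
  are then dropped.\<close>

lemma reaching_combination:
  assumes "u \<in> Y" "m \<in> carrier M" "m \<noteq> \<zero>\<^bsub>M\<^esub>"
  shows "\<exists>T x. finite T \<and> T \<subseteq> PP ({w. \<exists>s. walk u s w} \<inter> Y) \<and> x \<in> carrier (free_space K T) \<and> comb x \<cdot> m = m"
proof -
  let ?R = "{w. \<exists>s. walk u s w}"
  obtain p u' q w where w: "walk u p w" "walk u' q w" "mu u p \<cdot> (nu u' q \<cdot> m) \<noteq> \<zero>\<^bsub>M\<^esub>"
    using monomial_detects[OF assms] by blast
  have t: "(u, p, u', q) \<in> PP ?R" using w by (auto simp: PP_def)
  have "\<one>\<^bsub>K\<^esub> \<odot>\<^bsub>L\<^esub> mon (u, p, u', q) = mon (u, p, u', q)" using mon_closed[OF t] by simp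
  then have s: "mon (u, p, u', q) \<in> SP ?R" using SP_mon[OF t, of "\<one>\<^bsub>K\<^esub>"] by simp
  have "mon (u, p, u', q) \<cdot> m \<noteq> \<zero>\<^bsub>M\<^esub>" using w assms by (simp add: mon_def act_mult)
  then obtain b where "b \<in> SP ?R" "b \<cdot> m = m"
    using span_generates[OF reach_closed assms(2) s _ assms(2)] by blast
  then obtain c where c: "c \<in> SP (?R \<inter> Y)" "c \<cdot> m = m"
    using SP_restrict_Y[of b ?R] assms(2) by auto
  from c(1) obtain T x where "finite T" "T \<subseteq> PP (?R \<inter> Y)" "x \<in> carrier (free_space K T)" "c = comb x"
    by (rule SP_finite)
  with c(2) show ?thesis by blast
qed

definition path_verts :: "'v \<Rightarrow> 'e list \<Rightarrow> 'v set" where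
  "path_verts b q = {x. \<exists>j\<le>length q. walk b (take j q) x}"

lemma path_verts_finite: "finite (path_verts b q)"
proof -
  have "path_verts b q \<subseteq> (\<lambda>j. THE x. walk b (take j q) x) ` {..length q}"
  proof
    fix x assume "x \<in> path_verts b q"
    then obtain j where "j \<le> length q" "walk b (take j q) x" by (auto simp: path_verts_def)
    moreover from this have "(THE x. walk b (take j q) x) = x" using walk_unique by blast
    ultimately show "x \<in> (\<lambda>j. THE x. walk b (take j q) x) ` {..length q}" by force
  qed
  then show ?thesis by (rule finite_subset) simp
qed

lemma path_verts_Y:
  assumes "walk b q w" "w \<in> Y"
  shows "path_verts b q \<subseteq> Y"
proof
  fix x assume "x \<in> path_verts b q"
  then obtain j where j: "walk b (take j q) x" by (auto simp: path_verts_def)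
  have "walk b (take j q @ drop j q) w" using assms(1) by simp
  then obtain y where "walk b (take j q) y" "walk y (drop j q) w" unfolding walk_append by blast
  then show "x \<in> Y" using Y_up[of x "drop j q" w] assms(2) walk_unique[OF j] by blast
qed

text \<open>
  The vertices \<open>u\<close> are chosen greedily so that no later one reaches a path occurring for an
  earlier one. The paths \<open>q\<close> of the earlier ones are then prefixes of paths \<open>p'\<close> of the last one,
  and there are only boundedly many such prefixes.
\<close>

lemma finitely_many_suffice:
  fixes T :: "'v \<Rightarrow> ('v \<times> 'e list \<times> 'v \<times> 'e list) set"
  assumes T: "\<And>u. u \<in> U \<Longrightarrow> finite (T u)" "\<And>u. u \<in> U \<Longrightarrow> T u \<subseteq> PP ({w. \<exists>s. walk u s w} \<inter> Y)"
      "\<And>u. u \<in> U \<Longrightarrow> card (T u) \<le> n" "\<And>u a p b q. u \<in> U \<Longrightarrow> (a, p, b, q) \<in> T u \<Longrightarrow> length q \<le> n"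
    and comp: "\<And>u v. u \<in> U \<Longrightarrow> v \<in> U \<Longrightarrow> \<exists>a p b q p' b' q'. (a, p, b, q) \<in> T u \<and> (b, p', b', q') \<in> T v \<and>
       ((\<exists>r. p' = q @ r) \<or> (\<exists>r. q = p' @ r))"
  shows "\<exists>C. finite C \<and> C \<subseteq> Y \<and> (\<forall>u\<in>U. \<exists>c\<in>C. \<exists>s. walk u s c)"
proof (rule ccontr)
  assume none: "\<not> ?thesis"
  \<comment> \<open>All vertices along the second paths are collected, not only their ends: if the
    first path \<open>p'\<close> of the other vertex is the shorter one, it ends in the middle of
    \<open>q\<close>.\<close>
  define W where "W u = (\<Union>(a, p, b, q)\<in>T u. path_verts b q)" for u
  have Wfin: "finite (W u)" if "u \<in> U" for u
    unfolding W_def using T(1)[OF that] path_verts_finite by auto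
  have WY: "W u \<subseteq> Y" if u: "u \<in> U" for u
  proof
    fix x assume "x \<in> W u"
    then obtain a p b q where "(a, p, b, q) \<in> T u" "x \<in> path_verts b q" by (auto simp: W_def)
    moreover from this(1) obtain w where "walk b q w" "w \<in> Y" using T(2)[OF u] by (auto simp: PP_def)
    ultimately show "x \<in> Y" using path_verts_Y by blast
  qed
  have seq: "\<exists>us. length us = N \<and> set us \<subseteq> U \<and> (\<forall>i k. i < k \<longrightarrow> k < N \<longrightarrow> (\<forall>c\<in>W (us ! i). \<forall>s. \<not> walk (us ! k) s c))" for N
  proof (induction N)
    case (Suc N)
    then obtain us where us: "length us = N" "set us \<subseteq> U"
      "\<And>i k. i < k \<Longrightarrow> k < N \<Longrightarrow> (\<forall>c\<in>W (us ! i). \<forall>s. \<not> walk (us ! k) s c)" by blast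
    let ?C = "\<Union>u\<in>set us. W u"
    have "finite ?C" "?C \<subseteq> Y" using Wfin WY us(2) by auto
    then obtain u where u: "u \<in> U" "\<forall>c\<in>?C. \<forall>s. \<not> walk u s c" using none by meson
    have "\<forall>c\<in>W ((us @ [u]) ! i). \<forall>s. \<not> walk ((us @ [u]) ! k) s c" if "i < k" "k < Suc N" for i k
    proof (cases "k = N")
      case True
      then have "us ! i \<in> set us" using that us(1) by simp
      then have "\<forall>c\<in>W (us ! i). \<forall>s. \<not> walk u s c" using u(2) by blast
      then show ?thesis using True that us(1) by (simp add: nth_append)
    next
      case False
      then show ?thesis using that us(1) us(3)[of i k] by (auto simp: nth_append)
    qed
    then show ?case using us u by (intro exI[of _ "us @ [u]"]) auto
  qed simp
  \<comment> \<open>One more than the number of pairs of a quadruple for the last vertex, at most n,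
    and a prefix length between 0 and n.\<close>
  define N where "N = Suc (n * Suc n)"
  obtain us where us: "length us = Suc N" "set us \<subseteq> U"
      "\<And>i k. i < k \<Longrightarrow> k < Suc N \<Longrightarrow> (\<forall>c\<in>W (us ! i). \<forall>s. \<not> walk (us ! k) s c)" using seq[of "Suc N"] by blast
  let ?v = "us ! N"
  have v: "?v \<in> U" using us(1,2) by auto
  \<comment> \<open>A pair in \<open>G i\<close> names a prefix of a first path of the last vertex
    that ends in \<open>W (us ! i)\<close> and below \<open>us ! i\<close>. If one pair served i and
    a later k, then \<open>us ! k\<close> would reach \<open>W (us ! i)\<close>, against the greedy
    choice.\<close>
  define G where "G i = (\<lambda>(t, l). t \<in> T ?v \<and> l \<le> n \<and>
      (\<exists>w s. walk (fst t) (take l (fst (snd t))) w \<and> walk (us ! i) s w \<and> w \<in> W (us ! i)))" for i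
  have "\<exists>x. G i x" if i: "i < N" for i
  proof -
    have ui: "us ! i \<in> U" using us(1,2) i by auto
    obtain a p b q p' b' q' where t: "(a, p, b, q) \<in> T (us ! i)" "(b, p', b', q') \<in> T ?v"
      "(\<exists>r. p' = q @ r) \<or> (\<exists>r. q = p' @ r)" using comp[OF ui v] by blast
    obtain w s where w: "walk b q w" "walk (us ! i) s w" using T(2)[OF ui] t(1) by (auto simp: PP_def)
    obtain w' s' where w': "walk b p' w'" "walk ?v s' w'" using T(2)[OF v] t(2) by (auto simp: PP_def)
    \<comment> \<open>If \<open>p'\<close> were the shorter path, its end would lie on
      \<open>q\<close>, and the last vertex reaches that end.\<close>
    have "\<not> (\<exists>r. q = p' @ r)"
    proof
      assume "\<exists>r. q = p' @ r"
      then obtain r where r: "q = p' @ r" ..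
      have "w' \<in> path_verts b q" unfolding path_verts_def using w'(1) r by (intro CollectI exI[of _ "length p'"]) auto
      then have "w' \<in> W (us ! i)" using t(1) by (auto simp: W_def)
      then show False using us(3)[of i N] i w'(2) by auto
    qed
    then obtain r where r: "p' = q @ r" using t(3) by blast
    have "w \<in> path_verts b q" unfolding path_verts_def using w(1) by (intro CollectI exI[of _ "length q"]) auto
    then have "w \<in> W (us ! i)" using t(1) by (auto simp: W_def)
    then have "G i ((b, p', b', q'), length q)"
      using t(2) T(4)[OF ui t(1)] w r by (auto simp: G_def)
    then show ?thesis by blast
  qed
  then obtain h where h: "\<And>i. i < N \<Longrightarrow> G i (h i)" by metis
  have neq: "h i \<noteq> h k" if ik: "i < k" "k < N" for i k
  proof
    assume eq: "h i = h k"
    obtain t l where tl: "h i = (t, l)" by (cases "h i")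
    obtain w s where w: "walk (fst t) (take l (fst (snd t))) w" "w \<in> W (us ! i)"
      using h[of i] ik tl by (auto simp: G_def)
    obtain w' s' where w': "walk (fst t) (take l (fst (snd t))) w'" "walk (us ! k) s' w'"
      using h[of k] ik tl eq by (auto simp: G_def)
    have "w = w'" using walk_unique[OF w(1) w'(1)] .
    then show False using us(3)[of i k] ik w w' by auto
  qed
  have "inj_on h {..<N}" by (rule inj_onI) (metis neq lessThan_iff nat_neq_iff)
  moreover have "h ` {..<N} \<subseteq> T ?v \<times> {..n}" using h by (fastforce simp: G_def)
  moreover have "finite (T ?v \<times> {..n})" using T(1)[OF v] by simp
  ultimately have "N \<le> card (T ?v \<times> {..n})" by (metis card_inj_on_le card_lessThan)
  also have "\<dots> = card (T ?v) * Suc n" by (simp add: card_cartesian_product)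
  also have "\<dots> \<le> n * Suc n" by (rule mult_le_mono1[OF T(3)[OF v]])
  finally show False by (simp add: N_def)
qed

text \<open>The chosen combinations all fix the same \<open>m\<close>, so the product of any two is
  nonzero, and by \<open>comb_comb_zero\<close> some second path of one is comparable with some
  first path of the other. \<open>U n\<close> collects the vertices whose combination has at most n
  terms and second paths of length at most n. Each of these countably many classes is dealt with by
  finitely many vertices.\<close>

lemma countable_separation: "\<exists>C. countable C \<and> C \<subseteq> Y \<and> (\<forall>u\<in>Y. \<exists>c\<in>C. \<exists>s. walk u s c)"
proof -
  obtain m where m: "m \<in> carrier M" "m \<noteq> \<zero>\<^bsub>M\<^esub>" using ex_nonzero by blast
  have "\<forall>u\<in>Y. \<exists>Tx. finite (fst Tx) \<and> fst Tx \<subseteq> PP ({w. \<exists>s. walk u s w} \<inter> Y) \<and>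
      snd Tx \<in> carrier (free_space K (fst Tx)) \<and> comb (snd Tx) \<cdot> m = m"
  proof
    fix u assume "u \<in> Y"
    from reaching_combination[OF this m] obtain T x where "finite T \<and> T \<subseteq> PP ({w. \<exists>s. walk u s w} \<inter> Y) \<and>
      x \<in> carrier (free_space K T) \<and> comb x \<cdot> m = m" by blast
    then show "\<exists>Tx. finite (fst Tx) \<and> fst Tx \<subseteq> PP ({w. \<exists>s. walk u s w} \<inter> Y) \<and>
      snd Tx \<in> carrier (free_space K (fst Tx)) \<and> comb (snd Tx) \<cdot> m = m" by (intro exI[of _ "(T, x)"]) simp
  qed
  from bchoice[OF this] obtain F where F: "\<And>u. u \<in> Y \<Longrightarrow> finite (fst (F u)) \<and> fst (F u) \<subseteq> PP ({w. \<exists>s. walk u s w} \<inter> Y) \<and>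
      snd (F u) \<in> carrier (free_space K (fst (F u))) \<and> comb (snd (F u)) \<cdot> m = m" by blast
  let ?T = "\<lambda>u. fst (F u)"
  have comp: "\<exists>a p b q p' b' q'. (a, p, b, q) \<in> ?T u \<and> (b, p', b', q') \<in> ?T v \<and>
       ((\<exists>r. p' = q @ r) \<or> (\<exists>r. q = p' @ r))" if "u \<in> Y" "v \<in> Y" for u v
  proof (rule ccontr)
    assume none: "\<not> ?thesis"
    have "comb (snd (F u)) \<bullet> comb (snd (F v)) = \<zero>\<^bsub>L\<^esub>"
    proof (rule comb_comb_zero)
      fix a p b q a' p' b' q' assume t: "(a, p, b, q) \<in> ?T u" "(a', p', b', q') \<in> ?T v"
      have "(a, p, b, q) \<in> PP ({w. \<exists>s. walk u s w} \<inter> Y)" "(a', p', b', q') \<in> PP ({w. \<exists>s. walk v s w} \<inter> Y)"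
        using t F[OF \<open>u \<in> Y\<close>] F[OF \<open>v \<in> Y\<close>] by blast+
      then obtain w w' where "walk b q w" "walk a' p' w'" by (auto simp: PP_def)
      from nu_mu_cases[OF this] show "nu b q \<bullet> mu a' p' = \<zero>\<^bsub>L\<^esub>" using none t by blast
    qed (use F that in auto)
    moreover have "(comb (snd (F u)) \<bullet> comb (snd (F v))) \<cdot> m = m"
      using F[OF that(1)] F[OF that(2)] m comb_closed[of "?T u" _ "snd (F u)"] comb_closed[of "?T v" _ "snd (F v)"]
      by (subst act_mult) auto
    ultimately show False using m by simp
  qed
  define U where "U n = {u \<in> Y. card (?T u) \<le> n \<and> (\<forall>(a, p, b, q)\<in>?T u. length q \<le> n)}" for n
  have "\<forall>n. \<exists>C. finite C \<and> C \<subseteq> Y \<and> (\<forall>u\<in>U n. \<exists>c\<in>C. \<exists>s. walk u s c)"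
  proof (rule allI, rule finitely_many_suffice[where T = ?T])
    fix n
    show "\<And>u v. u \<in> U n \<Longrightarrow> v \<in> U n \<Longrightarrow> \<exists>a p b q p' b' q'. (a, p, b, q) \<in> ?T u \<and> (b, p', b', q') \<in> ?T v \<and>
       ((\<exists>r. p' = q @ r) \<or> (\<exists>r. q = p' @ r))" using comp by (simp add: U_def)
  qed (use F in \<open>auto simp: U_def\<close>)
  from choice[OF this] obtain C where C: "\<And>n. finite (C n) \<and> C n \<subseteq> Y \<and> (\<forall>u\<in>U n. \<exists>c\<in>C n. \<exists>s. walk u s c)" by blast
  have "u \<in> U (card (?T u) + (\<Sum>t\<in>?T u. length (snd (snd (snd t)))))" if "u \<in> Y" for u
  proof -
    have "length q \<le> card (?T u) + (\<Sum>t\<in>?T u. length (snd (snd (snd t))))" if t: "(a, p, b, q) \<in> ?T u" for a p b q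
    proof -
      have "length (snd (snd (snd (a, p, b, q)))) \<le> (\<Sum>t\<in>?T u. length (snd (snd (snd t))))"
        by (rule member_le_sum) (use t F[OF \<open>u \<in> Y\<close>] in auto)
      then show ?thesis by simp
    qed
    then show ?thesis using that by (auto simp: U_def)
  qed
  then have "\<exists>c\<in>(\<Union>n. C n). \<exists>s. walk u s c" if "u \<in> Y" for u
    using that C by blast
  moreover have "countable (\<Union>n. C n)" using C by (intro countable_UN) (auto intro: countable_finite)
  moreover have "(\<Union>n. C n) \<subseteq> Y" using C by blast
  ultimately show ?thesis by blast
qed

end

text \<open>One inclusion between the annihilators of two vectors is enough. If a kills
  \<open>N\<close> but not \<open>M\<close>, simplicity gives d = c a b that fixes \<open>m\<close>.
  Then v - d kills \<open>m\<close>, hence \<open>n\<close>, so d fixes \<open>n\<close> although it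
  kills \<open>N\<close>. The vertex v does the work of a unit.\<close>

lemma annihilator_eqI:
  assumes "lpa_simple K E M" "lpa_simple K E N"
    and "m \<in> carrier M" "m \<noteq> \<zero>\<^bsub>M\<^esub>" "n \<in> carrier N" "n \<noteq> \<zero>\<^bsub>N\<^esub>"
    and "v \<in> verts E" "lpa_gen K E (Vertex v) \<odot>\<^bsub>M\<^esub> m = m" "lpa_gen K E (Vertex v) \<odot>\<^bsub>N\<^esub> n = n"
    and imp: "\<And>a. a \<in> carrier (lpa K E) \<Longrightarrow> a \<odot>\<^bsub>M\<^esub> m = \<zero>\<^bsub>M\<^esub> \<Longrightarrow> a \<odot>\<^bsub>N\<^esub> n = \<zero>\<^bsub>N\<^esub>"
  shows "annihilator (lpa K E) M = annihilator (lpa K E) N"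
proof -
  interpret M: lpa_simple K E M by fact
  interpret N: lpa_simple K E N by fact
  note cl = assms(3,5,7)
  show ?thesis
  proof (intro subset_antisym subsetI)
    fix a assume a: "a \<in> annihilator (lpa K E) M"
    then have aL: "a \<in> carrier (lpa K E)" by (simp add: annihilator_def)
    have "a \<odot>\<^bsub>N\<^esub> y = \<zero>\<^bsub>N\<^esub>" if y: "y \<in> carrier N" for y
    proof -
      obtain b where b: "b \<in> carrier (lpa K E)" "b \<odot>\<^bsub>N\<^esub> n = y" using N.generates[OF assms(5,6) y] by blast
      have "(a \<otimes>\<^bsub>lpa K E\<^esub> b) \<odot>\<^bsub>M\<^esub> m = \<zero>\<^bsub>M\<^esub>"
        using a b aL cl by (simp add: M.act_mult annihilator_def)
      then have "(a \<otimes>\<^bsub>lpa K E\<^esub> b) \<odot>\<^bsub>N\<^esub> n = \<zero>\<^bsub>N\<^esub>" using imp aL b by simp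
      then show ?thesis using aL b cl by (simp add: N.act_mult)
    qed
    then show "a \<in> annihilator (lpa K E) N" using aL by (simp add: annihilator_def)
  next
    fix a assume a: "a \<in> annihilator (lpa K E) N"
    then have aL: "a \<in> carrier (lpa K E)" by (simp add: annihilator_def)
    have "a \<odot>\<^bsub>M\<^esub> x = \<zero>\<^bsub>M\<^esub>" if x: "x \<in> carrier M" for x
    proof (rule ccontr)
      assume nz: "a \<odot>\<^bsub>M\<^esub> x \<noteq> \<zero>\<^bsub>M\<^esub>"
      obtain b where b: "b \<in> carrier (lpa K E)" "b \<odot>\<^bsub>M\<^esub> m = x" using M.generates[OF assms(3,4) x] by blast
      obtain c where c: "c \<in> carrier (lpa K E)" "c \<odot>\<^bsub>M\<^esub> (a \<odot>\<^bsub>M\<^esub> x) = m"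
        using M.generates[OF _ nz assms(3)] aL x by auto
      let ?d = "c \<otimes>\<^bsub>lpa K E\<^esub> (a \<otimes>\<^bsub>lpa K E\<^esub> b)" and ?v = "lpa_gen K E (Vertex v)"
      have d: "?d \<in> carrier (lpa K E)" "?v \<in> carrier (lpa K E)" using aL b c cl by auto
      have "?d \<odot>\<^bsub>M\<^esub> m = m" using aL b c cl by (simp add: M.act_mult)
      then have "(?v \<ominus>\<^bsub>lpa K E\<^esub> ?d) \<odot>\<^bsub>M\<^esub> m = \<zero>\<^bsub>M\<^esub>"
        using d cl assms(8) by (simp add: M.act_diff_l M.M.minus_eq_zero_iff)
      then have "(?v \<ominus>\<^bsub>lpa K E\<^esub> ?d) \<odot>\<^bsub>N\<^esub> n = \<zero>\<^bsub>N\<^esub>" using imp d by simp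
      then have "?d \<odot>\<^bsub>N\<^esub> n = n"
        using d cl assms(9) by (simp add: N.act_diff_l N.M.minus_eq_zero_iff)
      moreover have "a \<odot>\<^bsub>N\<^esub> (b \<odot>\<^bsub>N\<^esub> n) = \<zero>\<^bsub>N\<^esub>" using a b cl by (simp add: annihilator_def)
      ultimately show False using aL b c cl assms(6) by (simp add: N.act_mult)
    qed
    then show "a \<in> annihilator (lpa K E) M" using aL by (simp add: annihilator_def)
  qed
qed

section \<open>Monomial modules\<close>

locale monomial = leavitt_path K E + S: field S
  for K :: "('k, 'c) ring_scheme" and E :: "('v, 'e) pre_digraph" and S :: "('l, 's) ring_scheme" +
  fixes h :: "'k \<Rightarrow> 'l" and \<chi> :: "('v, 'e) gen \<Rightarrow> 'l" and B :: "'b set"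
    and t :: "('v, 'e) gen \<Rightarrow> 'b \<Rightarrow> 'b option" and N :: "(('v, 'e, 'k) lpa_elt, 'b \<Rightarrow> 'l) module"
  assumes mm: "monomial_module K E S h \<chi> B t N"
    and h_hom: "h \<in> ring_hom K S"
    and chi_closed: "g \<in> gens E \<Longrightarrow> \<chi> g \<in> carrier S"
    and chi_nonzero: "g \<in> gens E \<Longrightarrow> \<chi> g \<noteq> \<zero>\<^bsub>S\<^esub>"
    and chi_vertex: "\<chi> (Vertex v) = \<one>\<^bsub>S\<^esub>"
begin

sublocale lpa_module K E N
  using mm by (intro lpa_module.intro leavitt_path_axioms) (simp add: monomial_module_def)

abbreviation actN (infixr "\<cdot>" 75) where "a \<cdot> x \<equiv> a \<odot>\<^bsub>N\<^esub> x"

lemma N_simps: "carrier N = carrier (free_space S B)" "\<zero>\<^bsub>N\<^esub> = (\<lambda>b. \<zero>\<^bsub>S\<^esub>)" "add N = add (free_space S B)"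
  using mm by (auto simp: monomial_module_def)

lemma h_simps: "k \<in> carrier K \<Longrightarrow> h k \<in> carrier S" "h \<one>\<^bsub>K\<^esub> = \<one>\<^bsub>S\<^esub>"
  "k \<in> carrier K \<Longrightarrow> l \<in> carrier K \<Longrightarrow> h (k \<otimes>\<^bsub>K\<^esub> l) = h k \<otimes>\<^bsub>S\<^esub> h l"
  "k \<in> carrier K \<Longrightarrow> l \<in> carrier K \<Longrightarrow> h (k \<oplus>\<^bsub>K\<^esub> l) = h k \<oplus>\<^bsub>S\<^esub> h l"
  using h_hom by (auto simp: ring_hom_closed ring_hom_one ring_hom_mult ring_hom_add)

lemma single_in_N: "l \<in> carrier S \<Longrightarrow> b \<in> B \<Longrightarrow> single S l b \<in> carrier N"
  unfolding N_simps by (rule S.single_carrier)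

lemma single_eq_zero: "single S l b = \<zero>\<^bsub>N\<^esub> \<longleftrightarrow> l = \<zero>\<^bsub>S\<^esub>"
  by (auto simp: N_simps single_def fun_eq_iff)

lemma single_add_N: "l \<in> carrier S \<Longrightarrow> l' \<in> carrier S \<Longrightarrow> single S l b \<oplus>\<^bsub>N\<^esub> single S l' b = single S (l \<oplus>\<^bsub>S\<^esub> l') b"
  unfolding N_simps by (auto simp: single_def fun_eq_iff)

lemma N_hom_iff: "abelian_group_hom N N' f \<longleftrightarrow> abelian_group_hom (free_space S B) N' f"
proof -
  have "abelian_group N" by intro_locales
  moreover have "abelian_group (free_space S B)" by (rule module.axioms(2)[OF S.free_space_module])
  ultimately have "abelian_group N" "abelian_group (free_space S B)" by blast+
  then show ?thesis
    by (auto intro!: abelian_group_homI' simp: N_simps simp del: free_space_simps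
        dest: abelian_group_hom.hom_closed abelian_group_hom.hom_add intro: abelian_group_hom.axioms)
qed

lemma N_ext:
  assumes "abelian_group_hom N N' f" "abelian_group_hom N N' g"
    and "\<And>l b. \<lbrakk>l \<in> carrier S; b \<in> B\<rbrakk> \<Longrightarrow> f (single S l b) = g (single S l b)" "x \<in> carrier N"
  shows "f x = g x"
  using S.additive_ext[of B N' f g x] assms by (simp add: N_hom_iff N_simps)

lemma N_induct [consumes 1, case_names zero single]:
  assumes "x \<in> carrier N" "Q \<zero>\<^bsub>N\<^esub>"
    and "\<And>x l b. \<lbrakk>x \<in> carrier N; l \<in> carrier S; b \<in> B; Q x\<rbrakk> \<Longrightarrow> Q (x \<oplus>\<^bsub>N\<^esub> single S l b)"
  shows "Q x"
  using assms unfolding N_simps by (rule S.free_space_induct)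

lemma gen_single:
  assumes "k \<in> carrier K" "g \<in> gens E" "l \<in> carrier S" "b \<in> B"
  shows "(k \<odot>\<^bsub>L\<^esub> \<gamma> g) \<cdot> single S l b =
    (case t g b of None \<Rightarrow> \<zero>\<^bsub>N\<^esub> | Some b' \<Rightarrow> single S (h k \<otimes>\<^bsub>S\<^esub> \<chi> g \<otimes>\<^bsub>S\<^esub> l) b')"
  using mm assms unfolding monomial_module_def N_simps by blast

lemma gen_single1:
  assumes "g \<in> gens E" "l \<in> carrier S" "b \<in> B"
  shows "\<gamma> g \<cdot> single S l b = (case t g b of None \<Rightarrow> \<zero>\<^bsub>N\<^esub> | Some b' \<Rightarrow> single S (\<chi> g \<otimes>\<^bsub>S\<^esub> l) b')"
  using gen_single[of "\<one>\<^bsub>K\<^esub>" g l b] assms chi_closed[of g] by (cases "t g b") (simp_all add: h_simps)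

text \<open>The module has no scalar multiplication of its own; scalars act through multiples of
  vertices.\<close>

lemma smult_ver_single:
  assumes "k \<in> carrier K" "v \<in> verts E" "l \<in> carrier S" "b \<in> B" "t (Vertex v) b = Some b"
  shows "(k \<odot>\<^bsub>L\<^esub> ver v) \<cdot> single S l b = single S (h k \<otimes>\<^bsub>S\<^esub> l) b"
  using gen_single[of k "Vertex v" l b] assms by (simp add: chi_vertex h_simps)

text \<open>A nonzero submodule contains a multiple of some basis element by \<open>iso\<close>,
  then all multiples of all basis elements by \<open>trans\<close>.\<close>

lemma simple_criterion:
  assumes "B \<noteq> {}"
    and iso: "\<And>x. \<lbrakk>x \<in> carrier N; x \<noteq> \<zero>\<^bsub>N\<^esub>\<rbrakk> \<Longrightarrow> \<exists>a\<in>carrier L. \<exists>b\<in>B. \<exists>l\<in>carrier S. l \<noteq> \<zero>\<^bsub>S\<^esub> \<and> a \<cdot> x = single S l b"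
    and trans: "\<And>b b' l l'. \<lbrakk>b \<in> B; b' \<in> B; l \<in> carrier S; l \<noteq> \<zero>\<^bsub>S\<^esub>; l' \<in> carrier S\<rbrakk> \<Longrightarrow>
      \<exists>a\<in>carrier L. a \<cdot> single S l b = single S l' b'"
  shows "simple_left_module L N"
  unfolding simple_left_module_def
proof (intro conjI allI impI)
  show "left_module L N" by (rule M.left_module_axioms)
  obtain b where b: "b \<in> B" using assms(1) by (meson ex_in_conv)
  then obtain a where "a \<in> carrier L" "a \<cdot> single S \<one>\<^bsub>S\<^esub> b = single S \<one>\<^bsub>S\<^esub> b"
    using trans[of b b "\<one>\<^bsub>S\<^esub>" "\<one>\<^bsub>S\<^esub>"] by auto
  then show "\<exists>a\<in>carrier L. \<exists>x\<in>carrier N. a \<cdot> x \<noteq> \<zero>\<^bsub>N\<^esub>"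
    using single_in_N[of "\<one>\<^bsub>S\<^esub>" b] single_eq_zero[of "\<one>\<^bsub>S\<^esub>" b] b by force
  fix X assume X: "submodule X L N"
  interpret X: submodule X L N by fact
  show "X = {\<zero>\<^bsub>N\<^esub>} \<or> X = carrier N"
  proof (rule disjCI)
    assume ne: "X \<noteq> carrier N"
    have zX: "\<zero>\<^bsub>N\<^esub> \<in> X" using X.one_closed by simp
    have sub: "X \<subseteq> carrier N" using X.subset by simp
    have "x = \<zero>\<^bsub>N\<^esub>" if x: "x \<in> X" for x
    proof (rule ccontr)
      assume nz: "x \<noteq> \<zero>\<^bsub>N\<^esub>"
      obtain a b l where ab: "a \<in> carrier L" "b \<in> B" "l \<in> carrier S" "l \<noteq> \<zero>\<^bsub>S\<^esub>" "a \<cdot> x = single S l b"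
        using iso[OF _ nz] x sub by blast
      have s: "single S l' b' \<in> X" if l': "l' \<in> carrier S" "b' \<in> B" for l' b'
      proof -
        obtain a' where "a' \<in> carrier L" "a' \<cdot> single S l b = single S l' b'"
          using trans[OF ab(2) l'(2) ab(3,4) l'(1)] by blast
        then show ?thesis using X.smult_closed[OF _ X.smult_closed[OF ab(1) x]] ab(5) by metis
      qed
      have "y \<in> X" if "y \<in> carrier N" for y
        using that
      proof (induction y rule: N_induct)
        case (single y l b)
        then show ?case using s[of l b] X.m_closed[of y "single S l b"] by simp
      qed (rule zX)
      then have "carrier N \<subseteq> X" by (rule subsetI)
      with ne sub show False by (simp add: subset_antisym)
    qed
    then have "X \<subseteq> {\<zero>\<^bsub>N\<^esub>}" by (intro subsetI) simp
    with zX show "X = {\<zero>\<^bsub>N\<^esub>}" by (intro subset_antisym) simp_all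
  qed
qed

end

text \<open>
  A common frame for the sinks of \<open>E\<close> and those of its quotient graphs, whose basis paths \<open>\<beta> u p\<close>
  lie over the paths \<open>p\<close> of \<open>E\<close> that end in \<open>w\<close>.
\<close>

locale path_module = monomial K E K id "\<lambda>_. \<one>\<^bsub>K\<^esub>" B t N
  for K :: "('k, 'c) ring_scheme" and E :: "('v, 'e) pre_digraph" and B :: "'b set"
    and t :: "('v, 'e) gen \<Rightarrow> 'b \<Rightarrow> 'b option" and N +
  fixes w :: 'v and \<beta> :: "'v \<Rightarrow> 'e list \<Rightarrow> 'b"
  assumes w: "w \<in> verts E"
    and beta_B: "E.awalk u p w \<Longrightarrow> \<beta> u p \<in> B"
    and beta_surj: "b \<in> B \<Longrightarrow> \<exists>u p. E.awalk u p w \<and> b = \<beta> u p"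
    and beta_inj: "\<lbrakk>E.awalk u p w; E.awalk u' p' w; \<beta> u p = \<beta> u' p'\<rbrakk> \<Longrightarrow> u = u' \<and> p = p'"
    and t_ver: "t (Vertex w) (\<beta> w []) = Some (\<beta> w [])"
    and t_edge: "\<lbrakk>e \<in> arcs E; E.awalk (head E e) p w\<rbrakk> \<Longrightarrow> t (Edge e) (\<beta> (head E e) p) = Some (\<beta> (tail E e) (e # p))"
    and t_ghost: "e \<in> arcs E \<Longrightarrow> t (Ghost e) (\<beta> w []) = None"
begin

definition "base = single K \<one>\<^bsub>K\<^esub> (\<beta> w [])"

lemma base_in_N: "base \<in> carrier N"
  unfolding base_def using w by (intro single_in_N beta_B) auto

lemma base_nonzero: "base \<noteq> \<zero>\<^bsub>N\<^esub>"
  by (simp add: base_def single_eq_zero)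

lemma ver_base: "ver w \<cdot> base = base"
  using gen_single1[of "Vertex w" "\<one>\<^bsub>K\<^esub>" "\<beta> w []"] w t_ver beta_B[of w "[]"] by (simp add: base_def)

lemma smult_mu_base:
  assumes "k \<in> carrier K" "walk u p w"
  shows "(k \<odot>\<^bsub>L\<^esub> mu u p) \<cdot> base = single K k (\<beta> u p)"
proof -
  have "k \<odot>\<^bsub>L\<^esub> mu u p = mu u p \<bullet> (k \<odot>\<^bsub>L\<^esub> ver w)"
    using assms w by (simp add: L.mult_smult mu_vertex)
  then have "(k \<odot>\<^bsub>L\<^esub> mu u p) \<cdot> base = mu u p \<cdot> single K k (\<beta> w [])"
    using assms w base_in_N smult_ver_single[of k w "\<one>\<^bsub>K\<^esub>" "\<beta> w []"] beta_B[of w "[]"] t_ver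
    by (simp add: act_mult base_def)
  also have "\<dots> = single K k (\<beta> u p)"
    using assms(2)
  proof (induction p arbitrary: u)
    case Nil
    then show ?case using gen_single1[of "Vertex w" k "\<beta> w []"] assms(1) w beta_B[of w "[]"] t_ver by simp
  next
    case (Cons e p)
    have "single K k (\<beta> w []) \<in> carrier N" using assms(1) w beta_B[of w "[]"] by (intro single_in_N) auto
    then have "mu u (e # p) \<cdot> single K k (\<beta> w []) = \<gamma> (Edge e) \<cdot> single K k (\<beta> (head E e) p)"
      using Cons mu_closed[of "head E e" p w] by (simp add: act_mult)
    then show ?case using Cons.prems assms(1) gen_single1[of "Edge e" k] beta_B t_edge by simp
  qed
  finally show ?thesis .
qed

lemma nu_base: "walk u p x \<Longrightarrow> p \<noteq> [] \<or> u \<noteq> w \<Longrightarrow> nu u p \<cdot> base = \<zero>\<^bsub>N\<^esub>"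
proof (cases p)
  case Nil
  assume "walk u p x" "p \<noteq> [] \<or> u \<noteq> w"
  then show ?thesis using Nil ver_ver[of u w base] ver_base base_in_N w by auto
next
  case (Cons e p')
  assume a: "walk u p x"
  have "\<gamma> (Ghost e) \<cdot> base = \<zero>\<^bsub>N\<^esub>"
    using a Cons gen_single1[of "Ghost e" "\<one>\<^bsub>K\<^esub>" "\<beta> w []"] t_ghost beta_B[of w "[]"] w by (simp add: base_def)
  then show ?thesis using a Cons base_in_N nu_closed[of "head E e" p' x] by (auto simp: act_mult)
qed

text \<open>Take a longest path p in the support and apply its ghost. Another path of the support
  survives only if it extends p, which its length forbids, or if p extends it, and then a nonempty
  ghost path is left over, which kills \<open>base\<close>.\<close>

lemma isolate:
  assumes "x \<in> carrier N" "x \<noteq> \<zero>\<^bsub>N\<^esub>"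
  shows "\<exists>a\<in>carrier L. \<exists>l\<in>carrier K. l \<noteq> \<zero>\<^bsub>K\<^esub> \<and> a \<cdot> x = single K l (\<beta> w [])"
proof -
  let ?Z = "{(u, p). walk u p w \<and> x (\<beta> u p) \<noteq> \<zero>\<^bsub>K\<^esub>}"
  have fin: "finite {b. x b \<noteq> \<zero>\<^bsub>K\<^esub>}" "{b. x b \<noteq> \<zero>\<^bsub>K\<^esub>} \<subseteq> B" and xc: "\<And>b. x b \<in> carrier K"
    using assms(1) by (auto simp: N_simps free_space_carrier_iff)
  have "inj_on (\<lambda>(u, p). \<beta> u p) ?Z" using beta_inj by (auto simp: inj_on_def)
  moreover have "(\<lambda>(u, p). \<beta> u p) ` ?Z \<subseteq> {b. x b \<noteq> \<zero>\<^bsub>K\<^esub>}" by auto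
  ultimately have finZ: "finite ?Z" using fin(1) by (metis (no_types, lifting) finite_imageD finite_subset)
  obtain b where "x b \<noteq> \<zero>\<^bsub>K\<^esub>" using assms(2) by (auto simp: N_simps fun_eq_iff)
  then have neZ: "?Z \<noteq> {}" using fin(2) beta_surj[of b] by auto
  define up where "up = (ARG_MAX (\<lambda>(u, p). length p) z. z \<in> ?Z)"
  obtain u p where upe: "up = (u, p)" by (cases up)
  obtain z0 where z0: "z0 \<in> ?Z" using neZ by (meson ex_in_conv)
  obtain n where "\<forall>z\<in>?Z. (\<lambda>(u, p). length p) z \<le> n"
    using finZ finite_nat_set_iff_bounded_le[of "(\<lambda>(u, p). length p) ` ?Z"] by blast
  then have bound: "\<forall>z. z \<in> ?Z \<longrightarrow> (\<lambda>(u, p). length p) z < Suc n" by (simp add: le_imp_less_Suc)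
  have "up \<in> ?Z" unfolding up_def by (rule arg_max_natI[OF z0 bound])
  then have wk: "walk u p w" "x (\<beta> u p) \<noteq> \<zero>\<^bsub>K\<^esub>" using upe by auto
  have mx: "length p' \<le> length p" if "walk u' p' w" "x (\<beta> u' p') \<noteq> \<zero>\<^bsub>K\<^esub>" for u' p'
    using arg_max_nat_le[of "\<lambda>z. z \<in> ?Z", OF _ bound, of "(u', p')"] that upe unfolding up_def by auto
  note nuc = nu_closed[OF wk(1)]
  \<comment> \<open>On the span of the paths no longer than p, the ghost of p does nothing but read
    off the coefficient at \<open>\<beta> u p\<close>.\<close>
  let ?B0 = "{b. \<exists>u' p'. walk u' p' w \<and> length p' \<le> length p \<and> b = \<beta> u' p'}"
  have B0: "?B0 \<subseteq> B" using beta_B by auto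
  then have sub: "carrier (free_space K ?B0) \<subseteq> carrier N"
    unfolding N_simps by (intro subsetI) (meson free_space_carrier_iff order_trans)
  have abN: "abelian_group N" by intro_locales
  note ab = abN module.axioms(2)[OF K.free_space_module, of ?B0]
  have add0: "add (free_space K ?B0) = add N" unfolding N_simps by (simp add: free_space_def)
  have bw: "\<beta> w [] \<in> B" using beta_B[of w "[]"] w by simp
  have "nu u p \<cdot> x = single K (x (\<beta> u p)) (\<beta> w [])"
  proof (rule K.additive_ext[where B = ?B0 and M = N and f = "\<lambda>y. nu u p \<cdot> y" and g = "\<lambda>y. single K (y (\<beta> u p)) (\<beta> w [])"])
    show "abelian_group_hom (free_space K ?B0) N (\<lambda>y. nu u p \<cdot> y)"
    proof (rule abelian_group_homI'[OF ab(2,1)])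
      fix y y' assume "y \<in> carrier (free_space K ?B0)" "y' \<in> carrier (free_space K ?B0)"
      then show "nu u p \<cdot> (y \<oplus>\<^bsub>free_space K ?B0\<^esub> y') = nu u p \<cdot> y \<oplus>\<^bsub>N\<^esub> nu u p \<cdot> y'"
        unfolding add0 using sub nuc by (intro M.smult_r_distr) auto
    qed (use sub nuc in auto)
    show "abelian_group_hom (free_space K ?B0) N (\<lambda>y. single K (y (\<beta> u p)) (\<beta> w []))"
    proof (rule abelian_group_homI'[OF ab(2,1)])
      fix y y' assume y: "y \<in> carrier (free_space K ?B0)" "y' \<in> carrier (free_space K ?B0)"
      then have "y (\<beta> u p) \<in> carrier K" "y' (\<beta> u p) \<in> carrier K" by (auto simp: free_space_carrier_iff)
      then show "single K ((y \<oplus>\<^bsub>free_space K ?B0\<^esub> y') (\<beta> u p)) (\<beta> w []) =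
          single K (y (\<beta> u p)) (\<beta> w []) \<oplus>\<^bsub>N\<^esub> single K (y' (\<beta> u p)) (\<beta> w [])"
        by (simp add: single_add_N)
    next
      fix y assume "y \<in> carrier (free_space K ?B0)"
      then show "single K (y (\<beta> u p)) (\<beta> w []) \<in> carrier N"
        using bw by (intro single_in_N) (auto simp: free_space_carrier_iff)
    qed
    show "x \<in> carrier (free_space K ?B0)"
      using fin xc mx beta_surj unfolding free_space_carrier_iff by blast
    fix l b assume l: "l \<in> carrier K" and "b \<in> ?B0"
    then obtain u' p' where b: "walk u' p' w" "length p' \<le> length p" "b = \<beta> u' p'" by blast
    note c = mu_closed[OF b(1)]
    have "nu u p \<cdot> single K l b = nu u p \<cdot> ((l \<odot>\<^bsub>L\<^esub> mu u' p') \<cdot> base)"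
      using smult_mu_base[OF l b(1)] b(3) by simp
    also have "\<dots> = (l \<odot>\<^bsub>L\<^esub> (nu u p \<bullet> mu u' p')) \<cdot> base"
      using nuc c l base_in_N by (simp add: act_smult_mult')
    finally have eq: "nu u p \<cdot> single K l b = (l \<odot>\<^bsub>L\<^esub> (nu u p \<bullet> mu u' p')) \<cdot> base" .
    have zz: "single K \<zero>\<^bsub>K\<^esub> (\<beta> w []) = \<zero>\<^bsub>N\<^esub>" by (simp add: single_eq_zero)
    show "nu u p \<cdot> single K l b = single K (single K l b (\<beta> u p)) (\<beta> w [])"
      using nu_mu_cases[OF wk(1) b(1)]
    proof (elim disjE conjE exE)
      fix r assume r: "u = u'" "p' = p @ r" "walk w r w" "nu u p \<bullet> mu u' p' = mu w r"
      then have "r = []" using b(2) by simp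
      then have "nu u p \<cdot> single K l b = single K l (\<beta> w [])"
        unfolding eq r(4) using smult_mu_base[OF l r(3)] by simp
      moreover have "single K l b (\<beta> u p) = l" using r \<open>r = []\<close> b(3) by (simp add: single_def)
      ultimately show ?thesis by simp
    next
      fix r assume r: "u = u'" "r \<noteq> []" "p = p' @ r" "walk w r w" "nu u p \<bullet> mu u' p' = nu w r"
      have "(l \<odot>\<^bsub>L\<^esub> nu w r) \<cdot> base = (l \<odot>\<^bsub>L\<^esub> (ver w \<bullet> nu w r)) \<cdot> base"
        using vertex_nu[OF r(4)] by simp
      also have "\<dots> = (l \<odot>\<^bsub>L\<^esub> ver w) \<cdot> (nu w r \<cdot> base)"
        using l w nu_closed[OF r(4)] base_in_N by (simp add: act_smult_mult)
      also have "\<dots> = \<zero>\<^bsub>N\<^esub>" using nu_base[OF r(4)] r(2) l w by simp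
      finally have "nu u p \<cdot> single K l b = \<zero>\<^bsub>N\<^esub>" unfolding eq r(5) .
      moreover have "single K l b (\<beta> u p) = \<zero>\<^bsub>K\<^esub>"
        using beta_inj[OF wk(1) b(1)] r(2,3) b(3) by (auto simp: single_def)
      ultimately show ?thesis by (simp add: zz)
    next
      assume r: "u = u' \<longrightarrow> (\<nexists>r. p' = p @ r) \<and> (\<nexists>r. p = p' @ r)" "nu u p \<bullet> mu u' p' = \<zero>\<^bsub>L\<^esub>"
      then have "\<beta> u p \<noteq> b" using beta_inj[OF wk(1) b(1)] b(3) by auto
      then have "single K l b (\<beta> u p) = \<zero>\<^bsub>K\<^esub>" by (simp add: single_def)
      then show ?thesis unfolding eq r(2) using l base_in_N by (simp add: zz L.smult_r_null)
    qed
  qed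
  then show ?thesis using nuc wk(2) xc by blast
qed

lemma path_module_simple: "simple_left_module L N"
proof (rule simple_criterion)
  show "B \<noteq> {}" using beta_B[of w "[]"] w by auto
next
  fix x assume "x \<in> carrier N" "x \<noteq> \<zero>\<^bsub>N\<^esub>"
  from isolate[OF this] show "\<exists>a\<in>carrier L. \<exists>b\<in>B. \<exists>l\<in>carrier K. l \<noteq> \<zero>\<^bsub>K\<^esub> \<and> a \<cdot> x = single K l b"
    using beta_B[of w "[]"] w by auto
next
  fix b b' l l' assume a: "b \<in> B" "b' \<in> B" "l \<in> carrier K" "l \<noteq> \<zero>\<^bsub>K\<^esub>" "l' \<in> carrier K"
  obtain u p where b: "walk u p w" "b = \<beta> u p" using beta_surj a(1) by blast
  obtain u' p' where b': "walk u' p' w" "b' = \<beta> u' p'" using beta_surj a(2) by blast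
  have bw: "\<beta> w [] \<in> B" using beta_B[of w "[]"] w by simp
  have sN: "single K l b \<in> carrier N" using a by (intro single_in_N)
  obtain a0 l0 where a0: "a0 \<in> carrier L" "l0 \<in> carrier K" "l0 \<noteq> \<zero>\<^bsub>K\<^esub>" "a0 \<cdot> single K l b = single K l0 (\<beta> w [])"
    using isolate[OF sN] a(4) single_eq_zero[of l b] by blast
  let ?k = "l' \<otimes>\<^bsub>K\<^esub> inv\<^bsub>K\<^esub> l0"
  have k: "?k \<in> carrier K" "inv\<^bsub>K\<^esub> l0 \<otimes>\<^bsub>K\<^esub> l0 = \<one>\<^bsub>K\<^esub>" "inv\<^bsub>K\<^esub> l0 \<in> carrier K"
    using a a0 K.field_Units by auto
  have "(?k \<odot>\<^bsub>L\<^esub> mu u' p') \<cdot> single K l0 (\<beta> w []) = (?k \<odot>\<^bsub>L\<^esub> mu u' p') \<cdot> ((l0 \<odot>\<^bsub>L\<^esub> ver w) \<cdot> base)"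
    using smult_mu_base[OF a0(2), of w "[]"] w by simp
  also have "\<dots> = ((?k \<otimes>\<^bsub>K\<^esub> l0) \<odot>\<^bsub>L\<^esub> mu u' p') \<cdot> base"
    using k a0(2) mu_closed[OF b'(1)] w base_in_N L.smult_left_commute[of l0 ?k "mu u' p'"]
    by (simp add: act_mult[symmetric] L.smult_mult L.mult_smult mu_vertex[OF b'(1)] L.smult_assoc1)
  also have "?k \<otimes>\<^bsub>K\<^esub> l0 = l'" using k a a0(2) by (simp add: K.m_assoc)
  also have "(l' \<odot>\<^bsub>L\<^esub> mu u' p') \<cdot> base = single K l' b'" using smult_mu_base[OF a(5) b'(1)] b'(2) by simp
  finally have "((?k \<odot>\<^bsub>L\<^esub> mu u' p') \<bullet> a0) \<cdot> single K l b = single K l' b'"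
    using a0 k mu_closed[OF b'(1)] sN by (simp add: act_mult)
  then show "\<exists>a\<in>carrier L. a \<cdot> single K l b = single K l' b'"
    using a0 k mu_closed[OF b'(1)] by (intro bexI[of _ "(?k \<odot>\<^bsub>L\<^esub> mu u' p') \<bullet> a0"]) auto
qed

text \<open>Sending the path p to the action of p on \<open>m\<close> defines an additive map \<Psi>
  with a m = \<Psi> (a base) for all a: paths agree by construction, and nonempty ghost paths kill
  both \<open>base\<close> and \<open>m\<close>. So whatever kills \<open>base\<close> kills
  \<open>m\<close>.\<close>

lemma path_module_annihilator:
  assumes "lpa_simple K E M'" and m: "m \<in> carrier M'" "m \<noteq> \<zero>\<^bsub>M'\<^esub>" "ver w \<odot>\<^bsub>M'\<^esub> m = m"
    and ghosts: "\<And>e. e \<in> arcs E \<Longrightarrow> \<gamma> (Ghost e) \<odot>\<^bsub>M'\<^esub> m = \<zero>\<^bsub>M'\<^esub>"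
  shows "annihilator L N = annihilator L M'"
proof -
  interpret M': lpa_simple K E M' by fact
  define \<pi> where "\<pi> b = (THE up. walk (fst up) (snd up) w \<and> b = \<beta> (fst up) (snd up))" for b
  have pi: "\<pi> (\<beta> u p) = (u, p)" if "walk u p w" for u p
    unfolding \<pi>_def
  proof (rule the_equality)
    fix z assume "walk (fst z) (snd z) w \<and> \<beta> u p = \<beta> (fst z) (snd z)"
    then show "z = (u, p)" using beta_inj[OF that, of "fst z" "snd z"] by (simp add: prod_eq_iff)
  qed (use that in simp)
  have pi_walk: "walk (fst (\<pi> b)) (snd (\<pi> b)) w" if "b \<in> B" for b
    using beta_surj[OF that] pi by auto
  define \<Psi> where "\<Psi> = lin K M' (\<lambda>b k. (k \<odot>\<^bsub>L\<^esub> mu (fst (\<pi> b)) (snd (\<pi> b))) \<odot>\<^bsub>M'\<^esub> m)"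
  have fam: "additive_family K B M' (\<lambda>b k. (k \<odot>\<^bsub>L\<^esub> mu (fst (\<pi> b)) (snd (\<pi> b))) \<odot>\<^bsub>M'\<^esub> m)"
    using mu_closed[OF pi_walk] m(1) by (intro additive_familyI) (auto simp: L.smult_l_distr M'.act_add_l)
  have abM: "abelian_group M'" by intro_locales
  have \<Psi>_add: "\<Psi> (x \<oplus>\<^bsub>N\<^esub> y) = \<Psi> x \<oplus>\<^bsub>M'\<^esub> \<Psi> y" if "x \<in> carrier N" "y \<in> carrier N" for x y
    unfolding \<Psi>_def N_simps using that unfolding N_simps by (rule K.lin_add[OF abM fam])
  have \<Psi>_single: "\<Psi> (single K k (\<beta> u p)) = (k \<odot>\<^bsub>L\<^esub> mu u p) \<odot>\<^bsub>M'\<^esub> m" if "k \<in> carrier K" "walk u p w" for k u p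
    unfolding \<Psi>_def using K.lin_single[OF abM fam that(1) beta_B[OF that(2)]] pi[OF that(2)] by simp
  have \<Psi>_zero: "\<Psi> \<zero>\<^bsub>N\<^esub> = \<zero>\<^bsub>M'\<^esub>" unfolding \<Psi>_def N_simps by (rule K.lin_zero[OF abM])
  have nuM: "nu u p \<odot>\<^bsub>M'\<^esub> m = \<zero>\<^bsub>M'\<^esub>" if "walk u p x" "p \<noteq> [] \<or> u \<noteq> w" for u p x
  proof (cases p)
    case Nil
    then show ?thesis using that M'.ver_ver[of u w m] m w by auto
  next
    case (Cons e p')
    then show ?thesis using that m(1) ghosts[of e] nu_closed[of "head E e" p' x] by (auto simp: M'.act_mult)
  qed
  have main: "a \<odot>\<^bsub>M'\<^esub> m = \<Psi> (a \<cdot> base)" if "a \<in> carrier L" for a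
    using that
  proof (induction a rule: mon_induct)
    case (add a b)
    then show ?case using m(1) base_in_N by (simp add: act_add_l M'.act_add_l \<Psi>_add)
  next
    case (mon k u p u' q x)
    show ?case
    proof (cases "q = [] \<and> u' = w")
      case True
      then have "x = w" using mon by simp
      have eq: "mu u p \<bullet> nu u' q = mu u p" using True mon \<open>x = w\<close> by (simp add: mu_vertex)
      show ?thesis unfolding eq using mon \<open>x = w\<close> by (simp add: smult_mu_base \<Psi>_single)
    next
      case False
      then show ?thesis using mon m(1) base_in_N nuM[OF mon(3)] nu_base[OF mon(3)]
        by (auto simp: act_smult_mult M'.act_smult_mult \<Psi>_zero)
    qed
  qed (use m(1) base_in_N \<Psi>_zero in simp)
  have sN: "lpa_simple K E N" using path_module_simple by unfold_locales
  show ?thesis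
    by (rule annihilator_eqI[OF sN assms(1) base_in_N base_nonzero m(1,2) w ver_base m(3)])
      (simp add: main \<Psi>_zero)
qed

end

section \<open>Modules of infinite paths\<close>

context leavitt_path
begin

abbreviation "tc \<equiv> tail_class E"
abbreviation "src q \<equiv> tail E (shd q)"

lemma infinite_path_Stream:
  "infinite_path E (e ## q) \<longleftrightarrow> e \<in> arcs E \<and> head E e = src q \<and> infinite_path E q"
proof
  assume a: "infinite_path E (e ## q)"
  then have *: "(e ## q) !! i \<in> arcs E \<and> head E ((e ## q) !! i) = tail E ((e ## q) !! Suc i)" for i
    by (simp only: infinite_path_def)
  have "infinite_path E q"
    unfolding infinite_path_def
  proof
    fix i show "q !! i \<in> arcs E \<and> head E (q !! i) = tail E (q !! Suc i)" using *[of "Suc i"] by simp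
  qed
  then show "e \<in> arcs E \<and> head E e = src q \<and> infinite_path E q" using *[of 0] by simp
next
  assume a: "e \<in> arcs E \<and> head E e = src q \<and> infinite_path E q"
  show "infinite_path E (e ## q)"
    unfolding infinite_path_def
  proof
    fix i show "(e ## q) !! i \<in> arcs E \<and> head E ((e ## q) !! i) = tail E ((e ## q) !! Suc i)"
      using a by (cases i) (auto simp: infinite_path_def)
  qed
qed

lemma infinite_path_shd: "infinite_path E q \<Longrightarrow> shd q \<in> arcs E \<and> head E (shd q) = src (stl q) \<and> infinite_path E (stl q)"
  using infinite_path_Stream[of "shd q" "stl q"] by simp

lemma src_verts: "infinite_path E q \<Longrightarrow> src q \<in> verts E"
  using infinite_path_shd by (simp add: ends_in_verts)

lemma infinite_path_sdrop: "infinite_path E q \<Longrightarrow> infinite_path E (sdrop n q)"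
proof (induction n arbitrary: q)
  case (Suc n)
  then show ?case using infinite_path_shd[OF Suc.prems] by simp
qed simp

lemma infinite_path_shift: "walk u r (src q) \<Longrightarrow> infinite_path E q \<Longrightarrow> infinite_path E (r @- q) \<and> src (r @- q) = u"
  by (induction r arbitrary: u) (auto simp: infinite_path_Stream)

lemma walk_stake: "infinite_path E q \<Longrightarrow> walk (src q) (stake n q) (src (sdrop n q))"
proof (induction n arbitrary: q)
  case (Suc n)
  then show ?case using infinite_path_shd[OF Suc.prems] Suc.IH[of "stl q"] by simp
qed (simp add: src_verts)

lemma tc_iff: "q \<in> tc p \<longleftrightarrow> infinite_path E q \<and> (\<exists>m n. sdrop m p = sdrop n q)"
proof
  assume "q \<in> tc p"
  then show "infinite_path E q \<and> (\<exists>m n. sdrop m p = sdrop n q)" unfolding tail_class_def by blast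
next
  assume a: "infinite_path E q \<and> (\<exists>m n. sdrop m p = sdrop n q)"
  then obtain m n where "sdrop m p = sdrop n q" by blast
  then have *: "sdrop (Suc m) p = sdrop (Suc n) q" by (simp only: sdrop.simps sdrop_stl)
  have "\<exists>m>0. \<exists>n>0. sdrop m p = sdrop n q"
    by (rule exI[of _ "Suc m"], rule conjI, rule zero_less_Suc,
        rule exI[of _ "Suc n"], rule conjI, rule zero_less_Suc, rule *)
  with a show "q \<in> tc p" unfolding tail_class_def by simp
qed

lemma tc_infinite: "q \<in> tc p \<Longrightarrow> infinite_path E q"
  by (simp add: tc_iff)

lemma tc_refl: "infinite_path E p \<Longrightarrow> p \<in> tc p"
  by (auto simp: tc_iff)

lemma tc_sdrop: "q \<in> tc p \<Longrightarrow> sdrop n q \<in> tc p"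
proof -
  assume "q \<in> tc p"
  then obtain m k where q: "infinite_path E q" "sdrop m p = sdrop k q" by (auto simp: tc_iff)
  then have "sdrop (m + n) p = sdrop k (sdrop n q)"
    using sdrop_add[of n m p] sdrop_add[of n k q] sdrop_add[of k n q] by (simp add: add.commute)
  then show ?thesis using infinite_path_sdrop[OF q(1)] by (auto simp: tc_iff)
qed

lemma tc_stl: "q \<in> tc p \<Longrightarrow> stl q \<in> tc p"
  using tc_sdrop[of q p 1] by simp

lemma tc_shift: "q \<in> tc p \<Longrightarrow> walk u r (src q) \<Longrightarrow> r @- q \<in> tc p"
proof -
  assume a: "q \<in> tc p" "walk u r (src q)"
  then obtain m k where q: "infinite_path E q" "sdrop m p = sdrop k q" by (auto simp: tc_iff)
  have "sdrop (length r + k) (r @- q) = sdrop k q" by (simp add: sdrop_shift)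
  then show ?thesis using infinite_path_shift[OF a(2) q(1)] q(2) unfolding tc_iff by metis
qed

lemma tc_common: "q \<in> tc p \<Longrightarrow> q' \<in> tc p \<Longrightarrow> \<exists>m n. sdrop m q = sdrop n q'"
proof -
  assume "q \<in> tc p" "q' \<in> tc p"
  then obtain m k m' k' where *: "sdrop m p = sdrop k q" "sdrop m' p = sdrop k' q'" by (auto simp: tc_iff)
  then have "sdrop (k + m') q = sdrop (k' + m) q'"
    using sdrop_add[of m' k q] sdrop_add[of m' m p] sdrop_add[of m k' q'] sdrop_add[of m m' p]
    by (metis add.commute)
  then show ?thesis by blast
qed

end

text \<open>Different streams differ at some position, and finitely many such positions have a
  common bound.\<close>

lemma stream_separated:
  assumes "finite Z"
  shows "\<exists>n. \<forall>q'\<in>Z. q' \<noteq> q \<longrightarrow> (\<forall>n'\<ge>n. stake n' q' \<noteq> stake n' q)"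
  using assms
proof (induction Z rule: finite_induct)
  case (insert q' Z)
  then obtain n where n: "\<forall>q'\<in>Z. q' \<noteq> q \<longrightarrow> (\<forall>n'\<ge>n. stake n' q' \<noteq> stake n' q)" by blast
  show ?case
  proof (cases "q' = q")
    case False
    then obtain i where i: "q' !! i \<noteq> q !! i" using smap_alt[of id q' q] by (auto simp: stream.map_id)
    have "stake n' q' \<noteq> stake n' q" if "n' \<ge> Suc i" for n'
      using i that by (metis Suc_le_lessD stake_nth)
    then show ?thesis using n by (intro exI[of _ "n + Suc i"]) auto
  qed (use n in auto)
qed simp

text \<open>One locale for the modules of infinite paths, where \<chi> is constantly 1, and for
  their twisted versions over an extension field.\<close>

locale stream_module = monomial K E S h \<chi> "tail_class E p" "inf_path_act E" N
  for K :: "('k, 'c) ring_scheme" and E :: "('v, 'e) pre_digraph" and S :: "('l, 's) ring_scheme"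
    and h \<chi> p N +
  assumes p: "infinite_path E p"
    and chi_inverse: "e \<in> arcs E \<Longrightarrow> \<chi> (Edge e) \<otimes>\<^bsub>S\<^esub> \<chi> (Ghost e) = \<one>\<^bsub>S\<^esub>"
begin

primrec wt where
  "wt [] = \<one>\<^bsub>S\<^esub>"
| "wt (e # r) = \<chi> (Edge e) \<otimes>\<^bsub>S\<^esub> wt r"

primrec wtg where
  "wtg [] = \<one>\<^bsub>S\<^esub>"
| "wtg (e # r) = wtg r \<otimes>\<^bsub>S\<^esub> \<chi> (Ghost e)"

lemma wt_closed: "walk u r w \<Longrightarrow> wt r \<in> carrier S \<and> wt r \<noteq> \<zero>\<^bsub>S\<^esub>"
  by (induction r arbitrary: u) (auto simp: chi_closed chi_nonzero S.integral_iff)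

lemma wtg_closed: "walk u r w \<Longrightarrow> wtg r \<in> carrier S \<and> wtg r \<noteq> \<zero>\<^bsub>S\<^esub>"
  by (induction r arbitrary: u) (auto simp: chi_closed chi_nonzero S.integral_iff)

lemma ver_single:
  assumes "v \<in> verts E" "q \<in> tc p" "l \<in> carrier S"
  shows "ver v \<cdot> single S l q = (if v = src q then single S l q else \<zero>\<^bsub>N\<^esub>)"
  using gen_single1[of "Vertex v" l q] assms by (simp add: chi_vertex)

lemma edge_single:
  assumes "e \<in> arcs E" "q \<in> tc p" "l \<in> carrier S"
  shows "\<gamma> (Edge e) \<cdot> single S l q = (if head E e = src q then single S (\<chi> (Edge e) \<otimes>\<^bsub>S\<^esub> l) (e ## q) else \<zero>\<^bsub>N\<^esub>)"
  using gen_single1[of "Edge e" l q] assms by simp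

lemma ghost_single:
  assumes "e \<in> arcs E" "q \<in> tc p" "l \<in> carrier S"
  shows "\<gamma> (Ghost e) \<cdot> single S l q = (if shd q = e then single S (\<chi> (Ghost e) \<otimes>\<^bsub>S\<^esub> l) (stl q) else \<zero>\<^bsub>N\<^esub>)"
  using gen_single1[of "Ghost e" l q] assms by simp

lemma mu_single:
  assumes "q \<in> tc p" "l \<in> carrier S" "walk u r (src q)"
  shows "mu u r \<cdot> single S l q = single S (wt r \<otimes>\<^bsub>S\<^esub> l) (r @- q)"
  using assms(3)
proof (induction r arbitrary: u)
  case Nil
  then show ?case using ver_single[of "src q" q l] assms by auto
next
  case (Cons e r)
  have e: "e \<in> arcs E" "walk (head E e) r (src q)" using Cons.prems by auto
  have rq: "r @- q \<in> tc p" "src (r @- q) = head E e"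
    using tc_shift[OF assms(1) e(2)] infinite_path_shift[OF e(2)] assms(1) tc_infinite by auto
  have w: "wt r \<in> carrier S" "\<chi> (Edge e) \<in> carrier S" using wt_closed[OF e(2)] chi_closed e(1) by auto
  have "mu u (e # r) \<cdot> single S l q = \<gamma> (Edge e) \<cdot> single S (wt r \<otimes>\<^bsub>S\<^esub> l) (r @- q)"
    using Cons.IH[OF e(2)] e mu_closed[OF e(2)] single_in_N[OF assms(2,1)] by (simp add: act_mult)
  also have "\<dots> = single S (wt (e # r) \<otimes>\<^bsub>S\<^esub> l) ((e # r) @- q)"
    using e rq w assms(2) by (simp add: edge_single S.m_assoc)
  finally show ?case .
qed

lemma nu_single:
  assumes "q \<in> tc p" "l \<in> carrier S" "walk u r w"
  shows "nu u r \<cdot> single S l q =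
    (if src q = u \<and> stake (length r) q = r then single S (wtg r \<otimes>\<^bsub>S\<^esub> l) (sdrop (length r) q) else \<zero>\<^bsub>N\<^esub>)"
  using assms
proof (induction r arbitrary: u q l)
  case Nil
  then show ?case using ver_single[of u q l] by auto
next
  case (Cons e r)
  have e: "e \<in> arcs E" "walk (head E e) r w" "u = tail E e" using Cons.prems by auto
  have w: "wtg r \<in> carrier S" "\<chi> (Ghost e) \<in> carrier S" using wtg_closed[OF e(2)] chi_closed e(1) by auto
  have "nu u (e # r) \<cdot> single S l q = nu (head E e) r \<cdot> (\<gamma> (Ghost e) \<cdot> single S l q)"
    using e nu_closed[OF e(2)] single_in_N Cons.prems by (simp add: act_mult)
  also have "\<dots> = (if shd q = e then nu (head E e) r \<cdot> single S (\<chi> (Ghost e) \<otimes>\<^bsub>S\<^esub> l) (stl q) else \<zero>\<^bsub>N\<^esub>)"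
    using e Cons.prems nu_closed[OF e(2)] by (simp add: ghost_single)
  finally have *: "nu u (e # r) \<cdot> single S l q =
    (if shd q = e then nu (head E e) r \<cdot> single S (\<chi> (Ghost e) \<otimes>\<^bsub>S\<^esub> l) (stl q) else \<zero>\<^bsub>N\<^esub>)" .
  show ?case
  proof (cases "shd q = e")
    case True
    have "src (stl q) = head E e" using infinite_path_shd[OF tc_infinite[OF Cons.prems(1)]] True by simp
    then show ?thesis unfolding * using True e w Cons.prems Cons.IH[OF tc_stl[OF Cons.prems(1)] _ e(2), of "\<chi> (Ghost e) \<otimes>\<^bsub>S\<^esub> l"]
      by (auto simp: S.m_assoc)
  qed (use * in auto)
qed

lemma nu_stake_single:
  assumes "q \<in> tc p" "l \<in> carrier S"
  shows "nu (src q) (stake n q) \<cdot> single S l q = single S (wtg (stake n q) \<otimes>\<^bsub>S\<^esub> l) (sdrop n q)"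
  using nu_single[OF assms walk_stake[OF tc_infinite[OF assms(1)]], of n] by simp

lemma act_single_out:
  assumes "a \<in> carrier L" "x \<in> carrier N" "b0 \<in> tc p"
    and z: "\<And>b l. \<lbrakk>x b \<noteq> \<zero>\<^bsub>S\<^esub>; b \<noteq> b0; l \<in> carrier S\<rbrakk> \<Longrightarrow> a \<cdot> single S l b = \<zero>\<^bsub>N\<^esub>"
  shows "a \<cdot> x = a \<cdot> single S (x b0) b0"
proof -
  let ?B = "{b. x b \<noteq> \<zero>\<^bsub>S\<^esub>} - {b0}" and ?y = "x(b0 := \<zero>\<^bsub>S\<^esub>)"
  have xs: "\<And>b. x b \<in> carrier S" "finite {b. x b \<noteq> \<zero>\<^bsub>S\<^esub>}" "{b. x b \<noteq> \<zero>\<^bsub>S\<^esub>} \<subseteq> tc p"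
    using assms(2) by (auto simp: N_simps free_space_carrier_iff)
  have supp: "{b. ?y b \<noteq> \<zero>\<^bsub>S\<^esub>} = ?B" by (intro subset_antisym subsetI) (auto split: if_splits)
  have y: "?y \<in> carrier (free_space S ?B)"
    unfolding free_space_carrier_iff supp using xs by auto
  have ind: "y \<in> carrier N \<and> a \<cdot> y = \<zero>\<^bsub>N\<^esub>" if "y \<in> carrier (free_space S ?B)" for y
    using that
  proof (induction y rule: S.free_space_induct)
    case zero
    then show ?case using assms(1) by (simp add: N_simps(2)[symmetric])
  next
    case (single y l b)
    have eq: "y \<oplus>\<^bsub>free_space S ?B\<^esub> single S l b = y \<oplus>\<^bsub>N\<^esub> single S l b" by (simp add: N_simps)
    have s: "single S l b \<in> carrier N" using single(2,3) xs(3) by (intro single_in_N) auto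
    have "a \<cdot> single S l b = \<zero>\<^bsub>N\<^esub>" using z[of b l] single(2,3) by auto
    then show ?case unfolding eq using single(4) s assms(1) by (simp add: M.smult_r_distr)
  qed
  have "x = ?y \<oplus>\<^bsub>N\<^esub> single S (x b0) b0"
    using xs(1) by (auto simp: N_simps single_def fun_eq_iff)
  then have "a \<cdot> x = a \<cdot> (?y \<oplus>\<^bsub>N\<^esub> single S (x b0) b0)" by simp
  also have "\<dots> = a \<cdot> single S (x b0) b0"
    using ind[OF y] assms(1,3) xs(1) single_in_N by (simp add: M.smult_r_distr)
  finally show ?thesis .
qed

text \<open>A sufficiently long initial segment of b tells it apart from the other streams in the
  finite support, so the ghost of this segment kills all of them.\<close>

lemma isolate:
  assumes "x \<in> carrier N" "x \<noteq> \<zero>\<^bsub>N\<^esub>"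
  shows "\<exists>b\<in>tc p. \<exists>n. x b \<noteq> \<zero>\<^bsub>S\<^esub> \<and> x b \<in> carrier S \<and>
    (\<forall>n'\<ge>n. nu (src b) (stake n' b) \<cdot> x = single S (wtg (stake n' b) \<otimes>\<^bsub>S\<^esub> x b) (sdrop n' b))"
proof -
  have xs: "\<And>b. x b \<in> carrier S" "finite {b. x b \<noteq> \<zero>\<^bsub>S\<^esub>}" "{b. x b \<noteq> \<zero>\<^bsub>S\<^esub>} \<subseteq> tc p"
    using assms(1) by (auto simp: N_simps free_space_carrier_iff)
  obtain b where b: "x b \<noteq> \<zero>\<^bsub>S\<^esub>" using assms(2) by (auto simp: N_simps fun_eq_iff)
  then have bt: "b \<in> tc p" using xs(3) by blast
  obtain n where n: "\<forall>q'\<in>{b. x b \<noteq> \<zero>\<^bsub>S\<^esub>}. q' \<noteq> b \<longrightarrow> (\<forall>n'\<ge>n. stake n' q' \<noteq> stake n' b)"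
    using stream_separated[OF xs(2), of b] by blast
  have "nu (src b) (stake n' b) \<cdot> x = single S (wtg (stake n' b) \<otimes>\<^bsub>S\<^esub> x b) (sdrop n' b)" if n': "n' \<ge> n" for n'
  proof -
    note wk = walk_stake[OF tc_infinite[OF bt], of n']
    have "nu (src b) (stake n' b) \<cdot> x = nu (src b) (stake n' b) \<cdot> single S (x b) b"
    proof (rule act_single_out[OF nu_closed[OF wk] assms(1) bt])
      fix b' l assume b': "x b' \<noteq> \<zero>\<^bsub>S\<^esub>" "b' \<noteq> b" "l \<in> carrier S"
      then show "nu (src b) (stake n' b) \<cdot> single S l b' = \<zero>\<^bsub>N\<^esub>"
        using nu_single[OF _ b'(3) wk, of b'] n n' xs(3) by auto
    qed
    then show ?thesis using nu_stake_single[OF bt xs(1)] by simp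
  qed
  then show ?thesis using b bt xs(1) by blast
qed

text \<open>A ghost path strips \<open>b\<close> down to a common tail, and a path builds
  \<open>b'\<close> on top of it. The factor \<open>f\<close> collects the values of \<chi> on the
  way and does not depend on \<open>l\<close>.\<close>

lemma single_trans:
  assumes "b \<in> tc p" "b' \<in> tc p"
  shows "\<exists>a\<in>carrier L. \<exists>f\<in>carrier S. f \<noteq> \<zero>\<^bsub>S\<^esub> \<and> (\<forall>l\<in>carrier S. a \<cdot> single S l b = single S (f \<otimes>\<^bsub>S\<^esub> l) b')"
proof -
  obtain m n where mn: "sdrop m b = sdrop n b'" using tc_common[OF assms] by blast
  note wk = walk_stake[OF tc_infinite[OF assms(1)], of m]
  note wk' = walk_stake[OF tc_infinite[OF assms(2)], of n]
  have w: "wtg (stake m b) \<in> carrier S" "wtg (stake m b) \<noteq> \<zero>\<^bsub>S\<^esub>" "wt (stake n b') \<in> carrier S" "wt (stake n b') \<noteq> \<zero>\<^bsub>S\<^esub>"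
    using wt_closed[OF wk'] wtg_closed[OF wk] by auto
  let ?a = "mu (src b') (stake n b') \<bullet> nu (src b) (stake m b)"
  have "?a \<cdot> single S l b = single S (wt (stake n b') \<otimes>\<^bsub>S\<^esub> wtg (stake m b) \<otimes>\<^bsub>S\<^esub> l) b'" if l: "l \<in> carrier S" for l
  proof -
    have "?a \<cdot> single S l b = mu (src b') (stake n b') \<cdot> single S (wtg (stake m b) \<otimes>\<^bsub>S\<^esub> l) (sdrop n b')"
      using l nu_closed[OF wk] mu_closed[OF wk'] single_in_N[OF l assms(1)] nu_stake_single[OF assms(1) l, of m] mn
      by (simp add: act_mult)
    also have "\<dots> = single S (wt (stake n b') \<otimes>\<^bsub>S\<^esub> (wtg (stake m b) \<otimes>\<^bsub>S\<^esub> l)) b'"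
      using mu_single[OF tc_sdrop[OF assms(2)] _ wk', of "wtg (stake m b) \<otimes>\<^bsub>S\<^esub> l"] w l by (simp add: stake_sdrop)
    finally show ?thesis using w l by (simp add: S.m_assoc)
  qed
  moreover have "?a \<in> carrier L" using nu_closed[OF wk] mu_closed[OF wk'] by simp
  moreover have "wt (stake n b') \<otimes>\<^bsub>S\<^esub> wtg (stake m b) \<noteq> \<zero>\<^bsub>S\<^esub>" using w by (simp add: S.integral_iff)
  ultimately show ?thesis using w by (intro bexI[of _ ?a] bexI[of _ "wt (stake n b') \<otimes>\<^bsub>S\<^esub> wtg (stake m b)"]) auto
qed

text \<open>\<open>scal\<close> demands transitivity on the multiples of one basis element. It is a
  genuine condition, because vertices contribute only scalars from the image of \<open>K\<close>,
  and \<open>S\<close> may be larger; in the twisted case the powers of the cycle supply the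
  others.\<close>

lemma stream_module_simple:
  assumes "q \<in> tc p"
    and scal: "\<And>l l'. \<lbrakk>l \<in> carrier S; l \<noteq> \<zero>\<^bsub>S\<^esub>; l' \<in> carrier S\<rbrakk> \<Longrightarrow> \<exists>a\<in>carrier L. a \<cdot> single S l q = single S l' q"
  shows "simple_left_module L N"
proof (rule simple_criterion)
  show "tc p \<noteq> {}" using assms(1) by auto
next
  fix x assume x: "x \<in> carrier N" "x \<noteq> \<zero>\<^bsub>N\<^esub>"
  obtain b n where b: "b \<in> tc p" "x b \<noteq> \<zero>\<^bsub>S\<^esub>" "x b \<in> carrier S"
    "nu (src b) (stake n b) \<cdot> x = single S (wtg (stake n b) \<otimes>\<^bsub>S\<^esub> x b) (sdrop n b)"
    using isolate[OF x] by blast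
  note wk = walk_stake[OF tc_infinite[OF b(1)], of n]
  show "\<exists>a\<in>carrier L. \<exists>b\<in>tc p. \<exists>l\<in>carrier S. l \<noteq> \<zero>\<^bsub>S\<^esub> \<and> a \<cdot> x = single S l b"
    using wtg_closed[OF wk] b tc_sdrop[OF b(1)] nu_closed[OF wk]
    by (intro bexI[of _ "nu (src b) (stake n b)"] bexI[of _ "sdrop n b"] bexI[of _ "wtg (stake n b) \<otimes>\<^bsub>S\<^esub> x b"])
      (auto simp: S.integral_iff)
next
  fix b b' l l' assume a: "b \<in> tc p" "b' \<in> tc p" "l \<in> carrier S" "l \<noteq> \<zero>\<^bsub>S\<^esub>" "l' \<in> carrier S"
  obtain a1 f1 where 1: "a1 \<in> carrier L" "f1 \<in> carrier S" "f1 \<noteq> \<zero>\<^bsub>S\<^esub>"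
    "\<And>l. l \<in> carrier S \<Longrightarrow> a1 \<cdot> single S l b = single S (f1 \<otimes>\<^bsub>S\<^esub> l) q"
    using single_trans[OF a(1) assms(1)] by blast
  obtain a2 f2 where 2: "a2 \<in> carrier L" "f2 \<in> carrier S" "f2 \<noteq> \<zero>\<^bsub>S\<^esub>"
    "\<And>l. l \<in> carrier S \<Longrightarrow> a2 \<cdot> single S l q = single S (f2 \<otimes>\<^bsub>S\<^esub> l) b'"
    using single_trans[OF assms(1) a(2)] by blast
  have i: "inv\<^bsub>S\<^esub> f2 \<in> carrier S" "f2 \<otimes>\<^bsub>S\<^esub> inv\<^bsub>S\<^esub> f2 = \<one>\<^bsub>S\<^esub>" using 2 S.field_Units by auto
  obtain a3 where 3: "a3 \<in> carrier L" "a3 \<cdot> single S (f1 \<otimes>\<^bsub>S\<^esub> l) q = single S (inv\<^bsub>S\<^esub> f2 \<otimes>\<^bsub>S\<^esub> l') q"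
    using scal[of "f1 \<otimes>\<^bsub>S\<^esub> l" "inv\<^bsub>S\<^esub> f2 \<otimes>\<^bsub>S\<^esub> l'"] a 1 i by (auto simp: S.integral_iff)
  have "f2 \<otimes>\<^bsub>S\<^esub> (inv\<^bsub>S\<^esub> f2 \<otimes>\<^bsub>S\<^esub> l') = l'" using i 2 a by (simp add: S.m_assoc[symmetric])
  then have "(a2 \<bullet> (a3 \<bullet> a1)) \<cdot> single S l b = single S l' b'"
    using 1 2 3 a i single_in_N[OF a(3,1)] by (simp add: act_mult)
  then show "\<exists>a\<in>carrier L. a \<cdot> single S l b = single S l' b'"
    using 1 2 3 by (intro bexI[of _ "a2 \<bullet> (a3 \<bullet> a1)"]) auto
qed

lemma Y_eq: "Y = {src q | q. q \<in> tc p}"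
proof (intro subset_antisym subsetI)
  fix v assume "v \<in> Y"
  then have v: "v \<in> verts E" "\<not> (\<forall>x\<in>carrier N. ver v \<cdot> x = \<zero>\<^bsub>N\<^esub>)" by (auto simp: Y_def)
  show "v \<in> {src q | q. q \<in> tc p}"
  proof (rule ccontr)
    assume c: "v \<notin> {src q | q. q \<in> tc p}"
    have "ver v \<cdot> x = \<zero>\<^bsub>N\<^esub>" if "x \<in> carrier N" for x
      using that
    proof (induction x rule: N_induct)
      case (single x l b)
      then show ?case using v(1) c ver_single[of v b l] single_in_N[of l b] by (auto simp: M.smult_r_distr)
    qed (use v in simp)
    with v show False by blast
  qed
next
  fix v assume "v \<in> {src q | q. q \<in> tc p}"
  then obtain q where q: "q \<in> tc p" "v = src q" by blast
  then show "v \<in> Y"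
    using ver_single[of v q "\<one>\<^bsub>S\<^esub>"] src_verts[OF tc_infinite[OF q(1)]] single_in_N[of "\<one>\<^bsub>S\<^esub>" q]
    by (intro Y_I[of v "single S \<one>\<^bsub>S\<^esub> q"]) (auto simp: single_eq_zero)
qed

lemma edge_ghost_single:
  assumes "q \<in> tc p" "l \<in> carrier S" "e \<in> arcs E"
  shows "\<gamma> (Edge e) \<cdot> (\<gamma> (Ghost e) \<cdot> single S l q) = (if shd q = e then single S l q else \<zero>\<^bsub>N\<^esub>)"
proof (cases "shd q = e")
  case True
  have "head E e = src (stl q)" using infinite_path_shd[OF tc_infinite[OF assms(1)]] True by simp
  moreover have "\<chi> (Edge e) \<otimes>\<^bsub>S\<^esub> (\<chi> (Ghost e) \<otimes>\<^bsub>S\<^esub> l) = l"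
    using chi_inverse[OF assms(3)] chi_closed[of "Edge e"] chi_closed[of "Ghost e"] assms(2,3) by (simp add: S.m_assoc[symmetric])
  moreover have "e ## stl q = q" using True by (metis stream.collapse)
  ultimately show ?thesis
    using True assms tc_stl[OF assms(1)] chi_closed[of "Ghost e"] ghost_single[OF assms(3,1,2)]
      edge_single[OF assms(3) tc_stl[OF assms(1)], of "\<chi> (Ghost e) \<otimes>\<^bsub>S\<^esub> l"] by simp
qed (use assms ghost_single in simp)

end

section \<open>Uniqueness in the presence of exits\<close>

context leavitt_path
begin

text \<open>The bound n on the second path is the induction parameter of
  \<open>annihilator_subset\<close>; for n = 0 only combinations of paths ending in v
  remain.\<close>

definition PQ :: "'v \<Rightarrow> nat \<Rightarrow> ('v \<times> 'e list \<times> 'v \<times> 'e list) set" where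
  "PQ v n = {(u, p, b, q). \<exists>w. walk u p w \<and> walk b q w \<and> b = v \<and> length q \<le> n}"

lemma PQ_PP: "PQ v n \<subseteq> PP UNIV"
  by (auto simp: PQ_def PP_def)

lemma PQ_mono: "n \<le> n' \<Longrightarrow> PQ v n \<subseteq> PQ v n'"
  by (auto simp: PQ_def)

definition SQ :: "'v \<Rightarrow> nat \<Rightarrow> ('v, 'e, 'k) lpa_elt set" where
  "SQ v n = comb ` carrier (free_space K (PQ v n))"

lemma SQ_closed: "a \<in> SQ v n \<Longrightarrow> a \<in> carrier L"
  using comb_closed[OF PQ_PP] by (auto simp: SQ_def)

lemma SQ_zero: "\<zero>\<^bsub>L\<^esub> \<in> SQ v n"
  unfolding SQ_def by (rule image_eqI[of _ _ "\<lambda>t. \<zero>\<^bsub>K\<^esub>"]) (auto simp: comb_zero free_space_carrier_iff)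

lemma SQ_add: "a \<in> SQ v n \<Longrightarrow> b \<in> SQ v n \<Longrightarrow> a \<oplus>\<^bsub>L\<^esub> b \<in> SQ v n"
proof -
  assume "a \<in> SQ v n" "b \<in> SQ v n"
  then obtain x y where xy: "x \<in> carrier (free_space K (PQ v n))" "a = comb x"
    "y \<in> carrier (free_space K (PQ v n))" "b = comb y" by (auto simp: SQ_def)
  have "a \<oplus>\<^bsub>L\<^esub> b = comb (x \<oplus>\<^bsub>free_space K (PQ v n)\<^esub> y)"
    using comb_add[OF PQ_PP xy(1,3)] xy by (simp only:)
  moreover have "x \<oplus>\<^bsub>free_space K (PQ v n)\<^esub> y \<in> carrier (free_space K (PQ v n))"
    by (rule abelian_groupE(1)[OF module.axioms(2)[OF K.free_space_module] xy(1,3)])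
  ultimately show ?thesis unfolding SQ_def by (rule image_eqI)
qed

lemma SQ_mon: "t \<in> PQ v n \<Longrightarrow> k \<in> carrier K \<Longrightarrow> k \<odot>\<^bsub>L\<^esub> mon t \<in> SQ v n"
  unfolding SQ_def using comb_single[OF subsetD[OF PQ_PP]] K.single_carrier by (metis imageI)

lemma SQ_induct [consumes 1, case_names zero add]:
  assumes "a \<in> SQ v n" "Q \<zero>\<^bsub>L\<^esub>"
    and "\<And>a k t. \<lbrakk>a \<in> SQ v n; k \<in> carrier K; t \<in> PQ v n; Q a\<rbrakk> \<Longrightarrow> Q (a \<oplus>\<^bsub>L\<^esub> k \<odot>\<^bsub>L\<^esub> mon t)"
  shows "Q a"
proof -
  obtain x where x: "x \<in> carrier (free_space K (PQ v n))" "a = comb x" using assms(1) by (auto simp: SQ_def)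
  have "comb x \<in> SQ v n \<and> Q (comb x)"
    using PQ_PP x(1)
  proof (induction x rule: comb_induct)
    case (add a k t)
    then show ?case using assms(3)[of a k t] SQ_add SQ_mon by blast
  qed (use assms SQ_zero in auto)
  with x show ?thesis by simp
qed

lemma SQ_right_vertex: "a \<in> SQ v n \<Longrightarrow> v \<in> verts E \<Longrightarrow> a \<bullet> \<gamma> (Vertex v) = a"
proof (induction a rule: SQ_induct)
  case (add a k t)
  obtain u p q w where t: "t = (u, p, v, q)" "walk u p w" "walk v q w"
    using add(3) by (auto simp: PQ_def)
  then have "mon t \<bullet> \<gamma> (Vertex v) = mon t" "mon t \<in> carrier L"
    using add(5) by (simp_all add: mon_def L.mult_assoc nu_vertex)
  then show ?case using add SQ_closed[OF add(1)] by (simp add: L.mult_l_distr L.smult_mult)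
qed simp

lemma SQ_vertex:
  assumes "a \<in> carrier L" "v \<in> verts E"
  shows "\<exists>n. a \<bullet> \<gamma> (Vertex v) \<in> SQ v n"
  using assms(1)
proof (induction a rule: mon_induct)
  case zero
  then show ?case using SQ_zero assms(2) by auto
next
  case (add a b)
  then obtain n n' where "a \<bullet> \<gamma> (Vertex v) \<in> SQ v n" "b \<bullet> \<gamma> (Vertex v) \<in> SQ v n'" by blast
  then have "a \<bullet> \<gamma> (Vertex v) \<in> SQ v (max n n')" "b \<bullet> \<gamma> (Vertex v) \<in> SQ v (max n n')"
    using PQ_mono[of n "max n n'" v] PQ_mono[of n' "max n n'" v] unfolding SQ_def
    by (auto simp: free_space_carrier_iff) (blast+)?
  from SQ_add[OF this] show ?case using add(1,2) assms(2) by (auto simp: L.mult_l_distr)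
next
  case (mon k u p u' q w)
  then have eq: "(k \<odot>\<^bsub>L\<^esub> (mu u p \<bullet> nu u' q)) \<bullet> \<gamma> (Vertex v) =
      (if v = u' then k \<odot>\<^bsub>L\<^esub> mon (u, p, u', q) else \<zero>\<^bsub>L\<^esub>)"
    using assms(2) by (simp add: L.smult_mult L.mult_assoc nu_vertex mon_def L.smult_r_null)
  show ?case
  proof (cases "v = u'")
    case True
    then have "(u, p, u', q) \<in> PQ v (length q)" using mon by (auto simp: PQ_def)
    from SQ_mon[OF this mon(1)] show ?thesis unfolding eq using True by auto
  qed (use eq SQ_zero in auto)
qed

text \<open>The edge cancels the first edge of the second path. If that path is empty, the edge is
  appended to the first path, whose length is not bounded.\<close>

lemma SQ_edge:
  assumes "a \<in> SQ v (Suc n)" "e \<in> arcs E" "tail E e = v"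
  shows "a \<bullet> \<gamma> (Edge e) \<in> SQ (head E e) n"
  using assms(1)
proof (induction a rule: SQ_induct)
  case zero
  then show ?case using SQ_zero assms(2) by auto
next
  case (add a k t)
  obtain u p q w where t: "t = (u, p, v, q)" "walk u p w" "walk v q w" "length q \<le> Suc n"
    using add(3) by (auto simp: PQ_def)
  have mt: "mon t \<in> carrier L" using add(3) PQ_PP mon_closed by blast
  have "mon t \<bullet> \<gamma> (Edge e) \<in> insert \<zero>\<^bsub>L\<^esub> (mon ` PQ (head E e) n)"
  proof (cases q)
    case Nil
    then have w: "w = v" using t by simp
    have wk: "walk u (p @ [e]) (head E e)" using t(2) w assms by (auto simp: walk_append ends_in_verts)
    have "mon t \<bullet> \<gamma> (Edge e) = mu u p \<bullet> \<gamma> (Edge e)"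
      using t Nil w assms by (simp add: mon_def mu_vertex)
    also have "\<dots> = mu u (p @ [e])"
      using mu_append[OF t(2), of "[e]" "head E e"] w assms by (simp add: ends_in_verts edge_head)
    also have "\<dots> = mon (u, p @ [e], head E e, [])"
      using mu_vertex[OF wk] by (simp add: mon_def)
    finally show ?thesis using wk assms(2) by (auto simp: PQ_def ends_in_verts)
  next
    case (Cons f q')
    then have f: "f \<in> arcs E" "tail E f = v" "walk (head E f) q' w" using t by auto
    have "mon t \<bullet> \<gamma> (Edge e) = mu u p \<bullet> (nu (head E f) q' \<bullet> (\<gamma> (Ghost f) \<bullet> \<gamma> (Edge e)))"
      using t Cons f assms mu_closed[OF t(2)] nu_closed[OF f(3)] by (simp add: mon_def L.mult_assoc)
    also have "\<dots> = (if f = e then mon (u, p, head E e, q') else \<zero>\<^bsub>L\<^esub>)"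
      using f assms nu_closed[OF f(3)] mu_closed[OF t(2)] nu_vertex[OF f(3), of "head E f"]
      by (auto simp: ghost_edge mon_def ends_in_verts)
    finally show ?thesis using t f Cons by (auto simp: PQ_def)
  qed
  then have "k \<odot>\<^bsub>L\<^esub> (mon t \<bullet> \<gamma> (Edge e)) \<in> SQ (head E e) n"
    using SQ_mon[of _ "head E e" n k] SQ_zero add(2) by (auto simp: L.smult_r_null)
  then show ?case using add mt assms(2) SQ_add SQ_closed[OF add(1)]
    by (simp add: L.mult_l_distr L.smult_mult)
qed

text \<open>
  This lowers the bound \<open>n\<close> on the lengths of the ghost paths: multiplying \<open>a1\<close> by an edge
  shortens them, and \<open>a1\<close> is recovered from finitely many such products.
\<close>

lemma SQ_split:
  assumes "a \<in> SQ v n" "v \<in> verts E"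
  shows "\<exists>x a1 F. x \<in> carrier (free_space K (PQ v 0)) \<and> a1 \<in> carrier L \<and> finite F \<and> F \<subseteq> out_arcs E v \<and>
    a = comb x \<oplus>\<^bsub>L\<^esub> a1 \<and> (\<forall>e\<in>out_arcs E v - F. a1 \<bullet> \<gamma> (Edge e) = \<zero>\<^bsub>L\<^esub>) \<and>
    (\<forall>F'. finite F' \<longrightarrow> F \<subseteq> F' \<longrightarrow> F' \<subseteq> out_arcs E v \<longrightarrow>
      a1 = (\<Oplus>\<^bsub>L\<^esub>e\<in>F'. (a1 \<bullet> \<gamma> (Edge e)) \<bullet> \<gamma> (Ghost e)))"
  using assms(1)
proof (induction a rule: SQ_induct)
  case zero
  have "\<zero>\<^bsub>L\<^esub> = (\<Oplus>\<^bsub>L\<^esub>e\<in>F'. (\<zero>\<^bsub>L\<^esub> \<bullet> \<gamma> (Edge e)) \<bullet> \<gamma> (Ghost e))" if "F' \<subseteq> out_arcs E v" for F'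
  proof -
    have "(\<Oplus>\<^bsub>L\<^esub>e\<in>F'. (\<zero>\<^bsub>L\<^esub> \<bullet> \<gamma> (Edge e)) \<bullet> \<gamma> (Ghost e)) = (\<Oplus>\<^bsub>L\<^esub>e\<in>F'. \<zero>\<^bsub>L\<^esub>)"
      by (rule L.M.finsum_cong') (use that in auto)
    then show ?thesis by simp
  qed
  then show ?case
    by (intro exI[of _ "\<lambda>t. \<zero>\<^bsub>K\<^esub>"] exI[of _ "\<zero>\<^bsub>L\<^esub>"] exI[of _ "{}"])
      (auto simp: free_space_carrier_iff comb_zero)
next
  case (add a k t)
  from add(4) obtain x a1 F where IH: "x \<in> carrier (free_space K (PQ v 0))" "a1 \<in> carrier L" "finite F" "F \<subseteq> out_arcs E v"
    "a = comb x \<oplus>\<^bsub>L\<^esub> a1" "\<forall>e\<in>out_arcs E v - F. a1 \<bullet> \<gamma> (Edge e) = \<zero>\<^bsub>L\<^esub>"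
    "\<forall>F'. finite F' \<longrightarrow> F \<subseteq> F' \<longrightarrow> F' \<subseteq> out_arcs E v \<longrightarrow>
      a1 = (\<Oplus>\<^bsub>L\<^esub>e\<in>F'. (a1 \<bullet> \<gamma> (Edge e)) \<bullet> \<gamma> (Ghost e))"
    by (elim exE conjE) (rule that)
  obtain u p q w where t: "t = (u, p, v, q)" "walk u p w" "walk v q w"
    using add(3) by (auto simp: PQ_def)
  have mt: "mon t \<in> carrier L" using add(3) PQ_PP mon_closed by blast
  have cx: "comb x \<in> carrier L" using comb_closed[OF PQ_PP IH(1)] .
  show ?case
  proof (cases q)
    case Nil
    then have t0: "t \<in> PQ v 0" using t by (auto simp: PQ_def)
    let ?x = "x \<oplus>\<^bsub>free_space K (PQ v 0)\<^esub> single K k t"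
    have s: "single K k t \<in> carrier (free_space K (PQ v 0))" using add(2) t0 by (rule K.single_carrier)
    have "?x \<in> carrier (free_space K (PQ v 0))"
      by (rule abelian_groupE(1)[OF module.axioms(2)[OF K.free_space_module] IH(1) s])
    moreover have "comb ?x = comb x \<oplus>\<^bsub>L\<^esub> k \<odot>\<^bsub>L\<^esub> mon t"
      using comb_add[OF PQ_PP IH(1) s] comb_single[OF subsetD[OF PQ_PP t0] add(2)] by (simp only:)
    then have "a \<oplus>\<^bsub>L\<^esub> k \<odot>\<^bsub>L\<^esub> mon t = comb ?x \<oplus>\<^bsub>L\<^esub> a1"
      using IH(2,5) cx mt add(2) by (simp add: L.M.a_ac)
    ultimately show ?thesis
      by (intro exI[of _ ?x] exI[of _ a1] exI[of _ F] conjI IH(2,3,4,6,7))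
  next
    case (Cons f q')
    then have f: "f \<in> arcs E" "tail E f = v" "walk (head E f) q' w" using t by auto
    \<comment> \<open>The sum formula is claimed for every finite \<open>F'\<close> above
      \<open>F\<close> so that the induction can enlarge \<open>F\<close> by the edge
      \<open>f\<close>.\<close>
    let ?a = "a1 \<oplus>\<^bsub>L\<^esub> k \<odot>\<^bsub>L\<^esub> mon t" and ?F = "insert f F"
    have kt: "k \<odot>\<^bsub>L\<^esub> mon t \<in> carrier L" using mt add(2) by simp
    have mte: "mon t \<bullet> \<gamma> (Edge e) = (if f = e then mu u p \<bullet> nu (head E f) q' else \<zero>\<^bsub>L\<^esub>)" if "e \<in> arcs E" for e
    proof -
      have "mon t \<bullet> \<gamma> (Edge e) = mu u p \<bullet> (nu (head E f) q' \<bullet> (\<gamma> (Ghost f) \<bullet> \<gamma> (Edge e)))"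
        using t Cons f that mu_closed[OF t(2)] nu_closed[OF f(3)] by (simp add: mon_def L.mult_assoc)
      then show ?thesis
        using f that nu_closed[OF f(3)] mu_closed[OF t(2)] nu_vertex[OF f(3), of "head E f"]
        by (auto simp: ghost_edge ends_in_verts)
    qed
    have mtee: "(mon t \<bullet> \<gamma> (Edge e)) \<bullet> \<gamma> (Ghost e) = (if f = e then mon t else \<zero>\<^bsub>L\<^esub>)" if "e \<in> arcs E" for e
      using that mte[OF that] t Cons f mu_closed[OF t(2)] nu_closed[OF f(3)] by (auto simp: mon_def L.mult_assoc)
    have "a \<oplus>\<^bsub>L\<^esub> k \<odot>\<^bsub>L\<^esub> mon t = comb x \<oplus>\<^bsub>L\<^esub> ?a"
      using IH(2,5) cx kt by (simp add: L.M.a_assoc)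
    moreover have "?a \<in> carrier L" "finite ?F" "?F \<subseteq> out_arcs E v" using IH kt f by auto
    moreover have "?a \<bullet> \<gamma> (Edge e) = \<zero>\<^bsub>L\<^esub>" if "e \<in> out_arcs E v - ?F" for e
      using that IH(2) bspec[OF IH(6), of e] kt mt mte[of e] add(2) by (auto simp: L.mult_l_distr L.smult_mult L.smult_r_null)
    moreover have "?a = (\<Oplus>\<^bsub>L\<^esub>e\<in>F'. (?a \<bullet> \<gamma> (Edge e)) \<bullet> \<gamma> (Ghost e))"
      if F': "finite F'" "?F \<subseteq> F'" "F' \<subseteq> out_arcs E v" for F'
    proof -
      have ar: "e \<in> arcs E" if "e \<in> F'" for e using F'(3) that by auto
      have "(\<Oplus>\<^bsub>L\<^esub>e\<in>F'. (?a \<bullet> \<gamma> (Edge e)) \<bullet> \<gamma> (Ghost e)) =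
        (\<Oplus>\<^bsub>L\<^esub>e\<in>F'. (a1 \<bullet> \<gamma> (Edge e)) \<bullet> \<gamma> (Ghost e) \<oplus>\<^bsub>L\<^esub> (if f = e then k \<odot>\<^bsub>L\<^esub> mon t else \<zero>\<^bsub>L\<^esub>))"
        using ar IH(2) kt mt add(2)
        by (intro L.M.finsum_cong') (auto simp: L.mult_l_distr L.smult_mult mtee L.smult_r_null)
      also have "\<dots> = (\<Oplus>\<^bsub>L\<^esub>e\<in>F'. (a1 \<bullet> \<gamma> (Edge e)) \<bullet> \<gamma> (Ghost e)) \<oplus>\<^bsub>L\<^esub> (\<Oplus>\<^bsub>L\<^esub>e\<in>F'. if f = e then k \<odot>\<^bsub>L\<^esub> mon t else \<zero>\<^bsub>L\<^esub>)"
        using ar IH(2) kt by (intro L.M.finsum_addf) auto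
      also have "(\<Oplus>\<^bsub>L\<^esub>e\<in>F'. (a1 \<bullet> \<gamma> (Edge e)) \<bullet> \<gamma> (Ghost e)) = a1" using IH(7) F' by simp
      also have "(\<Oplus>\<^bsub>L\<^esub>e\<in>F'. if f = e then k \<odot>\<^bsub>L\<^esub> mon t else \<zero>\<^bsub>L\<^esub>) = k \<odot>\<^bsub>L\<^esub> mon t"
        using L.M.finsum_singleton[of f F' "\<lambda>_. k \<odot>\<^bsub>L\<^esub> mon t"] F' kt by auto
      finally show ?thesis by simp
    qed
    ultimately show ?thesis using IH(1)
      by (intro exI[of _ x] exI[of _ ?a] exI[of _ ?F]) (intro conjI ballI allI impI; simp only:)
  qed
qed

end

text \<open>
  The equation \<open>\<delta> @ \<eta> = \<eta> @ r\<close> says that \<open>\<eta>\<close> is an initial segment of the infinite path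
  \<open>\<delta>\<delta>\<delta>\<dots>\<close>.
\<close>

definition (in leavitt_path) exits :: "'v set \<Rightarrow> bool" where
  "exits Y0 \<longleftrightarrow> (\<forall>w\<in>Y0. \<forall>n. \<exists>\<eta> z. walk w \<eta> z \<and> z \<in> Y0 \<and>
     (\<forall>\<delta>. walk w \<delta> w \<longrightarrow> \<delta> \<noteq> [] \<longrightarrow> length \<delta> \<le> n \<longrightarrow> \<not> (\<exists>r. \<delta> @ \<eta> = \<eta> @ r)))"

section \<open>Combinations of paths act faithfully\<close>

context lpa_module
begin

lemma smult_ver_faithful:
  assumes "z \<in> Y" "k \<in> carrier K" "\<And>m. m \<in> carrier M \<Longrightarrow> (k \<odot>\<^bsub>L\<^esub> ver z) \<cdot> m = \<zero>\<^bsub>M\<^esub>"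
  shows "k = \<zero>\<^bsub>K\<^esub>"
proof (rule ccontr)
  assume "k \<noteq> \<zero>\<^bsub>K\<^esub>"
  then have k: "inv\<^bsub>K\<^esub> k \<in> carrier K" "inv\<^bsub>K\<^esub> k \<otimes>\<^bsub>K\<^esub> k = \<one>\<^bsub>K\<^esub>" "k \<otimes>\<^bsub>K\<^esub> inv\<^bsub>K\<^esub> k = \<one>\<^bsub>K\<^esub>" using K.field_Units assms(2) by auto
  obtain m where m: "m \<in> carrier M" "ver z \<cdot> m \<noteq> \<zero>\<^bsub>M\<^esub>" using assms(1) by (auto simp: Y_def)
  have z: "z \<in> verts E" using assms(1) by (rule Y_verts)
  have "ver z = (inv\<^bsub>K\<^esub> k \<odot>\<^bsub>L\<^esub> ver z) \<bullet> (k \<odot>\<^bsub>L\<^esub> ver z)"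
    using k z assms(2) by (simp add: L.smult_mult L.mult_smult vertex_mult L.smult_assoc1[symmetric])
  then have "ver z \<cdot> m = (inv\<^bsub>K\<^esub> k \<odot>\<^bsub>L\<^esub> ver z) \<cdot> ((k \<odot>\<^bsub>L\<^esub> ver z) \<cdot> m)"
    using k z assms(2) m(1) by (metis L.smult_closed act_mult ver_closed)
  then show False using assms(3)[OF m(1)] m k z by simp
qed

text \<open>Let p be a shortest path in the support. Its ghost on the left turns p into the vertex
  v, each extension of p into a closed path s at v, and the other terms into 0. Now put R = r \<eta>
  on the right and its ghost on the left, with \<eta> from the exit condition for the maximal length
  in the support. Since R is not an initial segment of s R, every s disappears. The coefficient of p
  times the vertex z remains, and z acts faithfully up to scalars.\<close>

lemma pure_faithful:
  assumes ex: "exits Y" and x: "x \<in> carrier (free_space K (PQ v 0))" "x t0 \<noteq> \<zero>\<^bsub>K\<^esub>"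
    and r: "walk v r w" "w \<in> Y"
    and kills: "\<And>m. m \<in> carrier M \<Longrightarrow> (comb x \<bullet> mu v r) \<cdot> m = \<zero>\<^bsub>M\<^esub>"
  shows False
proof -
  let ?T = "{t. x t \<noteq> \<zero>\<^bsub>K\<^esub>}"
  let ?len = "\<lambda>t :: 'v \<times> 'e list \<times> 'v \<times> 'e list. length (fst (snd t))"
  have T: "finite ?T" "?T \<subseteq> PQ v 0" and xc: "\<And>t. x t \<in> carrier K" using x(1) by (auto simp: free_space_carrier_iff)
  have xT: "x \<in> carrier (free_space K ?T)" using x(1) by (auto simp: free_space_carrier_iff)
  have v: "v \<in> verts E" using r walk_verts by blast
  have form: "\<exists>u p. t = (u, p, v, []) \<and> walk u p v" if "t \<in> PQ v 0" for t using that by (auto simp: PQ_def)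
  obtain n where n: "\<And>t. t \<in> ?T \<Longrightarrow> ?len t \<le> n"
    using T(1) finite_nat_set_iff_bounded_le[of "?len ` ?T"] by blast
  define t1 where "t1 = (ARG_MIN ?len t. x t \<noteq> \<zero>\<^bsub>K\<^esub>)"
  have t1: "x t1 \<noteq> \<zero>\<^bsub>K\<^esub>" unfolding t1_def by (rule arg_min_natI[of _ t0]) (rule x(2))
  have t1min: "?len t1 \<le> ?len t" if "x t \<noteq> \<zero>\<^bsub>K\<^esub>" for t unfolding t1_def using that by (rule arg_min_nat_le)
  obtain u p where up: "t1 = (u, p, v, [])" "walk u p v" using form t1 T(2) by blast
  obtain \<eta> z where \<eta>: "walk w \<eta> z" "z \<in> Y"
    "\<And>\<delta>. \<lbrakk>walk w \<delta> w; \<delta> \<noteq> []; length \<delta> \<le> n\<rbrakk> \<Longrightarrow> \<not> (\<exists>r. \<delta> @ \<eta> = \<eta> @ r)"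
    using ex r(2) unfolding exits_def by meson
  let ?R = "r @ \<eta>"
  have R: "walk v ?R z" using r \<eta> by (auto simp: walk_append)
  note c = nu_closed[OF R] mu_closed[OF R] nu_closed[OF up(2)] mu_closed[OF r(1)] mu_closed[OF \<eta>(1)]
  have z: "z \<in> verts E" using \<eta>(2) by (rule Y_verts)
  have single: "nu v ?R \<bullet> ((nu u p \<bullet> mon t) \<bullet> mu v ?R) = (if t = t1 then ver z else \<zero>\<^bsub>L\<^esub>)" if tT: "t \<in> ?T" for t
  proof -
    obtain u' p' where t: "t = (u', p', v, [])" "walk u' p' v" using form tT T(2) by blast
    have le: "length p \<le> length p'" "length p' \<le> n" using t1min[of t] n[OF tT] tT t up by auto
    have mt: "mon t = mu u' p'" using t by (simp add: mon_def mu_vertex)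
    consider (same) "t = t1" | (ext) s where "u = u'" "p' = p @ s" "s \<noteq> []" "walk v s v" "nu u p \<bullet> mu u' p' = mu v s"
      | (no) "t \<noteq> t1" "nu u p \<bullet> mu u' p' = \<zero>\<^bsub>L\<^esub>"
      using nu_mu_cases[OF up(2) t(2)] le t up by (cases "p' = p \<and> u = u'") auto
    then show ?thesis
    proof cases
      case same
      then have "nu u p \<bullet> mon t = ver v" using t up mt nu_mu_same[OF up(2)] by simp
      then show ?thesis using same vertex_mu[OF R v] nu_mu_same[OF R] by simp
    next
      case ext
      have sR: "walk v (s @ ?R) z" using ext(4) R by (auto simp: walk_append)
      have "\<not> (\<exists>y. s @ ?R = ?R @ y)"
      proof
        assume "\<exists>y. s @ ?R = ?R @ y"
        then obtain y where y: "s @ r @ \<eta> = r @ \<eta> @ y" by auto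
        \<comment> \<open>The exit condition concerns closed paths at w, whereas s is closed at v.
          If s R started with R, then s r = r \<delta>, with \<delta> closed at w and as long as
          s.\<close>
        define \<delta> where "\<delta> = drop (length r) (s @ r)"
        have "take (length r) (s @ r @ \<eta>) = r" unfolding y by simp
        then have "take (length r) (s @ r) = r" by simp
        then have sr: "s @ r = r @ \<delta>" unfolding \<delta>_def by (metis append_take_drop_id)
        have "r @ \<delta> @ \<eta> = r @ \<eta> @ y" using y sr by (metis append.assoc)
        then have pre: "\<delta> @ \<eta> = \<eta> @ y" by simp
        have "walk v (r @ \<delta>) w" unfolding sr[symmetric] using ext(4) r(1) by (auto simp: walk_append)
        then have "walk w \<delta> w" using walk_unique[OF r(1)] by (auto simp: walk_append)
        moreover have "length \<delta> = length s" using arg_cong[OF sr, of length] by simp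
        moreover from this have "\<delta> \<noteq> []" using ext(3) by (metis length_0_conv)
        ultimately show False using \<eta>(3)[of \<delta>] pre ext(2) le by auto
      qed
      then have "nu v ?R \<bullet> mu v (s @ ?R) = \<zero>\<^bsub>L\<^esub>"
        using nu_mu_cases[OF R sR] ext(3) by (auto dest: arg_cong[of _ _ length])
      moreover have "mu v (s @ ?R) = mu v s \<bullet> mu v ?R" by (rule mu_append[OF ext(4) R])
      moreover have "t \<noteq> t1" using ext t up by auto
      ultimately show ?thesis unfolding mt ext(5) by simp
    next
      case no
      then show ?thesis unfolding mt using c by simp
    qed
  qed
  have "nu v ?R \<bullet> ((nu u p \<bullet> comb x) \<bullet> mu v ?R) = x t1 \<odot>\<^bsub>L\<^esub> ver z"
  proof (rule K.additive_ext[where B = ?T and M = L and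
        f = "\<lambda>x. nu v ?R \<bullet> ((nu u p \<bullet> comb x) \<bullet> mu v ?R)" and g = "\<lambda>x. x t1 \<odot>\<^bsub>L\<^esub> ver z"])
    have sub: "?T \<subseteq> PP UNIV" using T(2) PQ_PP by blast
    note ab = module.axioms(2)[OF K.free_space_module, of ?T] L.abelian_group_A
    show "abelian_group_hom (free_space K ?T) L (\<lambda>x. nu v ?R \<bullet> ((nu u p \<bullet> comb x) \<bullet> mu v ?R))"
      using c by (intro abelian_group_homI'[OF ab])
        (simp_all only: L.mult_closed comb_closed[OF sub] comb_add[OF sub] L.mult_r_distr L.mult_l_distr)
    show "abelian_group_hom (free_space K ?T) L (\<lambda>x. x t1 \<odot>\<^bsub>L\<^esub> ver z)"
      using z by (intro abelian_group_homI'[OF ab]) (auto simp: free_space_carrier_iff L.smult_l_distr simp del: split_paired_All)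
    show "x \<in> carrier (free_space K ?T)" by (rule xT)
    fix k t assume kt: "k \<in> carrier K" "t \<in> ?T"
    have tc: "comb (single K k t) = k \<odot>\<^bsub>L\<^esub> mon t" "mon t \<in> carrier L"
      using comb_single[of t UNIV k] mon_closed[of t UNIV] sub kt by auto
    have "nu v ?R \<bullet> ((nu u p \<bullet> comb (single K k t)) \<bullet> mu v ?R) =
        k \<odot>\<^bsub>L\<^esub> (nu v ?R \<bullet> ((nu u p \<bullet> mon t) \<bullet> mu v ?R))"
      unfolding tc(1) using c kt(1) tc(2) by (simp add: L.mult_smult L.smult_mult)
    also have "\<dots> = single K k t t1 \<odot>\<^bsub>L\<^esub> ver z"
      unfolding single[OF kt(2)] using kt(1) z by (auto simp: single_def L.smult_r_null)
    finally show "nu v ?R \<bullet> ((nu u p \<bullet> comb (single K k t)) \<bullet> mu v ?R) = single K k t t1 \<odot>\<^bsub>L\<^esub> ver z" .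
  qed
  moreover have "(nu v ?R \<bullet> ((nu u p \<bullet> comb x) \<bullet> mu v ?R)) \<cdot> m = \<zero>\<^bsub>M\<^esub>" if m: "m \<in> carrier M" for m
  proof -
    have cx: "comb x \<in> carrier L" by (rule comb_closed[OF PQ_PP x(1)])
    have "(nu u p \<bullet> comb x) \<bullet> mu v ?R = nu u p \<bullet> ((comb x \<bullet> mu v r) \<bullet> mu w \<eta>)"
      using c cx mu_append[OF r(1) \<eta>(1)] by (simp add: L.mult_assoc)
    then show ?thesis using c cx m kills[of "mu w \<eta> \<cdot> m"] by (simp add: act_mult del: L.mult_assoc)
  qed
  ultimately have "x t1 = \<zero>\<^bsub>K\<^esub>" using smult_ver_faithful[OF \<eta>(2) xc] by simp
  with t1 show False by simp
qed

text \<open>The sum relation of the graph restricted to \<open>Y\<close>, imposed on the module. It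
  includes the empty sum: a vertex of \<open>Y\<close> with no edge into \<open>Y\<close> would act
  as 0, which is how \<open>expands_edge\<close> arises.\<close>

definition expands :: bool where
  "expands \<longleftrightarrow> (\<forall>v\<in>Y. finite {e \<in> out_arcs E v. head E e \<in> Y} \<longrightarrow>
     (\<forall>m\<in>carrier M. ver v \<cdot> m = (\<Oplus>\<^bsub>M\<^esub>e\<in>{e \<in> out_arcs E v. head E e \<in> Y}. \<gamma> (Edge e) \<cdot> (\<gamma> (Ghost e) \<cdot> m))))"

end

text \<open>Induction on the length of the ghost paths in a. The products of a with edges e at v
  have shorter ones and kill \<open>N\<close> by induction, so a has to be recovered from them. If v
  has finitely many edges into \<open>Y0\<close>, \<open>expands\<close> writes v on
  \<open>N\<close> as a sum over these edges. If it has infinitely many,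
  \<open>pure_faithful\<close> removes the part of a without ghost edges, and the rest is a finite
  sum of products a e e*.\<close>

lemma annihilator_subset:
  assumes "lpa_module K E M" "lpa_simple K E N"
    and Y: "lpa_module.Y K E M = Y0" "lpa_module.Y K E N = Y0"
    and expN: "lpa_module.expands K E N"
    and ex: "leavitt_path.exits E Y0"
    and a: "a \<in> annihilator (lpa K E) M"
  shows "a \<in> annihilator (lpa K E) N"
proof -
  interpret M: lpa_module K E M by fact
  interpret N: lpa_simple K E N by fact
  have exY: "M.exits M.Y" using ex Y by simp
  have main: "\<forall>y\<in>carrier N. a \<odot>\<^bsub>N\<^esub> y = \<zero>\<^bsub>N\<^esub>"
    if "a \<in> M.SQ v n" "v \<in> verts E" "\<forall>m\<in>carrier M. a \<odot>\<^bsub>M\<^esub> m = \<zero>\<^bsub>M\<^esub>" for a v n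
    using that
  proof (induction n arbitrary: a v)
    case 0
    have aL: "a \<in> carrier (lpa K E)" using 0(1) by (rule M.SQ_closed)
    obtain x where x: "x \<in> carrier (free_space K (M.PQ v 0))" "a = M.comb x" using 0(1) by (auto simp: M.SQ_def)
    show ?case
    proof (cases "v \<in> Y0")
      case True
      have "x t = \<zero>\<^bsub>K\<^esub>" for t
      proof (rule ccontr)
        assume nz: "x t \<noteq> \<zero>\<^bsub>K\<^esub>"
        show False
        proof (rule M.pure_faithful[OF exY x(1) nz, of "[]" v])
          show "v \<in> M.Y" "M.walk v [] v" using True Y 0(2) by auto
          fix m assume "m \<in> carrier M"
          then show "(M.comb x \<otimes>\<^bsub>lpa K E\<^esub> M.mu v []) \<odot>\<^bsub>M\<^esub> m = \<zero>\<^bsub>M\<^esub>"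
            using 0(2,3) x(2) aL by (simp add: M.act_mult)
        qed
      qed
      then have "x = (\<lambda>t. \<zero>\<^bsub>K\<^esub>)" by auto
      then show ?thesis using x M.comb_zero by simp
    next
      case False
      have "a \<odot>\<^bsub>N\<^esub> y = \<zero>\<^bsub>N\<^esub>" if "y \<in> carrier N" for y
      proof -
        have "a \<odot>\<^bsub>N\<^esub> y = (a \<otimes>\<^bsub>lpa K E\<^esub> M.ver v) \<odot>\<^bsub>N\<^esub> y" using M.SQ_right_vertex[OF 0(1,2)] by simp
        then show ?thesis using N.not_Y[OF 0(2) _ that] False Y aL 0(2) that by (simp add: N.act_mult)
      qed
      then show ?thesis by blast
    qed
  next
    case (Suc n)
    have aL: "a \<in> carrier (lpa K E)" using Suc.prems(1) by (rule M.SQ_closed)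
    note av = M.SQ_right_vertex[OF Suc.prems(1,2)]
    have ae: "(a \<otimes>\<^bsub>lpa K E\<^esub> M.\<gamma> (Edge e)) \<odot>\<^bsub>N\<^esub> y = \<zero>\<^bsub>N\<^esub>" if "e \<in> out_arcs E v" "y \<in> carrier N" for e y
    proof -
      have e: "e \<in> arcs E" "tail E e = v" using that(1) by auto
      have "\<forall>m\<in>carrier M. (a \<otimes>\<^bsub>lpa K E\<^esub> M.\<gamma> (Edge e)) \<odot>\<^bsub>M\<^esub> m = \<zero>\<^bsub>M\<^esub>"
        using Suc.prems(3) aL e by (simp add: M.act_mult M.ghost_closed)
      from Suc.IH[OF M.SQ_edge[OF Suc.prems(1) e] _ this] show ?thesis
        using that(2) e by (simp add: M.ends_in_verts)
    qed
    let ?Z = "{e \<in> out_arcs E v. head E e \<in> Y0}"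
    have av_act: "a \<odot>\<^bsub>N\<^esub> y = a \<odot>\<^bsub>N\<^esub> (M.ver v \<odot>\<^bsub>N\<^esub> y)" if "y \<in> carrier N" for y
      using av aL that Suc.prems(2) by (metis N.act_mult M.ver_closed)
    consider (out) "v \<notin> Y0" | (fin) "v \<in> Y0" "finite ?Z" | (inf) "v \<in> Y0" "infinite ?Z" by blast
    then show ?case
    proof cases
      case out
      then show ?thesis using av_act N.not_Y[OF Suc.prems(2)] Y aL by simp
    next
      case fin
      have "a \<odot>\<^bsub>N\<^esub> y = \<zero>\<^bsub>N\<^esub>" if y: "y \<in> carrier N" for y
      proof -
        have "M.ver v \<odot>\<^bsub>N\<^esub> y = (\<Oplus>\<^bsub>N\<^esub>e\<in>?Z. M.\<gamma> (Edge e) \<odot>\<^bsub>N\<^esub> (M.\<gamma> (Ghost e) \<odot>\<^bsub>N\<^esub> y))"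
          using expN fin y Y(2) unfolding N.expands_def by blast
        then have "a \<odot>\<^bsub>N\<^esub> y = a \<odot>\<^bsub>N\<^esub> (\<Oplus>\<^bsub>N\<^esub>e\<in>?Z. M.\<gamma> (Edge e) \<odot>\<^bsub>N\<^esub> (M.\<gamma> (Ghost e) \<odot>\<^bsub>N\<^esub> y))"
          using av_act[OF y] by simp
        also have "\<dots> = (\<Oplus>\<^bsub>N\<^esub>e\<in>?Z. a \<odot>\<^bsub>N\<^esub> (M.\<gamma> (Edge e) \<odot>\<^bsub>N\<^esub> (M.\<gamma> (Ghost e) \<odot>\<^bsub>N\<^esub> y)))"
          by (rule hom_finsum[OF N.M.act_r_hom[OF aL]]) (use y N.ghost_closed in auto)
        also have "\<dots> = (\<Oplus>\<^bsub>N\<^esub>e\<in>?Z. \<zero>\<^bsub>N\<^esub>)"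
        proof (rule N.M.finsum_cong')
          fix e assume e: "e \<in> ?Z"
          then have "M.\<gamma> (Ghost e) \<odot>\<^bsub>N\<^esub> y \<in> carrier N" using y N.ghost_closed by auto
          then show "a \<odot>\<^bsub>N\<^esub> (M.\<gamma> (Edge e) \<odot>\<^bsub>N\<^esub> (M.\<gamma> (Ghost e) \<odot>\<^bsub>N\<^esub> y)) = \<zero>\<^bsub>N\<^esub>"
            using ae[of e "M.\<gamma> (Ghost e) \<odot>\<^bsub>N\<^esub> y"] e aL N.ghost_closed by (simp add: N.act_mult)
        qed auto
        finally show ?thesis by simp
      qed
      then show ?thesis by blast
    next
      case inf
      obtain x a1 F where s: "x \<in> carrier (free_space K (M.PQ v 0))" "a1 \<in> carrier (lpa K E)" "finite F" "F \<subseteq> out_arcs E v"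
        "a = M.comb x \<oplus>\<^bsub>lpa K E\<^esub> a1" "\<forall>e\<in>out_arcs E v - F. a1 \<otimes>\<^bsub>lpa K E\<^esub> M.\<gamma> (Edge e) = \<zero>\<^bsub>lpa K E\<^esub>"
        "\<forall>F'. finite F' \<longrightarrow> F \<subseteq> F' \<longrightarrow> F' \<subseteq> out_arcs E v \<longrightarrow>
          a1 = (\<Oplus>\<^bsub>lpa K E\<^esub>e\<in>F'. (a1 \<otimes>\<^bsub>lpa K E\<^esub> M.\<gamma> (Edge e)) \<otimes>\<^bsub>lpa K E\<^esub> M.\<gamma> (Ghost e))"
        using M.SQ_split[OF Suc.prems(1,2)] by blast
      \<comment> \<open>Only finitely many edges matter for \<open>a1\<close>. On another edge e
        into \<open>Y0\<close>, a and \<open>comb x\<close> agree, so \<open>comb x\<close> times e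
        kills \<open>M\<close> and \<open>pure_faithful\<close> gives x = 0.\<close>
      have "infinite (?Z - F)" using inf(2) s(3) by (rule Diff_infinite_finite[rotated])
      then have "?Z - F \<noteq> {}" by (metis finite.emptyI)
      then obtain e where e: "e \<in> ?Z - F" by (meson ex_in_conv)
      then have e': "e \<in> arcs E" "tail E e = v" "head E e \<in> Y0" "e \<in> out_arcs E v - F" by auto
      have cx: "M.comb x \<in> carrier (lpa K E)" using M.comb_closed[OF M.PQ_PP s(1)] .
      have "a1 \<otimes>\<^bsub>lpa K E\<^esub> M.\<gamma> (Edge e) = \<zero>\<^bsub>lpa K E\<^esub>" using s(6) e'(4) by blast
      then have eq: "a \<otimes>\<^bsub>lpa K E\<^esub> M.\<gamma> (Edge e) = M.comb x \<otimes>\<^bsub>lpa K E\<^esub> M.\<gamma> (Edge e)"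
        using s(2,5) cx e'(1) by (simp add: M.L.mult_l_distr M.ghost_closed)
      have mu: "M.mu v [e] = M.\<gamma> (Edge e)" using M.edge_head[OF e'(1)] by simp
      have "x t = \<zero>\<^bsub>K\<^esub>" for t
      proof (rule ccontr)
        assume nz: "x t \<noteq> \<zero>\<^bsub>K\<^esub>"
        show False
        proof (rule M.pure_faithful[OF exY s(1) nz, of "[e]" "head E e"])
          show "head E e \<in> M.Y" "M.walk v [e] (head E e)" using e' Y M.ends_in_verts by auto
          fix m assume "m \<in> carrier M"
          then show "(M.comb x \<otimes>\<^bsub>lpa K E\<^esub> M.mu v [e]) \<odot>\<^bsub>M\<^esub> m = \<zero>\<^bsub>M\<^esub>"
            unfolding mu eq[symmetric] using Suc.prems(3) aL e'(1) by (simp add: M.act_mult M.ghost_closed)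
        qed
      qed
      then have "x = (\<lambda>t. \<zero>\<^bsub>K\<^esub>)" by auto
      then have a1: "a = a1" using s(2,5) M.comb_zero by simp
      have "a \<odot>\<^bsub>N\<^esub> y = \<zero>\<^bsub>N\<^esub>" if y: "y \<in> carrier N" for y
      proof -
        have ar: "e \<in> arcs E" if "e \<in> F" for e using s(4) that by auto
        have eqa: "a = (\<Oplus>\<^bsub>lpa K E\<^esub>e\<in>F. (a \<otimes>\<^bsub>lpa K E\<^esub> M.\<gamma> (Edge e)) \<otimes>\<^bsub>lpa K E\<^esub> M.\<gamma> (Ghost e))"
          using s(7) s(3,4) a1 by blast
        have "(\<Oplus>\<^bsub>lpa K E\<^esub>e\<in>F. (a \<otimes>\<^bsub>lpa K E\<^esub> M.\<gamma> (Edge e)) \<otimes>\<^bsub>lpa K E\<^esub> M.\<gamma> (Ghost e)) \<odot>\<^bsub>N\<^esub> y =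
            (\<Oplus>\<^bsub>N\<^esub>e\<in>F. ((a \<otimes>\<^bsub>lpa K E\<^esub> M.\<gamma> (Edge e)) \<otimes>\<^bsub>lpa K E\<^esub> M.\<gamma> (Ghost e)) \<odot>\<^bsub>N\<^esub> y)"
          by (rule hom_finsum[OF N.act_l_hom[OF y]]) (use aL ar M.ghost_closed in auto)
        also have "\<dots> = (\<Oplus>\<^bsub>N\<^esub>e\<in>F. \<zero>\<^bsub>N\<^esub>)"
        proof (rule N.M.finsum_cong')
          fix e assume e: "e \<in> F"
          then show "((a \<otimes>\<^bsub>lpa K E\<^esub> M.\<gamma> (Edge e)) \<otimes>\<^bsub>lpa K E\<^esub> M.\<gamma> (Ghost e)) \<odot>\<^bsub>N\<^esub> y = \<zero>\<^bsub>N\<^esub>"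
            using ae[of e "M.\<gamma> (Ghost e) \<odot>\<^bsub>N\<^esub> y"] s(4) aL y ar[OF e] M.ghost_closed by (subst N.act_mult) auto
        qed auto
        finally show ?thesis using eqa by simp
      qed
      then show ?thesis by blast
    qed
  qed
  have aL: "a \<in> carrier (lpa K E)" and kill: "\<And>m. m \<in> carrier M \<Longrightarrow> a \<odot>\<^bsub>M\<^esub> m = \<zero>\<^bsub>M\<^esub>" using a by (auto simp: annihilator_def)
  obtain n0 where "n0 \<in> carrier N" "n0 \<noteq> \<zero>\<^bsub>N\<^esub>" using N.ex_nonzero by blast
  then obtain v where v: "v \<in> verts E" "M.ver v \<odot>\<^bsub>N\<^esub> n0 \<noteq> \<zero>\<^bsub>N\<^esub>" "M.ver v \<odot>\<^bsub>N\<^esub> n0 \<in> carrier N" "n0 \<in> carrier N"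
    using N.ex_vertex by auto
  have "a \<odot>\<^bsub>N\<^esub> y = \<zero>\<^bsub>N\<^esub>" if y: "y \<in> carrier N" for y
  proof -
    obtain b where b: "b \<in> carrier (lpa K E)" "b \<odot>\<^bsub>N\<^esub> (M.ver v \<odot>\<^bsub>N\<^esub> n0) = y" using N.generates[OF v(3,2) y] by blast
    have ab: "a \<otimes>\<^bsub>lpa K E\<^esub> b \<in> carrier (lpa K E)" using aL b by simp
    obtain n where n: "(a \<otimes>\<^bsub>lpa K E\<^esub> b) \<otimes>\<^bsub>lpa K E\<^esub> M.ver v \<in> M.SQ v n" using M.SQ_vertex[OF ab v(1)] by blast
    have "\<forall>m\<in>carrier M. ((a \<otimes>\<^bsub>lpa K E\<^esub> b) \<otimes>\<^bsub>lpa K E\<^esub> M.ver v) \<odot>\<^bsub>M\<^esub> m = \<zero>\<^bsub>M\<^esub>"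
      using aL b v(1) kill by (simp add: M.act_mult)
    from main[OF n v(1) this] have "((a \<otimes>\<^bsub>lpa K E\<^esub> b) \<otimes>\<^bsub>lpa K E\<^esub> M.ver v) \<odot>\<^bsub>N\<^esub> n0 = \<zero>\<^bsub>N\<^esub>" using v(4) by blast
    then show ?thesis using aL b v by (simp add: N.act_mult)
  qed
  then show ?thesis using aL by (simp add: annihilator_def)
qed

section \<open>Closed paths with exits and infinite paths\<close>

lemma take_concat_replicate:
  "j \<le> length c \<Longrightarrow> take (i * length c + j) (concat (replicate i c) @ c @ r) = concat (replicate i c) @ take j c"
  by (induction i) (auto simp: add.assoc)

lemma concat_replicate_add: "concat (replicate (i + n) c) = concat (replicate i c) @ concat (replicate n c)"
  by (simp add: replicate_add)

context leavitt_path
begin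

lemma walk_concat_replicate: "walk v c v \<Longrightarrow> walk v (concat (replicate n c)) v"
  by (induction n) (auto simp: walk_append dest: walk_verts)

lemma walk_nth: "walk u r w \<Longrightarrow> Suc i < length r \<Longrightarrow> r ! i \<in> arcs E \<and> head E (r ! i) = tail E (r ! Suc i)"
proof (induction r arbitrary: u i)
  case (Cons e r)
  then show ?case by (cases i; cases r) auto
qed simp

lemma walk_arcs: "walk u r w \<Longrightarrow> e \<in> set r \<Longrightarrow> e \<in> arcs E"
  by (induction r arbitrary: u) auto

text \<open>Take a shortest closed path c at v, run around it more than n times and then leave it by
  an exit f. If the resulting \<eta> is an initial segment of \<delta> \<eta>, then \<delta>
  consists of full turns around c followed by a closed initial part of c, which minimality makes
  empty. Thus \<delta> is a power of c, and comparing the letters at the exit gives e = f.\<close>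

lemma exitsI:
  assumes "\<And>v c. \<lbrakk>v \<in> Y0; walk v c v; c \<noteq> []\<rbrakk> \<Longrightarrow>
    \<exists>e\<in>set c. \<exists>f\<in>arcs E. tail E f = tail E e \<and> head E f \<in> Y0 \<and> f \<noteq> e"
    and verts: "Y0 \<subseteq> verts E"
  shows "exits Y0"
  unfolding exits_def
proof (intro ballI allI)
  fix v n assume v: "v \<in> Y0"
  show "\<exists>\<eta> z. walk v \<eta> z \<and> z \<in> Y0 \<and>
     (\<forall>\<delta>. walk v \<delta> v \<longrightarrow> \<delta> \<noteq> [] \<longrightarrow> length \<delta> \<le> n \<longrightarrow> \<not> (\<exists>r. \<delta> @ \<eta> = \<eta> @ r))"
  proof (cases "\<exists>c. walk v c v \<and> c \<noteq> []")
    case False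
    then show ?thesis using v verts by (intro exI[of _ "[]"] exI[of _ v]) auto
  next
    case True
    then obtain c0 where c0: "walk v c0 v \<and> c0 \<noteq> []" ..
    define c where "c = (ARG_MIN length c. walk v c v \<and> c \<noteq> [])"
    have c: "walk v c v" "c \<noteq> []" unfolding c_def using arg_min_natI[of "\<lambda>c. walk v c v \<and> c \<noteq> []", OF c0] by auto
    have cmin: "length c \<le> length d" if "walk v d v" "d \<noteq> []" for d
      unfolding c_def using arg_min_nat_le[of "\<lambda>c. walk v c v \<and> c \<noteq> []" d length] that by simp
    obtain e f where ef: "e \<in> set c" "f \<in> arcs E" "tail E f = tail E e" "head E f \<in> Y0" "f \<noteq> e"
      using assms(1)[OF v c] by blast
    obtain c1 c2 where cc: "c = c1 @ e # c2" using ef(1) by (meson split_list)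
    \<comment> \<open>At most n full turns fit into \<delta>, so with \<open>Suc n\<close> turns in
      \<eta> there is room for the incomplete last one.\<close>
    let ?N = "Suc n"
    let ?\<eta> = "concat (replicate ?N c) @ c1 @ [f]"
    have w1: "walk v c1 (tail E e)" using c(1) cc by (auto simp: walk_append)
    have "walk v ?\<eta> (head E f)"
      using walk_concat_replicate[OF c(1), of ?N] w1 ef ends_in_verts unfolding walk_append by auto
    moreover have "\<not> (\<exists>r. \<delta> @ ?\<eta> = ?\<eta> @ r)" if \<delta>: "walk v \<delta> v" "\<delta> \<noteq> []" "length \<delta> \<le> n" for \<delta>
    proof
      assume "\<exists>r. \<delta> @ ?\<eta> = ?\<eta> @ r"
      then obtain r where r: "\<delta> @ ?\<eta> = ?\<eta> @ r" ..
      let ?i = "length \<delta> div length c" and ?j = "length \<delta> mod length c"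
      have cl: "0 < length c" using c(2) by simp
      have len: "length \<delta> = ?i * length c + ?j" by simp
      have il: "?i \<le> n" using \<delta>(3) by (meson div_le_dividend order_trans)

      have "concat (replicate ?N c) = concat (replicate ?i c) @ concat (replicate (Suc (n - ?i)) c)"
        using concat_replicate_add[of ?i "Suc (n - ?i)" c] il by simp
      then have rep: "concat (replicate ?N c) = concat (replicate ?i c) @ c @ concat (replicate (n - ?i) c)" by simp
      have "\<delta> = take (?i * length c + ?j) (\<delta> @ ?\<eta>)" using len by simp
      also have "\<delta> @ ?\<eta> = ?\<eta> @ r" by (rule r)
      also have "?\<eta> @ r = concat (replicate ?i c) @ c @ (concat (replicate (n - ?i) c) @ c1 @ [f] @ r)"
        unfolding rep by (simp only: append_assoc)
      also have "take (?i * length c + ?j) (concat (replicate ?i c) @ c @ (concat (replicate (n - ?i) c) @ c1 @ [f] @ r)) =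
          concat (replicate ?i c) @ take ?j c"
        by (rule take_concat_replicate) (use cl in \<open>simp add: less_imp_le\<close>)
      finally have \<delta>': "\<delta> = concat (replicate ?i c) @ take ?j c" .
      have "walk v (concat (replicate ?i c) @ take ?j c) v" using \<delta>(1) \<delta>' by simp
      then have "walk v (take ?j c) v"
        using walk_concat_replicate[OF c(1), of ?i] walk_unique unfolding walk_append by blast
      \<comment> \<open>This initial part of c is closed at v and shorter than c.\<close>
      then have "take ?j c = []" using cmin[of "take ?j c"] cl by (metis length_take min.absorb4 mod_less_divisor not_le)
      then have \<delta>i: "\<delta> = concat (replicate ?i c)" using \<delta>' by (metis append.right_neutral)
      then have "?i \<noteq> 0" using \<delta>(2) by (metis concat.simps(1) replicate_0)
      then obtain i' where i': "?i = Suc i'" using not0_implies_Suc by blast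
      have "\<delta> @ concat (replicate ?N c) = concat (replicate (?N + ?i) c)"
        using \<delta>i concat_replicate_add[of ?i ?N c] by (metis add.commute)
      also have "\<dots> = concat (replicate ?N c) @ c @ concat (replicate i' c)"
        unfolding concat_replicate_add i' by simp
      finally have "\<delta> @ ?\<eta> = concat (replicate ?N c) @ (c1 @ e # c2) @ concat (replicate i' c) @ c1 @ [f]"
        using cc by simp
      with r have "concat (replicate ?N c) @ c1 @ e # (c2 @ concat (replicate i' c) @ c1 @ [f]) = concat (replicate ?N c) @ c1 @ f # r"
        by simp
      then have "e = f" by simp
      with ef show False by simp
    qed
    ultimately show ?thesis using ef(4) by blast
  qed
qed

text \<open>The bound \<open>k \<ge> n\<close> lets \<open>cofinal_path\<close> pass beyond any
  given offset in the path.\<close>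

lemma infinite_path_of_walks:
  assumes ws: "\<And>i. walk (ws i) (s i) (ws (Suc i))" and ne: "\<And>i. s i \<noteq> []"
  shows "\<exists>p. infinite_path E p \<and> (\<forall>n. \<exists>k\<ge>n. src (sdrop k p) = ws n)"
proof -
  define Ls where "Ls n = concat (map s [0..<n])" for n
  have Suc: "Ls (Suc n) = Ls n @ s n" for n by (simp add: Ls_def)
  have wk: "walk (ws 0) (Ls n) (ws n)" for n
  proof (induction n)
    case 0
    then show ?case using walk_verts(1)[OF ws[of 0]] by (simp add: Ls_def)
  next
    case (Suc n)
    then show ?case unfolding \<open>\<And>n. Ls (Suc n) = Ls n @ s n\<close> walk_append using ws[of n] by blast
  qed
  have len: "n \<le> length (Ls n)" for n
  proof (induction n)
    case (Suc n)
    have "1 \<le> length (s n)" using ne[of n] by (cases "s n") auto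
    then show ?case unfolding \<open>\<And>n. Ls (Suc n) = Ls n @ s n\<close> length_append using Suc by linarith
  qed simp
  have pre: "\<exists>r. Ls (n + m) = Ls n @ r" for n m
    by (induction m) (auto simp: Suc)
  have agree: "Ls n ! i = Ls m ! i" if "i < length (Ls n)" "i < length (Ls m)" for n m i
  proof -
    have "Ls n ! i = Ls m ! i" if nm: "n \<le> m" "i < length (Ls n)" for n m
    proof -
      obtain r where "Ls m = Ls n @ r" using pre[of n "m - n"] nm by auto
      then show ?thesis using nm by (simp add: nth_append)
    qed
    then show ?thesis using that by (metis nat_le_linear)
  qed
  \<comment> \<open>Each walk has at least one edge, so position \<open>i\<close> already occurs in
    \<open>Ls (Suc i)\<close>.\<close>
  define p where "p = smap (\<lambda>i. Ls (Suc i) ! i) nats"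
  have pn: "p !! i = Ls n ! i" if "i < length (Ls n)" for i n
    unfolding p_def using agree[of i "Suc i" n] that len[of "Suc i"] by simp
  have inf: "infinite_path E p"
    unfolding infinite_path_def
  proof
    fix i
    have l: "Suc i < length (Ls (Suc (Suc i)))" using len[of "Suc (Suc i)"] by simp
    show "p !! i \<in> arcs E \<and> head E (p !! i) = tail E (p !! Suc i)"
      using walk_nth[OF wk l] pn[OF l] pn[of i "Suc (Suc i)"] l by simp
  qed
  have st: "stake (length (Ls n)) p = Ls n" for n
    by (rule nth_equalityI) (auto simp: pn)
  have "src p = ws 0"
  proof -
    have "Ls 1 \<noteq> []" using len[of 1] by auto
    then obtain e r where er: "Ls 1 = e # r" by (meson neq_Nil_conv)
    then have "shd p = e" using pn[of 0 1] by simp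
    then show ?thesis using wk[of 1] er by simp
  qed
  then have "src (sdrop (length (Ls n)) p) = ws n" for n
    using walk_stake[OF inf, of "length (Ls n)"] wk[of n] walk_unique unfolding st by simp
  then show ?thesis using inf len by blast
qed

end

section \<open>The sum relation over \<open>Y\<close> and a cofinal path\<close>

context lpa_module
begin

text \<open>The difference of the two sides is fixed by the vertex. A ghost edge into
  \<open>Y\<close> at this vertex takes both sides to the same vector, and any other ghost edge
  kills the difference, so \<open>notA\<close> applies to it.\<close>

lemma expandsI:
  assumes notA: "\<And>w m. \<lbrakk>w \<in> verts E; m \<in> carrier M; ver w \<cdot> m = m; finite {e \<in> out_arcs E w. head E e \<in> Y};
    \<And>e. e \<in> arcs E \<Longrightarrow> \<gamma> (Ghost e) \<cdot> m = \<zero>\<^bsub>M\<^esub>\<rbrakk> \<Longrightarrow> m = \<zero>\<^bsub>M\<^esub>"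
  shows expands
  unfolding expands_def
proof (intro ballI impI)
  fix v m assume v: "v \<in> Y" and fin: "finite {e \<in> out_arcs E v. head E e \<in> Y}" and m: "m \<in> carrier M"
  let ?Z = "{e \<in> out_arcs E v. head E e \<in> Y}"
  let ?s = "\<Oplus>\<^bsub>M\<^esub>e\<in>?Z. \<gamma> (Edge e) \<cdot> (\<gamma> (Ghost e) \<cdot> m)"
  let ?d = "ver v \<cdot> m \<ominus>\<^bsub>M\<^esub> ?s"
  have vv: "v \<in> verts E" using v by (rule Y_verts)
  have c: "(\<lambda>e. \<gamma> (Edge e) \<cdot> (\<gamma> (Ghost e) \<cdot> m)) \<in> ?Z \<rightarrow> carrier M" using m ghost_closed by auto
  have s: "?s \<in> carrier M" using c by (rule M.finsum_closed)
  have d: "?d \<in> carrier M" using s m vv by simp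
  have diff: "a \<cdot> ?d = a \<cdot> (ver v \<cdot> m) \<ominus>\<^bsub>M\<^esub> a \<cdot> ?s" if "a \<in> carrier L" for a
    using that s m vv abelian_group_hom.hom_a_inv[OF M.act_r_hom[OF that] s]
    by (simp add: a_minus_def M.smult_r_distr)
  have sum: "a \<cdot> ?s = (\<Oplus>\<^bsub>M\<^esub>e\<in>?Z. a \<cdot> (\<gamma> (Edge e) \<cdot> (\<gamma> (Ghost e) \<cdot> m)))" if "a \<in> carrier L" for a
    by (rule hom_finsum[OF M.act_r_hom[OF that] c])
  have "ver v \<cdot> ?s = ?s"
    unfolding sum[OF ver_closed[OF vv]]
    by (rule M.finsum_cong') (use c m ghost_closed tail_edge in \<open>auto simp: act_mult[symmetric] L.mult_assoc[symmetric] vv\<close>)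
  then have vd: "ver v \<cdot> ?d = ?d" using diff[OF ver_closed[OF vv]] vv m by (simp add: ver_ver)
  have "\<gamma> (Ghost f) \<cdot> ?d = \<zero>\<^bsub>M\<^esub>" if f: "f \<in> arcs E" for f
  proof -
    have hg: "ver (head E f) \<cdot> (\<gamma> (Ghost f) \<cdot> m) = \<gamma> (Ghost f) \<cdot> m"
      using f m head_ghost[OF f] by (simp add: act_mult[symmetric] ghost_closed ends_in_verts)
    have gt: "\<gamma> (Ghost f) \<cdot> y = \<gamma> (Ghost f) \<cdot> (ver (tail E f) \<cdot> y)" if "y \<in> carrier M" for y
      using that f ghost_tail[OF f] by (simp add: act_mult[symmetric] ghost_closed ends_in_verts)
    consider "tail E f \<noteq> v" | "head E f \<notin> Y" | "f \<in> ?Z" using f by auto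
    then show ?thesis
    proof cases
      case 1
      have "\<gamma> (Ghost f) \<cdot> ?d = \<gamma> (Ghost f) \<cdot> (ver (tail E f) \<cdot> (ver v \<cdot> ?d))" using gt[OF d] vd by simp
      then show ?thesis using 1 f d vv ends_in_verts[OF f] by (simp add: ver_ver ghost_closed)
    next
      case 2
      then show ?thesis using ghost_not_Y f d by blast
    next
      case 3
      then have tf: "tail E f = v" by simp
      have "\<gamma> (Ghost f) \<cdot> ?s = (\<Oplus>\<^bsub>M\<^esub>e\<in>?Z. if f = e then \<gamma> (Ghost f) \<cdot> m else \<zero>\<^bsub>M\<^esub>)"
        unfolding sum[OF ghost_closed(1)[OF f]]
      proof (rule M.finsum_cong')
        fix e assume e: "e \<in> ?Z"
        then have ea: "e \<in> arcs E" by simp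
        have "\<gamma> (Ghost f) \<cdot> (\<gamma> (Edge e) \<cdot> (\<gamma> (Ghost e) \<cdot> m)) = (\<gamma> (Ghost f) \<bullet> \<gamma> (Edge e)) \<cdot> (\<gamma> (Ghost e) \<cdot> m)"
          using f ea m ghost_closed by (simp add: act_mult)
        also have "\<dots> = (if f = e then ver (head E f) \<cdot> (\<gamma> (Ghost f) \<cdot> m) else \<zero>\<^bsub>M\<^esub>)"
          using f ea m ghost_closed by (auto simp: ghost_edge)
        also have "\<dots> = (if f = e then \<gamma> (Ghost f) \<cdot> m else \<zero>\<^bsub>M\<^esub>)"
          using hg by (cases "f = e") auto
        finally show "\<gamma> (Ghost f) \<cdot> (\<gamma> (Edge e) \<cdot> (\<gamma> (Ghost e) \<cdot> m)) = (if f = e then \<gamma> (Ghost f) \<cdot> m else \<zero>\<^bsub>M\<^esub>)" .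
      qed (use f m ghost_closed in auto)
      also have "\<dots> = \<gamma> (Ghost f) \<cdot> m"
        using M.finsum_singleton[OF 3 fin, of "\<lambda>_. \<gamma> (Ghost f) \<cdot> m"] f m ghost_closed by simp
      finally show ?thesis using diff[OF ghost_closed(1)[OF f]] gt[OF m] tf f m vv ghost_closed(1)[OF f]
        by (simp add: M.minus_eq_zero_iff)
    qed
  qed
  then have "?d = \<zero>\<^bsub>M\<^esub>" using notA[OF vv d vd fin] by blast
  then show "ver v \<cdot> m = ?s" using s m vv by (simp add: M.minus_eq_zero_iff)
qed

lemma expands_edge:
  assumes expands "v \<in> Y"
  shows "\<exists>e\<in>arcs E. tail E e = v \<and> head E e \<in> Y"
proof (rule ccontr)
  assume "\<not> ?thesis"
  then have Z: "{e \<in> out_arcs E v. head E e \<in> Y} = {}" by auto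
  obtain m where m: "m \<in> carrier M" "ver v \<cdot> m \<noteq> \<zero>\<^bsub>M\<^esub>" using assms(2) by (auto simp: Y_def)
  have "finite {e \<in> out_arcs E v. head E e \<in> Y}" unfolding Z by simp
  then have "ver v \<cdot> m = (\<Oplus>\<^bsub>M\<^esub>e\<in>{e \<in> out_arcs E v. head E e \<in> Y}. \<gamma> (Edge e) \<cdot> (\<gamma> (Ghost e) \<cdot> m))"
    using assms m(1) unfolding expands_def by blast
  then show False using m(2) unfolding Z by simp
qed

end

context lpa_simple
begin

text \<open>Enumerate a countable set below which every vertex of \<open>Y\<close> leads. In step i,
  move on to a common descendant in \<open>Y\<close> with its i-th member. Then each vertex of
  \<open>Y\<close> reaches the path, and every vertex above the path lies in \<open>Y\<close> by
  \<open>Y_up\<close>.\<close>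

lemma cofinal_path:
  assumes expands
  shows "\<exists>p. infinite_path E p \<and> Y = {src q | q. q \<in> tc p}"
proof -
  obtain C where C: "countable C" "C \<subseteq> Y" "\<And>u. u \<in> Y \<Longrightarrow> \<exists>c\<in>C. \<exists>s. walk u s c"
    using countable_separation by blast
  obtain w0 where w0: "w0 \<in> Y" using Y_nonempty by (meson ex_in_conv)
  have "C \<noteq> {}" using C(3)[OF w0] by auto
  then have rng: "range (from_nat_into C) = C" using C(1) by (rule range_from_nat_into)
  have step: "\<exists>w' s. w' \<in> Y \<and> s \<noteq> [] \<and> walk w s w' \<and> (\<exists>r. walk (from_nat_into C i) r w')" if wY: "w \<in> Y" for w i
  proof -
    \<comment> \<open>An edge inside \<open>Y\<close> comes first, because the common descendant
      might be the current vertex itself and each segment must be nonempty.\<close>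
    obtain e where e: "e \<in> arcs E" "tail E e = w" "head E e \<in> Y" using expands_edge[OF assms wY] by blast
    have "from_nat_into C i \<in> Y" using rng C(2) by blast
    from Y_directed[OF e(3) this] obtain w' s r where "w' \<in> Y" "walk (head E e) s w'" "walk (from_nat_into C i) r w'"
      by blast
    then show ?thesis using e by (intro exI[of _ w'] exI[of _ "e # s"]) auto
  qed
  define nx where "nx i w = (SOME w'. w' \<in> Y \<and> (\<exists>s. s \<noteq> [] \<and> walk w s w') \<and> (\<exists>r. walk (from_nat_into C i) r w'))" for i w
  have nx: "nx i w \<in> Y \<and> (\<exists>s. s \<noteq> [] \<and> walk w s (nx i w)) \<and> (\<exists>r. walk (from_nat_into C i) r (nx i w))" if "w \<in> Y" for i w
    unfolding nx_def by (rule someI_ex) (use step[OF that, of i] in blast)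
  define ws where "ws = rec_nat w0 nx"
  have wsY: "ws i \<in> Y" for i by (induction i) (use w0 nx in \<open>auto simp: ws_def\<close>)
  have wsS: "ws (Suc i) = nx i (ws i)" for i by (simp add: ws_def)
  have "\<forall>i. \<exists>s. s \<noteq> [] \<and> walk (ws i) s (ws (Suc i))" using nx[OF wsY] wsS by simp
  from choice[OF this] obtain s where s: "\<And>i. s i \<noteq> []" "\<And>i. walk (ws i) (s i) (ws (Suc i))" by blast
  obtain p where p: "infinite_path E p" "\<And>n. \<exists>k\<ge>n. src (sdrop k p) = ws n"
    using infinite_path_of_walks[of ws s] s by blast
  have "Y = {src q | q. q \<in> tc p}"
  proof (intro subset_antisym subsetI)
    fix u assume "u \<in> Y"
    then obtain c r where c: "c \<in> C" "walk u r c" using C(3) by blast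
    then obtain i where i: "c = from_nat_into C i" using rng by blast
    obtain r' where r': "walk c r' (ws (Suc i))" using nx[OF wsY, of i i] wsS i by auto
    obtain k where k: "src (sdrop k p) = ws (Suc i)" using p(2) by blast
    have wk: "walk u (r @ r') (src (sdrop k p))" using c r' k by (auto simp: walk_append)
    have "(r @ r') @- sdrop k p \<in> tc p" by (rule tc_shift[OF tc_sdrop[OF tc_refl[OF p(1)]] wk])
    moreover have "src ((r @ r') @- sdrop k p) = u"
      using infinite_path_shift[OF wk infinite_path_sdrop[OF p(1)]] by simp
    ultimately show "u \<in> {src q | q. q \<in> tc p}" by blast
  next
    fix u assume "u \<in> {src q | q. q \<in> tc p}"
    then obtain q where q: "q \<in> tc p" "u = src q" by blast
    obtain m n where mn: "sdrop m q = sdrop n p" using tc_common[OF q(1) tc_refl[OF p(1)]] by blast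
    obtain k where k: "k \<ge> n" "src (sdrop k p) = ws n" using p(2) by blast
    have "sdrop (m + (k - n)) q = sdrop k p"
      using mn k(1) sdrop_add[of "k - n" m q] sdrop_add[of "k - n" n p] by simp
    then have "walk u (stake (m + (k - n)) q) (ws n)"
      using walk_stake[OF tc_infinite[OF q(1)], of "m + (k - n)"] q(2) k(2) by simp
    then show "u \<in> Y" using Y_up wsY by blast
  qed
  with p(1) show ?thesis by blast
qed

end

context stream_module
begin

text \<open>On a basis stream only its first edge contributes, and the head of that edge is again in
  \<open>Y\<close>, as the source of the remaining stream.\<close>

lemma stream_expands: expands
  unfolding expands_def
proof (intro ballI impI)
  fix v m assume v: "v \<in> Y" and fin: "finite {e \<in> out_arcs E v. head E e \<in> Y}" and m: "m \<in> carrier N"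
  let ?Z = "{e \<in> out_arcs E v. head E e \<in> Y}"
  have vv: "v \<in> verts E" using v by (rule Y_verts)
  have abN: "abelian_group N" by intro_locales
  have c: "(\<lambda>e. \<gamma> (Edge e) \<cdot> (\<gamma> (Ghost e) \<cdot> y)) \<in> ?Z \<rightarrow> carrier N" if "y \<in> carrier N" for y
    using that ghost_closed by auto
  show "ver v \<cdot> m = (\<Oplus>\<^bsub>N\<^esub>e\<in>?Z. \<gamma> (Edge e) \<cdot> (\<gamma> (Ghost e) \<cdot> m))"
  proof (rule N_ext[where f = "\<lambda>m. ver v \<cdot> m" and g = "\<lambda>m. \<Oplus>\<^bsub>N\<^esub>e\<in>?Z. \<gamma> (Edge e) \<cdot> (\<gamma> (Ghost e) \<cdot> m)" and N' = N])
    show "abelian_group_hom N N (\<lambda>m. ver v \<cdot> m)" using vv by (intro M.act_r_hom) simp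
    show "abelian_group_hom N N (\<lambda>m. \<Oplus>\<^bsub>N\<^esub>e\<in>?Z. \<gamma> (Edge e) \<cdot> (\<gamma> (Ghost e) \<cdot> m))"
    proof (rule abelian_group_homI'[OF abN abN])
      fix y y' assume y: "y \<in> carrier N" "y' \<in> carrier N"
      have "(\<Oplus>\<^bsub>N\<^esub>e\<in>?Z. \<gamma> (Edge e) \<cdot> (\<gamma> (Ghost e) \<cdot> (y \<oplus>\<^bsub>N\<^esub> y'))) =
        (\<Oplus>\<^bsub>N\<^esub>e\<in>?Z. \<gamma> (Edge e) \<cdot> (\<gamma> (Ghost e) \<cdot> y) \<oplus>\<^bsub>N\<^esub> \<gamma> (Edge e) \<cdot> (\<gamma> (Ghost e) \<cdot> y'))"
        by (rule M.finsum_cong') (use y ghost_closed in \<open>auto simp: M.smult_r_distr\<close>)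
      also have "\<dots> = (\<Oplus>\<^bsub>N\<^esub>e\<in>?Z. \<gamma> (Edge e) \<cdot> (\<gamma> (Ghost e) \<cdot> y)) \<oplus>\<^bsub>N\<^esub> (\<Oplus>\<^bsub>N\<^esub>e\<in>?Z. \<gamma> (Edge e) \<cdot> (\<gamma> (Ghost e) \<cdot> y'))"
        using c y by (intro M.finsum_addf)
      finally show "(\<Oplus>\<^bsub>N\<^esub>e\<in>?Z. \<gamma> (Edge e) \<cdot> (\<gamma> (Ghost e) \<cdot> (y \<oplus>\<^bsub>N\<^esub> y'))) =
        (\<Oplus>\<^bsub>N\<^esub>e\<in>?Z. \<gamma> (Edge e) \<cdot> (\<gamma> (Ghost e) \<cdot> y)) \<oplus>\<^bsub>N\<^esub> (\<Oplus>\<^bsub>N\<^esub>e\<in>?Z. \<gamma> (Edge e) \<cdot> (\<gamma> (Ghost e) \<cdot> y'))" .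
    qed (use c in \<open>simp add: M.finsum_closed\<close>)
    fix l q assume l: "l \<in> carrier S" and q: "q \<in> tc p"
    note s = single_in_N[OF l q]
    have "(\<Oplus>\<^bsub>N\<^esub>e\<in>?Z. \<gamma> (Edge e) \<cdot> (\<gamma> (Ghost e) \<cdot> single S l q)) =
        (\<Oplus>\<^bsub>N\<^esub>e\<in>?Z. if shd q = e then single S l q else \<zero>\<^bsub>N\<^esub>)"
      by (rule M.finsum_cong') (use s in \<open>auto simp: edge_ghost_single[OF q l]\<close>)
    also have "\<dots> = ver v \<cdot> single S l q"
    proof (cases "src q = v")
      case True
      have "src (stl q) \<in> Y" using tc_stl[OF q] by (auto simp: Y_eq)
      then have "shd q \<in> ?Z" using infinite_path_shd[OF tc_infinite[OF q]] True by auto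
      from M.finsum_singleton[OF this fin, of "\<lambda>_. single S l q"] show ?thesis
        using True s ver_single[OF vv q l] by simp
    next
      case False
      have "(\<Oplus>\<^bsub>N\<^esub>e\<in>?Z. if shd q = e then single S l q else \<zero>\<^bsub>N\<^esub>) = (\<Oplus>\<^bsub>N\<^esub>e\<in>?Z. \<zero>\<^bsub>N\<^esub>)"
        by (rule M.finsum_cong') (use False in auto)
      then show ?thesis using False ver_single[OF vv q l] by simp
    qed
    finally show "ver v \<cdot> single S l q = (\<Oplus>\<^bsub>N\<^esub>e\<in>?Z. \<gamma> (Edge e) \<cdot> (\<gamma> (Ghost e) \<cdot> single S l q))" by simp
  qed (rule m)
qed

end

section \<open>Laurent polynomials\<close>

lemma finite_int_bounded: "finite Z \<Longrightarrow> \<exists>b::int. \<forall>i\<in>Z. \<bar>i\<bar> \<le> b"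
  by (rule exI[of _ "Max (abs ` Z)"]) simp

context cring
begin

interpretation Z: semigroup_alg R integer_group
  by unfold_locales auto

lemma laurent_simps:
  "carrier (laurent R) = carrier (free_space R UNIV)" "\<zero>\<^bsub>laurent R\<^esub> = (\<lambda>b. \<zero>)"
  "add (laurent R) = add (free_space R UNIV)" "\<one>\<^bsub>laurent R\<^esub> = single R \<one> 0"
  "k \<odot>\<^bsub>laurent R\<^esub> x = (\<lambda>b. k \<otimes> x b)"
  by (simp_all add: laurent_def semigroup_algebra_def free_space_def basis_elt_single)

lemma laurent_nonunital_algebra: "nonunital_algebra R (laurent R)"
  unfolding laurent_def by (rule Z.SA_nonunital_algebra)

lemma laurent_single: "k \<in> carrier R \<Longrightarrow> single R k i \<in> carrier (laurent R)"
  unfolding laurent_simps by (rule single_carrier) simp_all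

lemma laurent_single_mult:
  "k \<in> carrier R \<Longrightarrow> l \<in> carrier R \<Longrightarrow>
    single R k i \<otimes>\<^bsub>laurent R\<^esub> single R l j = single R (k \<otimes> l) (i + j)"
  unfolding laurent_def using Z.SA_single_mult[of k l i j] by simp

lemma laurent_ext:
  assumes "abelian_group_hom (laurent R) M f" "abelian_group_hom (laurent R) M g"
    and "\<And>k i. k \<in> carrier R \<Longrightarrow> f (single R k i) = g (single R k i)" "x \<in> carrier (laurent R)"
  shows "f x = g x"
proof (rule additive_ext[where B = UNIV and M = M and f = f and g = g])
  have "abelian_group (free_space R UNIV)" by (rule module.axioms(2)[OF free_space_module])
  moreover have "abelian_group M" using assms(1) by (simp add: abelian_group_hom_def)
  ultimately show "abelian_group_hom (free_space R UNIV) M f" "abelian_group_hom (free_space R UNIV) M g"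
    using abelian_group_hom.hom_closed[OF assms(1)] abelian_group_hom.hom_add[OF assms(1)]
      abelian_group_hom.hom_closed[OF assms(2)] abelian_group_hom.hom_add[OF assms(2)]
    unfolding laurent_simps by (auto intro!: abelian_group_homI')
qed (use assms laurent_simps(1) in auto)

lemma laurent_cring: "cring (laurent R)"
proof -
  interpret A: nonunital_algebra R "laurent R" by (rule laurent_nonunital_algebra)
  have comm: "x \<otimes>\<^bsub>laurent R\<^esub> y = y \<otimes>\<^bsub>laurent R\<^esub> x" if "x \<in> carrier (laurent R)" "y \<in> carrier (laurent R)" for x y
  proof (rule laurent_ext[OF A.right_mult_hom[OF that(2)] A.left_mult_hom[OF that(2)] _ that(1)])
    fix k i assume k: "k \<in> carrier R"
    show "single R k i \<otimes>\<^bsub>laurent R\<^esub> y = y \<otimes>\<^bsub>laurent R\<^esub> single R k i"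
      by (rule laurent_ext[OF A.left_mult_hom[OF laurent_single[OF k]] A.right_mult_hom[OF laurent_single[OF k]] _ that(2)])
        (simp add: k laurent_single_mult m_comm add.commute)
  qed
  have one: "\<one>\<^bsub>laurent R\<^esub> \<in> carrier (laurent R)" unfolding laurent_simps(4) by (rule laurent_single) simp
  have l_one: "\<one>\<^bsub>laurent R\<^esub> \<otimes>\<^bsub>laurent R\<^esub> x = x" if "x \<in> carrier (laurent R)" for x
  proof (rule laurent_ext[OF A.left_mult_hom[OF one] _ _ that])
    show "abelian_group_hom (laurent R) (laurent R) (\<lambda>x. x)"
      using A.abelian_group_A by (intro abelian_group_homI') auto
  qed (simp add: laurent_simps(4) laurent_single_mult)
  show ?thesis
  proof (rule cringI[OF A.abelian_group_A])
    show "comm_monoid (laurent R)"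
      by (rule comm_monoidI[OF A.mult_closed one A.mult_assoc l_one comm])
  qed (rule A.mult_l_distr)
qed

lemma laurent_single_coeff:
  assumes "k \<in> carrier R" "g \<in> carrier (laurent R)"
  shows "(single R k i \<otimes>\<^bsub>laurent R\<^esub> g) j = k \<otimes> g (j - i)"
proof -
  have g: "g \<in> carrier (free_space R UNIV)" "\<And>i. g i \<in> carrier R"
    using assms(2) by (auto simp: laurent_simps free_space_carrier_iff)
  have eq: "{(a, b). a \<in> {i} \<and> b \<in> insert (j - i) {b. g b \<noteq> \<zero>} \<and> a \<otimes>\<^bsub>integer_group\<^esub> b = j} = {(i, j - i)}"
    by (intro subset_antisym subsetI) auto
  have "(single R k i \<otimes>\<^bsub>laurent R\<^esub> g) j = finsum R (\<lambda>(a, b). single R k i a \<otimes> g b)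
      {(a, b). a \<in> {i} \<and> b \<in> insert (j - i) {b. g b \<noteq> \<zero>} \<and> a \<otimes>\<^bsub>integer_group\<^esub> b = j}"
    unfolding laurent_def
    by (rule Z.SA_mult_superset) (use assms g in \<open>auto simp: single_def free_space_carrier_iff\<close>)
  then show ?thesis unfolding eq using assms g by (simp add: single_def)
qed

end

context field
begin

text \<open>Division with remainder, the length of the support taking the role of the degree. Since
  x is a unit, the generator can be shifted to start at exponent 0 and scaled to constant term 1,
  which is the shape that \<open>twist_polynomial\<close> asks for.\<close>

lemma laurent_ideal_principal:
  assumes "ideal J (laurent R)" "g0 \<in> J" "g0 \<noteq> \<zero>\<^bsub>laurent R\<^esub>"
  shows "\<exists>f\<in>J. J = PIdl\<^bsub>laurent R\<^esub> f \<and> f 0 = \<one> \<and> (\<forall>i<0. f i = \<zero>)"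
proof -
  interpret C: cring "laurent R" by (rule laurent_cring)
  interpret J: ideal J "laurent R" by fact
  have c: "g \<in> carrier (laurent R) \<Longrightarrow> g i \<in> carrier R" for g i
    by (auto simp: laurent_simps free_space_carrier_iff)
  have JC: "g \<in> J \<Longrightarrow> g \<in> carrier (laurent R)" for g using J.a_subset by blast
  \<comment> \<open>The support lies in some n consecutive exponents; their position is left open
    because multiplication by powers of x moves it.\<close>
  define width where "width n g \<longleftrightarrow> (\<exists>a. \<forall>i. g i \<noteq> \<zero> \<longrightarrow> a \<le> i \<and> i < a + int n)" for n and g :: "int \<Rightarrow> 'a"
  have "\<exists>n g. g \<in> J \<and> g \<noteq> \<zero>\<^bsub>laurent R\<^esub> \<and> width n g"
  proof -
    have "finite {i. g0 i \<noteq> \<zero>}" using JC[OF assms(2)] by (simp add: laurent_simps free_space_carrier_iff)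
    then obtain b where b: "\<And>i. g0 i \<noteq> \<zero> \<Longrightarrow> \<bar>i\<bar> \<le> b"
      using finite_int_bounded by (metis (mono_tags) mem_Collect_eq)
    have "width (nat (2 * b + 1)) g0"
      unfolding width_def using b by (intro exI[of _ "- b"]) fastforce
    with assms show ?thesis by blast
  qed
  then have "\<exists>n. (\<exists>g. g \<in> J \<and> g \<noteq> \<zero>\<^bsub>laurent R\<^esub> \<and> width n g) \<and>
      (\<forall>m<n. \<not> (\<exists>g. g \<in> J \<and> g \<noteq> \<zero>\<^bsub>laurent R\<^esub> \<and> width m g))"
    unfolding exists_least_iff[of "\<lambda>n. \<exists>g. g \<in> J \<and> g \<noteq> \<zero>\<^bsub>laurent R\<^esub> \<and> width n g", symmetric] .
  then obtain N where N: "\<exists>g. g \<in> J \<and> g \<noteq> \<zero>\<^bsub>laurent R\<^esub> \<and> width N g"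
    and Nmin: "\<And>m g. m < N \<Longrightarrow> g \<in> J \<Longrightarrow> width m g \<Longrightarrow> g = \<zero>\<^bsub>laurent R\<^esub>" by blast
  then obtain g a where g: "g \<in> J" "g \<noteq> \<zero>\<^bsub>laurent R\<^esub>" "\<And>i. g i \<noteq> \<zero> \<Longrightarrow> a \<le> i \<and> i < a + int N"
    by (auto simp: width_def)
  have "N \<noteq> 0"
  proof
    assume "N = 0"
    then have "g i = \<zero>" for i using g(3)[of i] by fastforce
    then have "g = \<zero>\<^bsub>laurent R\<^esub>" unfolding laurent_simps by (intro ext)
    with g(2) show False by simp
  qed
  have ga: "g a \<noteq> \<zero>"
  proof
    assume z: "g a = \<zero>"
    have "width (N - 1) g" unfolding width_def
    proof (intro exI[of _ "a + 1"] allI impI)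
      fix i assume "g i \<noteq> \<zero>"
      then show "a + 1 \<le> i \<and> i < a + 1 + int (N - 1)" using g(3)[of i] z \<open>N \<noteq> 0\<close> by (cases "i = a") auto
    qed
    with Nmin[of "N - 1" g] g \<open>N \<noteq> 0\<close> show False by simp
  qed
  define f where "f = single R (inv (g a)) (- a) \<otimes>\<^bsub>laurent R\<^esub> g"
  have inv: "inv (g a) \<in> carrier R" "inv (g a) \<otimes> g a = \<one>"
    using ga c[OF JC[OF g(1)]] field_Units by auto
  have inv_nz: "inv (g a) \<noteq> \<zero>"
  proof
    assume "inv (g a) = \<zero>"
    then show False using inv c[OF JC[OF g(1)], of a] by simp
  qed
  have fi: "f i = inv (g a) \<otimes> g (i + a)" for i
    unfolding f_def using laurent_single_coeff[OF inv(1) JC[OF g(1)], of "- a" i] by simp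
  have fJ: "f \<in> J" unfolding f_def using J.I_l_closed[OF g(1) laurent_single[OF inv(1)]] .
  have f0: "f 0 = \<one>" using fi[of 0] inv by simp
  have fsupp: "0 \<le> i \<and> i < int N" if "f i \<noteq> \<zero>" for i
  proof -
    have "g (i + a) \<noteq> \<zero>" using that fi[of i] inv by auto
    then show ?thesis using g(3)[of "i + a"] by simp
  qed
  have fN: "f (int N - 1) \<noteq> \<zero>"
  proof
    assume z: "f (int N - 1) = \<zero>"
    have "width (N - 1) f" unfolding width_def
    proof (intro exI[of _ 0] allI impI)
      fix i assume "f i \<noteq> \<zero>"
      then show "0 \<le> i \<and> i < 0 + int (N - 1)" using fsupp[of i] z \<open>N \<noteq> 0\<close> by (cases "i = int N - 1") auto
    qed
    then have "f = \<zero>\<^bsub>laurent R\<^esub>" using Nmin[of "N - 1" f] fJ \<open>N \<noteq> 0\<close> by simp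
    then show False using f0 by (simp add: laurent_simps)
  qed
  have sub: "PIdl\<^bsub>laurent R\<^esub> f \<subseteq> J" using C.cgenideal_minimal[OF assms(1) fJ] .
  interpret P: ideal "PIdl\<^bsub>laurent R\<^esub> f" "laurent R" using C.cgenideal_ideal[OF JC[OF fJ]] .
  have "\<forall>i. x i \<noteq> \<zero> \<longrightarrow> a \<le> i \<and> i < a + int n \<Longrightarrow> x \<in> J \<Longrightarrow> x \<in> PIdl\<^bsub>laurent R\<^esub> f" for n x a
  proof (induction n arbitrary: x)
    case 0
    then have "x i = \<zero>" for i by force
    then have "x = \<zero>\<^bsub>laurent R\<^esub>" unfolding laurent_simps by (intro ext)
    then show ?case using P.zero_closed by simp
  next
    case (Suc n)
    show ?case
    proof (cases "Suc n < N")
      case True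
      then have "x = \<zero>\<^bsub>laurent R\<^esub>" using Nmin[of "Suc n" x] Suc.prems unfolding width_def by blast
      then show ?thesis using P.zero_closed by simp
    next
      case False
      have if_: "inv (f (int N - 1)) \<in> carrier R" "inv (f (int N - 1)) \<otimes> f (int N - 1) = \<one>"
        using fN c[OF JC[OF fJ]] field_Units by auto
      define k where "k = x (a + int n) \<otimes> inv (f (int N - 1))"
      have k: "k \<in> carrier R" using c[OF JC[OF Suc.prems(2)]] if_ by (simp add: k_def)
      \<comment> \<open>This shift moves the top exponent N - 1 of \<open>f\<close> to the top
        exponent a + n of \<open>x\<close>. As N \<le> Suc n, the shifted support does not begin
        before a.\<close>
      let ?s = "a + int n - (int N - 1)"
      let ?y = "single R k ?s \<otimes>\<^bsub>laurent R\<^esub> f"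
      have yP: "?y \<in> PIdl\<^bsub>laurent R\<^esub> f"
        using P.I_l_closed[OF C.cgenideal_self[OF JC[OF fJ]] laurent_single[OF k]] .
      have yi: "?y i = k \<otimes> f (i - ?s)" for i using laurent_single_coeff[OF k JC[OF fJ]] .
      let ?z = "x \<ominus>\<^bsub>laurent R\<^esub> ?y"
      have yJ: "?y \<in> J" using yP sub by blast
      have zJ: "?z \<in> J" unfolding a_minus_def using Suc.prems(2) yJ by (intro J.a_closed J.a_inv_closed)
      have xz: "x = ?z \<oplus>\<^bsub>laurent R\<^esub> ?y"
        using JC[OF Suc.prems(2)] JC[OF yJ] by (simp add: a_minus_def C.a_assoc C.l_neg)
      have xi: "x i = ?z i \<oplus> ?y i" for i by (subst xz) (simp add: laurent_simps)
      have "\<forall>i. ?z i \<noteq> \<zero> \<longrightarrow> a \<le> i \<and> i < a + int n"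
      proof (intro allI impI)
        fix i assume zi: "?z i \<noteq> \<zero>"
        have zc: "?z i \<in> carrier R" using c[OF JC[OF zJ]] .
        show "a \<le> i \<and> i < a + int n"
        proof (rule ccontr)
          assume out: "\<not> (a \<le> i \<and> i < a + int n)"
          show False
          proof (cases "i = a + int n")
            case True
            have "?y i = k \<otimes> f (int N - 1)" using yi[of i] True by simp
            also have "\<dots> = x i" unfolding k_def using if_ c[OF JC[OF Suc.prems(2)]] c[OF JC[OF fJ]] True by (simp add: m_assoc)
            finally have "?z i \<oplus> x i = x i" using xi[of i] by simp
            then have "?z i = \<zero>" using zc c[OF JC[OF Suc.prems(2)], of i] by (metis add.r_cancel_one')
            with zi show False by simp
          next
            case neq: False
            then have x0: "x i = \<zero>" using Suc.prems(1) out by fastforce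
            have "f (i - ?s) = \<zero>" using fsupp[of "i - ?s"] out neq False by fastforce
            then have "?y i = \<zero>" using yi[of i] k by simp
            then show False using xi[of i] x0 zi zc by simp
          qed
        qed
      qed
      then have "?z \<in> PIdl\<^bsub>laurent R\<^esub> f" using Suc.IH zJ by blast
      then show ?thesis using xz yP P.a_closed by metis
    qed
  qed note div = this
  have "x \<in> PIdl\<^bsub>laurent R\<^esub> f" if x: "x \<in> J" for x
  proof -
    have "finite {i. x i \<noteq> \<zero>}" using JC[OF x] by (simp add: laurent_simps free_space_carrier_iff)
    then obtain b where b: "\<And>i. x i \<noteq> \<zero> \<Longrightarrow> \<bar>i\<bar> \<le> b"
      using finite_int_bounded by (metis (mono_tags) mem_Collect_eq)
    have "\<forall>i. x i \<noteq> \<zero> \<longrightarrow> - b \<le> i \<and> i < - b + int (nat (2 * b + 1))" using b by fastforce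
    with div x show ?thesis by blast
  qed
  then have "J = PIdl\<^bsub>laurent R\<^esub> f" using sub by (intro subset_antisym subsetI) auto
  moreover have "\<forall>i<0. f i = \<zero>" using fsupp by fastforce
  ultimately show ?thesis using fJ f0 by blast
qed

text \<open>The sum of the coefficients, that is, evaluation at x = 1, is 0 on every multiple of 1 -
  x and 1 on the unit element.\<close>

lemma laurent_one_minus_x_not_unit:
  assumes "g \<in> carrier (laurent R)"
  shows "g \<otimes>\<^bsub>laurent R\<^esub> (\<one>\<^bsub>laurent R\<^esub> \<ominus>\<^bsub>laurent R\<^esub> basis_elt R 1) \<noteq> \<one>\<^bsub>laurent R\<^esub>"
proof
  interpret C: cring "laurent R" by (rule laurent_cring)
  interpret A: nonunital_algebra R "laurent R" by (rule laurent_nonunital_algebra)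
  have fam: "additive_family R UNIV R (\<lambda>i k. k)" by (rule additive_familyI) auto
  have hom: "abelian_group_hom (free_space R UNIV) R (lin R R (\<lambda>i k. k))" by (rule lin_hom[OF is_abelian_group fam])
  then have hom': "abelian_group_hom (laurent R) R (lin R R (\<lambda>i k. k))"
    using A.abelian_group_A is_abelian_group abelian_group_hom.hom_closed[OF hom] abelian_group_hom.hom_add[OF hom]
    by (intro abelian_group_homI') (auto simp: laurent_simps)
  interpret e: abelian_group_hom "laurent R" R "lin R R (\<lambda>i k. k)" by (rule hom')
  let ?x = "basis_elt R (1 :: int)" and ?e = "lin R R (\<lambda>(i :: int) k. k)"
  have x: "?x \<in> carrier (laurent R)" unfolding basis_elt_single by (rule laurent_single) simp
  have single: "?e (single R k i) = k" if "k \<in> carrier R" for k i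
    using lin_single[OF is_abelian_group fam that, of i] by simp
  have "?e (g \<otimes>\<^bsub>laurent R\<^esub> (\<one>\<^bsub>laurent R\<^esub> \<ominus>\<^bsub>laurent R\<^esub> ?x)) = \<zero>"
  proof -
    have "?e (g \<otimes>\<^bsub>laurent R\<^esub> ?x) = ?e g"
    proof (rule laurent_ext[where f = "\<lambda>g. ?e (g \<otimes>\<^bsub>laurent R\<^esub> ?x)" and g = ?e and M = R])
      show "abelian_group_hom (laurent R) R (\<lambda>g. ?e (g \<otimes>\<^bsub>laurent R\<^esub> ?x))"
        using A.abelian_group_A is_abelian_group x
        by (intro abelian_group_homI') (auto simp: A.mult_l_distr)
    qed (use hom' assms in \<open>auto simp: basis_elt_single laurent_single_mult single\<close>)
    moreover have "g \<otimes>\<^bsub>laurent R\<^esub> (\<one>\<^bsub>laurent R\<^esub> \<ominus>\<^bsub>laurent R\<^esub> ?x) = g \<ominus>\<^bsub>laurent R\<^esub> g \<otimes>\<^bsub>laurent R\<^esub> ?x"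
      using assms x by (simp add: a_minus_def C.r_distr C.r_minus)
    ultimately show ?thesis using assms x by (simp add: a_minus_def r_neg)
  qed
  moreover assume "g \<otimes>\<^bsub>laurent R\<^esub> (\<one>\<^bsub>laurent R\<^esub> \<ominus>\<^bsub>laurent R\<^esub> ?x) = \<one>\<^bsub>laurent R\<^esub>"
  ultimately show False using single[of \<one> 0] by (simp add: laurent_simps(4))
qed

text \<open>A proper divisor of \<open>f\<close> generates a strictly larger ideal, which by
  maximality contains 1.\<close>

lemma laurent_maximal_irreducible:
  assumes "maximalideal (PIdl\<^bsub>laurent R\<^esub> f) (laurent R)" "f \<in> carrier (laurent R)" "f \<noteq> \<zero>\<^bsub>laurent R\<^esub>"
  shows "ring_irreducible\<^bsub>laurent R\<^esub> f"
proof -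
  interpret C: cring "laurent R" by (rule laurent_cring)
  interpret P: maximalideal "PIdl\<^bsub>laurent R\<^esub> f" "laurent R" by fact
  have "irreducible (laurent R) f"
  proof (rule irreducibleI)
    show "f \<notin> Units (laurent R)"
    proof
      assume "f \<in> Units (laurent R)"
      then have "inv\<^bsub>laurent R\<^esub> f \<otimes>\<^bsub>laurent R\<^esub> f = \<one>\<^bsub>laurent R\<^esub>" "inv\<^bsub>laurent R\<^esub> f \<in> carrier (laurent R)"
        by (rule C.Units_l_inv, rule C.Units_inv_closed)
      then have "\<one>\<^bsub>laurent R\<^esub> \<in> PIdl\<^bsub>laurent R\<^esub> f"
        using P.I_l_closed[OF C.cgenideal_self[OF assms(2)], of "inv\<^bsub>laurent R\<^esub> f"] by simp
      then have "PIdl\<^bsub>laurent R\<^esub> f = carrier (laurent R)" by (rule P.one_imp_carrier)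
      then show False using P.I_notcarr by simp
    qed
  next
    fix b assume b: "b \<in> carrier (laurent R)" "properfactor (laurent R) b f"
    then have d: "b divides\<^bsub>laurent R\<^esub> f" "\<not> f divides\<^bsub>laurent R\<^esub> b" by (auto simp: properfactor_def)
    interpret B: ideal "PIdl\<^bsub>laurent R\<^esub> b" "laurent R" using C.cgenideal_ideal[OF b(1)] .
    have "PIdl\<^bsub>laurent R\<^esub> f \<subseteq> PIdl\<^bsub>laurent R\<^esub> b"
      using d(1) C.to_contain_is_to_divide[OF b(1) assms(2)] by simp
    moreover have "\<not> PIdl\<^bsub>laurent R\<^esub> b \<subseteq> PIdl\<^bsub>laurent R\<^esub> f"
      using d(2) C.to_contain_is_to_divide[OF assms(2) b(1)] by simp
    moreover have "PIdl\<^bsub>laurent R\<^esub> b \<subseteq> carrier (laurent R)" by (rule B.a_subset)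
    ultimately have "PIdl\<^bsub>laurent R\<^esub> b = carrier (laurent R)"
      using P.I_maximal[OF B.ideal_axioms] by auto
    then have "\<one>\<^bsub>laurent R\<^esub> \<in> PIdl\<^bsub>laurent R\<^esub> b" using C.one_closed by simp
    then obtain y where y: "y \<in> carrier (laurent R)" "\<one>\<^bsub>laurent R\<^esub> = y \<otimes>\<^bsub>laurent R\<^esub> b"
      unfolding cgenideal_def by blast
    have "b \<otimes>\<^bsub>laurent R\<^esub> y = \<one>\<^bsub>laurent R\<^esub>" using C.m_comm[OF b(1) y(1)] y(2) by simp
    then show "b \<in> Units (laurent R)" unfolding Units_def using b(1) y by auto
  qed
  then show ?thesis using assms(3) by (simp add: ring_irreducible_def)
qed

end

section \<open>Cycles without exits\<close>

lemma (in leavitt_path) awalk_verts_map: "walk u p w \<Longrightarrow> E.awalk_verts u p = u # map (head E) p"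
  by (induction p arbitrary: u) auto

text \<open>\<open>no_exit\<close> speaks only of edges from which \<open>v\<close> can be reached
  again. Other edges may leave the cycle; in the application they end outside \<open>Y\<close>,
  which consists of the vertices above \<open>v\<close>.\<close>

locale no_exit_cycle = leavitt_path K E
  for K :: "('k, 'c) ring_scheme" and E :: "('v, 'e) pre_digraph" +
  fixes v :: 'v and c :: "'e list"
  assumes c_walk: "E.awalk v c v" and c_nonempty: "c \<noteq> []"
    and no_exit: "\<lbrakk>e \<in> set c; f \<in> arcs E; tail E f = tail E e; E.awalk (head E f) r v\<rbrakk> \<Longrightarrow> f = e"
    and c_minimal: "\<lbrakk>E.awalk v d v; d \<noteq> []\<rbrakk> \<Longrightarrow> length c \<le> length d"
begin

abbreviation "l \<equiv> length c"
abbreviation "q \<equiv> cycle c"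
text \<open>Positions are counted along the infinite repetition of \<open>c\<close>, so segments
  that wrap around need no modular indices.\<close>

definition "seg i k = stake k (sdrop i q)"
definition "ed i = q !! i"
definition "x i = tail E (ed i)"

lemma v: "v \<in> verts E"
  using c_walk by (rule walk_verts)

lemma l_pos: "0 < l" using c_nonempty by simp

lemma q_path: "infinite_path E q"
  unfolding infinite_path_def
proof
  fix i
  have c: "walk v (c @ c) v" using c_walk by (auto simp: walk_append)
  have snth: "q !! i = c ! (i mod l)" for i
  proof -
    have "q !! i = shd (sdrop i q)" by simp
    also have "\<dots> = c ! (i mod l)"
      using c_nonempty by (simp add: sdrop_cycle hd_rotate_conv_nth)
    finally show ?thesis .
  qed
  have m: "i mod l < l" using l_pos by simp
  have 1: "(c @ c) ! (i mod l) = q !! i" unfolding snth using m by (simp add: nth_append)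
  have 2: "(c @ c) ! Suc (i mod l) = q !! Suc i"
    unfolding snth using m by (auto simp: nth_append mod_Suc)
  show "q !! i \<in> arcs E \<and> head E (q !! i) = tail E (q !! Suc i)"
    using walk_nth[OF c, of "i mod l"] m unfolding 1 2 by simp
qed

lemma ed_arcs: "ed i \<in> arcs E" and head_ed: "head E (ed i) = x (Suc i)"
  using q_path by (auto simp only: infinite_path_def ed_def x_def)

lemma x_src: "x i = src (sdrop i q)"
  by (simp add: x_def ed_def)

lemma seg_simps: "seg i 0 = []" "seg i (Suc k) = ed i # seg (Suc i) k" "length (seg i k) = k"
  by (simp_all add: seg_def ed_def sdrop_stl)

lemma seg_nth: "j < k \<Longrightarrow> seg i k ! j = ed (i + j)"
  by (simp add: seg_def ed_def sdrop_snth add.commute)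

lemma x_0: "x 0 = v"
proof -
  have "v = tail E (hd c)" using c_walk c_nonempty by (cases c) auto
  then show ?thesis by (simp add: x_def ed_def)
qed

lemma period: "sdrop (i + n * l) q = sdrop i q"
proof -
  have "sdrop (n * l + i) q = sdrop i (sdrop (n * l) q)" by (simp add: sdrop_add)
  then show ?thesis using c_nonempty by (simp add: add.commute)
qed

lemma x_period: "x (i + n * l) = x i" "x (n * l) = v"
  using period[of i n] period[of 0 n] x_0 by (auto simp only: x_src add_0)

lemma seg_walk: "walk (x i) (seg i k) (x (i + k))"
  using walk_stake[OF infinite_path_sdrop[OF q_path], of i k]
  by (simp only: x_src seg_def sdrop_add)

lemma seg_walk_0: "walk v (seg 0 i) (x i)"
  using seg_walk[of 0 i] x_0 by simp

lemma x_reach: "\<exists>r. walk (x i) r v"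
proof -
  \<comment> \<open>Position l * i carries \<open>v\<close> and does not come before i, because l is
    positive.\<close>
  have "i + (l * i - i) = i * l" using l_pos by (cases l) auto
  then have "x (i + (l * i - i)) = v" using x_period(2) by simp
  with seg_walk[of i "l * i - i"] show ?thesis by auto
qed

lemma ed_c: "ed i \<in> set c"
proof -
  have "q !! i \<in> sset q" by simp
  then show ?thesis using c_nonempty unfolding ed_def by (simp del: snth_sset)
qed

text \<open>A walk that can still be continued to \<open>v\<close> has no choice at any of its
  edges.\<close>

lemma follow:
  assumes "walk (x i) r w" "walk w s v"
  shows "r = seg i (length r) \<and> w = x (i + length r)"
  using assms(1)
proof (induction r arbitrary: i)
  case (Cons e r)
  have e: "e \<in> arcs E" "tail E e = tail E (ed i)" "walk (head E e) r w" using Cons.prems by (auto simp: x_def)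
  have "walk (head E e) (r @ s) v" unfolding walk_append using e(3) assms(2) by blast
  then have eq: "e = ed i" using no_exit[OF ed_c e(1,2)] by blast
  with Cons.IH[of "Suc i"] e(3) show ?case by (simp add: head_ed seg_simps)
qed (simp add: seg_simps)

lemma x_eq_v: "x i = v \<Longrightarrow> i mod l = 0"
proof (rule ccontr)
  assume a: "x i = v" "i mod l \<noteq> 0"
  have "x (i mod l) = v" using a(1) x_period(1)[of "i mod l" "i div l"] by simp
  then have "walk v (seg 0 (i mod l)) v" using seg_walk_0[of "i mod l"] by simp
  moreover have "seg 0 (i mod l) \<noteq> []" using a(2) seg_simps(3)[of 0 "i mod l"] by (metis list.size(3))
  ultimately have "l \<le> i mod l" using c_minimal seg_simps(3) by metis
  then show False using l_pos mod_less_divisor[OF l_pos, of i] by simp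
qed

text \<open>One and the same path leads from both positions to \<open>v\<close>. By
  \<open>follow\<close> its length moves both indices to positions of \<open>v\<close>, and these
  are multiples of l.\<close>

lemma x_inj:
  assumes "x i = x j"
  shows "int l dvd int i - int j"
proof -
  obtain r where r: "walk (x i) r v" using x_reach by blast
  have vv: "walk v [] v" using v by simp
  have "v = x (i + length r)" "v = x (j + length r)"
    using follow[OF r vv] follow[of j r v, OF _ vv] r assms by auto
  then have "(i + length r) mod l = 0" "(j + length r) mod l = 0" using x_eq_v by metis+
  then have "l dvd i + length r" "l dvd j + length r" by (auto simp only: mod_eq_0_iff_dvd)
  then have "int l dvd int (i + length r)" "int l dvd int (j + length r)" by (simp_all only: int_dvd_int_iff)
  then have "int l dvd int (i + length r) - int (j + length r)" by (rule dvd_diff)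
  then show ?thesis by simp
qed

lemma heads_distinct: "distinct (map (head E) (seg i l))"
proof -
  have h: "head E (seg i l ! j) = x (Suc (i + j))" if "j < l" for j
    using that by (simp add: seg_nth head_ed)
  have neq: "x (Suc (i + j)) \<noteq> x (Suc (i + k))" if jk: "j < k" "k < l" for j k
  proof
    assume "x (Suc (i + j)) = x (Suc (i + k))"
    then have "int l dvd int (Suc (i + k)) - int (Suc (i + j))" by (intro x_inj) simp
    then have "int l \<le> int k - int j" using jk(1) by (intro zdvd_imp_le) auto
    then show False using jk by simp
  qed
  show ?thesis unfolding distinct_conv_nth
  proof (intro allI impI)
    fix j k assume "j < length (map (head E) (seg i l))" "k < length (map (head E) (seg i l))" "j \<noteq> k"
    then show "map (head E) (seg i l) ! j \<noteq> map (head E) (seg i l) ! k"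
      using neq[of j k] neq[of k j] by (cases "j < k") (auto simp: seg_simps(3) h)
  qed
qed

text \<open>A cycle based at a vertex of \<open>c\<close> returns to that vertex and so can be
  continued to \<open>v\<close>; hence it follows \<open>c\<close>. By \<open>x_inj\<close> its
  length is a multiple of l, and going around more than once would repeat a vertex.\<close>

lemma c_exclusive: "exclusive_cycle E c"
proof -
  have "seg 0 l = c" using c_nonempty by (simp add: seg_def)
  then have "E.cycle c"
    using heads_distinct[of 0] c_walk c_nonempty awalk_verts_map[OF c_walk] unfolding E.cycle_def by auto
  moreover have "\<exists>n. d = rotate n c" if d: "E.cycle d" "tail E (hd d) \<in> tail E ` set c" for d
  proof -
    obtain u where u: "walk u d u" "distinct (tl (E.awalk_verts u d))" "d \<noteq> []" using d(1) by (auto simp: E.cycle_def)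
    then have ud: "u = tail E (hd d)" by (cases d) auto
    obtain i where i: "i < l" "u = tail E (c ! i)" using d(2) ud by (auto simp: in_set_conv_nth)
    have sd: "sdrop i q = cycle (rotate i c)" using c_nonempty i(1) by (simp add: sdrop_cycle)
    then have ux: "u = x i" using i c_nonempty by (simp add: hd_rotate_conv_nth x_src)
    obtain r where r: "walk u r v" using x_reach ux by blast
    have f: "d = seg i (length d)" "x i = x (i + length d)" using follow[of i d u r] u(1) r ux by auto
    have "int l dvd int (i + length d) - int i" by (rule x_inj) (rule f(2)[symmetric])
    then have "int l dvd int (length d)" by simp
    then have le: "l \<le> length d" using u(3) by (intro dvd_imp_le) (auto simp only: int_dvd_int_iff length_greater_0_conv)
    have "\<not> l < length d"
    proof
      assume lt: "l < length d"
      have dist: "distinct (map (head E) d)" using u(2) awalk_verts_map[OF u(1)] by simp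
      have "d ! 0 = ed i" "d ! l = ed (i + l)"
        using seg_nth[of 0 "length d" i] seg_nth[of l "length d" i] lt f(1) u(3) by auto
      then have "head E (d ! 0) = x (Suc i)" "head E (d ! l) = x (Suc i + 1 * l)" by (auto simp: head_ed)
      then have "head E (d ! 0) = head E (d ! l)" using x_period(1)[of "Suc i" 1] by simp
      moreover have "map (head E) d ! 0 = head E (d ! 0)" "map (head E) d ! l = head E (d ! l)"
        by (rule nth_map, use lt u(3) in simp)+
      ultimately have "map (head E) d ! 0 = map (head E) d ! l" by simp
      then show False using dist lt l_pos u(3) nth_eq_iff_index_eq[of "map (head E) d" 0 l] by auto
    qed
    then have len: "length d = length (rotate i c)" using le by simp
    have "seg i (length (rotate i c)) = rotate i c"
      unfolding seg_def sd by (rule stake_cycle_eq) (use c_nonempty in simp)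
    then have "d = rotate i c" using f(1) len by simp
    then show ?thesis ..
  qed
  ultimately show ?thesis unfolding exclusive_cycle_def by blast
qed

text \<open>
  \<open>cp z\<close> is \<open>c\<^sup>z\<close>, with ghost paths for negative \<open>z\<close>. Without exits from \<open>c\<close> they invert each other,
  so that \<open>gl\<close> turns the corner of a module at \<open>v\<close> into a module over the Laurent polynomials.
\<close>

definition cp :: "int \<Rightarrow> ('v, 'e, 'k) lpa_elt" where
  "cp z = (if 0 \<le> z then mu v (seg 0 (nat z * l)) else nu v (seg 0 (nat (- z) * l)))"

lemma seg_closed: "walk v (seg 0 (n * l)) v"
  using seg_walk_0[of "n * l"] by (simp add: x_period)

lemma cp_closed [simp]: "cp z \<in> carrier L"
  unfolding cp_def using mu_closed[OF seg_closed] nu_closed[OF seg_closed] by (cases "0 \<le> z") (simp_all only: if_True if_False)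

lemma cp_ver: "cp z \<bullet> \<gamma> (Vertex v) = cp z" "\<gamma> (Vertex v) \<bullet> cp z = cp z"
  unfolding cp_def
  using mu_vertex[OF seg_closed] vertex_mu[OF seg_closed v] nu_vertex[OF seg_closed v] vertex_nu[OF seg_closed]
  by (cases "0 \<le> z"; simp only: if_True if_False refl)+

definition gl :: "(int \<Rightarrow> 'k) \<Rightarrow> ('v, 'e, 'k) lpa_elt" where
  "gl g = lin K L (\<lambda>i k. k \<odot>\<^bsub>L\<^esub> cp i) g"

abbreviation "P \<equiv> laurent K"

lemma gl_family: "additive_family K UNIV L (\<lambda>i k. k \<odot>\<^bsub>L\<^esub> cp i)"
  by (rule L.smult_additive_family) simp

lemma gl_hom: "abelian_group_hom P L gl"
proof -
  have hom: "abelian_group_hom (free_space K UNIV) L gl"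
    unfolding gl_def using K.lin_hom[OF L.abelian_group_A gl_family] .
  have ab: "abelian_group P"
    using K.laurent_nonunital_algebra by (rule nonunital_algebra.abelian_group_A)
  show ?thesis
    using abelian_group_hom.hom_closed[OF hom] abelian_group_hom.hom_add[OF hom] ab L.abelian_group_A
    by (intro abelian_group_homI') (simp_all only: K.laurent_simps)
qed

lemma gl_closed [simp]: "g \<in> carrier P \<Longrightarrow> gl g \<in> carrier L"
  using abelian_group_hom.hom_closed[OF gl_hom] .

lemma gl_single: "k \<in> carrier K \<Longrightarrow> gl (single K k i) = k \<odot>\<^bsub>L\<^esub> cp i"
  unfolding gl_def using K.lin_single[OF L.abelian_group_A gl_family] by simp

end

section \<open>The corner of a module at the base of the cycle\<close>

locale cyclic_module = no_exit_cycle K E v c + lpa_module K E M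
  for K :: "('k, 'c) ring_scheme" and E :: "('v, 'e) pre_digraph" and v c
    and M :: "(('v, 'e, 'k) lpa_elt, 'm) module" +
  assumes reaches: "Y = {u. \<exists>r. E.awalk u r v}"
    and edge_ghost: "\<lbrakk>e \<in> set c; y \<in> carrier M\<rbrakk> \<Longrightarrow>
      lpa_gen K E (Edge e) \<odot>\<^bsub>M\<^esub> (lpa_gen K E (Ghost e) \<odot>\<^bsub>M\<^esub> y) = lpa_gen K E (Vertex (tail E e)) \<odot>\<^bsub>M\<^esub> y"
begin

text \<open>By \<open>edge_ghost\<close> the edges of the cycle act as if they were unitary. This
  makes the powers of \<open>c\<close> invertible on the range of \<open>v\<close>.\<close>

lemma mu_nu_seg:
  assumes "y \<in> carrier M"
  shows "mu (x i) (seg i k) \<cdot> (nu (x i) (seg i k) \<cdot> y) = ver (x i) \<cdot> y"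
  using assms
proof (induction k arbitrary: i y)
  case 0
  show ?case using 0 walk_verts(1)[OF seg_walk] by (simp add: ver_ver seg_simps)
next
  case (Suc k)
  note seg = mu_closed[OF seg_walk[of "Suc i" k]] nu_closed[OF seg_walk[of "Suc i" k]]
  have g: "\<gamma> (Ghost (ed i)) \<cdot> y \<in> carrier M" using ed_arcs Suc.prems ghost_closed by simp
  have "mu (x i) (seg i (Suc k)) \<cdot> (nu (x i) (seg i (Suc k)) \<cdot> y) =
      \<gamma> (Edge (ed i)) \<cdot> (mu (x (Suc i)) (seg (Suc i) k) \<cdot> (nu (x (Suc i)) (seg (Suc i) k) \<cdot> (\<gamma> (Ghost (ed i)) \<cdot> y)))"
    using seg g Suc.prems ghost_closed[OF ed_arcs] by (simp add: act_mult seg_simps head_ed)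
  also have "\<dots> = \<gamma> (Edge (ed i)) \<cdot> (ver (x (Suc i)) \<cdot> (\<gamma> (Ghost (ed i)) \<cdot> y))"
    using Suc.IH[OF g, of "Suc i"] by simp
  also have "ver (x (Suc i)) \<cdot> (\<gamma> (Ghost (ed i)) \<cdot> y) = \<gamma> (Ghost (ed i)) \<cdot> y"
    using head_ghost[OF ed_arcs[of i]] Suc.prems ghost_closed[OF ed_arcs[of i]] walk_verts(1)[OF seg_walk[of "Suc i" 0]]
    by (simp add: act_mult[symmetric] head_ed)
  also have "\<gamma> (Edge (ed i)) \<cdot> (\<gamma> (Ghost (ed i)) \<cdot> y) = ver (x i) \<cdot> y"
    using edge_ghost[OF ed_c Suc.prems] unfolding x_def .
  finally show ?case .
qed

lemma seg_append: "seg i (j + k) = seg i j @ seg (i + j) k"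
  by (simp only: seg_def stake_add sdrop_add[symmetric])

text \<open>If the positions i and j have the same continuation, the k further edges and their
  ghosts meet in the middle and cancel by \<open>mu_nu_seg\<close>.\<close>

lemma shift_cancel:
  assumes "y \<in> carrier M" "x i = x j" "\<And>k. seg i k = seg j k"
  shows "mu v (seg 0 (i + k)) \<cdot> (nu v (seg 0 (j + k)) \<cdot> y) = mu v (seg 0 i) \<cdot> (nu v (seg 0 j) \<cdot> y)"
proof -
  have eq: "mu v (seg 0 (i + k)) = mu v (seg 0 i) \<bullet> mu (x i) (seg i k)"
      "nu v (seg 0 (j + k)) = nu (x i) (seg i k) \<bullet> nu v (seg 0 j)"
    using mu_append[OF seg_walk_0 seg_walk, of i k] nu_append[OF seg_walk_0 seg_walk, of j k] assms(2,3)
    by (auto simp: seg_append)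
  have c: "mu v (seg 0 i) \<in> carrier L" "mu (x i) (seg i k) \<in> carrier L" "nu (x i) (seg i k) \<in> carrier L"
    "nu v (seg 0 j) \<in> carrier L"
    using mu_closed[OF seg_walk_0] mu_closed[OF seg_walk] nu_closed[OF seg_walk] nu_closed[OF seg_walk_0] by blast+
  have "mu v (seg 0 (i + k)) \<cdot> (nu v (seg 0 (j + k)) \<cdot> y) = mu v (seg 0 i) \<cdot> (ver (x i) \<cdot> (nu v (seg 0 j) \<cdot> y))"
    unfolding eq using c assms(1) mu_nu_seg[of "nu v (seg 0 j) \<cdot> y" i k] by (simp add: act_mult)
  also have "ver (x i) \<cdot> (nu v (seg 0 j) \<cdot> y) = nu v (seg 0 j) \<cdot> y"
    using ver_nu[OF seg_walk_0 assms(1), of j] assms(2) by simp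
  finally show ?thesis .
qed

text \<open>Cancelling the shorter of the two lengths with \<open>shift_cancel\<close> leaves a pure
  power, positive or negative.\<close>

lemma cp_eq:
  assumes "y \<in> carrier M" "ver v \<cdot> y = y" "int i - int j = z * int l"
  shows "mu v (seg 0 i) \<cdot> (nu v (seg 0 j) \<cdot> y) = cp z \<cdot> y"
proof (cases "0 \<le> z")
  case True
  then have i: "i = nat z * l + j" using assms(3) by (metis diff_eq_eq int_nat_eq of_nat_add of_nat_eq_iff of_nat_mult)
  have p: "x (nat z * l) = x 0" "seg (nat z * l) k = seg 0 k" for k
    using x_period(2)[of "nat z"] period[of 0 "nat z"] x_0 by (auto simp: seg_def)
  have "mu v (seg 0 i) \<cdot> (nu v (seg 0 (0 + j)) \<cdot> y) = mu v (seg 0 (nat z * l)) \<cdot> (nu v (seg 0 0) \<cdot> y)"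
    unfolding i by (rule shift_cancel[OF assms(1) p])
  then show ?thesis using True assms(2) by (simp add: cp_def seg_simps)
next
  case False
  then have "int j = int (nat (- z) * l + i)" using assms(3) by (simp add: algebra_simps)
  then have j: "j = nat (- z) * l + i" by (simp only: of_nat_eq_iff)
  have p: "x 0 = x (nat (- z) * l)" "seg 0 k = seg (nat (- z) * l) k" for k
    using x_period(2)[of "nat (- z)"] period[of 0 "nat (- z)"] x_0 by (auto simp: seg_def)
  have "mu v (seg 0 (0 + i)) \<cdot> (nu v (seg 0 j) \<cdot> y) = mu v (seg 0 0) \<cdot> (nu v (seg 0 (nat (- z) * l)) \<cdot> y)"
    unfolding j by (rule shift_cancel[OF assms(1) p])
  then show ?thesis using False ver_nu[OF seg_closed assms(1), of "nat (- z)"] by (simp add: cp_def seg_simps)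
qed

lemma ver_cp: "y \<in> carrier M \<Longrightarrow> ver v \<cdot> (cp z \<cdot> y) = cp z \<cdot> y"
  using v cp_ver(2)[of z] by (simp add: act_mult[symmetric])

lemma cp_add:
  assumes "y \<in> carrier M" "ver v \<cdot> y = y"
  shows "cp z \<cdot> (cp z' \<cdot> y) = cp (z + z') \<cdot> y"
proof -
  \<comment> \<open>Large enough to write both powers as a path times a ghost path with the same
    middle length N * l, where the ghost of the first and the path of the second cancel.\<close>
  define N where "N = \<bar>z\<bar> + \<bar>z'\<bar>"
  define i j k where "i = nat (N + z) * l" and "j = nat N * l" and "k = nat (N - z') * l"
  have nn: "0 \<le> N + z" "0 \<le> N" "0 \<le> N - z'" unfolding N_def by auto
  have ijk: "int i - int j = z * int l" "int j - int k = z' * int l" "int i - int k = (z + z') * int l"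
    using nn unfolding i_def j_def k_def by (simp_all add: algebra_simps)
  have c: "mu v (seg 0 i) \<in> carrier L" "nu v (seg 0 j) \<in> carrier L" "mu v (seg 0 j) \<in> carrier L" "nu v (seg 0 k) \<in> carrier L"
    using mu_closed[OF seg_walk_0] nu_closed[OF seg_walk_0] by blast+
  have "cp z \<cdot> (cp z' \<cdot> y) = mu v (seg 0 i) \<cdot> (nu v (seg 0 j) \<cdot> (cp z' \<cdot> y))"
    using cp_eq[OF _ ver_cp ijk(1), of z'] assms by simp
  also have "\<dots> = mu v (seg 0 i) \<cdot> (nu v (seg 0 j) \<cdot> (mu v (seg 0 j) \<cdot> (nu v (seg 0 k) \<cdot> y)))"
    using cp_eq[OF assms ijk(2)] by simp
  also have "nu v (seg 0 j) \<cdot> (mu v (seg 0 j) \<cdot> (nu v (seg 0 k) \<cdot> y)) = ver (x j) \<cdot> (nu v (seg 0 k) \<cdot> y)"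
    using c assms by (intro nu_mu[OF seg_walk_0]) simp
  also have "\<dots> = nu v (seg 0 k) \<cdot> y"
    using ver_nu[OF seg_walk_0 assms(1), of k] x_period(2) unfolding j_def k_def by simp
  also have "mu v (seg 0 i) \<cdot> (nu v (seg 0 k) \<cdot> y) = cp (z + z') \<cdot> y"
    by (rule cp_eq[OF assms ijk(3)])
  finally show ?thesis .
qed

lemma gl_act_hom: "y \<in> carrier M \<Longrightarrow> abelian_group_hom P M (\<lambda>g. gl g \<cdot> y)"
proof -
  assume y: "y \<in> carrier M"
  have ab: "abelian_group M" by intro_locales
  show ?thesis
    using abelian_group_hom.hom_add[OF gl_hom] y ab K.laurent_nonunital_algebra[THEN nonunital_algebra.abelian_group_A]
    by (intro abelian_group_homI') (simp_all add: act_add_l)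
qed

lemma gl_ver: "g \<in> carrier P \<Longrightarrow> y \<in> carrier M \<Longrightarrow> ver v \<cdot> (gl g \<cdot> y) = gl g \<cdot> y"
proof -
  assume g: "g \<in> carrier P" and y: "y \<in> carrier M"
  have ab: "abelian_group M" by intro_locales
  note h = gl_act_hom[OF y]
  have h': "abelian_group_hom P M (\<lambda>g. ver v \<cdot> (gl g \<cdot> y))"
    using abelian_group_hom.hom_add[OF h] y v ab K.laurent_nonunital_algebra[THEN nonunital_algebra.abelian_group_A]
    by (intro abelian_group_homI') (simp_all add: M.smult_r_distr)
  show ?thesis
  proof (rule K.laurent_ext[OF h' h _ g])
    fix k i assume k: "k \<in> carrier K"
    have "ver v \<cdot> ((k \<odot>\<^bsub>L\<^esub> cp i) \<cdot> y) = (ver v \<bullet> (k \<odot>\<^bsub>L\<^esub> cp i)) \<cdot> y" using k v y by (simp add: act_mult)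
    also have "ver v \<bullet> (k \<odot>\<^bsub>L\<^esub> cp i) = k \<odot>\<^bsub>L\<^esub> cp i" using k v by (simp add: L.mult_smult cp_ver)
    finally show "ver v \<cdot> (gl (single K k i) \<cdot> y) = gl (single K k i) \<cdot> y" using k by (simp add: gl_single)
  qed
qed

lemma smult_cp_act:
  assumes "k \<in> carrier K" "y \<in> carrier M" "ver v \<cdot> y = y"
  shows "(k \<odot>\<^bsub>L\<^esub> cp i) \<cdot> y = cp i \<cdot> ((k \<odot>\<^bsub>L\<^esub> ver v) \<cdot> y)"
  using act_smult_mult'[of k "cp i" "ver v" y] assms v by (simp add: cp_ver)

lemma gl_mult:
  assumes "f \<in> carrier P" "g \<in> carrier P" "y \<in> carrier M" "ver v \<cdot> y = y"
  shows "gl (f \<otimes>\<^bsub>P\<^esub> g) \<cdot> y = gl f \<cdot> (gl g \<cdot> y)"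
proof -
  interpret P: nonunital_algebra K P by (rule K.laurent_nonunital_algebra)
  have ab: "abelian_group M" by intro_locales
  have left: "abelian_group_hom P M (\<lambda>f. gl (f \<otimes>\<^bsub>P\<^esub> g) \<cdot> y)" if "g \<in> carrier P" for g
    using abelian_group_hom.hom_add[OF gl_act_hom[OF assms(3)]] that assms(3) ab P.abelian_group_A
    by (intro abelian_group_homI') (simp_all add: P.mult_l_distr)
  have right: "abelian_group_hom P M (\<lambda>g. gl (f \<otimes>\<^bsub>P\<^esub> g) \<cdot> y)" if "f \<in> carrier P" for f
    using abelian_group_hom.hom_add[OF gl_act_hom[OF assms(3)]] that assms(3) ab P.abelian_group_A
    by (intro abelian_group_homI') (simp_all add: P.mult_r_distr)
  have right': "abelian_group_hom P M (\<lambda>g. gl f \<cdot> (gl g \<cdot> y))" if "f \<in> carrier P" for f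
    using abelian_group_hom.hom_add[OF gl_act_hom[OF assms(3)]] that assms(3) ab P.abelian_group_A
    by (intro abelian_group_homI') (simp_all add: M.smult_r_distr)
  have left': "abelian_group_hom P M (\<lambda>f. gl f \<cdot> (gl g \<cdot> y))" using gl_act_hom assms by simp
  show ?thesis
  proof (rule K.laurent_ext[OF left left' _ assms(1)], rule assms(2))
    fix k i assume k: "k \<in> carrier K"
    have s: "single K k i \<in> carrier P" using k by (rule K.laurent_single)
    show "gl (single K k i \<otimes>\<^bsub>P\<^esub> g) \<cdot> y = gl (single K k i) \<cdot> (gl g \<cdot> y)"
    proof (rule K.laurent_ext[OF right[OF s] right'[OF s] _ assms(2)])
      fix k' j assume k': "k' \<in> carrier K"
      \<comment> \<open>Scalars act through multiples of \<open>v\<close>, and these commute with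
        the powers of the cycle.\<close>
      have kv: "(k \<odot>\<^bsub>L\<^esub> ver v) \<cdot> (cp j \<cdot> z) = cp j \<cdot> ((k \<odot>\<^bsub>L\<^esub> ver v) \<cdot> z)" if "z \<in> carrier M" "ver v \<cdot> z = z" for z
        using act_smult_mult[of k "ver v" "cp j" z] smult_cp_act[OF k that, of j] k v that by (simp add: cp_ver)
      have vk: "ver v \<cdot> ((k \<odot>\<^bsub>L\<^esub> ver v) \<cdot> z) = (k \<odot>\<^bsub>L\<^esub> ver v) \<cdot> z" if "k \<in> carrier K" "z \<in> carrier M" for k z
        using that v by (simp add: act_mult[symmetric] L.mult_smult vertex_mult)
      let ?z = "(k' \<odot>\<^bsub>L\<^esub> ver v) \<cdot> y" and ?w = "(k \<odot>\<^bsub>L\<^esub> ver v) \<cdot> ((k' \<odot>\<^bsub>L\<^esub> ver v) \<cdot> y)"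
      have z: "?z \<in> carrier M" "ver v \<cdot> ?z = ?z" "?w \<in> carrier M" "ver v \<cdot> ?w = ?w"
        using k k' v assms(3) vk by auto
      have cz: "cp j \<cdot> ?z \<in> carrier M" "ver v \<cdot> (cp j \<cdot> ?z) = cp j \<cdot> ?z" using z ver_cp by auto
      have "gl (single K k i) \<cdot> (gl (single K k' j) \<cdot> y) = cp i \<cdot> ((k \<odot>\<^bsub>L\<^esub> ver v) \<cdot> (cp j \<cdot> ?z))"
        using k k' assms z smult_cp_act[OF k cz, of i] smult_cp_act[OF k' assms(3,4), of j]
        by (simp add: gl_single)
      also have "\<dots> = cp (i + j) \<cdot> ?w" using kv[OF z(1,2)] cp_add[OF z(3,4)] by simp
      also have "?w = ((k \<otimes>\<^bsub>K\<^esub> k') \<odot>\<^bsub>L\<^esub> ver v) \<cdot> y"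
        using k k' v assms(3) L.smult_left_commute[OF k k', of "ver v"]
        by (simp add: act_mult[symmetric] L.smult_mult L.mult_smult vertex_mult L.smult_assoc1)
      also have "cp (i + j) \<cdot> \<dots> = ((k \<otimes>\<^bsub>K\<^esub> k') \<odot>\<^bsub>L\<^esub> cp (i + j)) \<cdot> y"
        using smult_cp_act[of "k \<otimes>\<^bsub>K\<^esub> k'" y "i + j"] k k' assms by simp
      finally show "gl (single K k i \<otimes>\<^bsub>P\<^esub> single K k' j) \<cdot> y = gl (single K k i) \<cdot> (gl (single K k' j) \<cdot> y)"
        using k k' by (simp add: K.laurent_single_mult gl_single)
    qed
  qed
qed

lemma gl_one: "y \<in> carrier M \<Longrightarrow> gl \<one>\<^bsub>P\<^esub> \<cdot> y = ver v \<cdot> y"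
  using v by (simp add: K.laurent_simps gl_single cp_def seg_simps)

text \<open>If the meeting vertex w does not reach \<open>v\<close>, it lies outside
  \<open>Y\<close> and the monomial acts as 0. Otherwise \<open>follow\<close> forces both paths
  along the cycle, and by \<open>x_inj\<close> their lengths differ by a multiple of l.\<close>

lemma corner_mon:
  assumes "walk u p w" "walk u' r w" "k \<in> carrier K" "y \<in> carrier M" "ver v \<cdot> y = y"
  shows "ver v \<cdot> ((k \<odot>\<^bsub>L\<^esub> (mu u p \<bullet> nu u' r)) \<cdot> y) =
    (if u = v \<and> u' = v \<and> (\<exists>s. walk w s v)
     then (k \<odot>\<^bsub>L\<^esub> cp ((int (length p) - int (length r)) div int l)) \<cdot> y else \<zero>\<^bsub>M\<^esub>)"
proof -
  have c: "mu u p \<in> carrier L" "nu u' r \<in> carrier L" using assms mu_closed nu_closed by blast+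
  have eq: "ver v \<cdot> ((k \<odot>\<^bsub>L\<^esub> (mu u p \<bullet> nu u' r)) \<cdot> y) = (k \<odot>\<^bsub>L\<^esub> (ver v \<bullet> mu u p)) \<cdot> (nu u' r \<cdot> y)"
    using c v assms by (simp add: act_mult[symmetric] L.mult_smult L.smult_mult L.mult_assoc)
  note vm = vertex_mu[OF assms(1) v]
  have nz: "nu u' r \<cdot> y = \<zero>\<^bsub>M\<^esub>" if "u' \<noteq> v"
    using nu_ver[OF assms(2) v assms(4)] that assms(5) by simp
  have nr: "nu u' r \<cdot> y = \<zero>\<^bsub>M\<^esub>" if "\<not> (\<exists>s. walk w s v)"
    using nu_Y_zero[OF assms(2,4)] that reaches by simp
  show ?thesis
  proof (cases "u = v \<and> u' = v \<and> (\<exists>s. walk w s v)")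
    case True
    then obtain s where s: "walk w s v" by blast
    have p: "p = seg 0 (length p)" "w = x (length p)" using follow[of 0 p w s] assms(1) True s x_0 by auto
    have r: "r = seg 0 (length r)" "w = x (length r)" using follow[of 0 r w s] assms(2) True s x_0 by auto
    have "int l dvd int (length p) - int (length r)" using x_inj p(2) r(2) by simp
    then have z: "int (length p) - int (length r) = (int (length p) - int (length r)) div int l * int l" by simp
    let ?z = "(int (length p) - int (length r)) div int l"
    have kv: "(k \<odot>\<^bsub>L\<^esub> ver v) \<cdot> y \<in> carrier M" "ver v \<cdot> ((k \<odot>\<^bsub>L\<^esub> ver v) \<cdot> y) = (k \<odot>\<^bsub>L\<^esub> ver v) \<cdot> y"
      using assms v by (auto simp: act_mult[symmetric] L.mult_smult vertex_mult)
    have "ver v \<cdot> ((k \<odot>\<^bsub>L\<^esub> (mu u p \<bullet> nu u' r)) \<cdot> y) = (k \<odot>\<^bsub>L\<^esub> (mu v p \<bullet> nu v r)) \<cdot> y"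
      using eq c assms True vm by (simp add: act_smult_mult)
    also have "\<dots> = (k \<odot>\<^bsub>L\<^esub> (mu v p \<bullet> (nu v r \<bullet> ver v))) \<cdot> y"
      using nu_vertex[OF assms(2) v] True by simp
    also have "\<dots> = (mu v p \<bullet> (nu v r \<bullet> (k \<odot>\<^bsub>L\<^esub> ver v))) \<cdot> y"
      using c True v assms by (simp add: L.mult_smult)
    also have "\<dots> = mu v p \<cdot> (nu v r \<cdot> ((k \<odot>\<^bsub>L\<^esub> ver v) \<cdot> y))"
      using c True v assms by (simp add: act_mult)
    also have "\<dots> = mu v (seg 0 (length p)) \<cdot> (nu v (seg 0 (length r)) \<cdot> ((k \<odot>\<^bsub>L\<^esub> ver v) \<cdot> y))"
      using p(1) r(1) by simp
    also have "\<dots> = cp ?z \<cdot> ((k \<odot>\<^bsub>L\<^esub> ver v) \<cdot> y)" by (rule cp_eq[OF kv z])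
    finally show ?thesis using True smult_cp_act[OF assms(3-5)] by simp
  next
    case False
    then consider "u \<noteq> v" | "u' \<noteq> v" | "\<not> (\<exists>s. walk w s v)" by blast
    then have "(k \<odot>\<^bsub>L\<^esub> (ver v \<bullet> mu u p)) \<cdot> (nu u' r \<cdot> y) = \<zero>\<^bsub>M\<^esub>"
    proof cases
      case 1
      then show ?thesis using vm c assms(3,4) by (simp add: L.smult_r_null)
    qed (use nz nr vm c assms(3) v in \<open>simp_all\<close>)
    then show ?thesis using eq False by (simp only: if_False)
  qed
qed

end

text \<open>One Laurent polynomial serves both modules at once, because the power of the cycle in
  \<open>corner_mon\<close> is read off the monomial alone. Through it the actions of a on
  \<open>M\<close> and \<open>N\<close> can be compared.\<close>

lemma (in no_exit_cycle) corner:
  assumes "cyclic_module K E v c M" "cyclic_module K E v c N" "a \<in> carrier L"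
  shows "\<exists>g\<in>carrier P.
    (\<forall>y\<in>carrier M. \<gamma> (Vertex v) \<odot>\<^bsub>M\<^esub> y = y \<longrightarrow> \<gamma> (Vertex v) \<odot>\<^bsub>M\<^esub> (a \<odot>\<^bsub>M\<^esub> y) = gl g \<odot>\<^bsub>M\<^esub> y) \<and>
    (\<forall>y\<in>carrier N. \<gamma> (Vertex v) \<odot>\<^bsub>N\<^esub> y = y \<longrightarrow> \<gamma> (Vertex v) \<odot>\<^bsub>N\<^esub> (a \<odot>\<^bsub>N\<^esub> y) = gl g \<odot>\<^bsub>N\<^esub> y)"
  using assms(3)
proof (induction a rule: mon_induct)
  interpret M: cyclic_module K E v c M by fact
  interpret N: cyclic_module K E v c N by fact
  interpret P: nonunital_algebra K P by (rule K.laurent_nonunital_algebra)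
  have gl_zero: "gl \<zero>\<^bsub>P\<^esub> = \<zero>\<^bsub>L\<^esub>" by (rule abelian_group_hom.hom_zero[OF gl_hom])
  {
    case zero
    show ?case using v gl_zero by (intro bexI[of _ "\<zero>\<^bsub>P\<^esub>"]) simp_all
  next
    case (add a b)
    then obtain f g where fg: "f \<in> carrier P" "g \<in> carrier P"
      "\<forall>y\<in>carrier M. \<gamma> (Vertex v) \<odot>\<^bsub>M\<^esub> y = y \<longrightarrow> \<gamma> (Vertex v) \<odot>\<^bsub>M\<^esub> (a \<odot>\<^bsub>M\<^esub> y) = gl f \<odot>\<^bsub>M\<^esub> y"
      "\<forall>y\<in>carrier N. \<gamma> (Vertex v) \<odot>\<^bsub>N\<^esub> y = y \<longrightarrow> \<gamma> (Vertex v) \<odot>\<^bsub>N\<^esub> (a \<odot>\<^bsub>N\<^esub> y) = gl f \<odot>\<^bsub>N\<^esub> y"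
      "\<forall>y\<in>carrier M. \<gamma> (Vertex v) \<odot>\<^bsub>M\<^esub> y = y \<longrightarrow> \<gamma> (Vertex v) \<odot>\<^bsub>M\<^esub> (b \<odot>\<^bsub>M\<^esub> y) = gl g \<odot>\<^bsub>M\<^esub> y"
      "\<forall>y\<in>carrier N. \<gamma> (Vertex v) \<odot>\<^bsub>N\<^esub> y = y \<longrightarrow> \<gamma> (Vertex v) \<odot>\<^bsub>N\<^esub> (b \<odot>\<^bsub>N\<^esub> y) = gl g \<odot>\<^bsub>N\<^esub> y"
      by blast
    have "gl (f \<oplus>\<^bsub>P\<^esub> g) = gl f \<oplus>\<^bsub>L\<^esub> gl g" by (rule abelian_group_hom.hom_add[OF gl_hom fg(1,2)])
    then show ?case
      using fg add(1,2) v by (intro bexI[of _ "f \<oplus>\<^bsub>P\<^esub> g"])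
        (simp_all add: M.act_add_l N.act_add_l M.M.smult_r_distr N.M.smult_r_distr)
  next
    case (mon k u p u' r w)
    show ?case
    proof (cases "u = v \<and> u' = v \<and> (\<exists>s. walk w s v)")
      case True
      show ?thesis
        using True M.corner_mon[OF mon(2,3,1)] N.corner_mon[OF mon(2,3,1)] mon(1)
        by (intro bexI[of _ "single K k ((int (length p) - int (length r)) div int l)"])
          (simp_all add: gl_single K.laurent_single)
    next
      case False
      show ?thesis
        using M.corner_mon[OF mon(2,3,1)] N.corner_mon[OF mon(2,3,1)] gl_zero
        unfolding if_not_P[OF False] by (intro bexI[of _ "\<zero>\<^bsub>P\<^esub>"]) simp_all
    qed
  }
qed

section \<open>The annihilating polynomial\<close>

locale cyclic_simple = cyclic_module K E v c M + lpa_simple K E M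
  for K :: "('k, 'c) ring_scheme" and E :: "('v, 'e) pre_digraph" and v c
    and M :: "(('v, 'e, 'k) lpa_elt, 'm) module"
begin

lemma gl_transitive:
  assumes "y \<in> carrier M" "y \<noteq> \<zero>\<^bsub>M\<^esub>" "ver v \<cdot> y = y" "m \<in> carrier M" "ver v \<cdot> m = m"
  shows "\<exists>g\<in>carrier P. gl g \<cdot> y = m"
proof -
  obtain a where a: "a \<in> carrier L" "a \<cdot> y = m" using generates[OF assms(1,2,4)] by blast
  with corner[OF cyclic_module_axioms cyclic_module_axioms a(1)] assms show ?thesis by auto
qed

definition "ann m = {g \<in> carrier P. gl g \<cdot> m = \<zero>\<^bsub>M\<^esub>}"

text \<open>By \<open>gl_transitive\<close> the corner at \<open>v\<close> is a simple module over
  the Laurent polynomials. An element g outside \<open>ann m\<close> has an f with f g m = m, so an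
  ideal containing \<open>ann m\<close> and g contains 1.\<close>

lemma ann_maximal:
  assumes m: "m \<in> carrier M" "m \<noteq> \<zero>\<^bsub>M\<^esub>" "ver v \<cdot> m = m"
  shows "maximalideal (ann m) P"
proof -
  interpret P: cring P by (rule K.laurent_cring)
  interpret h: abelian_group_hom P M "\<lambda>g. gl g \<cdot> m" by (rule gl_act_hom[OF m(1)])
  have ideal: "ideal (ann m) P"
  proof (rule idealI[OF P.ring_axioms])
    show "subgroup (ann m) (add_monoid P)"
      by (rule group.subgroupI[OF P.add.is_group])
        (auto simp: ann_def a_inv_def[symmetric] intro: P.zero_closed)
  next
    fix a b assume a: "a \<in> ann m" and b: "b \<in> carrier P"
    then have "gl (b \<otimes>\<^bsub>P\<^esub> a) \<cdot> m = \<zero>\<^bsub>M\<^esub>" using gl_mult[OF b _ m(1,3), of a] by (simp add: ann_def)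
    then show "b \<otimes>\<^bsub>P\<^esub> a \<in> ann m" "a \<otimes>\<^bsub>P\<^esub> b \<in> ann m"
      using a b P.m_comm[of a b] by (auto simp: ann_def)
  qed
  show ?thesis
  proof (rule maximalidealI[OF ideal])
    have "\<one>\<^bsub>P\<^esub> \<notin> ann m" using gl_one[OF m(1)] m by (simp add: ann_def)
    then show "carrier P \<noteq> ann m" using P.one_closed by metis
  next
    fix J assume J: "ideal J P" "ann m \<subseteq> J" "J \<subseteq> carrier P"
    interpret J: ideal J P by fact
    show "J = ann m \<or> J = carrier P"
    proof (rule disjCI)
      assume ne: "J \<noteq> carrier P"
      have "g \<in> ann m" if g: "g \<in> J" for g
      proof (rule ccontr)
        assume nz: "g \<notin> ann m"
        have gP: "g \<in> carrier P" using g J(3) by blast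
        then have "gl g \<cdot> m \<noteq> \<zero>\<^bsub>M\<^esub>" using nz by (simp add: ann_def)
        then obtain f where f: "f \<in> carrier P" "gl f \<cdot> (gl g \<cdot> m) = m"
          using gl_transitive[of "gl g \<cdot> m" m] m gP gl_ver[OF gP m(1)] by auto
        have fg: "f \<otimes>\<^bsub>P\<^esub> g \<in> carrier P" "f \<otimes>\<^bsub>P\<^esub> g \<in> J" using f(1) gP J.I_l_closed[OF g] by auto
        have "gl (\<one>\<^bsub>P\<^esub> \<ominus>\<^bsub>P\<^esub> f \<otimes>\<^bsub>P\<^esub> g) \<cdot> m = \<zero>\<^bsub>M\<^esub>"
          using fg(1) f(2) gl_mult[OF f(1) gP m(1,3)] gl_one[OF m(1)] m by (simp add: a_minus_def M.r_neg)
        then have "\<one>\<^bsub>P\<^esub> \<ominus>\<^bsub>P\<^esub> f \<otimes>\<^bsub>P\<^esub> g \<in> J" using J(2) fg(1) by (auto simp: ann_def)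
        then have "(\<one>\<^bsub>P\<^esub> \<ominus>\<^bsub>P\<^esub> f \<otimes>\<^bsub>P\<^esub> g) \<oplus>\<^bsub>P\<^esub> f \<otimes>\<^bsub>P\<^esub> g \<in> J" using fg(2) by (rule J.a_closed)
        then have "\<one>\<^bsub>P\<^esub> \<in> J" using fg(1) by (simp add: a_minus_def P.a_assoc P.l_neg)
        then show False using J.one_imp_carrier ne by simp
      qed
      then show "J = ann m" using J(2) by (intro subset_antisym subsetI) auto
    qed
  qed
qed

text \<open>Otherwise 1 - x would not kill \<open>m\<close>, some f would carry the result back to
  \<open>m\<close>, and f (1 - x) - 1 would annihilate \<open>m\<close>, hence be 0. But 1 - x is
  not a unit.\<close>

lemma ann_nonzero:
  assumes m: "m \<in> carrier M" "m \<noteq> \<zero>\<^bsub>M\<^esub>" "ver v \<cdot> m = m"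
  shows "\<exists>g\<in>ann m. g \<noteq> \<zero>\<^bsub>P\<^esub>"
proof (rule ccontr)
  interpret P: cring P by (rule K.laurent_cring)
  interpret h: abelian_group_hom P M "\<lambda>g. gl g \<cdot> m" by (rule gl_act_hom[OF m(1)])
  assume none: "\<not> ?thesis"
  let ?d = "\<one>\<^bsub>P\<^esub> \<ominus>\<^bsub>P\<^esub> basis_elt K (1 :: int)"
  have d: "?d \<in> carrier P" using K.laurent_single[of "\<one>\<^bsub>K\<^esub>" 1] by (simp add: basis_elt_single)
  have d0: "?d \<noteq> \<zero>\<^bsub>P\<^esub>"
  proof
    assume "?d = \<zero>\<^bsub>P\<^esub>"
    then have "\<one>\<^bsub>P\<^esub> = basis_elt K (1 :: int)"
      using K.laurent_single[of "\<one>\<^bsub>K\<^esub>" 1] by (simp add: basis_elt_single P.minus_eq_zero_iff)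
    then have "single K \<one>\<^bsub>K\<^esub> (0 :: int) 0 = single K \<one>\<^bsub>K\<^esub> (1 :: int) 0" by (simp only: K.laurent_simps basis_elt_single)
    then show False by (simp add: single_def)
  qed
  then have "gl ?d \<cdot> m \<noteq> \<zero>\<^bsub>M\<^esub>" using none d by (auto simp: ann_def)
  then obtain f where f: "f \<in> carrier P" "gl f \<cdot> (gl ?d \<cdot> m) = m"
    using gl_transitive[of "gl ?d \<cdot> m" m] m d gl_ver[OF d m(1)] by auto
  have fd: "f \<otimes>\<^bsub>P\<^esub> ?d \<in> carrier P" using f(1) d by simp
  have "gl (f \<otimes>\<^bsub>P\<^esub> ?d \<ominus>\<^bsub>P\<^esub> \<one>\<^bsub>P\<^esub>) \<cdot> m = gl (f \<otimes>\<^bsub>P\<^esub> ?d) \<cdot> m \<ominus>\<^bsub>M\<^esub> gl \<one>\<^bsub>P\<^esub> \<cdot> m"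
    using h.hom_add[OF fd P.a_inv_closed[OF P.one_closed]] h.hom_a_inv[OF P.one_closed] by (simp add: a_minus_def)
  also have "\<dots> = \<zero>\<^bsub>M\<^esub>"
    using f(2) gl_mult[OF f(1) d m(1,3)] gl_one[OF m(1)] m by (simp add: a_minus_def M.r_neg)
  finally have "f \<otimes>\<^bsub>P\<^esub> ?d \<ominus>\<^bsub>P\<^esub> \<one>\<^bsub>P\<^esub> = \<zero>\<^bsub>P\<^esub>" using none fd by (auto simp: ann_def)
  then have "f \<otimes>\<^bsub>P\<^esub> ?d = \<one>\<^bsub>P\<^esub>" using P.minus_eq_zero_iff[OF fd P.one_closed] by simp
  then show False using K.laurent_one_minus_x_not_unit[OF f(1)] by simp
qed

lemma ann_generator:
  assumes m: "m \<in> carrier M" "m \<noteq> \<zero>\<^bsub>M\<^esub>" "ver v \<cdot> m = m"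
  shows "\<exists>f\<in>carrier P. ann m = PIdl\<^bsub>P\<^esub> f \<and> f 0 = \<one>\<^bsub>K\<^esub> \<and> (\<forall>i<0. f i = \<zero>\<^bsub>K\<^esub>) \<and>
    (\<exists>n\<ge>1. f n \<noteq> \<zero>\<^bsub>K\<^esub>) \<and> maximalideal (PIdl\<^bsub>P\<^esub> f) P \<and> ring_irreducible\<^bsub>P\<^esub> f"
proof -
  interpret J: maximalideal "ann m" P by (rule ann_maximal[OF m])
  obtain g where "g \<in> ann m" "g \<noteq> \<zero>\<^bsub>P\<^esub>" using ann_nonzero[OF m] by blast
  from K.laurent_ideal_principal[OF J.ideal_axioms this] obtain f where
    f: "f \<in> ann m" "ann m = PIdl\<^bsub>P\<^esub> f" "f 0 = \<one>\<^bsub>K\<^esub>" "\<forall>i<0. f i = \<zero>\<^bsub>K\<^esub>" by blast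
  \<comment> \<open>With constant term 1 and no other coefficient, f would be 1, which fixes
    \<open>m\<close>.\<close>
  have "\<exists>n\<ge>1. f n \<noteq> \<zero>\<^bsub>K\<^esub>"
  proof (rule ccontr)
    assume "\<not> ?thesis"
    then have "f i = \<zero>\<^bsub>K\<^esub>" if "i \<noteq> 0" for i using f(4) that by (cases "i < 0") auto
    then have "f i = single K \<one>\<^bsub>K\<^esub> 0 i" for i using f(3) by (cases "i = 0") (simp_all add: single_def)
    then have "f = \<one>\<^bsub>P\<^esub>" unfolding K.laurent_simps by (rule ext)
    moreover have "gl f \<cdot> m = \<zero>\<^bsub>M\<^esub>" using f(1) unfolding ann_def by simp
    ultimately show False using gl_one[OF m(1)] m(2,3) by metis
  qed
  moreover have "f \<noteq> \<zero>\<^bsub>P\<^esub>"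
  proof
    assume "f = \<zero>\<^bsub>P\<^esub>"
    then have "f 0 = \<zero>\<^bsub>K\<^esub>" by (simp add: K.laurent_simps)
    then show False using f(3) by simp
  qed
  moreover have fP: "f \<in> carrier P" using f(1) unfolding ann_def by blast
  moreover have mx: "maximalideal (PIdl\<^bsub>P\<^esub> f) P"
    unfolding f(2)[symmetric] by (rule J.maximalideal_axioms)
  ultimately show ?thesis using K.laurent_maximal_irreducible[OF mx] f by blast
qed

text \<open>Suppose a kills \<open>m\<close> but not \<open>n\<close>, and let b bring a n back to
  \<open>n\<close>. The polynomial of b a at the corner kills \<open>m\<close>, so it is a multiple
  of f and kills \<open>n\<close>, although it should fix \<open>n\<close>.\<close>

lemma annihilator_cyclic:
  assumes N: "cyclic_simple K E v c N"
    and m: "m \<in> carrier M" "m \<noteq> \<zero>\<^bsub>M\<^esub>" "ver v \<cdot> m = m"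
    and n: "n \<in> carrier N" "n \<noteq> \<zero>\<^bsub>N\<^esub>" "\<gamma> (Vertex v) \<odot>\<^bsub>N\<^esub> n = n"
    and f: "f \<in> carrier P" "ann m = PIdl\<^bsub>P\<^esub> f" "gl f \<odot>\<^bsub>N\<^esub> n = \<zero>\<^bsub>N\<^esub>"
  shows "annihilator L N = annihilator L M"
proof -
  interpret N: cyclic_simple K E v c N by fact
  interpret P: cring P by (rule K.laurent_cring)
  have "annihilator L M = annihilator L N"
  proof (rule annihilator_eqI[OF lpa_simple_axioms N.lpa_simple_axioms m(1,2) n(1,2) v m(3) n(3)])
    fix a assume a: "a \<in> carrier L" "a \<cdot> m = \<zero>\<^bsub>M\<^esub>"
    show "a \<odot>\<^bsub>N\<^esub> n = \<zero>\<^bsub>N\<^esub>"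
    proof (rule ccontr)
      assume nz: "a \<odot>\<^bsub>N\<^esub> n \<noteq> \<zero>\<^bsub>N\<^esub>"
      have anN: "a \<odot>\<^bsub>N\<^esub> n \<in> carrier N" using a(1) n(1) by simp
      obtain b where b: "b \<in> carrier L" "b \<odot>\<^bsub>N\<^esub> (a \<odot>\<^bsub>N\<^esub> n) = n" using N.generates[OF anN nz n(1)] by blast
      have ba: "b \<bullet> a \<in> carrier L" using a b by simp
      obtain g where g: "g \<in> carrier P" "ver v \<cdot> ((b \<bullet> a) \<cdot> m) = gl g \<cdot> m"
        "\<gamma> (Vertex v) \<odot>\<^bsub>N\<^esub> ((b \<bullet> a) \<odot>\<^bsub>N\<^esub> n) = gl g \<odot>\<^bsub>N\<^esub> n"
        using corner[OF cyclic_module_axioms N.cyclic_module_axioms ba] m n by blast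
      have "gl g \<cdot> m = \<zero>\<^bsub>M\<^esub>" using g(2) a b m v by (simp add: act_mult)
      then have "g \<in> PIdl\<^bsub>P\<^esub> f" unfolding f(2)[symmetric] ann_def using g(1) by simp
      then obtain r where r: "r \<in> carrier P" "g = r \<otimes>\<^bsub>P\<^esub> f" unfolding cgenideal_def by blast
      have "gl g \<odot>\<^bsub>N\<^esub> n = \<zero>\<^bsub>N\<^esub>" using N.gl_mult[OF r(1) f(1) n(1,3)] r f(3) by simp
      moreover have "gl g \<odot>\<^bsub>N\<^esub> n = n" using g(3) a b n by (simp add: N.act_mult)
      ultimately show False using n(2) by simp
    qed
  qed
  then show ?thesis by simp
qed

end

section \<open>The Chen modules\<close>

context leavitt_path
begin

lemma basis_monomial:
  assumes "branching_system K E B t s"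
  shows "monomial K E K id (\<lambda>_. \<one>\<^bsub>K\<^esub>) B t (basis_module K B t)"
proof -
  interpret branching_system K E B t s by fact
  show ?thesis
    by (intro monomial.intro leavitt_path_axioms K.field_axioms monomial_axioms.intro basis_monomial_module)
      (auto simp: ring_hom_def)
qed

lemma sink_branching_system:
  assumes "sink E w"
  shows "branching_system K E {(u, p). walk u p w} (path_act E) fst"
proof (intro branching_system.intro leavitt_path_axioms branching_system_axioms.intro)
  fix x b assume "x \<in> verts E" "b \<in> {(u, p). walk u p w}"
  then show "path_act E (Vertex x) b = (if x = fst b then Some b else None)" by (cases b) simp
next
  fix e b assume e: "e \<in> arcs E" "b \<in> {(u, p). walk u p w}" "head E e = fst b"
  then obtain u p where b: "b = (u, p)" "walk u p w" by blast
  then show "\<exists>b'\<in>{(u, p). walk u p w}. path_act E (Edge e) b = Some b' \<and> fst b' = tail E e \<and> path_act E (Ghost e) b' = Some b"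
    using e by (intro bexI[of _ "(tail E e, e # p)"]) auto
next
  fix e b assume "e \<in> arcs E" "b \<in> {(u, p). walk u p w}" "head E e \<noteq> fst b"
  then show "path_act E (Edge e) b = None" by (cases b) simp
next
  fix e b b' assume e: "e \<in> arcs E" "b \<in> {(u, p). walk u p w}" "path_act E (Ghost e) b = Some b'"
  then obtain u p where b: "b = (u, p)" "walk u p w" by blast
  then show "b' \<in> {(u, p). walk u p w} \<and> fst b = tail E e \<and> fst b' = head E e \<and> path_act E (Edge e) b' = Some b"
    using e(3) by (cases p) (simp_all split: if_splits, auto)
next
  fix e f b assume "b \<in> {(u, p). walk u p w}" "path_act E (Ghost e) b \<noteq> None" "path_act E (Ghost f) b \<noteq> None"
  then show "e = f" by (cases b) (simp split: if_splits)
next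
  fix b assume "b \<in> {(u, p). walk u p w}" "regular E (fst b)"
  then obtain u p where b: "b = (u, p)" "walk u p w" "regular E u" by fastforce
  then have "p \<noteq> []" using assms by (auto simp: sink_def regular_def)
  then show "\<exists>e\<in>arcs E. path_act E (Ghost e) b \<noteq> None" using b by (cases p) auto
qed

lemma sink_path_module:
  assumes "sink E w"
  shows "path_module K E {(u, p). walk u p w} (path_act E) (sink_module K E w) w Pair"
proof -
  interpret monomial K E K id "\<lambda>_. \<one>\<^bsub>K\<^esub>" "{(u, p). walk u p w}" "path_act E" "sink_module K E w"
    unfolding sink_module_def by (rule basis_monomial[OF sink_branching_system[OF assms]])
  show ?thesis
    by unfold_locales (use assms in \<open>auto simp: sink_def\<close>)
qed

lemma inf_path_branching_system:
  assumes "infinite_path E p"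
  shows "branching_system K E (tc p) (inf_path_act E) src"
proof (unfold_locales)
  fix e b assume e: "e \<in> arcs E" "b \<in> tc p" "head E e = src b"
  then have "[e] @- b \<in> tc p" by (intro tc_shift[of b p "tail E e"]) (auto simp: src_verts[OF tc_infinite])
  then show "\<exists>b'\<in>tc p. inf_path_act E (Edge e) b = Some b' \<and> src b' = tail E e \<and> inf_path_act E (Ghost e) b' = Some b"
    using e by simp
next
  fix e b b' assume e: "e \<in> arcs E" "b \<in> tc p" "inf_path_act E (Ghost e) b = Some b'"
  then have b: "shd b = e" "b' = stl b" by (auto split: if_splits)
  then have "e ## stl b = b" by (metis stream.collapse)
  then show "b' \<in> tc p \<and> src b = tail E e \<and> src b' = head E e \<and> inf_path_act E (Edge e) b' = Some b"
    using b tc_stl[OF e(2)] infinite_path_shd[OF tc_infinite[OF e(2)]] by simp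
next
  fix b assume "b \<in> tc p"
  then show "\<exists>e\<in>arcs E. inf_path_act E (Ghost e) b \<noteq> None"
    using infinite_path_shd[OF tc_infinite] by (intro bexI[of _ "shd b"]) auto
qed (auto split: if_splits)

lemma inf_path_stream_module:
  assumes "infinite_path E p"
  shows "stream_module K E K id (\<lambda>_. \<one>\<^bsub>K\<^esub>) p (inf_path_module K E p)"
proof -
  interpret monomial K E K id "\<lambda>_. \<one>\<^bsub>K\<^esub>" "tc p" "inf_path_act E" "inf_path_module K E p"
    unfolding inf_path_module_def by (rule basis_monomial[OF inf_path_branching_system[OF assms]])
  show ?thesis by unfold_locales (use assms in auto)
qed

lemma inf_path_module_simple:
  assumes "infinite_path E p"
  shows "simple_left_module L (inf_path_module K E p)"
proof -
  interpret stream_module K E K id "\<lambda>_. \<one>\<^bsub>K\<^esub>" p "inf_path_module K E p"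
    by (rule inf_path_stream_module[OF assms])
  show ?thesis
  proof (rule stream_module_simple[OF tc_refl[OF assms]])
    fix l l' assume l: "l \<in> carrier K" "l \<noteq> \<zero>\<^bsub>K\<^esub>" "l' \<in> carrier K"
    have i: "inv\<^bsub>K\<^esub> l \<in> carrier K" "inv\<^bsub>K\<^esub> l \<otimes>\<^bsub>K\<^esub> l = \<one>\<^bsub>K\<^esub>" using l K.field_Units by auto
    have "(l' \<otimes>\<^bsub>K\<^esub> inv\<^bsub>K\<^esub> l) \<otimes>\<^bsub>K\<^esub> l = l'" using l i by (simp add: K.m_assoc)
    then have "((l' \<otimes>\<^bsub>K\<^esub> inv\<^bsub>K\<^esub> l) \<odot>\<^bsub>L\<^esub> ver (src p)) \<odot>\<^bsub>inf_path_module K E p\<^esub> single K l p = single K l' p"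
      using smult_ver_single[of "l' \<otimes>\<^bsub>K\<^esub> inv\<^bsub>K\<^esub> l" "src p" l p] l i src_verts[OF assms] tc_refl[OF assms] by simp
    then show "\<exists>a\<in>carrier L. a \<odot>\<^bsub>inf_path_module K E p\<^esub> single K l p = single K l' p"
      using l i src_verts[OF assms] by (intro bexI[of _ "(l' \<otimes>\<^bsub>K\<^esub> inv\<^bsub>K\<^esub> l) \<odot>\<^bsub>L\<^esub> ver (src p)"]) auto
  qed
qed

lemma vertex_edge_mult:
  "x \<in> verts E \<Longrightarrow> e \<in> arcs E \<Longrightarrow> \<gamma> (Vertex x) \<bullet> \<gamma> (Edge e) = (if x = tail E e then \<gamma> (Edge e) else \<zero>\<^bsub>L\<^esub>)"
  "x \<in> verts E \<Longrightarrow> e \<in> arcs E \<Longrightarrow> \<gamma> (Edge e) \<bullet> \<gamma> (Vertex x) = (if x = head E e then \<gamma> (Edge e) else \<zero>\<^bsub>L\<^esub>)"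
  "x \<in> verts E \<Longrightarrow> e \<in> arcs E \<Longrightarrow> \<gamma> (Vertex x) \<bullet> \<gamma> (Ghost e) = (if x = head E e then \<gamma> (Ghost e) else \<zero>\<^bsub>L\<^esub>)"
  "x \<in> verts E \<Longrightarrow> e \<in> arcs E \<Longrightarrow> \<gamma> (Ghost e) \<bullet> \<gamma> (Vertex x) = (if x = tail E e then \<gamma> (Ghost e) else \<zero>\<^bsub>L\<^esub>)"
proof -
  assume x: "x \<in> verts E" and e: "e \<in> arcs E"
  then have c: "\<gamma> (Edge e) \<in> carrier L" "\<gamma> (Ghost e) \<in> carrier L" "\<gamma> (Vertex x) \<in> carrier L"
    "\<gamma> (Vertex (tail E e)) \<in> carrier L" "\<gamma> (Vertex (head E e)) \<in> carrier L" "tail E e \<in> verts E" "head E e \<in> verts E"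
    by (auto simp: ends_in_verts)
  show "\<gamma> (Vertex x) \<bullet> \<gamma> (Edge e) = (if x = tail E e then \<gamma> (Edge e) else \<zero>\<^bsub>L\<^esub>)"
    using c x L.mult_assoc[of "\<gamma> (Vertex x)" "\<gamma> (Vertex (tail E e))" "\<gamma> (Edge e)"] by (simp add: tail_edge[OF e] vertex_mult split: if_splits)
  show "\<gamma> (Edge e) \<bullet> \<gamma> (Vertex x) = (if x = head E e then \<gamma> (Edge e) else \<zero>\<^bsub>L\<^esub>)"
    using c x L.mult_assoc[of "\<gamma> (Edge e)" "\<gamma> (Vertex (head E e))" "\<gamma> (Vertex x)"] by (simp add: edge_head[OF e] vertex_mult split: if_splits)
  show "\<gamma> (Vertex x) \<bullet> \<gamma> (Ghost e) = (if x = head E e then \<gamma> (Ghost e) else \<zero>\<^bsub>L\<^esub>)"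
    using c x L.mult_assoc[of "\<gamma> (Vertex x)" "\<gamma> (Vertex (head E e))" "\<gamma> (Ghost e)"] by (simp add: head_ghost[OF e] vertex_mult split: if_splits)
  show "\<gamma> (Ghost e) \<bullet> \<gamma> (Vertex x) = (if x = tail E e then \<gamma> (Ghost e) else \<zero>\<^bsub>L\<^esub>)"
    using c x L.mult_assoc[of "\<gamma> (Ghost e)" "\<gamma> (Vertex (tail E e))" "\<gamma> (Vertex x)"] by (simp add: ghost_tail[OF e] vertex_mult split: if_splits)
qed

lemma edge_ghost_zero:
  assumes "e \<in> arcs E" "f \<in> arcs E" "head E e \<noteq> head E f"
  shows "\<gamma> (Edge e) \<bullet> \<gamma> (Ghost f) = \<zero>\<^bsub>L\<^esub>"
proof -
  have c: "\<gamma> (Edge e) \<in> carrier L" "\<gamma> (Ghost f) \<in> carrier L" "\<gamma> (Vertex (head E e)) \<in> carrier L" "head E e \<in> verts E"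
    using assms by (auto simp: ends_in_verts)
  have "\<gamma> (Edge e) \<bullet> \<gamma> (Ghost f) = \<gamma> (Edge e) \<bullet> (\<gamma> (Vertex (head E e)) \<bullet> \<gamma> (Ghost f))"
    using c L.mult_assoc[of "\<gamma> (Edge e)" "\<gamma> (Vertex (head E e))" "\<gamma> (Ghost f)"] edge_head[OF assms(1)] by simp
  also have "\<dots> = \<zero>\<^bsub>L\<^esub>" using c assms by (simp add: vertex_edge_mult)
  finally show ?thesis .
qed

end

section \<open>Quotient graphs and the modules of their sinks\<close>

locale quotient = leavitt_path K E
  for K :: "('k, 'c) ring_scheme" and E :: "('v, 'e) pre_digraph" +
  fixes H S :: "'v set"
  assumes hereditary: "\<lbrakk>e \<in> arcs E; tail E e \<in> H\<rbrakk> \<Longrightarrow> head E e \<in> H"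
    and saturated: "\<lbrakk>regular E u; head E ` out_arcs E u \<subseteq> H\<rbrakk> \<Longrightarrow> u \<in> H"
begin

abbreviation "F \<equiv> quotient_graph E H S"
abbreviation "T \<equiv> B_set E H - S"
abbreviation "LF \<equiv> lpa K F"
abbreviation "\<gamma>F \<equiv> lpa_gen K F"
abbreviation "\<phi> \<equiv> quotient_gen K E H S"

lemma T: "u \<in> T \<Longrightarrow> u \<in> verts E" "u \<in> T \<Longrightarrow> u \<notin> H" "u \<in> T \<Longrightarrow> infinite_emitter E u"
  by (auto simp: B_set_def infinite_emitter_def)

lemma F_simps [simp]:
  "Inl u \<in> verts F \<longleftrightarrow> u \<in> verts E \<and> u \<notin> H" "Inr u \<in> verts F \<longleftrightarrow> u \<in> T"
  "Inl e \<in> arcs F \<longleftrightarrow> e \<in> arcs E \<and> head E e \<notin> H" "Inr e \<in> arcs F \<longleftrightarrow> e \<in> arcs E \<and> head E e \<in> T"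
  "tail F (Inl e) = Inl (tail E e)" "tail F (Inr e) = Inl (tail E e)"
  "head F (Inl e) = Inl (head E e)" "head F (Inr e) = Inr (head E e)"
  by (auto simp: quotient_graph_def)

sublocale Q: leavitt_path K F
proof (intro leavitt_path.intro K.field_axioms wf_digraph.intro)
  fix f assume f: "f \<in> arcs F"
  show "tail F f \<in> verts F"
    using f hereditary T(2) by (cases f) (auto simp: ends_in_verts)
  show "head F f \<in> verts F"
    using f by (cases f) (auto simp: ends_in_verts)
qed

lemma quotient_gen_simps:
  "\<phi> (Vertex u) = (if u \<in> H then \<zero>\<^bsub>LF\<^esub> else if u \<in> T then \<gamma>F (Vertex (Inl u)) \<oplus>\<^bsub>LF\<^esub> \<gamma>F (Vertex (Inr u)) else \<gamma>F (Vertex (Inl u)))"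
  "\<phi> (Edge e) = (if head E e \<in> H then \<zero>\<^bsub>LF\<^esub> else if head E e \<in> T then \<gamma>F (Edge (Inl e)) \<oplus>\<^bsub>LF\<^esub> \<gamma>F (Edge (Inr e)) else \<gamma>F (Edge (Inl e)))"
  "\<phi> (Ghost e) = (if head E e \<in> H then \<zero>\<^bsub>LF\<^esub> else if head E e \<in> T then \<gamma>F (Ghost (Inl e)) \<oplus>\<^bsub>LF\<^esub> \<gamma>F (Ghost (Inr e)) else \<gamma>F (Ghost (Inl e)))"
  by (simp_all add: quotient_gen_def Let_def)

lemma quotient_gen_closed:
  "u \<in> verts E \<Longrightarrow> \<phi> (Vertex u) \<in> carrier LF" "e \<in> arcs E \<Longrightarrow> \<phi> (Edge e) \<in> carrier LF" "e \<in> arcs E \<Longrightarrow> \<phi> (Ghost e) \<in> carrier LF"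
  unfolding quotient_gen_simps by auto

text \<open>Saturation leaves a regular vertex outside \<open>H\<close> at least one edge, so its
  sum relation survives, with a second summand for each edge whose head is doubled.\<close>

lemma regular_quotient:
  assumes "regular E u" "u \<notin> H"
  shows "regular F (Inl u)"
    "out_arcs F (Inl u) = Inl ` {e \<in> out_arcs E u. head E e \<notin> H} \<union> Inr ` {e \<in> out_arcs E u. head E e \<in> T}"
proof -
  have eq: "f \<in> out_arcs F (Inl u) \<longleftrightarrow> f \<in> Inl ` {e \<in> out_arcs E u. head E e \<notin> H} \<union> Inr ` {e \<in> out_arcs E u. head E e \<in> T}" for f
    by (cases f) auto
  then show *: "out_arcs F (Inl u) = Inl ` {e \<in> out_arcs E u. head E e \<notin> H} \<union> Inr ` {e \<in> out_arcs E u. head E e \<in> T}"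
    by (intro subset_antisym subsetI) blast+
  have fin: "finite (out_arcs E u)" "u \<in> verts E" using assms(1) by (auto simp: regular_def)
  have "finite {e \<in> out_arcs E u. Q e}" for Q by (rule finite_subset[OF _ fin(1)]) blast
  then have fin': "finite (out_arcs F (Inl u))" unfolding * by (intro finite_UnI finite_imageI)
  obtain e where "e \<in> out_arcs E u" "head E e \<notin> H" using saturated[OF assms(1)] assms(2) by blast
  then have "Inl e \<in> out_arcs F (Inl u)" using eq by blast
  then have ne: "out_arcs F (Inl u) \<noteq> {}" by (rule ex_in_conv[THEN iffD1, OF exI])
  show "regular F (Inl u)" unfolding regular_def using fin' ne fin(2) assms(2) by (simp del: in_out_arcs_conv)
qed

text \<open>The sum relation is the only one that is not a mere case distinction. The product of the
  images of an edge and its ghost splits into an unprimed and a primed term, because the mixed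
  products vanish by \<open>edge_ghost_zero\<close>. A regular vertex is no infinite emitter, hence
  is not doubled itself.\<close>

lemma quotient_gen_family: "leavitt_family LF E \<phi>"
  unfolding leavitt_family_def
proof (intro conjI ballI allI impI)
  show "\<phi> ` gens E \<subseteq> carrier LF"
    using quotient_gen_closed by (auto simp: gens_def simp del: quotient_gen_simps)
next
  fix u w assume "u \<in> verts E" "w \<in> verts E"
  then show "\<phi> (Vertex u) \<otimes>\<^bsub>LF\<^esub> \<phi> (Vertex w) = (if u = w then \<phi> (Vertex u) else \<zero>\<^bsub>LF\<^esub>)"
    by (simp add: quotient_gen_simps Q.L.mult_l_distr Q.L.mult_r_distr Q.vertex_mult)
next
  fix e assume e: "e \<in> arcs E"
  then have v: "tail E e \<in> verts E" "head E e \<in> verts E" by (auto simp: ends_in_verts)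
  have t: "head E e \<notin> H \<Longrightarrow> tail E e \<notin> H" using hereditary e by blast
  show "\<phi> (Vertex (tail E e)) \<otimes>\<^bsub>LF\<^esub> \<phi> (Edge e) = \<phi> (Edge e)"
    "\<phi> (Ghost e) \<otimes>\<^bsub>LF\<^esub> \<phi> (Vertex (tail E e)) = \<phi> (Ghost e)"
    using quotient_gen_closed(1)[OF v(1)] e v t by (cases "head E e \<in> H"; simp add: quotient_gen_simps Q.L.mult_l_distr Q.L.mult_r_distr Q.vertex_edge_mult)+
  show "\<phi> (Edge e) \<otimes>\<^bsub>LF\<^esub> \<phi> (Vertex (head E e)) = \<phi> (Edge e)"
    "\<phi> (Vertex (head E e)) \<otimes>\<^bsub>LF\<^esub> \<phi> (Ghost e) = \<phi> (Ghost e)"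
    using e v by (simp_all add: quotient_gen_simps Q.L.mult_l_distr Q.L.mult_r_distr Q.vertex_edge_mult)
next
  fix e f assume ef: "e \<in> arcs E" "f \<in> arcs E"
  then have v: "head E e \<in> verts E" by (auto simp: ends_in_verts)
  show "\<phi> (Ghost e) \<otimes>\<^bsub>LF\<^esub> \<phi> (Edge f) = (if e = f then \<phi> (Vertex (head E e)) else \<zero>\<^bsub>LF\<^esub>)"
  proof (cases "e = f")
    case True
    show ?thesis using ef v unfolding True
      by (cases "head E f \<in> H"; cases "head E f \<in> T")
        (auto simp: quotient_gen_simps Q.L.mult_l_distr Q.L.mult_r_distr Q.ghost_edge)
  next
    case False
    then show ?thesis using ef v quotient_gen_closed(2)[OF ef(2)] quotient_gen_closed(3)[OF ef(1)]
      by (cases "head E e \<in> H"; cases "head E f \<in> H"; cases "head E e \<in> T"; cases "head E f \<in> T")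
        (simp_all add: quotient_gen_simps Q.L.mult_l_distr Q.L.mult_r_distr Q.ghost_edge)
  qed
next
  fix u assume u: "regular E u"
  have uv: "u \<in> verts E" "finite (out_arcs E u)" "u \<notin> T" using u T(3)[of u] by (auto simp: regular_def infinite_emitter_def)
  let ?g = "\<lambda>f. \<gamma>F (Edge f) \<otimes>\<^bsub>LF\<^esub> \<gamma>F (Ghost f)"
  have eq: "\<phi> (Edge e) \<otimes>\<^bsub>LF\<^esub> \<phi> (Ghost e) =
      (if head E e \<notin> H then ?g (Inl e) else \<zero>\<^bsub>LF\<^esub>) \<oplus>\<^bsub>LF\<^esub> (if head E e \<in> T then ?g (Inr e) else \<zero>\<^bsub>LF\<^esub>)" if "e \<in> arcs E" for e
    using that T(2)[of "head E e"]
    by (simp add: quotient_gen_simps Q.L.mult_l_distr Q.L.mult_r_distr Q.edge_ghost_zero)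
  have gc: "f \<in> arcs F \<Longrightarrow> ?g f \<in> carrier LF" for f by simp
  have part: "(\<Oplus>\<^bsub>LF\<^esub>e\<in>out_arcs E u. if Q e then G e else \<zero>\<^bsub>LF\<^esub>) = (\<Oplus>\<^bsub>LF\<^esub>e\<in>{e \<in> out_arcs E u. Q e}. G e)"
    if G: "\<And>e. e \<in> out_arcs E u \<Longrightarrow> Q e \<Longrightarrow> G e \<in> carrier LF" for Q and G :: "'e \<Rightarrow> _"
  proof -
    have "(\<Oplus>\<^bsub>LF\<^esub>e\<in>{e \<in> out_arcs E u. Q e}. G e) = (\<Oplus>\<^bsub>LF\<^esub>e\<in>{e \<in> out_arcs E u. Q e}. if Q e then G e else \<zero>\<^bsub>LF\<^esub>)"
      by (rule Q.L.M.finsum_cong') (use G in auto)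
    also have "\<dots> = (\<Oplus>\<^bsub>LF\<^esub>e\<in>out_arcs E u. if Q e then G e else \<zero>\<^bsub>LF\<^esub>)"
      by (rule Q.L.M.add.finprod_mono_neutral_cong_left) (use G uv(2) in auto)
    finally show ?thesis by simp
  qed
  show "\<phi> (Vertex u) = (\<Oplus>\<^bsub>LF\<^esub>e\<in>out_arcs E u. \<phi> (Edge e) \<otimes>\<^bsub>LF\<^esub> \<phi> (Ghost e))"
  proof (cases "u \<in> H")
    case True
    have "(\<Oplus>\<^bsub>LF\<^esub>e\<in>out_arcs E u. \<phi> (Edge e) \<otimes>\<^bsub>LF\<^esub> \<phi> (Ghost e)) = (\<Oplus>\<^bsub>LF\<^esub>e\<in>out_arcs E u. \<zero>\<^bsub>LF\<^esub>)"
      by (rule Q.L.M.finsum_cong') (use True hereditary in \<open>auto simp: quotient_gen_simps\<close>)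
    then show ?thesis using True by (simp add: quotient_gen_simps)
  next
    case False
    have finQ: "finite {e \<in> out_arcs E u. Q e}" for Q by (rule finite_subset[OF _ uv(2)]) blast
    have disj: "Inl ` A \<inter> Inr ` B = {}" for A B :: "'e set" by (intro subset_antisym subsetI) auto
    let ?A = "{e \<in> out_arcs E u. head E e \<notin> H}" and ?B = "{e \<in> out_arcs E u. head E e \<in> T}"
    have "\<phi> (Vertex u) = \<gamma>F (Vertex (Inl u))" using False uv by (auto simp: quotient_gen_simps)
    also have "\<dots> = (\<Oplus>\<^bsub>LF\<^esub>f\<in>Inl ` ?A \<union> Inr ` ?B. ?g f)"
      using Q.regular_sum[OF regular_quotient(1)[OF u False]] unfolding regular_quotient(2)[OF u False] .
    also have "\<dots> = (\<Oplus>\<^bsub>LF\<^esub>f\<in>Inl ` ?A. ?g f) \<oplus>\<^bsub>LF\<^esub> (\<Oplus>\<^bsub>LF\<^esub>f\<in>Inr ` ?B. ?g f)"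
      by (rule Q.L.M.finsum_Un_disjoint[OF finite_imageI[OF finQ] finite_imageI[OF finQ] disj]) auto
    also have "(\<Oplus>\<^bsub>LF\<^esub>f\<in>Inl ` ?A. ?g f) = (\<Oplus>\<^bsub>LF\<^esub>e\<in>?A. ?g (Inl e))"
      by (rule Q.L.M.finsum_reindex) auto
    also have "(\<Oplus>\<^bsub>LF\<^esub>f\<in>Inr ` ?B. ?g f) = (\<Oplus>\<^bsub>LF\<^esub>e\<in>?B. ?g (Inr e))"
      by (rule Q.L.M.finsum_reindex) auto
    also have "(\<Oplus>\<^bsub>LF\<^esub>e\<in>?A. ?g (Inl e)) \<oplus>\<^bsub>LF\<^esub> (\<Oplus>\<^bsub>LF\<^esub>e\<in>?B. ?g (Inr e)) =
      (\<Oplus>\<^bsub>LF\<^esub>e\<in>out_arcs E u. if head E e \<notin> H then ?g (Inl e) else \<zero>\<^bsub>LF\<^esub>) \<oplus>\<^bsub>LF\<^esub>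
      (\<Oplus>\<^bsub>LF\<^esub>e\<in>out_arcs E u. if head E e \<in> T then ?g (Inr e) else \<zero>\<^bsub>LF\<^esub>)"
      by (subst (1 2) part) auto
    also have "\<dots> = (\<Oplus>\<^bsub>LF\<^esub>e\<in>out_arcs E u. (if head E e \<notin> H then ?g (Inl e) else \<zero>\<^bsub>LF\<^esub>) \<oplus>\<^bsub>LF\<^esub>
      (if head E e \<in> T then ?g (Inr e) else \<zero>\<^bsub>LF\<^esub>))"
      by (rule Q.L.M.finsum_addf[symmetric]) auto
    also have "\<dots> = (\<Oplus>\<^bsub>LF\<^esub>e\<in>out_arcs E u. \<phi> (Edge e) \<otimes>\<^bsub>LF\<^esub> \<phi> (Ghost e))"
      by (rule Q.L.M.finsum_cong') (use eq quotient_gen_closed in \<open>auto simp del: quotient_gen_simps\<close>)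
    finally show ?thesis .
  qed
qed

sublocale U: lpa_univ K E K LF id \<phi>
  by (intro lpa_univ.intro leavitt_path_axioms Q.L.nonunital_algebra_axioms lpa_univ_axioms.intro quotient_gen_family)
    (simp add: ring_hom_def)

end

text \<open>
  Over a path of \<open>E\<close> ending in \<open>w\<close> lies the path of the quotient graph ending in \<open>w'\<close> that has only
  its last edge primed.
\<close>

primrec mark_last :: "('e \<Rightarrow> 'e + 'e) \<Rightarrow> 'e list \<Rightarrow> ('e + 'e) list" where
  "mark_last c [] = []"
| "mark_last c (e # p) = (if p = [] then c e else Inl e) # mark_last c p"

lemma mark_last_inj: "inj c \<Longrightarrow> mark_last c p = mark_last c p' \<Longrightarrow> p = p'"
proof (induction p arbitrary: p')
  case Nil
  then show ?case by (cases p') auto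
next
  case (Cons e p)
  then obtain e' p'' where p': "p' = e' # p''" by (cases p') auto
  then have "p = p''" using Cons by simp
  then show ?case using Cons.prems p' by (auto split: if_splits dest: injD)
qed

context quotient
begin

text \<open>The generators of the algebra of \<open>E\<close> act on basis paths of \<open>F\<close>
  through sums of at most two generators. On a given path at most one summand is nonzero, so basis
  elements still go to basis elements or to 0.\<close>

primrec qact :: "('v, 'e) gen \<Rightarrow> ('v + 'v) \<times> ('e + 'e) list \<Rightarrow> (('v + 'v) \<times> ('e + 'e) list) option" where
  "qact (Vertex u) b = (if fst b = Inl u \<or> fst b = Inr u then Some b else None)"
| "qact (Edge e) b =
     (if fst b = Inl (head E e) then Some (Inl (tail E e), Inl e # snd b)
      else if fst b = Inr (head E e) then Some (Inl (tail E e), Inr e # snd b) else None)"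
| "qact (Ghost e) b =
     (if snd b \<noteq> [] \<and> (hd (snd b) = Inl e \<or> hd (snd b) = Inr e)
      then Some (head F (hd (snd b)), tl (snd b)) else None)"

lemma quotient_sink_monomial:
  assumes "sink F w"
  shows "monomial K E K id (\<lambda>_. \<one>\<^bsub>K\<^esub>) {(u, p). Q.walk u p w} qact (quotient_sink_module K E H S w)"
proof -
  let ?B = "{(u, p). Q.walk u p w}" and ?N' = "sink_module K F w" and ?N = "quotient_sink_module K E H S w"
  interpret N': path_module K F ?B "path_act F" ?N' w Pair by (rule Q.sink_path_module[OF assms])
  have N: "?N = with_action ?N' (\<lambda>a m. U.\<Theta> a \<odot>\<^bsub>?N'\<^esub> m)"
    by (simp add: quotient_sink_module_def quotient_map_def Let_def)
  have simps: "carrier ?N = carrier (free_space K ?B)" "\<zero>\<^bsub>?N\<^esub> = (\<lambda>b. \<zero>\<^bsub>K\<^esub>)" "add ?N = add (free_space K ?B)"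
      "a \<odot>\<^bsub>?N\<^esub> m = U.\<Theta> a \<odot>\<^bsub>?N'\<^esub> m" for a m
    using N'.N_simps unfolding N by (simp_all add: with_action_def ring.defs module.defs)
  have gen: "(k \<odot>\<^bsub>LF\<^esub> \<gamma>F g) \<odot>\<^bsub>?N'\<^esub> single K l b = (case path_act F g b of None \<Rightarrow> \<zero>\<^bsub>?N'\<^esub> | Some b' \<Rightarrow> single K (k \<otimes>\<^bsub>K\<^esub> l) b')"
    if "k \<in> carrier K" "g \<in> gens F" "l \<in> carrier K" "b \<in> ?B" for k g l b
    using N'.gen_single[OF that] that by (simp split: option.split)
  have main: "(k \<odot>\<^bsub>LF\<^esub> \<phi> g) \<odot>\<^bsub>?N'\<^esub> single K l b = (case qact g b of None \<Rightarrow> \<zero>\<^bsub>?N'\<^esub> | Some b' \<Rightarrow> single K (k \<otimes>\<^bsub>K\<^esub> l) b')"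
    if a: "k \<in> carrier K" "g \<in> gens E" "l \<in> carrier K" "b \<in> ?B" for k g l b
  proof -
    obtain u p where b: "b = (u, p)" "Q.walk u p w" using a(4) by blast
    have u: "u \<in> verts F" using Q.walk_verts(1)[OF b(2)] .
    have sN: "single K l b \<in> carrier ?N'" using N'.single_in_N[OF a(3,4)] .
    have r: "single K (k \<otimes>\<^bsub>K\<^esub> l) b' \<in> carrier ?N'" if "b' \<in> ?B" for b'
      using N'.single_in_N[OF _ that] a by simp
    have eq: "(k \<odot>\<^bsub>LF\<^esub> (x \<oplus>\<^bsub>LF\<^esub> y)) \<odot>\<^bsub>?N'\<^esub> single K l b = (k \<odot>\<^bsub>LF\<^esub> x) \<odot>\<^bsub>?N'\<^esub> single K l b \<oplus>\<^bsub>?N'\<^esub> (k \<odot>\<^bsub>LF\<^esub> y) \<odot>\<^bsub>?N'\<^esub> single K l b"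
      if "x \<in> carrier LF" "y \<in> carrier LF" for x y
      using that a sN by (simp add: Q.L.smult_r_distr N'.act_add_l)
    show ?thesis
    proof (cases g)
      case (Vertex x)
      then have x: "x \<in> verts E" using a(2) by simp
      show ?thesis
      proof (cases u)
        case (Inl y)
        then show ?thesis using u x a b Vertex sN r[of b] eq
          by (auto simp: quotient_gen_simps gen Q.L.smult_r_null)
      next
        case (Inr y)
        then show ?thesis using u x a b Vertex sN r[of b] eq T(2)
          by (auto simp: quotient_gen_simps gen Q.L.smult_r_null)
      qed
    next
      case (Edge e)
      then have e: "e \<in> arcs E" using a(2) by simp
      show ?thesis
      proof (cases u)
        case (Inl y)
        have "(Inl (tail E e), Inl e # p) \<in> ?B" if "head E e = y"
          using that u b Inl e by simp
        then show ?thesis using u e a b Edge sN r[of "(Inl (tail E e), Inl e # p)"] eq Inl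
          by (auto simp: quotient_gen_simps gen Q.L.smult_r_null)
      next
        case (Inr y)
        have "(Inl (tail E e), Inr e # p) \<in> ?B" if "head E e = y"
          using that u b Inr e by simp
        then show ?thesis using u e a b Edge sN r[of "(Inl (tail E e), Inr e # p)"] eq Inr T(2)
          by (auto simp: quotient_gen_simps gen Q.L.smult_r_null)
      qed
    next
      case (Ghost e)
      then have e: "e \<in> arcs E" using a(2) by simp
      show ?thesis
      proof (cases p)
        case Nil
        then show ?thesis using e a b Ghost sN eq
          by (auto simp: quotient_gen_simps gen Q.L.smult_r_null)
      next
        case (Cons f p')
        then have f: "f \<in> arcs F" "Q.walk (head F f) p' w" using b by auto
        then have "(head F f, p') \<in> ?B" by simp
        then show ?thesis using f(1) e a b Ghost sN eq r[of "(head F f, p')"] Cons T(2)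
          by (cases f) (auto simp: quotient_gen_simps gen Q.L.smult_r_null)
      qed
    qed
  qed
  have "left_module L ?N"
    unfolding N by (rule left_module_pullback[OF N'.M.left_module_axioms L.nonunital_algebra_axioms U.hom_closed U.hom_add U.hom_mult])
  then have "monomial_module K E K id (\<lambda>_. \<one>\<^bsub>K\<^esub>) ?B qact ?N"
    unfolding monomial_module_def using main N'.N_simps(2)
    by (auto simp: simps U.hom_smult U.hom_gen split: option.split)
  then show ?thesis
    by (intro monomial.intro leavitt_path_axioms K.field_axioms monomial_axioms.intro)
      (auto simp: ring_hom_def)
qed

text \<open>The two alternatives are the two kinds of infinite emitters. In the first no vertex is
  doubled and \<open>w\<close> loses all its edges. In the second \<open>w\<close> alone is doubled;
  its copy emits nothing, so it can be entered by the last edge of a path only.\<close>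

lemma quotient_path_module:
  fixes cv :: "'v \<Rightarrow> 'v + 'v" and ce :: "'e \<Rightarrow> 'e + 'e"
  assumes w: "w \<in> verts E" and reach: "\<And>u p. walk u p w \<Longrightarrow> u \<notin> H"
    and c: "(cv = Inl \<and> ce = Inl \<and> T = {} \<and> head E ` out_arcs E w \<subseteq> H) \<or> (cv = Inr \<and> ce = Inr \<and> T = {w})"
  shows "path_module K E {(x, r). Q.walk x r (cv w)} qact (quotient_sink_module K E H S (cv w)) w
    (\<lambda>u p. (if p = [] then cv u else Inl u, mark_last ce p))"
proof -
  let ?\<beta> = "\<lambda>u p. (if p = [] then cv u else Inl u, mark_last ce p)"
  have wH: "w \<notin> H" using reach[of w "[]"] w by simp
  have cvw: "cv w \<in> verts F" using c w wH by auto
  have sink: "sink F (cv w)"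
  proof -
    have "\<not> (f \<in> arcs F \<and> tail F f = cv w)" for f
      using c
    proof (elim disjE conjE)
      assume "cv = Inl" "T = {}" "head E ` out_arcs E w \<subseteq> H"
      then show ?thesis by (cases f) (auto simp: image_subset_iff)
    next
      assume "cv = Inr"
      then show ?thesis by (cases f) auto
    qed
    then show ?thesis using cvw by (simp add: sink_def out_arcs_def)
  qed
  interpret monomial K E K id "\<lambda>_. \<one>\<^bsub>K\<^esub>" "{(u, p). Q.walk u p (cv w)}" qact "quotient_sink_module K E H S (cv w)"
    by (rule quotient_sink_monomial[OF sink])
  have inj: "inj cv" "inj ce" using c by auto
  have into: "Q.walk (fst (?\<beta> u p)) (snd (?\<beta> u p)) (cv w)" if "walk u p w" for u p
    using that
  proof (induction p arbitrary: u)
    case (Cons e p)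
    have e: "e \<in> arcs E" "u = tail E e" "walk (head E e) p w" using Cons.prems by auto
    have "head E e \<notin> H" using reach[OF e(3)] .
    then show ?case using Cons.IH[OF e(3)] e c by (auto split: if_splits)
  qed (use cvw in simp)
  have onto: "\<exists>u p. walk u p w \<and> (x, r) = ?\<beta> u p" if "Q.walk x r (cv w)" for x r
    using that
  proof (induction r arbitrary: x)
    case Nil
    then show ?case using w by (intro exI[of _ w] exI[of _ "[]"]) auto
  next
    case (Cons f r)
    then have f: "f \<in> arcs F" "x = tail F f" "Q.walk (head F f) r (cv w)" by auto
    obtain u p where up: "walk u p w" "(head F f, r) = ?\<beta> u p" using Cons.IH[OF f(3)] by blast
    have uw: "p = [] \<Longrightarrow> u = w" using up(1) by simp
    have "\<exists>e. e \<in> arcs E \<and> head E e = u \<and> (x, f # r) = ?\<beta> (tail E e) (e # p)"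
      using c up(2) f(1,2) uw by (cases f; cases "p = []") auto
    then obtain e where e: "e \<in> arcs E" "head E e = u" "(x, f # r) = ?\<beta> (tail E e) (e # p)" by blast
    then have "walk (tail E e) (e # p) w" using up(1) by simp
    then show ?case using e(3) by blast
  qed
  show ?thesis
  proof (intro path_module.intro monomial_axioms path_module_axioms.intro)
    show "w \<in> verts E" by fact
  next
    fix u p assume "walk u p w"
    then show "?\<beta> u p \<in> {(x, r). Q.walk x r (cv w)}" using into by simp
  next
    fix b assume "b \<in> {(x, r). Q.walk x r (cv w)}"
    then show "\<exists>u p. walk u p w \<and> b = ?\<beta> u p" using onto by blast
  next
    fix u p u' p' assume a: "walk u p w" "walk u' p' w" "?\<beta> u p = ?\<beta> u' p'"
    then have "p = p'" using mark_last_inj[OF inj(2)] by simp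
    then show "u = u' \<and> p = p'" using a(3) injD[OF inj(1)] by (auto split: if_splits)
  next
    show "qact (Vertex w) (?\<beta> w []) = Some (?\<beta> w [])" using c by auto
  next
    fix e p assume "e \<in> arcs E" "walk (head E e) p w"
    then show "qact (Edge e) (?\<beta> (head E e) p) = Some (?\<beta> (tail E e) (e # p))"
      using c by auto
  qed simp
qed

end

section \<open>Twisted modules\<close>

definition twist_char :: "('l, 's) ring_scheme \<Rightarrow> 'e \<Rightarrow> 'l \<Rightarrow> ('v, 'e) gen \<Rightarrow> 'l" where
  "twist_char R e x g = (if g = Edge e then x else if g = Ghost e then inv\<^bsub>R\<^esub> x else \<one>\<^bsub>R\<^esub>)"

text \<open>Rescaling an edge and its ghost by inverse scalars preserves the Leavitt relations, so
  \<sigma> exists by the universal property. Pulling the action back along \<sigma> and the change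
  of scalars multiplies each generator by its value under \<open>twist_char\<close>, so the result
  is again monomial.\<close>

lemma (in leavitt_path) twisted_stream_module:
  fixes K' :: "('l, 's) ring_scheme"
  assumes "field K'" and h: "h \<in> ring_hom K K'" and x: "x \<in> carrier K'" "x \<noteq> \<zero>\<^bsub>K'\<^esub>" and p: "infinite_path E p"
  shows "stream_module K E K' h (twist_char K' e x) p
    (with_action (inf_path_module K' E p) (\<lambda>a m.
      twist_automorphism K' E e x (lpa_hom K (lpa K' E) h (lpa_gen K' E) a) \<odot>\<^bsub>inf_path_module K' E p\<^esub> m))"
proof -
  interpret K': field K' by fact
  interpret S: leavitt_path K' E by (intro leavitt_path.intro assms(1) E.wf_digraph_axioms)
  let ?\<chi> = "twist_char K' e x :: ('v, 'e) gen \<Rightarrow> 'l"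
  let ?V = "inf_path_module K' E p"
  define \<psi> where "\<psi> g = (if g = Edge e then x \<odot>\<^bsub>S.L\<^esub> S.\<gamma> g
          else if g = Ghost e then (inv\<^bsub>K'\<^esub> x) \<odot>\<^bsub>S.L\<^esub> S.\<gamma> g else S.\<gamma> g)" for g
  have ix: "inv\<^bsub>K'\<^esub> x \<in> carrier K'" "x \<otimes>\<^bsub>K'\<^esub> inv\<^bsub>K'\<^esub> x = \<one>\<^bsub>K'\<^esub>" "inv\<^bsub>K'\<^esub> x \<otimes>\<^bsub>K'\<^esub> x = \<one>\<^bsub>K'\<^esub>"
    using x K'.field_Units by auto
  have ix0: "inv\<^bsub>K'\<^esub> x \<noteq> \<zero>\<^bsub>K'\<^esub>"
  proof
    assume "inv\<^bsub>K'\<^esub> x = \<zero>\<^bsub>K'\<^esub>"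
    then show False using ix(2) x(1) by simp
  qed
  have chi: "?\<chi> g \<in> carrier K'" "?\<chi> g \<noteq> \<zero>\<^bsub>K'\<^esub>" "?\<chi> (Vertex u) = \<one>\<^bsub>K'\<^esub>"
    "?\<chi> (Edge f) \<otimes>\<^bsub>K'\<^esub> ?\<chi> (Ghost f) = \<one>\<^bsub>K'\<^esub>" "?\<chi> (Ghost f) \<otimes>\<^bsub>K'\<^esub> ?\<chi> (Edge f) = \<one>\<^bsub>K'\<^esub>" for g u f
    using x ix ix0 by (auto simp: twist_char_def)
  have \<psi>: "\<psi> g = ?\<chi> g \<odot>\<^bsub>S.L\<^esub> S.\<gamma> g" if "g \<in> gens E" for g
    using that by (auto simp: \<psi>_def twist_char_def)
  have gc: "S.\<gamma> g \<in> carrier S.L" if "g \<in> gens E" for g using that by auto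
  have mult: "\<psi> g \<otimes>\<^bsub>S.L\<^esub> \<psi> g' = (?\<chi> g \<otimes>\<^bsub>K'\<^esub> ?\<chi> g') \<odot>\<^bsub>S.L\<^esub> (S.\<gamma> g \<otimes>\<^bsub>S.L\<^esub> S.\<gamma> g')"
    if "g \<in> gens E" "g' \<in> gens E" for g g'
    using that gc chi(1) S.L.smult_left_commute[OF chi(1) chi(1), of "S.\<gamma> g \<otimes>\<^bsub>S.L\<^esub> S.\<gamma> g'" g g']
    by (simp add: \<psi> S.L.smult_mult S.L.mult_smult S.L.smult_assoc1)
  have fam: "leavitt_family S.L E \<psi>"
    unfolding leavitt_family_def
  proof (intro conjI ballI allI impI)
    show "\<psi> ` gens E \<subseteq> carrier S.L" using gc chi(1) by (auto simp: \<psi> simp del: gens_simps)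
  next
    fix u w assume "u \<in> verts E" "w \<in> verts E"
    then show "\<psi> (Vertex u) \<otimes>\<^bsub>S.L\<^esub> \<psi> (Vertex w) = (if u = w then \<psi> (Vertex u) else \<zero>\<^bsub>S.L\<^esub>)"
      by (simp add: mult S.vertex_mult \<psi> chi(3))
  next
    fix f assume f: "f \<in> arcs E"
    then have v: "tail E f \<in> verts E" "head E f \<in> verts E" by (auto simp: ends_in_verts)
    show "\<psi> (Vertex (tail E f)) \<otimes>\<^bsub>S.L\<^esub> \<psi> (Edge f) = \<psi> (Edge f)"
      "\<psi> (Edge f) \<otimes>\<^bsub>S.L\<^esub> \<psi> (Vertex (head E f)) = \<psi> (Edge f)"
      "\<psi> (Vertex (head E f)) \<otimes>\<^bsub>S.L\<^esub> \<psi> (Ghost f) = \<psi> (Ghost f)"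
      "\<psi> (Ghost f) \<otimes>\<^bsub>S.L\<^esub> \<psi> (Vertex (tail E f)) = \<psi> (Ghost f)"
      using f v chi(1) by (simp_all add: S.L.mult_smult S.L.smult_mult \<psi> chi(3) S.tail_edge S.edge_head S.head_ghost S.ghost_tail)
  next
    fix f f' assume f: "f \<in> arcs E" "f' \<in> arcs E"
    then have v: "head E f \<in> verts E" by (auto simp: ends_in_verts)
    show "\<psi> (Ghost f) \<otimes>\<^bsub>S.L\<^esub> \<psi> (Edge f') = (if f = f' then \<psi> (Vertex (head E f)) else \<zero>\<^bsub>S.L\<^esub>)"
      using f v mult[of "Ghost f" "Edge f'"] \<psi>[of "Vertex (head E f)"]
      by (auto simp: S.ghost_edge chi S.L.smult_r_null)
  next
    fix u assume u: "regular E u"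
    then have uv: "u \<in> verts E" by (simp add: regular_def)
    have "\<psi> (Vertex u) = S.\<gamma> (Vertex u)" by (simp add: \<psi>_def)
    also have "\<dots> = (\<Oplus>\<^bsub>S.L\<^esub>f\<in>out_arcs E u. S.\<gamma> (Edge f) \<otimes>\<^bsub>S.L\<^esub> S.\<gamma> (Ghost f))" by (rule S.regular_sum[OF u])
    also have "\<dots> = (\<Oplus>\<^bsub>S.L\<^esub>f\<in>out_arcs E u. \<psi> (Edge f) \<otimes>\<^bsub>S.L\<^esub> \<psi> (Ghost f))"
      by (rule S.L.M.finsum_cong') (auto simp: mult chi)
    finally show "\<psi> (Vertex u) = (\<Oplus>\<^bsub>S.L\<^esub>f\<in>out_arcs E u. \<psi> (Edge f) \<otimes>\<^bsub>S.L\<^esub> \<psi> (Ghost f))" .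
  qed
  interpret U1: lpa_univ K E K' S.L h S.\<gamma>
    by (intro lpa_univ.intro leavitt_path_axioms S.L.nonunital_algebra_axioms lpa_univ_axioms.intro h S.gen_family)
  interpret U2: lpa_univ K' E K' S.L id \<psi>
    by (intro lpa_univ.intro S.leavitt_path_axioms S.L.nonunital_algebra_axioms lpa_univ_axioms.intro fam) (simp add: ring_hom_def)
  interpret V: stream_module K' E K' id "\<lambda>_. \<one>\<^bsub>K'\<^esub>" p ?V by (rule S.inf_path_stream_module[OF p])
  have tw: "twist_automorphism K' E e x = U2.\<Theta>"
    unfolding twist_automorphism_def \<psi>_def ..
  let ?N = "with_action ?V (\<lambda>a m. U2.\<Theta> (U1.\<Theta> a) \<odot>\<^bsub>?V\<^esub> m)"
  have simps: "carrier ?N = carrier (free_space K' (tc p))" "\<zero>\<^bsub>?N\<^esub> = (\<lambda>b. \<zero>\<^bsub>K'\<^esub>)" "add ?N = add (free_space K' (tc p))"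
      "a \<odot>\<^bsub>?N\<^esub> m = U2.\<Theta> (U1.\<Theta> a) \<odot>\<^bsub>?V\<^esub> m" for a m
    using V.N_simps by (simp_all add: with_action_def ring.defs module.defs)
  have hc: "k \<in> carrier K \<Longrightarrow> h k \<in> carrier K'" for k using h by (rule ring_hom_closed)
  have left: "left_module L ?N"
    using left_module_pullback[OF V.M.left_module_axioms L.nonunital_algebra_axioms, of "\<lambda>a. U2.\<Theta> (U1.\<Theta> a)"]
    by (simp add: U1.hom_closed U2.hom_closed U1.hom_add U2.hom_add U1.hom_mult U2.hom_mult)
  have main: "U2.\<Theta> (U1.\<Theta> (k \<odot>\<^bsub>L\<^esub> \<gamma> g)) \<odot>\<^bsub>?V\<^esub> single K' l b =
      (case inf_path_act E g b of None \<Rightarrow> (\<lambda>b. \<zero>\<^bsub>K'\<^esub>) | Some b' \<Rightarrow> single K' (h k \<otimes>\<^bsub>K'\<^esub> ?\<chi> g \<otimes>\<^bsub>K'\<^esub> l) b')"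
    if a: "k \<in> carrier K" "g \<in> gens E" "l \<in> carrier K'" "b \<in> tc p" for k g l b
  proof -
    have "U2.\<Theta> (U1.\<Theta> (k \<odot>\<^bsub>L\<^esub> \<gamma> g)) = (h k \<otimes>\<^bsub>K'\<^esub> ?\<chi> g) \<odot>\<^bsub>S.L\<^esub> S.\<gamma> g"
      using a hc gc[OF a(2)] chi(1) by (simp add: U1.hom_smult U1.hom_gen U2.hom_smult U2.hom_gen \<psi> S.L.smult_assoc1)
    then show ?thesis using V.gen_single[of "h k \<otimes>\<^bsub>K'\<^esub> ?\<chi> g" g l b] a hc chi(1) V.N_simps(2)
      by (simp split: option.split)
  qed
  have "monomial_module K E K' h ?\<chi> (tc p) (inf_path_act E) ?N"
    unfolding monomial_module_def using left main by (simp add: simps)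
  then have "monomial K E K' h ?\<chi> (tc p) (inf_path_act E) ?N"
    by (intro monomial.intro leavitt_path_axioms K'.field_axioms monomial_axioms.intro h chi)
  then show ?thesis
    unfolding tw by (intro stream_module.intro stream_module_axioms.intro p chi)
qed

section \<open>Primitive ideals\<close>

text \<open>At a vertex of the cycle the only edge into \<open>Y\<close> is the edge of the cycle,
  so the sum in \<open>expands\<close> has one term.\<close>

lemma (in no_exit_cycle) cyclic_moduleI:
  assumes "lpa_module K E N" "lpa_module.Y K E N = {u. \<exists>r. walk u r v}" "lpa_module.expands K E N"
  shows "cyclic_module K E v c N"
proof -
  interpret N: lpa_module K E N by fact
  have "\<gamma> (Edge e) \<odot>\<^bsub>N\<^esub> (\<gamma> (Ghost e) \<odot>\<^bsub>N\<^esub> y) = \<gamma> (Vertex (tail E e)) \<odot>\<^bsub>N\<^esub> y" if e: "e \<in> set c" and y: "y \<in> carrier N" for e y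
  proof -
    have eE: "e \<in> arcs E" using walk_arcs[OF c_walk e] .
    obtain c1 c2 where "c = c1 @ e # c2" using e by (auto simp: in_set_conv_decomp)
    then have tl: "walk (tail E e) (e # c2) v" using c_walk by (auto simp: walk_append)
    then have hd: "walk (head E e) c2 v" by simp
    have tY: "tail E e \<in> N.Y" using tl assms(2) by blast
    have hY: "head E e \<in> N.Y" using hd assms(2) by blast
    have "f = e" if f: "f \<in> out_arcs E (tail E e)" "head E f \<in> N.Y" for f
    proof -
      obtain r where "walk (head E f) r v" using f(2) assms(2) by blast
      then show ?thesis using no_exit[OF e _ _] f(1) by simp
    qed
    then have Z: "{f \<in> out_arcs E (tail E e). head E f \<in> N.Y} = {e}"
      using eE hY by (intro subset_antisym subsetI) auto
    have fin: "finite {f \<in> out_arcs E (tail E e). head E f \<in> N.Y}" unfolding Z by simp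
    have "\<gamma> (Vertex (tail E e)) \<odot>\<^bsub>N\<^esub> y =
        (\<Oplus>\<^bsub>N\<^esub>f\<in>{f \<in> out_arcs E (tail E e). head E f \<in> N.Y}. \<gamma> (Edge f) \<odot>\<^bsub>N\<^esub> (\<gamma> (Ghost f) \<odot>\<^bsub>N\<^esub> y))"
      using assms(3) tY y fin unfolding N.expands_def by blast
    also have "\<dots> = \<gamma> (Edge e) \<odot>\<^bsub>N\<^esub> (\<gamma> (Ghost e) \<odot>\<^bsub>N\<^esub> y)"
      unfolding Z using y N.ghost_closed[OF eE] by simp
    finally show ?thesis by simp
  qed
  then show ?thesis
    by (intro cyclic_module.intro cyclic_module_axioms.intro no_exit_cycle_axioms assms(1,2))
qed

text \<open>A stream in the tail class runs into the cycle, hence its source reaches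
  \<open>v\<close>; conversely a path to \<open>v\<close> is prolonged by the repeated
  cycle.\<close>

lemma (in no_exit_cycle) stream_cyclic:
  assumes "stream_module K E S h \<chi> q N"
  shows "cyclic_module K E v c N"
proof -
  interpret N: stream_module K E S h \<chi> q N by fact
  have "N.Y = {u. \<exists>r. walk u r v}"
    unfolding N.Y_eq
  proof (intro subset_antisym subsetI)
    fix u assume "u \<in> {src q' |q'. q' \<in> tc q}"
    then obtain q' where q': "q' \<in> tc q" "u = src q'" by blast
    obtain m n where mn: "sdrop m q' = sdrop n q" using tc_common[OF q'(1) tc_refl[OF q_path]] by blast
    have "walk u (stake m q') (x n)" using walk_stake[OF tc_infinite[OF q'(1)], of m] q'(2) mn x_src[of n] by simp
    moreover obtain r where "walk (x n) r v" using x_reach by blast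
    ultimately have "walk u (stake m q' @ r) v" unfolding walk_append by blast
    then show "u \<in> {u. \<exists>r. walk u r v}" by blast
  next
    fix u assume "u \<in> {u. \<exists>r. walk u r v}"
    then obtain r where "walk u r v" by blast
    then have r: "walk u r (src q)" using x_0 x_src[of 0] by simp
    have "r @- q \<in> tc q" "src (r @- q) = u"
      using tc_shift[OF tc_refl[OF q_path] r] infinite_path_shift[OF r q_path] by auto
    then show "u \<in> {src q' |q'. q' \<in> tc q}" by blast
  qed
  then show ?thesis
    by (intro cyclic_moduleI N.lpa_module_axioms N.stream_expands)
qed

lemma (in no_exit_cycle) src_q: "src q = v"
  using x_0 x_src[of 0] by simp

text \<open>Prepending \<open>c\<close> to its infinite repetition changes nothing, so one turn acts
  by a scalar, its weight.\<close>

lemma (in no_exit_cycle) cp_one_single: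
  assumes "stream_module K E S h \<chi> q N" "l0 \<in> carrier S"
  shows "cp 1 \<odot>\<^bsub>N\<^esub> single S l0 q = single S (stream_module.wt S \<chi> c \<otimes>\<^bsub>S\<^esub> l0) q"
proof -
  interpret N: stream_module K E S h \<chi> q N by fact
  have "seg 0 l = c" using c_nonempty by (simp add: seg_def)
  then have "cp 1 = mu v c" by (simp add: cp_def)
  moreover have "c @- q = q" using cycle_decomp[OF c_nonempty] by simp
  ultimately show ?thesis using N.mu_single[OF tc_refl[OF q_path] assms(2), of v c] c_walk src_q by simp
qed

text \<open>Both g and multiplication by \<theta> g are additive in g, so powers of x suffice. They
  follow by induction in both directions from one turn, whose weight is \<theta> x.\<close>

lemma (in no_exit_cycle) gl_stream:
  assumes N: "stream_module K E S h \<chi> q N" and \<theta>: "\<theta> \<in> ring_hom P S"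
    "\<And>k. k \<in> carrier K \<Longrightarrow> \<theta> (single K k 0) = h k" "\<theta> (single K \<one>\<^bsub>K\<^esub> 1) = stream_module.wt S \<chi> c"
    and g: "g \<in> carrier P" and l0: "l0 \<in> carrier S"
  shows "gl g \<odot>\<^bsub>N\<^esub> single S l0 q = single S (\<theta> g \<otimes>\<^bsub>S\<^esub> l0) q"
proof -
  interpret N: stream_module K E S h \<chi> q N by fact
  interpret C: cyclic_module K E v c N by (rule stream_cyclic[OF N])
  interpret P: cring P by (rule K.laurent_cring)
  note qt = tc_refl[OF q_path]
  define X where "X = N.wt c"
  have X: "X \<in> carrier S" "X \<noteq> \<zero>\<^bsub>S\<^esub>" using N.wt_closed[OF c_walk] by (auto simp: X_def)
  then have iX: "inv\<^bsub>S\<^esub> X \<in> carrier S" "X \<otimes>\<^bsub>S\<^esub> inv\<^bsub>S\<^esub> X = \<one>\<^bsub>S\<^esub>" using N.S.field_Units by auto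
  have s: "single S l q \<in> carrier N" "\<gamma> (Vertex v) \<odot>\<^bsub>N\<^esub> single S l q = single S l q" if "l \<in> carrier S" for l
    using N.single_in_N[OF that qt] N.ver_single[OF v qt that] src_q by auto
  let ?e = "\<lambda>i. single K \<one>\<^bsub>K\<^esub> i"
  have eP: "?e i \<in> carrier P" for i by (rule K.laurent_single) simp
  have \<theta>c: "\<theta> (?e i) \<in> carrier S" for i using ring_hom_closed[OF \<theta>(1) eP] .
  have \<theta>mult: "\<theta> (single K k (i + j)) = \<theta> (single K k i) \<otimes>\<^bsub>S\<^esub> \<theta> (?e j)" if "k \<in> carrier K" for k i j
    using ring_hom_mult[OF \<theta>(1) K.laurent_single[OF that] eP, of i j] that by (simp add: K.laurent_single_mult)
  have \<theta>0: "\<theta> (?e 0) = \<one>\<^bsub>S\<^esub>" using \<theta>(2)[of "\<one>\<^bsub>K\<^esub>"] N.h_simps(2) by simp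
  have step: "\<theta> (?e (i + 1)) = \<theta> (?e i) \<otimes>\<^bsub>S\<^esub> X" for i using \<theta>mult[of "\<one>\<^bsub>K\<^esub>" i 1] \<theta>(3) by (simp add: X_def)
  have one: "cp 1 \<odot>\<^bsub>N\<^esub> single S l q = single S (X \<otimes>\<^bsub>S\<^esub> l) q" if "l \<in> carrier S" for l
    using cp_one_single[OF N that] by (simp add: X_def)
  have cp: "cp i \<odot>\<^bsub>N\<^esub> single S l q = single S (\<theta> (?e i) \<otimes>\<^bsub>S\<^esub> l) q" if l: "l \<in> carrier S" for i l
    using l
  proof (induction i arbitrary: l rule: int_induct[where k = 0])
    case base
    then show ?case using s[of l] \<theta>0 by (simp add: cp_def seg_simps)
  next
    case (step1 i)
    have "cp (i + 1) \<odot>\<^bsub>N\<^esub> single S l q = cp i \<odot>\<^bsub>N\<^esub> (cp 1 \<odot>\<^bsub>N\<^esub> single S l q)"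
      using C.cp_add[OF s, of l i 1] step1(3) by simp
    also have "\<dots> = single S (\<theta> (?e i) \<otimes>\<^bsub>S\<^esub> (X \<otimes>\<^bsub>S\<^esub> l)) q" using one step1 X by simp
    finally show ?case using step[of i] X \<theta>c step1(3) by (simp add: N.S.m_assoc)
  next
    case (step2 i)
    define l' where "l' = inv\<^bsub>S\<^esub> X \<otimes>\<^bsub>S\<^esub> l"
    have l': "l' \<in> carrier S" "X \<otimes>\<^bsub>S\<^esub> l' = l"
      using iX step2(3) X by (auto simp: l'_def N.S.m_assoc[symmetric])
    have "cp (i - 1) \<odot>\<^bsub>N\<^esub> single S l q = cp (i - 1) \<odot>\<^bsub>N\<^esub> (cp 1 \<odot>\<^bsub>N\<^esub> single S l' q)" using one l' by simp
    also have "\<dots> = cp i \<odot>\<^bsub>N\<^esub> single S l' q" using C.cp_add[OF s, of l' "i - 1" 1] l' by simp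
    also have "\<dots> = single S (\<theta> (?e i) \<otimes>\<^bsub>S\<^esub> l') q" using step2 l' by simp
    also have "\<theta> (?e i) \<otimes>\<^bsub>S\<^esub> l' = \<theta> (?e (i - 1)) \<otimes>\<^bsub>S\<^esub> l"
      using step[of "i - 1"] X \<theta>c l' by (simp add: N.S.m_assoc)
    finally show ?case .
  qed
  have \<theta>g: "f \<in> carrier P \<Longrightarrow> \<theta> f \<in> carrier S" for f using ring_hom_closed[OF \<theta>(1)] .
  have abP: "abelian_group P" by (rule nonunital_algebra.abelian_group_A[OF K.laurent_nonunital_algebra])
  have abN: "abelian_group N" by intro_locales
  have hom: "abelian_group_hom P N (\<lambda>f. single S (\<theta> f \<otimes>\<^bsub>S\<^esub> l0) q)"
    using s \<theta>g l0 ring_hom_add[OF \<theta>(1)]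
    by (intro abelian_group_homI'[OF abP abN]) (simp_all add: N.single_add_N N.S.l_distr)
  show ?thesis
  proof (rule K.laurent_ext[OF C.gl_act_hom[OF s(1)[OF l0]] hom _ g])
    fix k i assume k: "k \<in> carrier K"
    have hk: "h k \<in> carrier S" using N.h_simps(1)[OF k] .
    have "gl (single K k i) \<odot>\<^bsub>N\<^esub> single S l0 q = cp i \<odot>\<^bsub>N\<^esub> ((k \<odot>\<^bsub>L\<^esub> \<gamma> (Vertex v)) \<odot>\<^bsub>N\<^esub> single S l0 q)"
      using C.smult_cp_act[OF k s[OF l0], of i] k by (simp add: gl_single)
    also have "\<dots> = cp i \<odot>\<^bsub>N\<^esub> single S (h k \<otimes>\<^bsub>S\<^esub> l0) q"
      using N.smult_ver_single[OF k v l0 qt] src_q by simp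
    also have "\<dots> = single S (\<theta> (?e i) \<otimes>\<^bsub>S\<^esub> (h k \<otimes>\<^bsub>S\<^esub> l0)) q" using cp hk l0 by simp
    also have "\<theta> (?e i) \<otimes>\<^bsub>S\<^esub> (h k \<otimes>\<^bsub>S\<^esub> l0) = \<theta> (single K k i) \<otimes>\<^bsub>S\<^esub> l0"
      using \<theta>mult[OF k, of 0 i] \<theta>(2)[OF k] \<theta>c hk l0 by (simp add: N.S.m_ac)
    finally show "gl (single K k i) \<odot>\<^bsub>N\<^esub> single S l0 q = single S (\<theta> (single K k i) \<otimes>\<^bsub>S\<^esub> l0) q" .
  qed
qed

text \<open>Only \<open>hd c\<close> is twisted; since it occurs once in \<open>c\<close>, the
  weight of a turn is the class of x itself and not a power of it.\<close>

lemma (in no_exit_cycle) c_distinct: "distinct c"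
proof -
  have "seg 0 l = c" using c_nonempty by (simp add: seg_def)
  then show ?thesis using heads_distinct[of 0] by (simp add: distinct_map)
qed

lemma (in no_exit_cycle) no_exit_annihilator:
  assumes "cyclic_simple K E v c M"
  shows "(simple_left_module L (inf_path_module K E q) \<and> annihilator L (inf_path_module K E q) = annihilator L M) \<or>
    (\<exists>f. twist_polynomial K f \<and> simple_left_module L (twisted_module K E c f) \<and>
      annihilator L (twisted_module K E c f) = annihilator L M)"
proof -
  interpret M: cyclic_simple K E v c M by fact
  interpret P: cring P by (rule K.laurent_cring)
  note qt = tc_refl[OF q_path]
  have vY: "v \<in> M.Y" unfolding M.reaches using v by (intro CollectI exI[of _ "[]"]) simp
  then obtain m0 where m0: "m0 \<in> carrier M" "\<gamma> (Vertex v) \<odot>\<^bsub>M\<^esub> m0 \<noteq> \<zero>\<^bsub>M\<^esub>" by (auto simp: M.Y_def)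
  define m where "m = \<gamma> (Vertex v) \<odot>\<^bsub>M\<^esub> m0"
  have m: "m \<in> carrier M" "m \<noteq> \<zero>\<^bsub>M\<^esub>" "\<gamma> (Vertex v) \<odot>\<^bsub>M\<^esub> m = m" using m0 v by (auto simp: m_def M.ver_ver)
  obtain f where f: "f \<in> carrier P" "M.ann m = PIdl\<^bsub>P\<^esub> f" "f 0 = \<one>\<^bsub>K\<^esub>" "\<forall>i<0. f i = \<zero>\<^bsub>K\<^esub>" "\<exists>n\<ge>1. f n \<noteq> \<zero>\<^bsub>K\<^esub>"
    "maximalideal (PIdl\<^bsub>P\<^esub> f) P" "ring_irreducible\<^bsub>P\<^esub> f"
    using M.ann_generator[OF m] by blast
  have x: "basis_elt K 1 \<in> carrier P" unfolding basis_elt_single by (rule K.laurent_single) simp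
  show ?thesis
  \<comment> \<open>For f = 1 - x the class of x is 1 and no twist is left;
    \<open>twist_polynomial\<close> excludes this f, and the untwisted module takes its
    place.\<close>
  proof (cases "f = \<one>\<^bsub>P\<^esub> \<ominus>\<^bsub>P\<^esub> basis_elt K 1")
    case True
    let ?N = "inf_path_module K E q"
    have st: "stream_module K E K id (\<lambda>_. \<one>\<^bsub>K\<^esub>) q ?N" by (rule inf_path_stream_module[OF q_path])
    interpret N: stream_module K E K id "\<lambda>_. \<one>\<^bsub>K\<^esub>" q ?N by (rule st)
    interpret C: cyclic_module K E v c ?N by (rule stream_cyclic[OF st])
    have simple: "simple_left_module L ?N" by (rule inf_path_module_simple[OF q_path])
    have CN: "cyclic_simple K E v c ?N"
      by (intro cyclic_simple.intro C.cyclic_module_axioms lpa_simple.intro leavitt_path_axioms lpa_simple_axioms.intro simple)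
    let ?n = "single K \<one>\<^bsub>K\<^esub> q"
    have n: "?n \<in> carrier ?N" "?n \<noteq> \<zero>\<^bsub>?N\<^esub>" "\<gamma> (Vertex v) \<odot>\<^bsub>?N\<^esub> ?n = ?n"
      using N.single_in_N[OF _ qt] N.single_eq_zero N.ver_single[OF v qt] src_q by auto
    have "N.wt r = \<one>\<^bsub>K\<^esub>" for r by (induction r) auto
    then have "cp 1 \<odot>\<^bsub>?N\<^esub> ?n = ?n" using cp_one_single[OF st, of "\<one>\<^bsub>K\<^esub>"] by simp
    then have xn: "gl (basis_elt K 1) \<odot>\<^bsub>?N\<^esub> ?n = ?n" by (simp add: basis_elt_single gl_single)
    interpret h: abelian_group_hom P ?N "\<lambda>g. gl g \<odot>\<^bsub>?N\<^esub> ?n" by (rule C.gl_act_hom[OF n(1)])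
    have "gl f \<odot>\<^bsub>?N\<^esub> ?n = \<zero>\<^bsub>?N\<^esub>"
      unfolding True a_minus_def using h.hom_add[OF P.one_closed P.a_inv_closed[OF x]] h.hom_a_inv[OF x] xn C.gl_one[OF n(1)] n
      by (simp add: N.M.r_neg)
    from M.annihilator_cyclic[OF CN m n f(1,2) this] simple show ?thesis by simp
  next
    case False
    have tp: "twist_polynomial K f" unfolding twist_polynomial_def using f False by blast
    interpret I: maximalideal "PIdl\<^bsub>P\<^esub> f" P by (rule f(6))
    let ?K' = "twist_field K f" and ?\<theta> = "twist_class K f" and ?N = "twisted_module K E c f"
    have fld: "field ?K'" unfolding twist_field_def by (rule I.quotient_is_field[OF P.cring_axioms])
    interpret K': field ?K' by (rule fld)
    have \<theta>: "?\<theta> \<in> ring_hom P ?K'"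
      using I.rcos_ring_hom unfolding twist_field_def twist_class_def by simp
    have surj: "\<exists>g\<in>carrier P. ?\<theta> g = k" if "k \<in> carrier ?K'" for k
      using that unfolding twist_field_def twist_class_def FactRing_def A_RCOSETS_def' by auto
    have \<theta>f: "?\<theta> f = \<zero>\<^bsub>?K'\<^esub>"
      using P.a_rcos_zero[OF I.ideal_axioms P.cgenideal_self[OF f(1)]] by (simp add: twist_field_def twist_class_def FactRing_def)
    let ?h = "\<lambda>k. ?\<theta> (k \<odot>\<^bsub>P\<^esub> \<one>\<^bsub>P\<^esub>)" and ?x = "?\<theta> (basis_elt K 1)"
    have one: "k \<odot>\<^bsub>P\<^esub> \<one>\<^bsub>P\<^esub> = single K k 0" if "k \<in> carrier K" for k
      using that by (auto simp: K.laurent_simps single_def)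
    have h: "?h \<in> ring_hom K ?K'"
    proof (rule ring_hom_memI)
      fix k l assume k: "k \<in> carrier K" and l: "l \<in> carrier K"
      note s = K.laurent_single[OF k, of 0] K.laurent_single[OF l, of 0]
      show "?h k \<in> carrier ?K'" using ring_hom_closed[OF \<theta> s(1)] one[OF k] by simp
      show "?h (k \<otimes>\<^bsub>K\<^esub> l) = ?h k \<otimes>\<^bsub>?K'\<^esub> ?h l"
        using ring_hom_mult[OF \<theta> s] k l by (simp add: one K.laurent_single_mult)
      have "single K k (0::int) \<oplus>\<^bsub>P\<^esub> single K l 0 = single K (k \<oplus>\<^bsub>K\<^esub> l) 0"
        using k l by (auto simp: K.laurent_simps single_def)
      then show "?h (k \<oplus>\<^bsub>K\<^esub> l) = ?h k \<oplus>\<^bsub>?K'\<^esub> ?h l"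
        using ring_hom_add[OF \<theta> s] k l by (simp add: one)
    next
      have "single K \<one>\<^bsub>K\<^esub> 0 = \<one>\<^bsub>P\<^esub>" by (simp add: K.laurent_simps)
      then show "?h \<one>\<^bsub>K\<^esub> = \<one>\<^bsub>?K'\<^esub>" using ring_hom_one[OF \<theta>] by (simp add: one)
    qed
    have xc: "?x \<in> carrier ?K'" using ring_hom_closed[OF \<theta> x] .
    have x0: "?x \<noteq> \<zero>\<^bsub>?K'\<^esub>"
    proof
      assume z: "?x = \<zero>\<^bsub>?K'\<^esub>"
      \<comment> \<open>x is invertible among the Laurent polynomials, so its class cannot
        vanish.\<close>
      let ?y = "single K \<one>\<^bsub>K\<^esub> (- 1 :: int)"
      have y: "?y \<in> carrier P" by (rule K.laurent_single) simp
      have "basis_elt K 1 \<otimes>\<^bsub>P\<^esub> ?y = \<one>\<^bsub>P\<^esub>" by (simp add: basis_elt_single K.laurent_single_mult K.laurent_simps)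
      then have "?x \<otimes>\<^bsub>?K'\<^esub> ?\<theta> ?y = \<one>\<^bsub>?K'\<^esub>" using ring_hom_mult[OF \<theta> x y] ring_hom_one[OF \<theta>] by simp
      then show False using z ring_hom_closed[OF \<theta> y] by simp
    qed
    have N: "?N = with_action (inf_path_module ?K' E q) (\<lambda>a m.
      twist_automorphism ?K' E (hd c) ?x (lpa_hom K (lpa ?K' E) ?h (lpa_gen ?K' E) a) \<odot>\<^bsub>inf_path_module ?K' E q\<^esub> m)"
      unfolding twisted_module_def scalar_ext_def Let_def ..
    have st: "stream_module K E ?K' ?h (twist_char ?K' (hd c) ?x) q ?N"
      unfolding N by (rule twisted_stream_module[OF fld h xc x0 q_path])
    interpret N: stream_module K E ?K' ?h "twist_char ?K' (hd c) ?x" q ?N by (rule st)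
    have wt1: "hd c \<notin> set r \<Longrightarrow> N.wt r = \<one>\<^bsub>?K'\<^esub>" for r
      by (induction r) (auto simp: twist_char_def)
    have "hd c \<notin> set (tl c)" "c = hd c # tl c" using c_distinct c_nonempty by (cases c; simp)+
    then have "N.wt c = ?x" using wt1[of "tl c"] N.wt.simps(2)[of "hd c" "tl c"] xc by (simp add: twist_char_def)
    then have wtc: "?\<theta> (single K \<one>\<^bsub>K\<^esub> 1) = N.wt c" by (simp add: basis_elt_single)
    have \<theta>h: "?\<theta> (single K k 0) = ?h k" if "k \<in> carrier K" for k using one[OF that] by simp
    have gl: "gl g \<odot>\<^bsub>?N\<^esub> single ?K' l q = single ?K' (?\<theta> g \<otimes>\<^bsub>?K'\<^esub> l) q" if "g \<in> carrier P" "l \<in> carrier ?K'" for g l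
      by (rule gl_stream[OF st \<theta> _ wtc that]) (rule \<theta>h)
    interpret C: cyclic_module K E v c ?N by (rule stream_cyclic[OF st])
    have simple: "simple_left_module L ?N"
    proof (rule N.stream_module_simple[OF qt])
      fix l l' assume l: "l \<in> carrier ?K'" "l \<noteq> \<zero>\<^bsub>?K'\<^esub>" "l' \<in> carrier ?K'"
      have i: "inv\<^bsub>?K'\<^esub> l \<in> carrier ?K'" "inv\<^bsub>?K'\<^esub> l \<otimes>\<^bsub>?K'\<^esub> l = \<one>\<^bsub>?K'\<^esub>" using l K'.field_Units by auto
      \<comment> \<open>Every element of the extension field is the class of a Laurent polynomial,
        and the corresponding combination of turns multiplies the repeated cycle by it.\<close>
      obtain g where g: "g \<in> carrier P" "?\<theta> g = l' \<otimes>\<^bsub>?K'\<^esub> inv\<^bsub>?K'\<^esub> l" using surj[of "l' \<otimes>\<^bsub>?K'\<^esub> inv\<^bsub>?K'\<^esub> l"] l i by auto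
      have "?\<theta> g \<otimes>\<^bsub>?K'\<^esub> l = l'" using l i g(2) by (simp add: K'.m_assoc)
      then have "gl g \<odot>\<^bsub>?N\<^esub> single ?K' l q = single ?K' l' q" using gl[OF g(1) l(1)] by simp
      then show "\<exists>a\<in>carrier L. a \<odot>\<^bsub>?N\<^esub> single ?K' l q = single ?K' l' q" using gl_closed[OF g(1)] by blast
    qed
    have CN: "cyclic_simple K E v c ?N"
      by (intro cyclic_simple.intro C.cyclic_module_axioms lpa_simple.intro leavitt_path_axioms lpa_simple_axioms.intro simple)
    let ?n = "single ?K' \<one>\<^bsub>?K'\<^esub> q"
    have n: "?n \<in> carrier ?N" "?n \<noteq> \<zero>\<^bsub>?N\<^esub>" "\<gamma> (Vertex v) \<odot>\<^bsub>?N\<^esub> ?n = ?n"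
      using N.single_in_N[OF _ qt] N.single_eq_zero N.ver_single[OF v qt] src_q by auto
    have "gl f \<odot>\<^bsub>?N\<^esub> ?n = \<zero>\<^bsub>?N\<^esub>" using gl[OF f(1), of "\<one>\<^bsub>?K'\<^esub>"] \<theta>f N.single_eq_zero by simp
    from M.annihilator_cyclic[OF CN m n f(1,2) this] simple tp show ?thesis by blast
  qed
qed

lemma (in leavitt_path) closed_walk_heads:
  assumes "walk v c v" "c \<noteq> []" "e \<in> set c"
  shows "head E e \<in> tail E ` set c"
proof -
  have "walk u c w \<Longrightarrow> e \<in> set c \<Longrightarrow> head E e \<in> insert w (tail E ` set c)" for u w
  proof (induction c arbitrary: u)
    case (Cons f c)
    then have "e = f \<or> e \<in> set c" "walk (head E f) c w" by auto
    then show ?case using Cons.IH by (cases c) auto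
  qed simp
  then have "head E e \<in> insert v (tail E ` set c)" using assms by blast
  moreover have "v \<in> tail E ` set c" using assms(1,2) by (cases c) auto
  ultimately show ?thesis by auto
qed

text \<open>All vertices of a walk ending in \<open>Y\<close> lie in \<open>Y\<close> by
  \<open>Y_up\<close>, so each of its edges has to be the edge of \<open>c\<close> at that
  vertex.\<close>

lemma (in lpa_module) no_exit_follow:
  assumes c: "walk v c v" "c \<noteq> []" and ne: "\<And>e f. \<lbrakk>e \<in> set c; f \<in> arcs E; tail E f = tail E e; head E f \<in> Y\<rbrakk> \<Longrightarrow> f = e"
    and "walk u d w" "w \<in> Y" "u \<in> tail E ` set c"
  shows "set d \<subseteq> set c \<and> w \<in> tail E ` set c"
  using assms(4,6)
proof (induction d arbitrary: u)
  case (Cons f d)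
  then have f: "f \<in> arcs E" "u = tail E f" "walk (head E f) d w" by auto
  obtain e where e: "e \<in> set c" "tail E f = tail E e" using Cons.prems(2) f(2) by auto
  have "f = e" using ne[OF e(1) f(1) e(2) Y_up[OF f(3) assms(5)]] .
  then show ?case using Cons.IH[OF f(3)] closed_walk_heads[OF c] e(1) by auto
qed simp

lemma (in lpa_simple) no_exit_cycle_exists:
  assumes "expands" "v \<in> Y" "walk v c v" "c \<noteq> []"
    and "\<forall>e\<in>set c. \<forall>f\<in>arcs E. tail E f = tail E e \<longrightarrow> head E f \<in> Y \<longrightarrow> f = e"
  shows "\<exists>c. no_exit_cycle K E v c \<and> cyclic_simple K E v c M"
proof -
  let ?P = "\<lambda>c. walk v c v \<and> c \<noteq> [] \<and> (\<forall>e\<in>set c. \<forall>f\<in>arcs E. tail E f = tail E e \<longrightarrow> head E f \<in> Y \<longrightarrow> f = e)"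
  have "?P c" using assms by blast
  then obtain c where c: "walk v c v" "c \<noteq> []" and
    ne: "\<And>e f. \<lbrakk>e \<in> set c; f \<in> arcs E; tail E f = tail E e; head E f \<in> Y\<rbrakk> \<Longrightarrow> f = e"
    and least: "\<And>d. ?P d \<Longrightarrow> length c \<le> length d"
    using ex_has_least_nat[of ?P c length] by blast
  note follow = no_exit_follow[OF c ne]
  have vc: "v \<in> tail E ` set c" using c by (cases c) auto
  have C: "no_exit_cycle K E v c"
  proof (intro no_exit_cycle.intro leavitt_path_axioms no_exit_cycle_axioms.intro c)
    fix e f r assume "e \<in> set c" "f \<in> arcs E" "tail E f = tail E e" "walk (head E f) r v"
    then show "f = e" using ne Y_up assms(2) by blast
  next
    fix d assume d: "walk v d v" "d \<noteq> []"
    \<comment> \<open>The length of \<open>c\<close> is minimal among closed paths without exits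
      into \<open>Y\<close>. Any closed path d at \<open>v\<close> is one of these, because its
      edges are edges of \<open>c\<close>.\<close>
    then have "set d \<subseteq> set c" using follow[OF _ _ _ _ d(1) assms(2) vc] by blast
    then have "?P d" using d ne by blast
    then show "length c \<le> length d" by (rule least)
  qed
  interpret C: no_exit_cycle K E v c by (rule C)
  have "Y = {u. \<exists>r. walk u r v}"
  proof (intro subset_antisym subsetI)
    fix u assume u: "u \<in> Y"
    obtain w p r where w: "w \<in> Y" "walk u p w" "walk v r w" using Y_directed[OF u assms(2)] by blast
    have "w \<in> tail E ` set c" using follow[OF _ _ _ _ w(3,1) vc] by blast
    then obtain e where e: "e \<in> set c" "w = tail E e" by blast
    obtain c1 c2 where "c = c1 @ e # c2" using e(1) by (auto simp: in_set_conv_decomp)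
    then have "walk w (e # c2) v" using c(1) e(2) by (auto simp: walk_append)
    then have "walk u (p @ e # c2) v" unfolding walk_append using w(2) by blast
    then show "u \<in> {u. \<exists>r. walk u r v}" by blast
  next
    fix u assume "u \<in> {u. \<exists>r. walk u r v}"
    then show "u \<in> Y" using Y_up assms(2) by blast
  qed
  then have "cyclic_simple K E v c M"
    by (intro cyclic_simple.intro C.cyclic_moduleI lpa_module_axioms assms(1) lpa_simple_axioms)
  with C show ?thesis by blast
qed

section \<open>The cases of the theorem\<close>

context lpa_simple
begin

text \<open>A monomial not killing \<open>m\<close> has an empty second path at \<open>w\<close>, so
  its first path leads to \<open>w\<close>; hence \<open>Y\<close> is M(w) and the edges into
  \<open>Y\<close> are those leading outside H(w). The vertex \<open>w\<close> is not regular, since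
  otherwise it would act on \<open>m\<close> as a sum of ee*, that is, as 0. So \<open>w\<close> is
  a sink, or an infinite emitter with no edge or with finitely many edges outside H(w).\<close>

lemma finite_emission_annihilator:
  assumes w: "w \<in> verts E" and m: "m \<in> carrier M" "m \<noteq> \<zero>\<^bsub>M\<^esub>" "ver w \<cdot> m = m"
    and fin: "finite {e \<in> out_arcs E w. head E e \<in> Y}"
    and "\<forall>e\<in>arcs E. \<gamma> (Ghost e) \<cdot> m = \<zero>\<^bsub>M\<^esub>"
  shows "(sink E w \<and> simple_left_module L (sink_module K E w) \<and> annihilator L (sink_module K E w) = annihilator L M) \<or>
    (infinite_emitter E w \<and> w \<in> B_set E (H_set E w) \<and>
      (let N = quotient_sink_module K E (H_set E w) (B_set E (H_set E w) - {w}) (Inr w)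
       in simple_left_module L N \<and> annihilator L N = annihilator L M)) \<or>
    (infinite_emitter E w \<and> head E ` out_arcs E w \<subseteq> H_set E w \<and>
      (let N = quotient_sink_module K E (H_set E w) (B_set E (H_set E w)) (Inl w)
       in simple_left_module L N \<and> annihilator L N = annihilator L M))"
proof -
  note ghosts = bspec[OF assms(6)]
  have path: "simple_left_module L N \<and> annihilator L N = annihilator L M" if "path_module K E B t N w \<beta>"
    for B :: "'b set" and t N \<beta>
    using path_module.path_module_simple[OF that]
      path_module.path_module_annihilator[OF that lpa_simple_axioms m ghosts] by blast
  have wY: "w \<in> Y" using Y_I[OF w m(1)] m by simp
  have Y: "Y = M_set E w"
  proof (intro subset_antisym subsetI)
    fix u assume u: "u \<in> Y"
    obtain p u' r w' where d: "walk u p w'" "walk u' r w'" "mu u p \<cdot> (nu u' r \<cdot> m) \<noteq> \<zero>\<^bsub>M\<^esub>"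
      using monomial_detects[OF u m(1,2)] by blast
    have nz: "nu u' r \<cdot> m \<noteq> \<zero>\<^bsub>M\<^esub>" using d(1,3) mu_closed[OF d(1)] by auto
    have "r = []"
    proof (rule ccontr)
      assume "r \<noteq> []"
      then obtain e r' where r: "r = e # r'" by (cases r) auto
      then have "nu (head E e) r' \<in> carrier L" "e \<in> arcs E" using d(2) nu_closed by auto
      then have "nu u' r \<cdot> m = \<zero>\<^bsub>M\<^esub>" using r ghosts m(1) ghost_closed by (simp add: act_mult)
      with nz show False by simp
    qed
    moreover have "u' = w" using nu_ver[OF d(2) w m(1)] m(3) nz by (auto split: if_splits)
    ultimately have "walk u p w" using d(1,2) by simp
    then show "u \<in> M_set E w" using walk_verts(1) by (auto simp: M_set_def)
  next
    fix u assume "u \<in> M_set E w"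
    then show "u \<in> Y" using Y_up wY by (auto simp: M_set_def)
  qed
  let ?H = "H_set E w"
  have H: "u \<in> verts E \<Longrightarrow> u \<in> ?H \<longleftrightarrow> u \<notin> Y" for u unfolding H_set_def Y by simp
  have not_regular: "\<not> regular E w"
    using regular_detects[of w m] m ghosts by auto
  show ?thesis
  proof (cases "sink E w")
    case True
    then show ?thesis using path[OF sink_path_module[OF True]] by blast
  next
    case False
    then have inf: "infinite_emitter E w"
      using not_regular w unfolding sink_def regular_def infinite_emitter_def by blast
    have quot: "quotient K E ?H"
    proof (intro quotient.intro leavitt_path_axioms quotient_axioms.intro)
      fix e assume e: "e \<in> arcs E" "tail E e \<in> ?H"
      have "walk (tail E e) [e] (head E e)" using e(1) by (simp add: ends_in_verts)
      from Y_up[OF this] show "head E e \<in> ?H" using H[of "tail E e"] H[of "head E e"] e by (auto simp: ends_in_verts)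
    next
      fix u assume u: "regular E u" "head E ` out_arcs E u \<subseteq> ?H"
      have "head E e \<notin> Y" if "e \<in> out_arcs E u" for e
        using u(2) that H[of "head E e"] by (auto simp: ends_in_verts image_subset_iff)
      then show "u \<in> ?H" using Y_saturated[OF _ u(1)] H[of u] u(1) by (auto simp: regular_def)
    qed
    have reach: "u \<notin> ?H" if "walk u p w" for u p
      using that walk_verts(1)[OF that] by (auto simp: H_set_def M_set_def)
    have Z: "{e \<in> out_arcs E w. head E e \<notin> ?H} = {e \<in> out_arcs E w. head E e \<in> Y}"
      using H by (intro subset_antisym subsetI) (auto simp: ends_in_verts)
    show ?thesis
    proof (cases "{e \<in> out_arcs E w. head E e \<in> Y} = {}")
      case True
      then have sub: "head E ` out_arcs E w \<subseteq> ?H" unfolding Z[symmetric] by blast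
      have "path_module K E {(x, r). pre_digraph.awalk (quotient_graph E ?H (B_set E ?H)) x r (Inl w)}
          (quotient.qact E ?H (B_set E ?H)) (quotient_sink_module K E ?H (B_set E ?H) (Inl w)) w
          (\<lambda>u p. (if p = [] then Inl u else Inl u, mark_last Inl p))"
        by (rule quotient.quotient_path_module[OF quot w reach]) (use sub in simp_all)
      from path[OF this] show ?thesis using inf sub by (simp add: Let_def)
    next
      case False
      have "finite {e \<in> out_arcs E w. head E e \<notin> ?H}" "{e \<in> out_arcs E w. head E e \<notin> ?H} \<noteq> {}"
        unfolding Z by (rule fin, rule False)
      then have B: "w \<in> B_set E ?H"
        using inf H[of w] w wY unfolding B_set_def by blast
      then have T: "B_set E ?H - (B_set E ?H - {w}) = {w}" by (intro subset_antisym subsetI) auto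
      have "path_module K E {(x, r). pre_digraph.awalk (quotient_graph E ?H (B_set E ?H - {w})) x r (Inr w)}
          (quotient.qact E ?H (B_set E ?H - {w})) (quotient_sink_module K E ?H (B_set E ?H - {w}) (Inr w)) w
          (\<lambda>u p. (if p = [] then Inr u else Inl u, mark_last Inr p))"
        by (rule quotient.quotient_path_module[OF quot w reach]) (use T in simp_all)
      from path[OF this] show ?thesis using inf B by (simp add: Let_def)
    qed
  qed
qed

text \<open>\<open>M\<close> and the module of the cofinal path have the same \<open>Y\<close>, and
  both satisfy \<open>expands\<close>, so \<open>annihilator_subset\<close> applies in both
  directions.\<close>

lemma exits_annihilator:
  assumes expands "exits Y"
  shows "\<exists>p. infinite_path E p \<and> simple_left_module L (inf_path_module K E p) \<and>
    annihilator L (inf_path_module K E p) = annihilator L M"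
proof -
  obtain p where p: "infinite_path E p" "Y = {src q | q. q \<in> tc p}" using cofinal_path[OF assms(1)] by blast
  let ?N = "inf_path_module K E p"
  interpret N: stream_module K E K id "\<lambda>_. \<one>\<^bsub>K\<^esub>" p ?N by (rule inf_path_stream_module[OF p(1)])
  have simple: "simple_left_module L ?N" by (rule inf_path_module_simple[OF p(1)])
  have NS: "lpa_simple K E ?N" by (intro lpa_simple.intro leavitt_path_axioms lpa_simple_axioms.intro simple)
  have Y: "N.Y = Y" using N.Y_eq p(2) by simp
  have "annihilator L ?N = annihilator L M"
  proof (intro subset_antisym subsetI)
    fix a
    show "a \<in> annihilator L ?N \<Longrightarrow> a \<in> annihilator L M"
      by (rule annihilator_subset[OF N.lpa_module_axioms lpa_simple_axioms Y refl assms])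
    show "a \<in> annihilator L M \<Longrightarrow> a \<in> annihilator L ?N"
      by (rule annihilator_subset[OF lpa_module_axioms NS refl Y N.stream_expands assms(2)])
  qed
  then show ?thesis using p simple by blast
qed

end

theorem theorem3p9:
  fixes K :: "('k, 'c) ring_scheme"
    and E :: "('v, 'e) pre_digraph"
    and P :: "('v, 'e, 'k) lpa_elt set"
  assumes "field K" and "wf_digraph E"
    and "primitive_ideal TYPE('m) (lpa K E) P"
  shows
    "(\<exists>w. sink E w \<and>
        (let S = sink_module K E w
         in simple_left_module (lpa K E) S \<and> annihilator (lpa K E) S = P))
   \<or> (\<exists>v. infinite_emitter E v \<and> v \<in> B_set E (H_set E v) \<and>
        (let S = quotient_sink_module K E (H_set E v) (B_set E (H_set E v) - {v}) (Inr v)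
         in simple_left_module (lpa K E) S \<and> annihilator (lpa K E) S = P))
   \<or> (\<exists>v. infinite_emitter E v \<and> head E ` out_arcs E v \<subseteq> H_set E v \<and>
        (let S = quotient_sink_module K E (H_set E v) (B_set E (H_set E v)) (Inl v)
         in simple_left_module (lpa K E) S \<and> annihilator (lpa K E) S = P))
   \<or> (\<exists>p. infinite_path E p \<and>
        (let S = inf_path_module K E p
         in simple_left_module (lpa K E) S \<and> annihilator (lpa K E) S = P))
   \<or> (\<exists>c f. exclusive_cycle E c \<and> twist_polynomial K f \<and>
        (let S = twisted_module K E c f
         in simple_left_module (lpa K E) S \<and> annihilator (lpa K E) S = P))"
proof -
  obtain M :: "(('v, 'e, 'k) lpa_elt, 'm) module" where M: "simple_left_module (lpa K E) M" "P = annihilator (lpa K E) M"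
    using assms(3) unfolding primitive_ideal_def by blast
  interpret lpa_simple K E M
    by (intro lpa_simple.intro leavitt_path.intro lpa_simple_axioms.intro assms(1,2) M(1))
  show ?thesis
  proof (cases "\<exists>w\<in>verts E. \<exists>m\<in>carrier M. m \<noteq> \<zero>\<^bsub>M\<^esub> \<and> ver w \<odot>\<^bsub>M\<^esub> m = m \<and>
      finite {e \<in> out_arcs E w. head E e \<in> Y} \<and> (\<forall>e\<in>arcs E. \<gamma> (Ghost e) \<odot>\<^bsub>M\<^esub> m = \<zero>\<^bsub>M\<^esub>)")
    case True
    then obtain w m where "w \<in> verts E" "m \<in> carrier M" "m \<noteq> \<zero>\<^bsub>M\<^esub>" "ver w \<odot>\<^bsub>M\<^esub> m = m"
      "finite {e \<in> out_arcs E w. head E e \<in> Y}" "\<forall>e\<in>arcs E. \<gamma> (Ghost e) \<odot>\<^bsub>M\<^esub> m = \<zero>\<^bsub>M\<^esub>" by blast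
    from finite_emission_annihilator[OF this] show ?thesis
    proof (elim disjE, goal_cases)
      case 1
      then show ?case by (intro disjI1 exI[of _ w]) (simp add: M(2))
    next
      case 2
      then show ?case unfolding M(2)[symmetric] by (rule disjI2[OF disjI1[OF exI[of _ w]]])
    next
      case 3
      then show ?case unfolding M(2)[symmetric] by (rule disjI2[OF disjI2[OF disjI1[OF exI[of _ w]]]])
    qed
  next
    case False
    have exp: expands
    proof (rule expandsI)
      fix w m assume "w \<in> verts E" "m \<in> carrier M" "ver w \<odot>\<^bsub>M\<^esub> m = m"
        "finite {e \<in> out_arcs E w. head E e \<in> Y}" "\<And>e. e \<in> arcs E \<Longrightarrow> \<gamma> (Ghost e) \<odot>\<^bsub>M\<^esub> m = \<zero>\<^bsub>M\<^esub>"
      with False show "m = \<zero>\<^bsub>M\<^esub>" by blast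
    qed
    show ?thesis
    proof (cases "exits Y")
      case True
      from exits_annihilator[OF exp this] obtain p where "infinite_path E p \<and>
          (let S = inf_path_module K E p in simple_left_module L S \<and> annihilator L S = P)"
        by (auto simp: M(2) Let_def)
      then show ?thesis by (rule disjI2[OF disjI2[OF disjI2[OF disjI1[OF exI]]]])
    next
      case False
      have "\<exists>v\<in>Y. \<exists>c. walk v c v \<and> c \<noteq> [] \<and>
        (\<forall>e\<in>set c. \<forall>f\<in>arcs E. tail E f = tail E e \<longrightarrow> head E f \<in> Y \<longrightarrow> f = e)"
      proof (rule ccontr)
        assume none: "\<not> ?thesis"
        have "exits Y"
          by (rule exitsI) (use none Y_verts in blast)+
        with False show False ..
      qed
      then obtain v c where "v \<in> Y" "walk v c v" "c \<noteq> []"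
        "\<forall>e\<in>set c. \<forall>f\<in>arcs E. tail E f = tail E e \<longrightarrow> head E f \<in> Y \<longrightarrow> f = e" by blast
      from no_exit_cycle_exists[OF exp this] obtain c where c: "no_exit_cycle K E v c" "cyclic_simple K E v c M"
        by blast
      from no_exit_cycle.no_exit_annihilator[OF c] show ?thesis
      proof (elim disjE exE, goal_cases)
        case 1
        with no_exit_cycle.q_path[OF c(1)] have "infinite_path E (cycle c) \<and>
            (let S = inf_path_module K E (cycle c) in simple_left_module L S \<and> annihilator L S = P)"
          by (simp add: M(2))
        then show ?case by (rule disjI2[OF disjI2[OF disjI2[OF disjI1[OF exI]]]])
      next
        case (2 f)
        with no_exit_cycle.c_exclusive[OF c(1)] have "exclusive_cycle E c \<and> twist_polynomial K f \<and>
            (let S = twisted_module K E c f in simple_left_module L S \<and> annihilator L S = P)"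
          by (simp add: M(2))
        then show ?case by - (rule disjI2, rule disjI2, rule disjI2, rule disjI2, rule exI, rule exI)
      qed
    qed
  qed
qed

end
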